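(* Let $\Bbbk$ be an algebraically closed field of characteristic $p>2$, and let $A$, $s$, $C$, $A_s$, $\Lambda$ be as defined in the context. (1) The prime spectrum of $A$ is $$\operatorname{Spec}(A)=\{\langle s,x,\mathfrak{p}\rangle\mid\mathfrak{p}\in\operatorname{Spec}(\Lambda)\}\cup\{\mathfrak{q}A_s\cap A\mid\mathfrak{q}\in\operatorname{Spec}(\Bbbk[C^{\pm1},s^{\pm p},y^{2p}])\}.$$ (2) The primitive and maximal spectra of $A$ coincide and are given by $$\operatorname{Prim}(A)=\operatorname{Max}(A)=\{\langle s,x,y,g-\gamma\rangle\mid\gamma\in\Bbbk^{\times}\}\cup\{\langle s,x,y^2-\alpha,g^2-\beta\rangle\mid\alpha,\beta\in\Bbbk^{\times}\}\cup\{\langle C-\alpha,s^p-\beta,y^{2p}-\gamma\rangle\mid\alpha,\beta\in\Bbbk^{\times},\gamma\in\Bbbk\}.$$ The corresponding primitive factor algebras are as follows: (a) for any $\gamma\in\Bbbk^{\times}$, $A/\langle s,x,y,g-\gamma\rangle\cong\Bbbk$; (b) for any $\alpha,\beta\in\Bbbk^{\times}$, $A/\langle s,x,y^2-\alpha,g^2-\beta\rangle\cong M_2(\Bbbk)$; (c) for any $\alpha,\beta\in\Bbbk^{\times}$ and $\gamma\in\Bbbk$, $A/\langle C-\alpha,s^p-\beta,y^{2p}-\gamma\rangle\cong M_{2p}(\Bbbk)$.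
   Context: $A$ (the bosonization of the super Jordan plane) is the $\Bbbk$-algebra generated by $x,y,g,g^{-1}$ with relations $x^2=0$, $ys-sy-xs=0$ where $s:=xy+yx$, $gg^{-1}=g^{-1}g=1$, $gxg^{-1}=-x$, $gyg^{-1}=-y+x$. The element $s$ is normal and regular in $A$, and $A_s$ is the localization of $A$ at the powers of $s$. The element $C:=(2yx-s)g^{-1}$ is central in $A$ and invertible in $A_s$; $\Bbbk[C^{\pm1},s^{\pm p},y^{2p}]$ is the (central) subalgebra of $A_s$ generated by these elements, a (Laurent) polynomial algebra in three variables. $\langle\cdots\rangle$ denotes the two-sided ideal of $A$ generated by the listed elements. $\Lambda:=A/\langle s,x\rangle\cong\Bbbk\langle y,g^{\pm1}\mid gy=-yg\rangle$; for an ideal $\mathfrak{p}$ of $\Lambda$, $\langle s,x,\mathfrak{p}\rangle$ denotes the preimage of $\mathfrak{p}$ under $A\to\Lambda$. $\operatorname{Spec}$, $\operatorname{Prim}$, $\operatorname{Max}$ denote the sets of prime (two-sided), primitive (annihilators of simple left modules) and maximal two-sided ideals. *)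

theory Defs
  imports
    "HOL-Library.Poly_Mapping"
    "HOL-Computational_Algebra.Computational_Algebra"
    "HOL-Algebra.QuotRing"
    "HOL-Algebra.Ideal_Product"
    "HOL-Algebra.Generated_Rings"
    "HOL-Algebra.Module"
    "Jordan_Normal_Form.Matrix"
begin

section \<open>Ring theory over arbitrary rings\<close>

text \<open>
  The type class ring as a structure with carrier \<open>UNIV\<close>. The sort omits \<open>0 \<noteq> 1\<close>, which
  \<open>ring_1\<close> (and hence \<open>ring_of_type_algebra\<close>) would require.
\<close>

definition univ_ring :: "'a::{ring,monoid_mult} ring" where
  "univ_ring = \<lparr>carrier = UNIV, monoid.mult = (*), one = 1, ring.zero = 0, add = (+)\<rparr>"

lemma univ_ring_simps [simp]:
  "carrier univ_ring = UNIV" "monoid.mult univ_ring = (*)" "one univ_ring = 1"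
  "ring.zero univ_ring = 0" "add univ_ring = (+)"
  by (simp_all add: univ_ring_def)

lemma ring_univ_ring: "ring (univ_ring :: 'a::{ring,monoid_mult} ring)"
proof (rule ringI)
  show "abelian_group (univ_ring :: 'a ring)"
    by (rule abelian_groupI) (auto simp: algebra_simps intro: exI[of _ "- _"] add.left_inverse)
  show "monoid (univ_ring :: 'a ring)"
    by (rule monoidI) (auto simp: mult.assoc)
qed (auto simp: algebra_simps)

text \<open>
  The library's \<open>primeideal\<close> is the commutative notion; the following is the two-sided one.
\<close>

definition prime_spectrum :: "('a, 'm) ring_scheme \<Rightarrow> 'a set set" where
  "prime_spectrum R = {P. ideal P R \<and> P \<noteq> carrier R \<and>
     (\<forall>I J. ideal I R \<longrightarrow> ideal J R \<longrightarrow> I \<cdot>\<^bsub>R\<^esub> J \<subseteq> P \<longrightarrow> I \<subseteq> P \<or> J \<subseteq> P)}"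

definition max_spectrum :: "('a, 'm) ring_scheme \<Rightarrow> 'a set set" where
  "max_spectrum R = {I. maximalideal I R}"

text \<open>The library's \<open>module\<close> locale requires a commutative base ring.\<close>

locale left_module = R?: ring R + M?: abelian_group M
  for R :: "('a, 'm) ring_scheme" (structure) and M :: "('a, 'b, 'c) module_scheme" (structure) +
  assumes smult_closed:
      "\<lbrakk>a \<in> carrier R; x \<in> carrier M\<rbrakk> \<Longrightarrow> a \<odot>\<^bsub>M\<^esub> x \<in> carrier M"
    and smult_l_distr:
      "\<lbrakk>a \<in> carrier R; b \<in> carrier R; x \<in> carrier M\<rbrakk> \<Longrightarrow>
        (a \<oplus>\<^bsub>R\<^esub> b) \<odot>\<^bsub>M\<^esub> x = (a \<odot>\<^bsub>M\<^esub> x) \<oplus>\<^bsub>M\<^esub> (b \<odot>\<^bsub>M\<^esub> x)"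
    and smult_r_distr:
      "\<lbrakk>a \<in> carrier R; x \<in> carrier M; y \<in> carrier M\<rbrakk> \<Longrightarrow>
        a \<odot>\<^bsub>M\<^esub> (x \<oplus>\<^bsub>M\<^esub> y) = (a \<odot>\<^bsub>M\<^esub> x) \<oplus>\<^bsub>M\<^esub> (a \<odot>\<^bsub>M\<^esub> y)"
    and smult_assoc1:
      "\<lbrakk>a \<in> carrier R; b \<in> carrier R; x \<in> carrier M\<rbrakk> \<Longrightarrow>
        (a \<otimes>\<^bsub>R\<^esub> b) \<odot>\<^bsub>M\<^esub> x = a \<odot>\<^bsub>M\<^esub> (b \<odot>\<^bsub>M\<^esub> x)"
    and smult_one: "x \<in> carrier M \<Longrightarrow> \<one>\<^bsub>R\<^esub> \<odot>\<^bsub>M\<^esub> x = x"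

definition simple_module :: "('a, 'm) ring_scheme \<Rightarrow> ('a, 'b, 'c) module_scheme \<Rightarrow> bool" where
  "simple_module R M \<longleftrightarrow> left_module R M \<and> carrier M \<noteq> {\<zero>\<^bsub>M\<^esub>} \<and>
     (\<forall>N. submodule N R M \<longrightarrow> N = {\<zero>\<^bsub>M\<^esub>} \<or> N = carrier M)"

definition annihilator :: "('a, 'm) ring_scheme \<Rightarrow> ('a, 'b, 'c) module_scheme \<Rightarrow> 'a set" where
  "annihilator R M = {r \<in> carrier R. \<forall>x\<in>carrier M. r \<odot>\<^bsub>M\<^esub> x = \<zero>\<^bsub>M\<^esub>}"

text \<open>
  A bound variable ranges over modules of one type only. A simple module is isomorphic to some
  \<open>R / L\<close> with \<open>L\<close> a left ideal, whose elements are subsets of \<open>R\<close>, so carriers in \<open>'a set\<close>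
  suffice; see \<open>annihilator_in_prim_spectrum\<close>.
\<close>

definition prim_spectrum :: "('a, 'm) ring_scheme \<Rightarrow> 'a set set" where
  "prim_spectrum R = {annihilator R M | M :: ('a, 'a set) module. simple_module R M}"

lemma annihilator_in_prim_spectrum:
  fixes R :: "('a, 'm) ring_scheme" and M :: "('a, 'b, 'c) module_scheme"
  assumes "simple_module R M"
  shows "annihilator R M \<in> prim_spectrum R"
proof -
  from assms interpret left_module R M by (simp add: simple_module_def)
  have simple: "N = {\<zero>\<^bsub>M\<^esub>} \<or> N = carrier M" if "submodule N R M" for N
    using assms that by (simp add: simple_module_def)
  obtain m where m: "m \<in> carrier M" "m \<noteq> \<zero>\<^bsub>M\<^esub>"
    using assms M.zero_closed unfolding simple_module_def by blast
  have smult_zero: "a \<odot>\<^bsub>M\<^esub> \<zero>\<^bsub>M\<^esub> = \<zero>\<^bsub>M\<^esub>" if "a \<in> carrier R" for a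
    using smult_r_distr[OF that M.zero_closed M.zero_closed] smult_closed[OF that M.zero_closed]
    by (metis M.add.r_cancel_one' M.l_zero M.zero_closed)
  have smult_neg: "(\<ominus>\<^bsub>R\<^esub> a) \<odot>\<^bsub>M\<^esub> x = \<ominus>\<^bsub>M\<^esub> (a \<odot>\<^bsub>M\<^esub> x)"
    if "a \<in> carrier R" "x \<in> carrier M" for a x
  proof -
    have z: "\<zero>\<^bsub>R\<^esub> \<odot>\<^bsub>M\<^esub> x = \<zero>\<^bsub>M\<^esub>"
      using smult_l_distr[OF R.zero_closed R.zero_closed that(2)]
        smult_closed[OF R.zero_closed that(2)]
      by (metis M.add.r_cancel_one' R.l_zero R.zero_closed)
    have "((\<ominus>\<^bsub>R\<^esub> a) \<odot>\<^bsub>M\<^esub> x) \<oplus>\<^bsub>M\<^esub> (a \<odot>\<^bsub>M\<^esub> x) = \<zero>\<^bsub>M\<^esub>"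
      using that smult_l_distr[of "\<ominus>\<^bsub>R\<^esub> a" a x] by (simp add: R.l_neg z)
    thus ?thesis using that by (metis M.minus_equality R.a_inv_closed smult_closed)
  qed
  have "submodule {r \<odot>\<^bsub>M\<^esub> m | r. r \<in> carrier R} R M" (is "submodule ?N R M")
  proof (rule submodule.intro)
    show "subgroup ?N (add_monoid M)"
    proof (rule M.add.subgroupI)
      show "?N \<subseteq> carrier M" using m smult_closed by auto
      show "?N \<noteq> {}" using R.one_closed by auto
      show "u \<oplus>\<^bsub>M\<^esub> v \<in> ?N" if uv: "u \<in> ?N" "v \<in> ?N" for u v
      proof -
        obtain a b where ab: "a \<in> carrier R" "u = a \<odot>\<^bsub>M\<^esub> m" "b \<in> carrier R" "v = b \<odot>\<^bsub>M\<^esub> m"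
          using uv by auto
        hence "u \<oplus>\<^bsub>M\<^esub> v = (a \<oplus>\<^bsub>R\<^esub> b) \<odot>\<^bsub>M\<^esub> m" using m by (simp add: smult_l_distr)
        thus ?thesis using ab by auto
      qed
      fix u assume "u \<in> ?N"
      then obtain a where a: "a \<in> carrier R" "u = a \<odot>\<^bsub>M\<^esub> m" by auto
      hence "\<ominus>\<^bsub>M\<^esub> u = (\<ominus>\<^bsub>R\<^esub> a) \<odot>\<^bsub>M\<^esub> m" using m by (simp add: smult_neg)
      thus "\<ominus>\<^bsub>M\<^esub> u \<in> ?N" using a by auto
    qed
    show "submodule_axioms ?N R M"
    proof
      fix a u assume a: "a \<in> carrier R" "u \<in> ?N"
      then obtain b where b: "b \<in> carrier R" "u = b \<odot>\<^bsub>M\<^esub> m" by auto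
      hence "a \<odot>\<^bsub>M\<^esub> u = (a \<otimes>\<^bsub>R\<^esub> b) \<odot>\<^bsub>M\<^esub> m" using a m by (simp add: smult_assoc1)
      thus "a \<odot>\<^bsub>M\<^esub> u \<in> ?N" using a b by auto
    qed
  qed
  moreover have "m \<in> ?N" using smult_one[OF m(1)] R.one_closed by (metis (mono_tags, lifting) mem_Collect_eq)
  ultimately have cyclic: "?N = carrier M" using simple m by blast
  define \<phi> where "\<phi> v = {r \<in> carrier R. r \<odot>\<^bsub>M\<^esub> m = v}" for v
  define \<psi> where "\<psi> = inv_into (carrier M) \<phi>"
  have inj: "inj_on \<phi> (carrier M)"
  proof (rule inj_onI)
    fix u v assume u: "u \<in> carrier M" and eq: "\<phi> u = \<phi> v"
    from u have "u \<in> ?N" unfolding cyclic .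
    then obtain r where "r \<in> carrier R" "r \<odot>\<^bsub>M\<^esub> m = u" by auto
    with eq show "u = v" by (auto simp: \<phi>_def)
  qed
  have \<psi>\<phi> [simp]: "\<psi> (\<phi> v) = v" if "v \<in> carrier M" for v
    unfolding \<psi>_def using inj that by (rule inv_into_f_f)
  define M' :: "('a, 'a set) module" where
    "M' = \<lparr>carrier = \<phi> ` carrier M, monoid.mult = undefined, one = undefined,
       ring.zero = \<phi> \<zero>\<^bsub>M\<^esub>, add = (\<lambda>U V. \<phi> (\<psi> U \<oplus>\<^bsub>M\<^esub> \<psi> V)), smult = (\<lambda>a U. \<phi> (a \<odot>\<^bsub>M\<^esub> \<psi> U))\<rparr>"
  have M'_simps [simp]: "carrier M' = \<phi> ` carrier M" "\<zero>\<^bsub>M'\<^esub> = \<phi> \<zero>\<^bsub>M\<^esub>"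
    "U \<oplus>\<^bsub>M'\<^esub> V = \<phi> (\<psi> U \<oplus>\<^bsub>M\<^esub> \<psi> V)" "a \<odot>\<^bsub>M'\<^esub> U = \<phi> (a \<odot>\<^bsub>M\<^esub> \<psi> U)" for a U V
    by (simp_all add: M'_def)
  note [simp] = smult_closed
  have "abelian_group M'"
  proof (rule abelian_groupI)
    fix U assume "U \<in> carrier M'"
    then obtain u where "u \<in> carrier M" "U = \<phi> u" by auto
    thus "\<exists>V\<in>carrier M'. V \<oplus>\<^bsub>M'\<^esub> U = \<zero>\<^bsub>M'\<^esub>"
      by (intro bexI[of _ "\<phi> (\<ominus>\<^bsub>M\<^esub> u)"]) (auto simp: M.l_neg)
  qed (auto simp: M.a_ac)
  hence "left_module R M'"
    by (intro left_module.intro R.ring_axioms left_module_axioms.intro)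
      (auto simp: smult_l_distr smult_r_distr smult_assoc1 smult_one)
  moreover have "carrier M' \<noteq> {\<zero>\<^bsub>M'\<^esub>}"
    using m inj_onD[OF inj _ m(1) M.zero_closed] by auto
  moreover have "N = {\<zero>\<^bsub>M'\<^esub>} \<or> N = carrier M'" if N: "submodule N R M'" for N
  proof -
    interpret N: submodule N R M' by (rule N)
    interpret M': abelian_group M' by fact
    define K where "K = {v \<in> carrier M. \<phi> v \<in> N}"
    have NK: "N = \<phi> ` K" using N.subset by (auto simp: K_def)
    have "submodule K R M"
    proof (rule submodule.intro)
      show "subgroup K (add_monoid M)"
      proof (rule M.add.subgroupI)
        show "K \<subseteq> carrier M" by (auto simp: K_def)
        show "K \<noteq> {}" using N.one_closed by (auto simp: K_def)
        show "u \<oplus>\<^bsub>M\<^esub> v \<in> K" if "u \<in> K" "v \<in> K" for u v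
        proof -
          have "\<phi> u \<oplus>\<^bsub>M'\<^esub> \<phi> v \<in> N" using that N.m_closed[of "\<phi> u" "\<phi> v"] by (simp add: K_def)
          thus ?thesis using that by (simp add: K_def)
        qed
        fix u assume u: "u \<in> K"
        have "(\<ominus>\<^bsub>R\<^esub> \<one>\<^bsub>R\<^esub>) \<odot>\<^bsub>M'\<^esub> \<phi> u \<in> N" using u by (intro N.smult_closed) (auto simp: K_def)
        hence "\<phi> (\<ominus>\<^bsub>M\<^esub> u) \<in> N" using u by (simp add: K_def smult_neg smult_one)
        thus "\<ominus>\<^bsub>M\<^esub> u \<in> K" using u by (simp add: K_def)
      qed
      show "submodule_axioms K R M"
      proof
        fix a u assume au: "a \<in> carrier R" "u \<in> K"
        hence "a \<odot>\<^bsub>M'\<^esub> \<phi> u \<in> N" by (intro N.smult_closed) (auto simp: K_def)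
        thus "a \<odot>\<^bsub>M\<^esub> u \<in> K" using au by (simp add: K_def)
      qed
    qed
    hence "K = {\<zero>\<^bsub>M\<^esub>} \<or> K = carrier M" by (rule simple)
    thus ?thesis using NK by auto
  qed
  ultimately have "simple_module R M'" by (simp add: simple_module_def)
  moreover have "annihilator R M = annihilator R M'"
    using inj_onD[OF inj _ _ M.zero_closed] by (auto simp: annihilator_def)
  ultimately show ?thesis unfolding prim_spectrum_def by blast
qed

text \<open>Isomorphism of \<open>\<kk>\<close>-algebras, the structure maps from \<open>\<kk>\<close> being given explicitly.\<close>

definition algebra_iso ::
  "('a, 'm) ring_scheme \<Rightarrow> ('k \<Rightarrow> 'a) \<Rightarrow> ('b, 'n) ring_scheme \<Rightarrow> ('k \<Rightarrow> 'b) \<Rightarrow> bool" where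
  "algebra_iso R \<iota> S \<kappa> \<longleftrightarrow> (\<exists>f \<in> ring_iso R S. \<forall>c. f (\<iota> c) = \<kappa> c)"


section \<open>The algebra\<close>

datatype sjp_gen = GX | GY | GG | GGinv

datatype sjp_word = Word (letters: "sjp_gen list")

instantiation sjp_word :: monoid_add
begin
definition "0 = Word []"
definition "u + v = Word (letters u @ letters v)"
instance by standard (auto simp: zero_sjp_word_def plus_sjp_word_def)
end

text \<open>The free algebra on the generators is the monoid algebra of the free monoid of words.\<close>

type_synonym 'k sjp_free = "sjp_word \<Rightarrow>\<^sub>0 'k"

definition free_gen :: "sjp_gen \<Rightarrow> 'k::field sjp_free" where
  "free_gen a = Poly_Mapping.single (Word [a]) 1"

definition sjp_relators :: "'k::field sjp_free set" where
  "sjp_relators =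
     (let x = free_gen GX; y = free_gen GY; g = free_gen GG; h = free_gen GGinv;
          s = x * y + y * x
      in {x * x, y * s - s * y - x * s, g * h - 1, h * g - 1, g * x * h + x, g * y * h + y - x})"

definition sjp_relideal :: "'k::field sjp_free set" where
  "sjp_relideal = Idl\<^bsub>univ_ring\<^esub> sjp_relators"

lemma ideal_sjp_relideal: "ideal sjp_relideal univ_ring"
  unfolding sjp_relideal_def by (rule ring.genideal_ideal[OF ring_univ_ring]) simp

lemma sjp_relators_subset: "sjp_relators \<subseteq> sjp_relideal"
  unfolding sjp_relideal_def by (rule ring.genideal_self[OF ring_univ_ring]) simp

lemma ideal_univ_ring_iff:
  "ideal I (univ_ring :: 'a::{ring,monoid_mult} ring) \<longleftrightarrow>
     0 \<in> I \<and> (\<forall>a\<in>I. \<forall>b\<in>I. a + b \<in> I) \<and> (\<forall>a\<in>I. \<forall>r. r * a \<in> I \<and> a * r \<in> I)"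
  (is "?L \<longleftrightarrow> ?R")
proof
  assume ?L
  then interpret ideal I "univ_ring :: 'a ring" .
  show ?R
    using additive_subgroup.zero_closed[OF is_additive_subgroup]
      additive_subgroup.a_closed[OF is_additive_subgroup] I_l_closed I_r_closed by simp
next
  assume R: ?R
  have inv: "\<ominus>\<^bsub>univ_ring\<^esub> a = - a" for a :: 'a
    by (rule abelian_group.minus_equality[OF ring.is_abelian_group[OF ring_univ_ring]]) auto
  have neg: "- a \<in> I" if "a \<in> I" for a
    using R that by (metis mult_1 mult_minus_left)
  show ?L
  proof (rule idealI[OF ring_univ_ring])
    interpret ring "univ_ring :: 'a ring" by (rule ring_univ_ring)
    show "subgroup I (add_monoid univ_ring)"
      by (rule add.subgroupI) (use R neg in \<open>auto simp: inv\<close>)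
  qed (use R in auto)
qed

lemma sjp_relidealD:
  shows "0 \<in> sjp_relideal" "a \<in> sjp_relideal \<Longrightarrow> b \<in> sjp_relideal \<Longrightarrow> a + b \<in> sjp_relideal"
    "a \<in> sjp_relideal \<Longrightarrow> r * a \<in> sjp_relideal" "a \<in> sjp_relideal \<Longrightarrow> a * r \<in> sjp_relideal"
    "a \<in> sjp_relideal \<Longrightarrow> - a \<in> sjp_relideal"
    "a \<in> sjp_relideal \<Longrightarrow> b \<in> sjp_relideal \<Longrightarrow> a - b \<in> sjp_relideal"
proof -
  note * = ideal_sjp_relideal[unfolded ideal_univ_ring_iff]
  show "0 \<in> sjp_relideal" "a \<in> sjp_relideal \<Longrightarrow> b \<in> sjp_relideal \<Longrightarrow> a + b \<in> sjp_relideal"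
    "a \<in> sjp_relideal \<Longrightarrow> r * a \<in> sjp_relideal" "a \<in> sjp_relideal \<Longrightarrow> a * r \<in> sjp_relideal"
    using * by auto
  show neg: "a \<in> sjp_relideal \<Longrightarrow> - a \<in> sjp_relideal" for a
    using * by (metis mult_1 mult_minus_left)
  show "a \<in> sjp_relideal \<Longrightarrow> b \<in> sjp_relideal \<Longrightarrow> a - b \<in> sjp_relideal"
    using * neg by (metis add_uminus_conv_diff)
qed

text \<open>Evaluation of a noncommutative polynomial.\<close>

definition free_eval :: "('k \<Rightarrow> 'b::ring_1) \<Rightarrow> (sjp_gen \<Rightarrow> 'b) \<Rightarrow> 'k::field sjp_free \<Rightarrow> 'b" where
  "free_eval sc f p =
     (\<Sum>w\<in>Poly_Mapping.keys p. sc (Poly_Mapping.lookup p w) * prod_list (map f (letters w)))"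

lemma free_sum_monomials:
  "p = (\<Sum>w\<in>Poly_Mapping.keys p. Poly_Mapping.single w (Poly_Mapping.lookup p w))"
  for p :: "'k::field sjp_free"
proof (rule poly_mapping_eqI)
  fix k
  have "(\<Sum>w\<in>Poly_Mapping.keys p.
          Poly_Mapping.lookup (Poly_Mapping.single w (Poly_Mapping.lookup p w)) k)
      = (\<Sum>w\<in>Poly_Mapping.keys p. if w = k then Poly_Mapping.lookup p k else 0)"
    by (intro sum.cong) (auto simp: lookup_single when_def)
  thus "Poly_Mapping.lookup p k = Poly_Mapping.lookup
     (\<Sum>w\<in>Poly_Mapping.keys p. Poly_Mapping.single w (Poly_Mapping.lookup p w)) k"
    by (simp add: lookup_sum in_keys_iff)
qed

locale eval_data =
  fixes sc :: "'k::field \<Rightarrow> 'b::ring_1" and f :: "sjp_gen \<Rightarrow> 'b"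
  assumes sc_add: "sc (a + b) = sc a + sc b"
    and sc_mult: "sc (a * b) = sc a * sc b"
    and sc_one: "sc 1 = 1"
    and sc_comm: "sc c * f i = f i * sc c"
begin

lemma sc_zero: "sc 0 = 0"
  using sc_add[of 0 0] by simp

lemma eval_superset:
  assumes "finite K" "Poly_Mapping.keys p \<subseteq> K"
  shows "free_eval sc f p =
    (\<Sum>w\<in>K. sc (Poly_Mapping.lookup p w) * prod_list (map f (letters w)))"
  unfolding free_eval_def using assms
  by (intro sum.mono_neutral_left) (auto simp: in_keys_iff sc_zero)

lemma eval_add: "free_eval sc f (p + q) = free_eval sc f p + free_eval sc f q"
proof -
  let ?K = "Poly_Mapping.keys p \<union> Poly_Mapping.keys q"
  have "Poly_Mapping.keys (p + q) \<subseteq> ?K" by (rule keys_add)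
  thus ?thesis
    by (simp add: eval_superset[of ?K] lookup_add sc_add distrib_right sum.distrib)
qed

lemma eval_zero: "free_eval sc f 0 = 0"
  by (simp add: free_eval_def)

lemma eval_uminus: "free_eval sc f (- p) = - free_eval sc f p"
  using eval_add[of p "- p"] eval_zero by (simp add: eq_neg_iff_add_eq_0 add.commute)

lemma eval_diff: "free_eval sc f (p - q) = free_eval sc f p - free_eval sc f q"
  using eval_add[of p "- q"] eval_uminus[of q] by simp

lemma eval_sum: "free_eval sc f (sum P K) = (\<Sum>i\<in>K. free_eval sc f (P i))"
  by (induction K rule: infinite_finite_induct) (auto simp: eval_zero eval_add)

lemma eval_single:
  "free_eval sc f (Poly_Mapping.single w c) = sc c * prod_list (map f (letters w))"
  by (subst eval_superset[of "{w}"]) auto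

lemma sc_comm_word: "sc c * prod_list (map f l) = prod_list (map f l) * sc c"
  by (induction l) (simp_all, metis sc_comm mult.assoc)

lemma eval_mult: "free_eval sc f (p * q) = free_eval sc f p * free_eval sc f q"
proof -
  have mono: "free_eval sc f (Poly_Mapping.single u a * Poly_Mapping.single v b)
     = free_eval sc f (Poly_Mapping.single u a) * free_eval sc f (Poly_Mapping.single v b)"
    for u v :: sjp_word and a b :: 'k
    by (simp add: mult_single eval_single sc_mult plus_sjp_word_def)
       (metis sc_comm_word mult.assoc)
  let ?P = "\<lambda>p w. Poly_Mapping.single w (Poly_Mapping.lookup p w)"
  have "p * q = (\<Sum>u\<in>Poly_Mapping.keys p. ?P p u) * (\<Sum>v\<in>Poly_Mapping.keys q. ?P q v)"
    using free_sum_monomials[of p] free_sum_monomials[of q] by simp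
  also have "free_eval sc f \<dots>
      = (\<Sum>u\<in>Poly_Mapping.keys p. free_eval sc f (?P p u)) *
        (\<Sum>v\<in>Poly_Mapping.keys q. free_eval sc f (?P q v))"
    by (simp add: sum_product eval_sum mono)
  also have "\<dots> = free_eval sc f p * free_eval sc f q"
    using free_sum_monomials[of p] free_sum_monomials[of q] by (simp add: eval_sum[symmetric])
  finally show ?thesis .
qed

lemma eval_one: "free_eval sc f 1 = 1"
  using eval_single[of 0 1]
  by (simp only: single_one sc_one mult_1) (simp add: zero_sjp_word_def)

lemma eval_free_gen: "free_eval sc f (free_gen a) = f a"
  by (simp add: free_gen_def eval_single sc_one)

lemma eval_relideal:
  assumes "\<And>r. r \<in> sjp_relators \<Longrightarrow> free_eval sc f r = 0" "p \<in> sjp_relideal"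
  shows "free_eval sc f p = 0"
proof -
  let ?I = "{p. free_eval sc f p = 0}"
  have "ideal ?I univ_ring"
    by (simp add: ideal_univ_ring_iff eval_zero eval_add eval_mult)
  hence "sjp_relideal \<subseteq> ?I"
    unfolding sjp_relideal_def using assms(1)
    by (intro ring.genideal_minimal[OF ring_univ_ring]) auto
  thus ?thesis using assms(2) by auto
qed

end

quotient_type (overloaded) 'k sjp = "'k::field sjp_free" / "\<lambda>p q. p - q \<in> sjp_relideal"
proof (rule equivpI)
  show "reflp (\<lambda>p q. p - q \<in> sjp_relideal)"
    by (rule reflpI) (simp add: sjp_relidealD)
  show "symp (\<lambda>p q. p - q \<in> sjp_relideal)"
    by (rule sympI) (metis minus_diff_eq sjp_relidealD(5))
  show "transp (\<lambda>p q. p - q \<in> sjp_relideal)"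
    by (rule transpI) (metis diff_add_cancel add_diff_eq sjp_relidealD(2))
qed

instantiation sjp :: (field) ring_1
begin

lift_definition zero_sjp :: "'a sjp" is 0 .
lift_definition one_sjp :: "'a sjp" is 1 .
lift_definition plus_sjp :: "'a sjp \<Rightarrow> 'a sjp \<Rightarrow> 'a sjp" is "(+)"
  by (metis add_diff_add sjp_relidealD(2))
lift_definition uminus_sjp :: "'a sjp \<Rightarrow> 'a sjp" is uminus
  by (metis minus_diff_minus sjp_relidealD(5))
lift_definition minus_sjp :: "'a sjp \<Rightarrow> 'a sjp \<Rightarrow> 'a sjp" is "(-)"
proof -
  fix a b c d :: "'a sjp_free"
  assume "a - b \<in> sjp_relideal" "c - d \<in> sjp_relideal"
  moreover have "a - c - (b - d) = (a - b) - (c - d)" by simp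
  ultimately show "a - c - (b - d) \<in> sjp_relideal" by (metis sjp_relidealD(6))
qed
lift_definition times_sjp :: "'a sjp \<Rightarrow> 'a sjp \<Rightarrow> 'a sjp" is "(*)"
proof -
  fix a b c d :: "'a sjp_free"
  assume "a - b \<in> sjp_relideal" "c - d \<in> sjp_relideal"
  moreover have "a * c - b * d = (a - b) * c + b * (c - d)" by (simp add: algebra_simps)
  ultimately show "a * c - b * d \<in> sjp_relideal" by (metis sjp_relidealD(2,3,4))
qed

instance
proof
  fix a b c :: "'a sjp"
  show "a + b + c = a + (b + c)" by transfer (simp add: sjp_relidealD algebra_simps)
  show "a + b = b + a" by transfer (simp add: sjp_relidealD algebra_simps)
  show "0 + a = a" by transfer (simp add: sjp_relidealD)
  show "- a + a = 0" by transfer (simp add: sjp_relidealD)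
  show "a - b = a + - b" by transfer (simp add: sjp_relidealD)
  show "a * b * c = a * (b * c)" by transfer (simp add: sjp_relidealD algebra_simps)
  show "1 * a = a" by transfer (simp add: sjp_relidealD)
  show "a * 1 = a" by transfer (simp add: sjp_relidealD)
  show "(a + b) * c = a * c + b * c" by transfer (simp add: sjp_relidealD algebra_simps)
  show "a * (b + c) = a * b + a * c" by transfer (simp add: sjp_relidealD algebra_simps)
  show "(0 :: 'a sjp) \<noteq> 1"
  proof transfer
    define f :: "sjp_gen \<Rightarrow> 'a" where "f = (\<lambda>a. if a = GX \<or> a = GY then 0 else 1)"
    interpret eval_data "\<lambda>c::'a. c" f by standard auto
    have f: "f GX = 0" "f GY = 0" "f GG = 1" "f GGinv = 1" by (simp_all add: f_def)
    have "free_eval (\<lambda>c::'a. c) f p = 0" if "p \<in> sjp_relideal" for p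
      by (rule eval_relideal[OF _ that])
        (auto simp: sjp_relators_def Let_def eval_add eval_diff eval_mult eval_free_gen eval_one f)
    moreover have "free_eval (\<lambda>c::'a. c) f (0 - 1) = - 1"
      by (simp only: eval_diff eval_zero eval_one) simp
    ultimately show "(0::'a sjp_free) - 1 \<notin> sjp_relideal" by fastforce
  qed
qed

end

lift_definition sjp_gen :: "sjp_gen \<Rightarrow> 'k::field sjp" is free_gen .

text \<open>The structure map \<open>\<kk> \<rightarrow> A\<close>.\<close>

lift_definition sjp_scalar :: "'k::field \<Rightarrow> 'k sjp" is "Poly_Mapping.single 0" .

abbreviation sjp_ring :: "'k::field sjp ring" where "sjp_ring \<equiv> univ_ring"

abbreviation sjp_x :: "'k::field sjp" where "sjp_x \<equiv> sjp_gen GX"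
abbreviation sjp_y :: "'k::field sjp" where "sjp_y \<equiv> sjp_gen GY"
abbreviation sjp_g :: "'k::field sjp" where "sjp_g \<equiv> sjp_gen GG"
abbreviation sjp_ginv :: "'k::field sjp" where "sjp_ginv \<equiv> sjp_gen GGinv"

definition sjp_s :: "'k::field sjp" where
  "sjp_s = sjp_x * sjp_y + sjp_y * sjp_x"

definition sjp_C :: "'k::field sjp" where
  "sjp_C = (2 * sjp_y * sjp_x - sjp_s) * sjp_ginv"

lemma sjp_relations:
  shows "sjp_x * sjp_x = (0 :: 'k::field sjp)"
    and "sjp_y * sjp_s - sjp_s * sjp_y - sjp_x * sjp_s = (0 :: 'k sjp)"
    and "sjp_g * sjp_ginv = (1 :: 'k sjp)"
    and "sjp_ginv * sjp_g = (1 :: 'k sjp)"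
    and "sjp_g * sjp_x * sjp_ginv = (- sjp_x :: 'k sjp)"
    and "sjp_g * sjp_y * sjp_ginv = (- sjp_y + sjp_x :: 'k sjp)"
proof -
  note * = subsetD[OF sjp_relators_subset]
  show "sjp_x * sjp_x = (0 :: 'k sjp)"
    by transfer (rule *, simp add: sjp_relators_def Let_def)
  show "sjp_y * sjp_s - sjp_s * sjp_y - sjp_x * sjp_s = (0 :: 'k sjp)"
    unfolding sjp_s_def by transfer (rule *, simp add: sjp_relators_def Let_def)
  show "sjp_g * sjp_ginv = (1 :: 'k sjp)" "sjp_ginv * sjp_g = (1 :: 'k sjp)"
    by (transfer, rule *, simp add: sjp_relators_def Let_def)+
  show "sjp_g * sjp_x * sjp_ginv = (- sjp_x :: 'k sjp)"
    by transfer (rule *, simp add: sjp_relators_def Let_def)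
  show "sjp_g * sjp_y * sjp_ginv = (- sjp_y + sjp_x :: 'k sjp)"
    by transfer (rule *, simp add: sjp_relators_def Let_def)
qed


subsection \<open>Structural facts\<close>

lemma sjp_scalar_hom:
  "sjp_scalar (a + b) = sjp_scalar a + sjp_scalar b"
  "sjp_scalar (a * b) = sjp_scalar a * sjp_scalar b"
  "sjp_scalar 0 = 0" "sjp_scalar 1 = 1"
proof -
  show "sjp_scalar (a + b) = sjp_scalar a + sjp_scalar b"
    by transfer (simp add: single_add sjp_relidealD)
  show "sjp_scalar (a * b) = sjp_scalar a * sjp_scalar b"
    by transfer (simp add: mult_single sjp_relidealD)
  show "sjp_scalar 0 = 0" by transfer (simp add: sjp_relidealD)
  show "sjp_scalar 1 = 1" by transfer (simp add: sjp_relidealD)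
qed

lemma sjp_scalar_gen_commute: "sjp_scalar c * sjp_gen i = sjp_gen i * sjp_scalar c"
  by transfer (simp add: free_gen_def mult_single sjp_relidealD)

lemma sjp_induct [case_names scalar gen add mult]:
  fixes a :: "'k::field sjp"
  assumes scalar: "\<And>c. P (sjp_scalar c)" and gen: "\<And>i. P (sjp_gen i)"
    and add: "\<And>a b. P a \<Longrightarrow> P b \<Longrightarrow> P (a + b)"
    and mult: "\<And>a b. P a \<Longrightarrow> P b \<Longrightarrow> P (a * b)"
  shows "P a"
proof -
  have word: "P (abs_sjp (Poly_Mapping.single (Word l) 1))" for l
  proof (induction l)
    case Nil
    have "abs_sjp (Poly_Mapping.single (Word []) 1) = (sjp_scalar 1 :: 'k sjp)"
      by (simp add: sjp_scalar.abs_eq zero_sjp_word_def)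
    thus ?case using scalar by simp
  next
    case (Cons i l)
    have "abs_sjp (Poly_Mapping.single (Word (i # l)) 1)
        = (sjp_gen i * abs_sjp (Poly_Mapping.single (Word l) 1) :: 'k sjp)"
      by (simp add: sjp_gen.abs_eq times_sjp.abs_eq free_gen_def mult_single plus_sjp_word_def)
    thus ?case using gen mult Cons by simp
  qed
  have mono: "P (abs_sjp (Poly_Mapping.single w c))" for w c
  proof -
    have "abs_sjp (Poly_Mapping.single w c)
        = sjp_scalar c * abs_sjp (Poly_Mapping.single (Word (letters w)) 1)"
      by (simp add: sjp_scalar.abs_eq times_sjp.abs_eq mult_single)
    thus ?thesis using scalar word[of "letters w"] mult by simp
  qed
  have "P (abs_sjp (\<Sum>w\<in>K. Poly_Mapping.single w (h w)))" if "finite K" for K h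
    using that
  proof (induction K)
    case empty
    thus ?case using scalar[of 0] by (simp add: sjp_scalar_hom zero_sjp.abs_eq[symmetric])
  next
    case (insert w K)
    thus ?case using add mono by (simp add: plus_sjp.abs_eq[symmetric])
  qed
  moreover obtain p where "a = abs_sjp p" by (metis Quotient3_abs_rep Quotient3_sjp)
  ultimately show ?thesis using free_sum_monomials[of p] by (metis finite_keys)
qed

lemma commute_inverse:
  fixes g h w :: "'a::monoid_mult"
  assumes "g * h = 1" "h * g = 1" "g * w = w * g"
  shows "h * w = w * h"
proof -
  have "h * w = h * (w * g) * h" using assms(1) by (simp add: mult.assoc)
  also have "\<dots> = (h * g) * w * h" by (simp only: assms(3)[symmetric] mult.assoc)
  finally show ?thesis using assms(2) by simp
qed

lemma sjp_s_x: "sjp_s * sjp_x = sjp_x * (sjp_s :: 'k::field sjp)"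
proof -
  have "sjp_x * sjp_y * sjp_x + sjp_y * (sjp_x * sjp_x)
      = sjp_x * sjp_x * sjp_y + sjp_x * sjp_y * (sjp_x :: 'k sjp)"
    unfolding sjp_relations(1) by simp
  thus ?thesis by (simp add: sjp_s_def algebra_simps)
qed

lemma sjp_s_g: "sjp_s * sjp_g = sjp_g * (sjp_s :: 'k::field sjp)"
proof -
  let ?x = "sjp_x :: 'k sjp" and ?y = "sjp_y :: 'k sjp"
  let ?g = "sjp_g :: 'k sjp" and ?h = "sjp_ginv :: 'k sjp"
  have conj: "?g * (a * b) * ?h = (?g * a * ?h) * (?g * b * ?h)" for a b
    by (metis (no_types, lifting) mult.assoc mult_1 sjp_relations(4))
  have "?g * sjp_s * ?h = ?g * (?x * ?y) * ?h + ?g * (?y * ?x) * ?h"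
    by (simp add: sjp_s_def algebra_simps)
  also have "\<dots> = - ?x * (- ?y + ?x) + (- ?y + ?x) * - ?x"
    by (simp only: conj sjp_relations(5,6))
  also have "\<dots> = sjp_s" by (simp add: sjp_s_def algebra_simps sjp_relations(1))
  finally show ?thesis by (metis mult.assoc mult.right_neutral sjp_relations(4))
qed

text \<open>The automorphism with \<open>a * s = s * sjp_twist 1 a\<close>, as a one-parameter group.\<close>

definition twist_gen :: "'k::field \<Rightarrow> sjp_gen \<Rightarrow> 'k sjp" where
  "twist_gen c i = (if i = GY then sjp_y + sjp_scalar c * sjp_x else sjp_gen i)"

lemma twist_gen_simps:
  "twist_gen c GX = sjp_x" "twist_gen c GY = sjp_y + sjp_scalar c * sjp_x"
  "twist_gen c GG = sjp_g" "twist_gen c GGinv = sjp_ginv"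
  by (simp_all add: twist_gen_def)

interpretation twist: eval_data sjp_scalar "twist_gen c" for c
proof
  fix d i
  have "sjp_scalar d * sjp_scalar c = sjp_scalar c * sjp_scalar d"
    by (simp add: mult.commute flip: sjp_scalar_hom)
  thus "sjp_scalar d * twist_gen c i = twist_gen c i * sjp_scalar d"
    by (auto simp: twist_gen_def sjp_scalar_gen_commute distrib_left distrib_right)
      (metis mult.assoc sjp_scalar_gen_commute)
qed (simp_all add: sjp_scalar_hom)

lemma twist_relators:
  assumes "r \<in> sjp_relators"
  shows "free_eval sjp_scalar (twist_gen c) r = 0"
proof -
  let ?x = "sjp_x :: 'a sjp" and ?y = "sjp_y :: 'a sjp" and ?c = "sjp_scalar c"
  let ?g = "sjp_g :: 'a sjp" and ?h = "sjp_ginv :: 'a sjp" and ?z = "sjp_y + sjp_scalar c * sjp_x"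
  have comm: "?c * ?x = ?x * ?c" "?c * ?g = ?g * ?c" "?c * ?h = ?h * ?c"
    by (simp_all add: sjp_scalar_gen_commute)
  have xcx: "?x * (?c * ?x) = 0"
    by (simp only: comm(1) mult.assoc[symmetric] sjp_relations(1) mult_zero_left)
  have s: "?x * ?z + ?z * ?x = sjp_s"
    using xcx by (simp add: sjp_s_def distrib_left distrib_right mult.assoc sjp_relations(1))
  have cs: "?c * ?x * sjp_s = sjp_s * (?c * ?x)"
  proof -
    have gen: "?c * (sjp_gen i * sjp_gen j) = sjp_gen i * sjp_gen j * ?c" for i j
    proof -
      have "?c * (sjp_gen i * sjp_gen j) = sjp_gen i * (?c * sjp_gen j)"
        by (simp only: mult.assoc[symmetric] sjp_scalar_gen_commute[of c i])
      thus ?thesis by (simp only: mult.assoc sjp_scalar_gen_commute)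
    qed
    have "?c * sjp_s = sjp_s * ?c"
      unfolding sjp_s_def distrib_left distrib_right gen ..
    hence "?c * ?x * sjp_s = sjp_s * ?c * ?x"
      by (simp only: mult.assoc sjp_s_x[symmetric]) (simp only: mult.assoc[symmetric])
    thus ?thesis by (simp only: mult.assoc)
  qed
  have ys: "?z * sjp_s - sjp_s * ?z - ?x * sjp_s = 0"
    using sjp_relations(2)[where ?'k = 'a] cs by (simp add: distrib_left distrib_right algebra_simps)
  have "?g * (?c * ?x) * ?h = ?c * (?g * ?x * ?h)"
    by (simp only: mult.assoc[symmetric] comm(2)[symmetric])
  hence gy: "?g * ?z * ?h + ?z - ?x = 0"
    using sjp_relations(5,6)[where ?'k = 'a] by (simp add: distrib_left distrib_right)
  show ?thesis
    using assms s ys gy sjp_relations[where ?'k = 'a]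
    by (auto simp: sjp_relators_def Let_def twist.eval_add twist.eval_diff twist.eval_mult
        twist.eval_free_gen twist.eval_one twist_gen_simps)
qed

lift_definition sjp_twist :: "'k::field \<Rightarrow> 'k sjp \<Rightarrow> 'k sjp" is
  "\<lambda>c. free_eval sjp_scalar (twist_gen c)"
  using twist.eval_relideal[OF twist_relators] twist.eval_diff
  by (metis eq_iff_diff_eq_0)

lemma sjp_twist_hom:
  "sjp_twist c (a + b) = sjp_twist c a + sjp_twist c b"
  "sjp_twist c (a * b) = sjp_twist c a * sjp_twist c b"
  "sjp_twist c 0 = 0" "sjp_twist c 1 = 1" "sjp_twist c (- a) = - sjp_twist c a"
proof -
  show "sjp_twist c (a + b) = sjp_twist c a + sjp_twist c b"
    by transfer (simp add: twist.eval_add)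
  show "sjp_twist c (a * b) = sjp_twist c a * sjp_twist c b"
    by transfer (simp add: twist.eval_mult)
  show "sjp_twist c 0 = 0" by transfer (simp add: twist.eval_zero)
  show "sjp_twist c 1 = 1" by transfer (simp add: twist.eval_one)
  show "sjp_twist c (- a) = - sjp_twist c a" by transfer (simp add: twist.eval_uminus)
qed

lemma sjp_twist_scalar: "sjp_twist c (sjp_scalar d) = sjp_scalar d"
  by transfer (simp add: twist.eval_single zero_sjp_word_def)

lemma sjp_twist_gen: "sjp_twist c (sjp_gen i) = twist_gen c i"
  by transfer (simp add: twist.eval_free_gen)


lemma sjp_twist_sum: "sjp_twist c (sjp_twist d a) = sjp_twist (c + d) a"
proof (induction a rule: sjp_induct)
  case (gen i)
  show ?case
    by (cases i) (simp_all add: sjp_twist_gen twist_gen_simps sjp_twist_hom sjp_twist_scalar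
        sjp_scalar_hom distrib_right add.assoc)
qed (simp_all add: sjp_twist_scalar sjp_twist_hom)

lemma sjp_twist_zero: "sjp_twist 0 a = a"
proof (induction a rule: sjp_induct)
  case (gen i)
  show ?case
    by (cases i) (simp_all add: sjp_twist_gen twist_gen_simps sjp_scalar_hom)
qed (simp_all add: sjp_twist_scalar sjp_twist_hom)

lemma sjp_twist_s: "sjp_twist c sjp_s = sjp_s"
proof -
  have "sjp_x * (sjp_scalar c * sjp_x) = (sjp_x * sjp_x) * sjp_scalar c"
    by (simp only: mult.assoc sjp_scalar_gen_commute)
  thus ?thesis
    by (simp add: sjp_s_def sjp_twist_hom sjp_twist_gen twist_gen_simps distrib_left distrib_right
        sjp_relations(1) mult.assoc)
qed

lemma sjp_twist_s_power: "sjp_twist c (sjp_s ^ n) = sjp_s ^ n"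
  by (induction n) (simp_all add: sjp_twist_hom sjp_twist_s)

lemma sjp_s_normal: "a * sjp_s = sjp_s * sjp_twist 1 a"
proof (induction a rule: sjp_induct)
  case (scalar c)
  have "sjp_scalar c * (sjp_gen i * sjp_gen j) = sjp_gen i * sjp_gen j * sjp_scalar c" for i j
  proof -
    have "sjp_scalar c * (sjp_gen i * sjp_gen j) = sjp_gen i * (sjp_scalar c * sjp_gen j)"
      by (simp only: mult.assoc[symmetric] sjp_scalar_gen_commute[of c i])
    thus ?thesis by (simp only: mult.assoc sjp_scalar_gen_commute)
  qed
  thus ?case by (simp add: sjp_twist_scalar sjp_s_def distrib_left distrib_right)
next
  case (gen i)
  have "sjp_y * sjp_s = sjp_s * (sjp_y + sjp_x :: 'a sjp)"
    using sjp_relations(2)[where ?'k = 'a] sjp_s_x[where ?'k = 'a]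
    by (simp add: distrib_left algebra_simps)
  moreover have "sjp_ginv * sjp_s = sjp_s * (sjp_ginv :: 'a sjp)"
    by (rule commute_inverse[OF sjp_relations(3,4) sjp_s_g[symmetric]])
  ultimately show ?case
    by (cases i) (simp_all add: sjp_twist_gen twist_gen_simps sjp_scalar_hom sjp_s_x sjp_s_g)
next
  case (add a b)
  thus ?case by (simp add: sjp_twist_hom distrib_left distrib_right)
next
  case (mult a b)
  thus ?case by (metis sjp_twist_hom(2) mult.assoc)
qed

lemma sjp_s_power_normal: "a * sjp_s ^ n = sjp_s ^ n * sjp_twist (of_nat n) a"
proof (induction n)
  case (Suc n)
  have "a * sjp_s ^ Suc n = (a * sjp_s ^ n) * sjp_s"
    by (simp only: power_Suc2 mult.assoc)
  also have "\<dots> = sjp_s ^ n * (sjp_twist (of_nat n) a * sjp_s)"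
    by (simp only: Suc mult.assoc)
  also have "\<dots> = sjp_s ^ Suc n * sjp_twist (of_nat (Suc n)) a"
    by (simp only: sjp_s_normal[of "sjp_twist _ _"] sjp_twist_sum of_nat_Suc mult.assoc power_Suc2)
  finally show ?case .
qed (simp add: sjp_twist_zero)

lemma twist_s_power: "sjp_twist (of_nat m) a * sjp_s ^ n = sjp_s ^ n * sjp_twist (of_nat (m + n)) a"
  by (simp add: sjp_s_power_normal[of "sjp_twist _ _"] sjp_twist_sum add.commute)


section \<open>Localization at the powers of \<open>s\<close>\<close>

text \<open>
  The pair \<open>(a, n)\<close> represents the right fraction \<open>a s^(-n)\<close>. Products are computed with
  \<open>s^(-n) b = \<tau>^n(b) s^(-n)\<close>, where \<open>\<tau>^n = sjp_twist (of_nat n)\<close>; see \<open>sjp_s_power_normal\<close>.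
  The exponent \<open>k\<close> in \<open>frac_eq\<close> is the usual one for rings of fractions; it makes the construction
  independent of the regularity of \<open>s\<close>. That the result is the ring of fractions of \<open>A\<close> at the
  powers of \<open>s\<close> is \<open>sjp_loc_localization\<close> below.
\<close>

definition frac_eq :: "'k::field sjp \<times> nat \<Rightarrow> 'k sjp \<times> nat \<Rightarrow> bool" where
  "frac_eq = (\<lambda>(a, n) (b, m). \<exists>k. a * sjp_s ^ (m + k) = b * sjp_s ^ (n + k))"

lemma mult_s_power_mono:
  assumes "a * sjp_s ^ (m + k) = b * sjp_s ^ (n + k)" "k \<le> l"
  shows "a * sjp_s ^ (m + l) = b * sjp_s ^ (n + l)"
proof -
  obtain j where j: "l = k + j" using assms(2) le_Suc_ex by blast
  have "a * sjp_s ^ (m + k) * sjp_s ^ j = b * sjp_s ^ (n + k) * sjp_s ^ j"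
    using assms(1) by simp
  thus ?thesis by (simp add: j power_add mult.assoc)
qed

quotient_type (overloaded) 'k sjp_loc = "'k::field sjp \<times> nat" / frac_eq
proof (rule equivpI)
  show "reflp (frac_eq :: 'k sjp \<times> nat \<Rightarrow> _)" by (rule reflpI) (auto simp: frac_eq_def)
  show "symp (frac_eq :: 'k sjp \<times> nat \<Rightarrow> _)" by (rule sympI) (auto simp: frac_eq_def, metis)
  show "transp (frac_eq :: 'k sjp \<times> nat \<Rightarrow> _)"
  proof (rule transpI, clarify)
    fix a b c :: "'k sjp" and n m l
    assume "frac_eq (a, n) (b, m)" "frac_eq (b, m) (c, l)"
    then obtain k j where k: "a * sjp_s ^ (m + k) = b * sjp_s ^ (n + k)"
      and j: "b * sjp_s ^ (l + j) = c * sjp_s ^ (m + j)"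
      by (auto simp: frac_eq_def)
    have "a * sjp_s ^ (l + (m + k + j)) = a * sjp_s ^ (m + k) * sjp_s ^ (l + j)"
      by (simp add: mult.assoc add_ac flip: power_add)
    also have "\<dots> = b * sjp_s ^ (l + j) * sjp_s ^ (n + k)"
      by (simp only: k) (simp add: mult.assoc add_ac flip: power_add)
    also have "\<dots> = c * sjp_s ^ (n + (m + k + j))"
      by (simp only: j) (simp add: mult.assoc add_ac flip: power_add)
    finally show "frac_eq (a, n) (c, l)" unfolding frac_eq_def by auto
  qed
qed

instantiation sjp_loc :: (field) "{ring, monoid_mult}"
begin

lift_definition zero_sjp_loc :: "'a sjp_loc" is "(0, 0)" .
lift_definition one_sjp_loc :: "'a sjp_loc" is "(1, 0)" .
lift_definition uminus_sjp_loc :: "'a sjp_loc \<Rightarrow> 'a sjp_loc" is "\<lambda>(a, n). (- a, n)"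
  by (auto simp: frac_eq_def)
lift_definition plus_sjp_loc :: "'a sjp_loc \<Rightarrow> 'a sjp_loc \<Rightarrow> 'a sjp_loc" is
  "\<lambda>(a, n) (b, m). (a * sjp_s ^ m + b * sjp_s ^ n, n + m)"
proof clarify
  fix a b a' b' :: "'a sjp" and n m n' m'
  assume "frac_eq (a, n) (a', n')" "frac_eq (b, m) (b', m')"
  then obtain i j where "a * sjp_s ^ (n' + i) = a' * sjp_s ^ (n + i)"
    "b * sjp_s ^ (m' + j) = b' * sjp_s ^ (m + j)"
    by (auto simp: frac_eq_def)
  then obtain k where a: "a * sjp_s ^ (n' + k) = a' * sjp_s ^ (n + k)"
    and b: "b * sjp_s ^ (m' + k) = b' * sjp_s ^ (m + k)"
    by (meson mult_s_power_mono max.cobounded1 max.cobounded2)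
  have "(a * sjp_s ^ m + b * sjp_s ^ n) * sjp_s ^ (n' + m' + k)
      = a * sjp_s ^ (n' + k) * sjp_s ^ (m + m') + b * sjp_s ^ (m' + k) * sjp_s ^ (n + n')"
    by (simp add: distrib_right mult.assoc add_ac flip: power_add)
  also have "\<dots> = (a' * sjp_s ^ m' + b' * sjp_s ^ n') * sjp_s ^ (n + m + k)"
    by (simp only: a b) (simp add: distrib_right mult.assoc add_ac flip: power_add)
  finally show "frac_eq (a * sjp_s ^ m + b * sjp_s ^ n, n + m)
      (a' * sjp_s ^ m' + b' * sjp_s ^ n', n' + m')"
    unfolding frac_eq_def by auto
qed
definition minus_sjp_loc :: "'a sjp_loc \<Rightarrow> 'a sjp_loc \<Rightarrow> 'a sjp_loc" where
  "minus_sjp_loc u v = u + - v"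
lift_definition times_sjp_loc :: "'a sjp_loc \<Rightarrow> 'a sjp_loc \<Rightarrow> 'a sjp_loc" is
  "\<lambda>(a, n) (b, m). (a * sjp_twist (of_nat n) b, n + m)"
proof clarify
  fix a b a' b' :: "'a sjp" and n m n' m'
  assume "frac_eq (a, n) (a', n')" "frac_eq (b, m) (b', m')"
  then obtain i j where "a * sjp_s ^ (n' + i) = a' * sjp_s ^ (n + i)"
    "b * sjp_s ^ (m' + j) = b' * sjp_s ^ (m + j)"
    by (auto simp: frac_eq_def)
  then obtain k where a: "a * sjp_s ^ (n' + k) = a' * sjp_s ^ (n + k)"
    and b: "b * sjp_s ^ (m' + k) = b' * sjp_s ^ (m + k)"
    by (meson mult_s_power_mono max.cobounded1 max.cobounded2)
  let ?t = "\<lambda>n. sjp_twist (of_nat n)"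
  have tb: "?t n b * sjp_s ^ (m' + k) = ?t n b' * sjp_s ^ (m + k)" for n
    using arg_cong[OF b, of "?t n"] by (simp only: sjp_twist_hom sjp_twist_s_power)
  have "a * ?t n b * sjp_s ^ (n' + m' + (k + k))
      = a * (?t n b * sjp_s ^ (n' + k)) * sjp_s ^ (m' + k)"
    by (simp add: mult.assoc add_ac flip: power_add)
  also have "\<dots> = a * sjp_s ^ (n' + k) * ?t (n + (n' + k)) b * sjp_s ^ (m' + k)"
    by (simp only: twist_s_power mult.assoc)
  also have "\<dots> = a' * (sjp_s ^ (n + k) * ?t (n' + (n + k)) b) * sjp_s ^ (m' + k)"
    by (simp only: a) (simp only: mult.assoc add_ac)
  also have "\<dots> = a' * ?t n' b * sjp_s ^ (n + k) * sjp_s ^ (m' + k)"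
    by (simp only: twist_s_power[symmetric]) (simp only: mult.assoc)
  also have "\<dots> = a' * (?t n' b * sjp_s ^ (m' + k)) * sjp_s ^ (n + k)"
    by (simp add: mult.assoc add_ac flip: power_add)
  also have "\<dots> = a' * ?t n' b' * sjp_s ^ (n + m + (k + k))"
    by (simp only: tb) (simp add: mult.assoc add_ac flip: power_add)
  finally show "frac_eq (a * ?t n b, n + m) (a' * ?t n' b', n' + m')"
    unfolding frac_eq_def by auto
qed

instance
proof
  fix u v w :: "'a sjp_loc"
  have eqI: "frac_eq (a, n) (b, m)" if "a * sjp_s ^ m = b * sjp_s ^ n" for a b :: "'a sjp" and n m
    using that unfolding frac_eq_def by (auto intro: exI[of _ 0])
  have s_twist: "sjp_s ^ m * sjp_twist (of_nat (n + m)) c = sjp_twist (of_nat n) c * sjp_s ^ m"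
    "sjp_s ^ m * sjp_twist (of_nat (m + n)) c = sjp_twist (of_nat n) c * sjp_s ^ m"
    for c :: "'a sjp" and n m
    by (simp_all only: twist_s_power add.commute)
  show "u + v + w = u + (v + w)"
    by transfer (auto intro!: eqI simp: distrib_right mult.assoc add_ac simp flip: power_add)
  show "u + v = v + u"
    by transfer (auto intro!: eqI simp: distrib_right mult.assoc add_ac simp flip: power_add)
  show "0 + u = u" by transfer (auto intro!: eqI)
  show "- u + u = 0" by transfer (auto intro!: eqI)
  show "u - v = u + - v" by (rule minus_sjp_loc_def)
  show "u * v * w = u * (v * w)"
    by transfer (auto intro!: eqI simp: sjp_twist_hom sjp_twist_sum mult.assoc add_ac)
  show "1 * u = u" by transfer (auto intro!: eqI simp: sjp_twist_zero)
  show "u * 1 = u" by transfer (auto intro!: eqI simp: sjp_twist_hom)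
  show "(u + v) * w = u * w + v * w"
  proof transfer
    fix u v w :: "'a sjp \<times> nat"
    obtain a n b m c l where eq: "u = (a, n)" "v = (b, m)" "w = (c, l)" by (cases u, cases v, cases w)
    have "(a * sjp_s ^ m + b * sjp_s ^ n) * sjp_twist (of_nat (n + m)) c
       = a * (sjp_twist (of_nat n) c * sjp_s ^ m) + b * (sjp_twist (of_nat m) c * sjp_s ^ n)"
      by (simp only: distrib_right mult.assoc s_twist)
    hence "(a * sjp_s ^ m + b * sjp_s ^ n) * sjp_twist (of_nat (n + m)) c * sjp_s ^ (n + l + (m + l))
       = (a * sjp_twist (of_nat n) c * sjp_s ^ (m + l) + b * sjp_twist (of_nat m) c * sjp_s ^ (n + l))
         * sjp_s ^ (n + m + l)"
      by (simp add: distrib_right mult.assoc add_ac flip: power_add)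
    thus "frac_eq
        ((\<lambda>(a, n) (b, m). (a * sjp_twist (of_nat n) b, n + m))
          ((\<lambda>(a, n) (b, m). (a * sjp_s ^ m + b * sjp_s ^ n, n + m)) u v) w)
        ((\<lambda>(a, n) (b, m). (a * sjp_s ^ m + b * sjp_s ^ n, n + m))
          ((\<lambda>(a, n) (b, m). (a * sjp_twist (of_nat n) b, n + m)) u w)
          ((\<lambda>(a, n) (b, m). (a * sjp_twist (of_nat n) b, n + m)) v w))"
      unfolding eq prod.case by (rule eqI)
  qed
  show "u * (v + w) = u * v + u * w"
    by transfer (auto intro!: eqI simp: sjp_twist_hom sjp_twist_s_power distrib_left distrib_right
        mult.assoc add_ac simp flip: power_add)
qed

end


definition sjp_loc_of :: "'k::field sjp \<Rightarrow> 'k sjp_loc" where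
  "sjp_loc_of a = abs_sjp_loc (a, 0)"

definition sjp_s_inverse :: "'k::field sjp_loc" where
  "sjp_s_inverse = abs_sjp_loc (1, 1)"

theorem sjp_loc_localization:
  fixes a b :: "'k::field sjp" and u :: "'k sjp_loc"
  shows "sjp_loc_of (a + b) = sjp_loc_of a + sjp_loc_of b"
    and "sjp_loc_of (a * b) = sjp_loc_of a * sjp_loc_of b"
    and "sjp_loc_of (1 :: 'k sjp) = 1"
    and "sjp_loc_of (sjp_s :: 'k sjp) * sjp_s_inverse = 1"
    and "sjp_s_inverse * sjp_loc_of (sjp_s :: 'k sjp) = 1"
    and "\<exists>a n. u = sjp_loc_of a * sjp_s_inverse ^ n"
    and "sjp_loc_of a = 0 \<longleftrightarrow> (\<exists>n. a * sjp_s ^ n = 0)"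
proof -
  note simps = sjp_loc_of_def sjp_s_inverse_def plus_sjp_loc.abs_eq times_sjp_loc.abs_eq
    zero_sjp_loc_def one_sjp_loc_def sjp_loc.abs_eq_iff frac_eq_def sjp_twist_zero sjp_twist_s
  show "sjp_loc_of (a + b) = sjp_loc_of a + sjp_loc_of b"
    "sjp_loc_of (a * b) = sjp_loc_of a * sjp_loc_of b" "sjp_loc_of (1 :: 'k sjp) = 1"
    "sjp_loc_of (sjp_s :: 'k sjp) * sjp_s_inverse = 1"
    "sjp_s_inverse * sjp_loc_of (sjp_s :: 'k sjp) = 1"
    "sjp_loc_of a = 0 \<longleftrightarrow> (\<exists>n. a * sjp_s ^ n = 0)"
    by (simp_all add: simps)
  have inv: "sjp_s_inverse ^ n = abs_sjp_loc (1 :: 'k sjp, n)" for n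
  proof (induction n)
    case 0
    show ?case by (simp add: one_sjp_loc_def)
  next
    case (Suc n)
    thus ?case
      by (simp add: sjp_s_inverse_def times_sjp_loc.abs_eq sjp_twist_hom)
  qed
  obtain a n where "u = abs_sjp_loc (a, n)"
    by (metis Quotient3_abs_rep Quotient3_sjp_loc surj_pair)
  hence "u = sjp_loc_of a * sjp_s_inverse ^ n"
    by (simp add: inv sjp_loc_of_def times_sjp_loc.abs_eq sjp_twist_zero)
  thus "\<exists>a n. u = sjp_loc_of a * sjp_s_inverse ^ n" by blast
qed

lemma sjp_C_Units: "sjp_loc_of (sjp_C :: 'k::field sjp) \<in> Units univ_ring"
proof -
  let ?x = "sjp_x :: 'k sjp" and ?y = "sjp_y :: 'k sjp" and ?s = "sjp_s :: 'k sjp"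
  let ?g = "sjp_g :: 'k sjp" and ?h = "sjp_ginv :: 'k sjp" and ?w = "2 * sjp_y * sjp_x - sjp_s :: 'k sjp"
  have gx: "?g * ?x = - ?x * ?g" and gy: "?g * ?y = (- ?y + ?x) * ?g"
  proof -
    have conj: "?g * a = ?g * a * ?h * ?g" for a
      by (simp add: mult.assoc sjp_relations(4))
    show "?g * ?x = - ?x * ?g" by (subst conj) (simp only: sjp_relations(5))
    show "?g * ?y = (- ?y + ?x) * ?g" by (subst conj) (simp only: sjp_relations(6))
  qed
  have gw: "?g * ?w = ?w * ?g"
  proof -
    have "?g * (?y * ?x) = ?g * ?y * ?x" by (simp only: mult.assoc)
    also have "\<dots> = (- ?y + ?x) * (?g * ?x)" by (simp only: gy mult.assoc)
    also have "\<dots> = (- ?y + ?x) * - ?x * ?g" by (simp only: gx mult.assoc)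
    also have "(- ?y + ?x) * - ?x = ?y * ?x" by (simp add: left_diff_distrib sjp_relations(1))
    finally have "?g * (?y * ?x) = ?y * ?x * ?g" .
    thus ?thesis
      by (simp add: mult_2 distrib_left distrib_right left_diff_distrib right_diff_distrib sjp_s_g)
  qed
  have ww: "?w * ?w = ?s * ?s"
  proof -
    have yxyx: "?y * ?x * (?y * ?x) = ?s * (?y * ?x)"
    proof -
      have "?s * (?y * ?x) = ?x * (?y * ?y) * ?x + ?y * (?x * ?y * ?x)"
        by (simp add: sjp_s_def algebra_simps)
      moreover have "?s * (?y * ?x) = ?y * ?s * ?x - ?x * ?s * ?x"
        using sjp_relations(2)[where ?'k = 'k] by (simp add: algebra_simps)
      moreover have "?x * ?s * ?x = 0"
        by (simp only: mult.assoc sjp_s_x) (simp add: sjp_relations(1) flip: mult.assoc)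
      moreover have "?s * ?x = ?x * ?y * ?x"
        by (simp add: sjp_s_def distrib_right mult.assoc sjp_relations(1))
      ultimately show ?thesis by (simp add: mult.assoc)
    qed
    have yxs: "?y * ?x * ?s = ?s * (?y * ?x)"
    proof -
      have "?y * ?x * ?s = ?y * ?s * ?x" by (simp only: mult.assoc sjp_s_x)
      also have "\<dots> = ?s * ?y * ?x + ?x * ?s * ?x"
        using sjp_relations(2)[where ?'k = 'k] by (simp add: algebra_simps)
      also have "?x * ?s * ?x = 0"
        by (simp only: mult.assoc sjp_s_x) (simp add: sjp_relations(1) flip: mult.assoc)
      finally show ?thesis by (simp add: mult.assoc)
    qed
    have w: "?w = ?y * ?x + ?y * ?x - ?s" by (simp add: mult_2 distrib_right)
    show ?thesis unfolding w
      by (simp add: distrib_left distrib_right left_diff_distrib right_diff_distrib yxyx yxs)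
  qed
  define w where "w = ?w"
  note gw = gw[folded w_def] and ww = ww[folded w_def]
  have C: "sjp_C = w * ?h" by (simp add: sjp_C_def w_def)
  define D where "D = w * ?g"
  have hw: "?h * w = w * ?h"
    by (rule commute_inverse[OF sjp_relations(3,4) gw])
  have CD: "sjp_C * D = ?s * ?s" "D * sjp_C = ?s * ?s"
  proof -
    have "sjp_C * D = w * (?h * w) * ?g" by (simp only: C D_def mult.assoc)
    also have "\<dots> = w * w * (?h * ?g)" by (simp only: hw mult.assoc)
    finally show "sjp_C * D = ?s * ?s" by (simp add: ww sjp_relations(4))
    have "D * sjp_C = w * (?g * w) * ?h" by (simp only: C D_def mult.assoc)
    also have "\<dots> = w * w * (?g * ?h)" by (simp only: gw mult.assoc)
    finally show "D * sjp_C = ?s * ?s" by (simp add: ww sjp_relations(3))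
  qed
  let ?i = "sjp_loc_of" and ?t = "sjp_s_inverse :: 'k sjp_loc"
  have "?i sjp_C * (?i D * ?t * ?t) = ?i (sjp_C * D) * ?t * ?t"
    by (simp only: sjp_loc_localization(2) mult.assoc)
  also have "\<dots> = ?i ?s * (?i ?s * ?t) * ?t"
    by (simp only: CD sjp_loc_localization(2) mult.assoc)
  also have "\<dots> = 1" by (simp add: sjp_loc_localization)
  finally have right: "?i sjp_C * (?i D * ?t * ?t) = 1" .
  have "?t * ?t * ?i D * ?i sjp_C = ?t * (?t * ?i ?s) * ?i ?s"
    by (simp only: sjp_loc_localization(2)[symmetric] mult.assoc CD)
  also have "\<dots> = 1" by (simp add: sjp_loc_localization)
  finally have left: "?t * ?t * ?i D * ?i sjp_C = 1" .
  have "?t * ?t * ?i D * (?i sjp_C * (?i D * ?t * ?t)) = ?i D * ?t * ?t"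
    by (subst mult.assoc[symmetric]) (simp add: left)
  hence "?i D * ?t * ?t = ?t * ?t * ?i D"
    by (simp add: right)
  thus ?thesis using left right by (auto simp: Units_def)
qed


section \<open>The quotient \<open>\<Lambda>\<close> and the central subalgebra\<close>

definition sjp_Lambda :: "'k::field sjp set ring" where
  "sjp_Lambda = sjp_ring Quot (Idl\<^bsub>sjp_ring\<^esub> {sjp_s, sjp_x})"

definition sjp_Lambda_preimage :: "'k::field sjp set set \<Rightarrow> 'k sjp set" where
  "sjp_Lambda_preimage \<pp> = {a. Idl\<^bsub>sjp_ring\<^esub> {sjp_s, sjp_x} +>\<^bsub>sjp_ring\<^esub> a \<in> \<pp>}"

text \<open>The subalgebra of \<open>A\<^sub>s\<close> generated by \<open>C\<close>, \<open>C\<inverse>\<close>, \<open>s\<^sup>p\<close>, \<open>s\<^sup>-\<^sup>p\<close>, \<open>y\<^sup>2\<^sup>p\<close> with \<open>p = CHAR('k)\<close>.\<close>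

definition sjp_central_subalgebra :: "'k::field sjp_loc ring" where
  "sjp_central_subalgebra = univ_ring
     \<lparr>carrier := generate_ring univ_ring
        (range (\<lambda>c. sjp_loc_of (sjp_scalar c)) \<union>
         {sjp_loc_of sjp_C, inv\<^bsub>univ_ring\<^esub> (sjp_loc_of sjp_C),
          sjp_loc_of sjp_s ^ CHAR('k), sjp_s_inverse ^ CHAR('k),
          sjp_loc_of sjp_y ^ (2 * CHAR('k))})\<rparr>"

text \<open>\<open>\<qq>A\<^sub>s \<inter> A\<close>, where the intersection is the preimage under \<open>A \<rightarrow> A\<^sub>s\<close>.\<close>

definition sjp_contraction :: "'k::field sjp_loc set \<Rightarrow> 'k sjp set" where
  "sjp_contraction \<qq> = {a. sjp_loc_of a \<in> \<qq> \<cdot>\<^bsub>univ_ring\<^esub> UNIV}"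

end

theory Submission imports Defs begin

text \<open>
  A prime containing \<open>s\<close> contains \<open>x\<close>, since \<open>x\<close> is normal modulo \<open>s\<close> and \<open>x\<^sup>2 = 0\<close>; so these
  primes come from \<open>\<Lambda>\<close>. In \<open>A\<^sub>s\<close>, put \<open>t = s\<inverse>\<close> and \<open>z = s\<^sup>2 (ty)\<^sup>2\<close>. Then \<open>x\<close> and a suitable
  \<open>mu\<close> generate \<open>2 \<times> 2\<close> matrices commuting with \<open>t\<close>, \<open>z\<close>, where \<open>tz - zt = 1\<close> and
  \<open>z\<^sup>p = y\<^sup>2\<^sup>p\<close>. Hence \<open>A\<^sub>s\<close> is spanned over \<open>Z = \<kk>[C\<^sup>\<plusminus>\<^sup>1, s\<^sup>\<plusminus>\<^sup>p, y\<^sup>2\<^sup>p]\<close> by the products of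
  matrix units with \<open>t\<^sup>i z\<^sup>j\<close>, \<open>i, j < p\<close>. Commutators with \<open>t\<close> and \<open>z\<close> isolate the coefficients
  of an element, so every ideal of \<open>A\<^sub>s\<close> is generated by its intersection with \<open>Z\<close>.

  As \<open>A\<close> is finite over the central subalgebra generated by \<open>s\<^sup>p\<close>, \<open>y\<^sup>2\<^sup>p\<close> and \<open>g\<^sup>\<plusminus>\<^sup>2\<^sup>p\<close>, the
  Nullstellensatz and Nakayama's lemma show that these elements are scalars modulo any primitive
  or maximal ideal. A prime ideal with this property contains one of the ideals listed, and each of
  those is the kernel of an irreducible matrix representation, acting on periodic sequences.
\<close>


section \<open>Prime and maximal ideals\<close>

text \<open>The ground field is algebraically closed but of arbitrary cardinality, and simple
  modules are not known to be finite-dimensional in advance; the Nullstellensatz replaces a counting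
  argument for the existence of central characters. Characteristic \<open>p\<close> enters twice:
  the vanishing of \<open>p\<close> makes \<open>s^p\<close> and \<open>y^(2p)\<close> central, and
  the invertibility of the smaller integers allows coefficients to be recovered from commutators.
  The element \<open>s\<close> is only normal, so denominators are always taken to be powers of the
  central element \<open>s^p\<close>. The dimension of a quotient by an ideal of the third family is
  never counted: a matrix representation shows that the ideal is proper, while its maximality comes
  from \<open>A\<^sub>s\<close>, where every element of \<open>Z\<close> becomes a scalar modulo
  it.\<close>

lemma (in ring) prime_spectrum_elementwise:
  "P \<in> prime_spectrum R \<longleftrightarrow> ideal P R \<and> P \<noteq> carrier R \<and>
     (\<forall>a\<in>carrier R. \<forall>b\<in>carrier R. (\<forall>r\<in>carrier R. a \<otimes> r \<otimes> b \<in> P) \<longrightarrow> a \<in> P \<or> b \<in> P)"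
  (is "?L \<longleftrightarrow> ?R")
proof
  assume L: ?L
  then interpret P: ideal P R by (simp add: prime_spectrum_def)
  have "a \<in> P \<or> b \<in> P"
    if ab: "a \<in> carrier R" "b \<in> carrier R" "\<forall>r\<in>carrier R. a \<otimes> r \<otimes> b \<in> P" for a b
  proof -
    \<comment> \<open>For fixed \<open>b\<close>, the elements \<open>i\<close> with
      \<open>i R b\<close> inside \<open>P\<close> form a two-sided ideal, so \<open>a\<close> may
      be replaced by \<open>Idl {a}\<close>. The set \<open>?J\<close> below does the same for
      \<open>b\<close> on the right.\<close>
    have left: "ideal {i \<in> carrier R. \<forall>r\<in>carrier R. i \<otimes> r \<otimes> b \<in> P} R" (is "ideal ?I R")
      if b: "b \<in> carrier R" for b
    proof (rule idealI[OF ring_axioms])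
      show "subgroup ?I (add_monoid R)"
        using b P.a_inv_closed
        by (intro add.subgroupI) (auto simp: l_distr l_minus P.a_closed intro!: exI[of _ \<zero>])
    next
      fix i r assume "i \<in> ?I" "r \<in> carrier R"
      thus "r \<otimes> i \<in> ?I" using b P.I_l_closed by (auto simp: m_assoc)
      have "i \<otimes> r \<otimes> q \<otimes> b = i \<otimes> (r \<otimes> q) \<otimes> b" if "q \<in> carrier R" for q
        using \<open>i \<in> ?I\<close> \<open>r \<in> carrier R\<close> b that by (simp add: m_assoc)
      thus "i \<otimes> r \<in> ?I" using \<open>i \<in> ?I\<close> \<open>r \<in> carrier R\<close> b by auto
    qed
    have right: "ideal {j \<in> carrier R. \<forall>r\<in>carrier R. i \<otimes> r \<otimes> j \<in> P} R" (is "ideal ?J R")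
      if i: "i \<in> carrier R" for i
    proof (rule idealI[OF ring_axioms])
      show "subgroup ?J (add_monoid R)"
        using i P.a_inv_closed
        by (intro add.subgroupI) (auto simp: r_distr r_minus P.a_closed intro!: exI[of _ \<zero>])
    next
      fix j r assume j: "j \<in> ?J" and r: "r \<in> carrier R"
      have "i \<otimes> q \<otimes> (r \<otimes> j) = i \<otimes> (q \<otimes> r) \<otimes> j" if "q \<in> carrier R" for q
        using i j r that by (simp add: m_assoc)
      thus "r \<otimes> j \<in> ?J" using i j r by auto
      have "i \<otimes> q \<otimes> (j \<otimes> r) = i \<otimes> q \<otimes> j \<otimes> r" if "q \<in> carrier R" for q
        using i j r that by (simp add: m_assoc)
      thus "j \<otimes> r \<in> ?J" using i j r P.I_r_closed by auto
    qed
    have I: "Idl {a} \<subseteq> {i \<in> carrier R. \<forall>r\<in>carrier R. i \<otimes> r \<otimes> b \<in> P}"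
      using ab by (intro genideal_minimal left) auto
    have J: "Idl {b} \<subseteq> {j \<in> carrier R. \<forall>r\<in>carrier R. i \<otimes> r \<otimes> j \<in> P}" if "i \<in> Idl {a}" for i
      using ab I that by (intro genideal_minimal right) auto
    have prod: "i \<otimes> j \<in> P" if "i \<in> Idl {a}" "j \<in> Idl {b}" for i j
    proof -
      have "i \<in> carrier R" using I that(1) by blast
      moreover have "i \<otimes> \<one> \<otimes> j \<in> P" using J[OF that(1)] that(2) one_closed by blast
      ultimately show ?thesis by simp
    qed
    have "u \<in> P" if "u \<in> (Idl {a}) \<cdot> (Idl {b})" for u
      using that by induction (auto simp: P.a_closed prod)
    hence "(Idl {a}) \<cdot> (Idl {b}) \<subseteq> P" by (rule subsetI)
    hence "Idl {a} \<subseteq> P \<or> Idl {b} \<subseteq> P"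
      using L genideal_ideal[of "{a}"] genideal_ideal[of "{b}"] ab unfolding prime_spectrum_def
        by simp
    thus ?thesis using genideal_self'[OF ab(1)] genideal_self'[OF ab(2)] by auto
  qed
  thus ?R using L by (auto simp: prime_spectrum_def)
next
  assume R: ?R
  have "I \<subseteq> P \<or> J \<subseteq> P" if IJ: "ideal I R" "ideal J R" "I \<cdot> J \<subseteq> P" for I J
  proof (rule ccontr)
    assume "\<not> ?thesis"
    then obtain a b where a: "a \<in> I" "a \<notin> P" and b: "b \<in> J" "b \<notin> P" by blast
    have "a \<otimes> r \<otimes> b \<in> P" if "r \<in> carrier R" for r
      using ideal_prod.prod[OF ideal.I_r_closed[OF IJ(1) a(1) that] b(1), of R] IJ(3) by auto
    moreover have "a \<in> carrier R" "b \<in> carrier R"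
      using ideal.Icarr[OF IJ(1) a(1)] ideal.Icarr[OF IJ(2) b(1)] .
    ultimately show False using R a(2) b(2) by auto
  qed
  thus ?L using R by (auto simp: prime_spectrum_def)
qed

lemma prime_spectrum_univ_iff:
  fixes P :: "'a::{ring,monoid_mult} set"
  shows "P \<in> prime_spectrum univ_ring \<longleftrightarrow> ideal P univ_ring \<and> 1 \<notin> P \<and>
     (\<forall>a b. (\<forall>r. a * r * b \<in> P) \<longrightarrow> a \<in> P \<or> b \<in> P)"
proof -
  have "P \<noteq> UNIV \<longleftrightarrow> 1 \<notin> P" if "ideal P (univ_ring :: 'a ring)"
    using that ideal.one_imp_carrier by fastforce
  thus ?thesis
    by (auto simp: ring.prime_spectrum_elementwise[OF ring_univ_ring])
qed

lemma univ_ideal_minus: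
  fixes I :: "'a::{ring,monoid_mult} set"
  assumes "ideal I univ_ring"
  shows "a \<in> I \<Longrightarrow> - a \<in> I" "a \<in> I \<Longrightarrow> b \<in> I \<Longrightarrow> a - b \<in> I"
proof -
  show minus: "- a \<in> I" if "a \<in> I" for a
    using assms that unfolding ideal_univ_ring_iff by (metis mult_1 mult_minus_left)
  show "a - b \<in> I" if "a \<in> I" "b \<in> I" for a b
    using assms minus that unfolding ideal_univ_ring_iff by (metis add_uminus_conv_diff)
qed

lemma max_spectrum_univ_iff:
  fixes I :: "'a::{ring,monoid_mult} set"
  shows "I \<in> max_spectrum univ_ring \<longleftrightarrow> ideal I univ_ring \<and> 1 \<notin> I \<and>
     (\<forall>J. ideal J univ_ring \<longrightarrow> I \<subseteq> J \<longrightarrow> J = I \<or> 1 \<in> J)"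
proof -
  have one: "J = UNIV \<longleftrightarrow> 1 \<in> J" if "ideal J (univ_ring :: 'a ring)" for J
    using that ideal.one_imp_carrier by fastforce
  show ?thesis
    unfolding max_spectrum_def mem_Collect_eq
  proof
    assume "maximalideal I univ_ring"
    then interpret maximalideal I univ_ring .
    show "ideal I univ_ring \<and> 1 \<notin> I \<and> (\<forall>J. ideal J univ_ring \<longrightarrow> I \<subseteq> J \<longrightarrow> J = I \<or> 1 \<in> J)"
      using I_notcarr I_maximal one is_ideal by auto
  next
    assume "ideal I univ_ring \<and> 1 \<notin> I \<and> (\<forall>J. ideal J univ_ring \<longrightarrow> I \<subseteq> J \<longrightarrow> J = I \<or> 1 \<in> J)"
    thus "maximalideal I univ_ring"
      using one by (intro maximalidealI) auto
  qed
qed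

text \<open>If \<open>a R b\<close> lies in \<open>P\<close> and \<open>a\<close> does not, the
  ideal of all \<open>i\<close> with \<open>i R b\<close> in \<open>P\<close> is strictly larger
  than \<open>P\<close>; it therefore contains \<open>1\<close>, which puts \<open>b\<close> into
  \<open>P\<close>.\<close>

lemma max_spectrum_univ_prime:
  fixes P :: "'a::{ring,monoid_mult} set"
  assumes "P \<in> max_spectrum univ_ring"
  shows "P \<in> prime_spectrum univ_ring"
proof -
  have P: "ideal P univ_ring" "1 \<notin> P"
    and max: "\<And>J. ideal J univ_ring \<Longrightarrow> P \<subseteq> J \<Longrightarrow> J = P \<or> 1 \<in> J"
    using assms by (auto simp: max_spectrum_univ_iff)
  note Pi = P(1)[unfolded ideal_univ_ring_iff]
  have "b \<in> P" if ab: "\<forall>r. a * r * b \<in> P" and a: "a \<notin> P" for a b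
  proof -
    have left: "ideal {i. \<forall>r. i * r * b \<in> P} univ_ring"
      using Pi by (simp add: ideal_univ_ring_iff distrib_right) (metis mult.assoc)
    have "P \<subseteq> {i. \<forall>r. i * r * b \<in> P}" using Pi by auto
    moreover have "{i. \<forall>r. i * r * b \<in> P} \<noteq> P" using ab a by auto
    ultimately have "1 \<in> {i. \<forall>r. i * r * b \<in> P}" using max[OF left] by blast
    hence "1 * 1 * b \<in> P" by blast
    thus ?thesis by simp
  qed
  thus ?thesis using P by (auto simp: prime_spectrum_univ_iff)
qed

hide_const (open) Module.smult UnivPoly.coeff UnivPoly.monom

section \<open>The Nullstellensatz by extension of homomorphisms\<close>

definition unital_hom :: "('a::ring_1 \<Rightarrow> 'b::ring_1) \<Rightarrow> bool" where
  "unital_hom \<phi> \<longleftrightarrow> \<phi> 1 = 1 \<and> (\<forall>a b. \<phi> (a + b) = \<phi> a + \<phi> b) \<and> (\<forall>a b. \<phi> (a * b) = \<phi> a * \<phi> b)"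

lemma unital_homD:
  assumes "unital_hom \<phi>"
  shows "\<phi> 1 = 1" "\<phi> (a + b) = \<phi> a + \<phi> b" "\<phi> (a * b) = \<phi> a * \<phi> b"
    "\<phi> 0 = 0" "\<phi> (- a) = - \<phi> a" "\<phi> (a - b) = \<phi> a - \<phi> b" "\<phi> (a ^ n) = \<phi> a ^ n"
proof -
  show one: "\<phi> 1 = 1" and add: "\<phi> (a + b) = \<phi> a + \<phi> b" and mult: "\<phi> (a * b) = \<phi> a * \<phi> b" for a b
    using assms by (auto simp: unital_hom_def)
  show zero: "\<phi> 0 = 0" using add[of 0 0] by simp
  show minus: "\<phi> (- a) = - \<phi> a" for a
    using add[of a "- a"] zero by (simp add: eq_neg_iff_add_eq_0 add.commute)
  show "\<phi> (a - b) = \<phi> a - \<phi> b" using add[of a "- b"] minus by simp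
  show "\<phi> (a ^ n) = \<phi> a ^ n" by (induction n) (simp_all add: one mult)
qed

text \<open>The target may be noncommutative: values are taken in \<open>A\<close>, at elements that
  commute with the images of the coefficients. Powers of \<open>c\<close> stand to the left of the
  coefficients.\<close>

definition eval_poly :: "('a::comm_ring_1 \<Rightarrow> 'b::ring_1) \<Rightarrow> 'b \<Rightarrow> 'a poly \<Rightarrow> 'b" where
  "eval_poly \<phi> c F = fold_coeffs (\<lambda>a b. \<phi> a + c * b) F 0"

lemma eval_poly_0 [simp]: "eval_poly \<phi> c 0 = 0"
  by (simp add: eval_poly_def)

lemma eval_poly_pCons:
  assumes "unital_hom \<phi>"
  shows "eval_poly \<phi> c (pCons a F) = \<phi> a + c * eval_poly \<phi> c F"
  by (cases "F = 0 \<and> a = 0") (auto simp: eval_poly_def unital_homD[OF assms])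

lemma eval_poly_const:
  assumes "unital_hom \<phi>"
  shows "eval_poly \<phi> c [:a:] = \<phi> a"
  by (simp add: eval_poly_pCons[OF assms])

lemma eval_poly_X:
  assumes "unital_hom \<phi>"
  shows "eval_poly \<phi> c [:0, 1:] = c"
  by (simp add: eval_poly_pCons[OF assms] unital_homD[OF assms])

lemma unital_hom_eval_poly:
  assumes hom: "unital_hom \<phi>" and comm: "\<And>a. \<phi> a * c = c * \<phi> a"
  shows "unital_hom (eval_poly \<phi> c)"
proof -
  note simps = eval_poly_pCons[OF hom] unital_homD[OF hom]
  have add: "eval_poly \<phi> c (F + G) = eval_poly \<phi> c F + eval_poly \<phi> c G" for F G
    by (induction F G rule: poly_induct2) (simp_all add: simps algebra_simps)
  have smult: "eval_poly \<phi> c (smult a F) = \<phi> a * eval_poly \<phi> c F" for a F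
  proof (induction F)
    case (pCons b F)
    have "\<phi> a * (c * eval_poly \<phi> c F) = c * (\<phi> a * eval_poly \<phi> c F)"
      by (simp add: comm flip: mult.assoc)
    thus ?case using pCons by (simp add: simps distrib_left)
  qed simp
  have "eval_poly \<phi> c (F * G) = eval_poly \<phi> c F * eval_poly \<phi> c G" for F G
    by (induction F) (simp_all add: simps add smult algebra_simps)
  thus ?thesis using add eval_poly_const[OF hom, of c 1]
    by (simp add: unital_hom_def unital_homD[OF hom] one_pCons)
qed

lemma eval_poly_commute:
  assumes hom: "unital_hom \<phi>" and comm: "\<And>a. \<phi> a * d = d * \<phi> a" "c * d = d * c"
  shows "eval_poly \<phi> c F * d = d * eval_poly \<phi> c F"
proof (induction F)
  case (pCons a F)
  have "c * eval_poly \<phi> c F * d = d * (c * eval_poly \<phi> c F)"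
    by (simp only: mult.assoc pCons.IH) (simp only: comm mult.assoc[symmetric])
  thus ?case by (simp add: eval_poly_pCons[OF hom] distrib_left distrib_right comm)
qed simp

lemma eval_poly_conv_poly:
  fixes \<phi> :: "'a::comm_ring_1 \<Rightarrow> 'k::field"
  assumes "unital_hom \<phi>"
  shows "eval_poly \<phi> c F = poly (map_poly \<phi> F) c"
  by (induction F) (simp_all add: eval_poly_pCons[OF assms] map_poly_pCons unital_homD[OF assms])

section \<open>Separating prime ideals from elements by characters\<close>

lemma prime_spectrum_comm_iff:
  fixes Q :: "'a::comm_ring_1 set"
  shows "Q \<in> prime_spectrum univ_ring \<longleftrightarrow>
     ideal Q univ_ring \<and> 1 \<notin> Q \<and> (\<forall>a b. a * b \<in> Q \<longrightarrow> a \<in> Q \<or> b \<in> Q)"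
proof -
  have "(\<forall>r. a * r * b \<in> Q) \<longleftrightarrow> a * b \<in> Q" if "ideal Q univ_ring" for a b
  proof
    assume "\<forall>r. a * r * b \<in> Q"
    hence "a * 1 * b \<in> Q" by blast
    thus "a * b \<in> Q" by simp
  next
    assume "a * b \<in> Q"
    hence "r * (a * b) \<in> Q" for r using that by (simp add: ideal_univ_ring_iff)
    thus "\<forall>r. a * r * b \<in> Q" by (simp add: algebra_simps)
  qed
  thus ?thesis unfolding prime_spectrum_univ_iff by blast
qed

text \<open>Every prime ideal is an intersection of kernels of characters from \<open>H\<close>. The
  element \<open>f\<close> to be avoided is part of the notion because the step from
  \<open>R\<close> to \<open>R[X]\<close> must keep a leading coefficient and a further constant
  away from zero.\<close>

definition nullstellensatz :: "('a::comm_ring_1 \<Rightarrow> 'k::field) set \<Rightarrow> bool" where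
  "nullstellensatz H \<longleftrightarrow> (\<forall>\<phi>\<in>H. unital_hom \<phi>) \<and>
     (\<forall>Q f. Q \<in> prime_spectrum univ_ring \<longrightarrow> f \<notin> Q \<longrightarrow> (\<exists>\<phi>\<in>H. (\<forall>q\<in>Q. \<phi> q = 0) \<and> \<phi> f \<noteq> 0))"

lemma nullstellensatz_field: "nullstellensatz {\<lambda>c::'k::field. c}"
proof -
  have "q = 0" if Q: "Q \<in> prime_spectrum univ_ring" and q: "q \<in> Q" for Q :: "'k set" and q
  proof (rule ccontr)
    assume "q \<noteq> 0"
    moreover have "inverse q * q \<in> Q"
      using Q q by (simp add: prime_spectrum_comm_iff ideal_univ_ring_iff)
    ultimately show False using Q by (simp add: prime_spectrum_comm_iff)
  qed
  moreover have "0 \<in> Q" if "Q \<in> prime_spectrum univ_ring" for Q :: "'k set"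
    using that by (simp add: prime_spectrum_comm_iff ideal_univ_ring_iff)
  ultimately show ?thesis unfolding nullstellensatz_def by (auto simp: unital_hom_def)
qed

text \<open>Let \<open>q\<close> be the contraction of \<open>Q\<close> to the base ring
  \<open>R\<close>. If all coefficients of elements of \<open>Q\<close> lie in \<open>q\<close>, any
  point off the zeros of the specialised \<open>f\<close> works. Otherwise \<open>Q\<close> contains
  a polynomial with leading coefficient outside \<open>q\<close>; over the fraction field of
  \<open>R/q\<close> such a \<open>P\<close> of least degree generates \<open>Q\<close>, and
  \<open>\<tau>\<close> is a root of the specialised \<open>P\<close>. Pseudo-division replaces the
  fraction field throughout.\<close>

theorem nullstellensatz_poly:
  fixes H :: "('r::comm_ring_1 \<Rightarrow> 'k::alg_closed_field) set"
  assumes H: "nullstellensatz H"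
  shows "nullstellensatz {eval_poly \<phi> \<tau> | \<phi> \<tau>. \<phi> \<in> H}"
proof -
  have hom: "unital_hom \<phi>" if "\<phi> \<in> H" for \<phi> using H that by (simp add: nullstellensatz_def)
  have homp: "unital_hom (eval_poly \<phi> \<tau>)" if "\<phi> \<in> H" for \<phi> \<tau>
    by (rule unital_hom_eval_poly[OF hom[OF that]]) (simp add: mult.commute)
  have "\<exists>\<phi>\<in>H. \<exists>\<tau>. (\<forall>h\<in>Q. eval_poly \<phi> \<tau> h = 0) \<and> eval_poly \<phi> \<tau> f \<noteq> 0"
    if Q: "Q \<in> prime_spectrum univ_ring" and f: "f \<notin> Q" for Q :: "'r poly set" and f
  proof -
    have Qi: "ideal Q univ_ring" and Q1: "1 \<notin> Q" and Qp: "\<And>a b. a * b \<in> Q \<Longrightarrow> a \<in> Q \<or> b \<in> Q"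
      using Q by (auto simp: prime_spectrum_comm_iff)
    have Q0: "0 \<in> Q" and Qadd: "\<And>a b. a \<in> Q \<Longrightarrow> b \<in> Q \<Longrightarrow> a + b \<in> Q"
      and Ql: "\<And>a r. a \<in> Q \<Longrightarrow> r * a \<in> Q" and Qr: "\<And>a r. a \<in> Q \<Longrightarrow> a * r \<in> Q"
      using Qi by (auto simp: ideal_univ_ring_iff)
    note Qdiff = univ_ideal_minus(2)[OF Qi]
    define q where "q = {r. [:r:] \<in> Q}"
    have "[:r * a:] \<in> Q" "[:a * r:] \<in> Q" if "a \<in> q" for a r
    proof -
      have "[:r:] * [:a:] \<in> Q" "[:a:] * [:r:] \<in> Q" using that
        by (auto simp only: q_def mem_Collect_eq intro: Ql Qr)
      thus "[:r * a:] \<in> Q" "[:a * r:] \<in> Q" by (simp_all add: mult.commute)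
    qed
    moreover have "[:a + b:] \<in> Q" if "a \<in> q" "b \<in> q" for a b
      using Qadd[of "[:a:]" "[:b:]"] that by (simp add: q_def)
    moreover have "a \<in> q \<or> b \<in> q" if "a * b \<in> q" for a b
      using Qp[of "[:a:]" "[:b:]"] that by (simp add: q_def mult.commute)
    ultimately have q: "q \<in> prime_spectrum univ_ring"
      using Q0 Q1 by (auto simp: prime_spectrum_comm_iff ideal_univ_ring_iff q_def one_pCons)
    have qi: "ideal q univ_ring" and qp: "\<And>a b. a * b \<in> q \<Longrightarrow> a \<in> q \<or> b \<in> q" and q1: "1 \<notin> q"
      using q by (auto simp: prime_spectrum_comm_iff)
    have q0: "0 \<in> q" and qadd: "\<And>a b. a \<in> q \<Longrightarrow> b \<in> q \<Longrightarrow> a + b \<in> q"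
      and ql: "\<And>a r. a \<in> q \<Longrightarrow> r * a \<in> q"
      using qi by (auto simp: ideal_univ_ring_iff)
    note qdiff = univ_ideal_minus(2)[OF qi]
    have qpow: "a ^ n \<notin> q" if "a \<notin> q" for a n
      using that q1 qp by (induction n) auto
    have qsum: "sum F K \<in> q" if "\<And>i. i \<in> K \<Longrightarrow> F i \<in> q" for F and K :: "nat set"
      using that by (induction K rule: infinite_finite_induct) (auto simp: q0 qadd)
    have coeffs: "F \<in> Q" if "\<And>i. coeff F i \<in> q" for F
      using that
    proof (induction F)
      case 0
      show ?case by (rule Q0)
    next
      case (pCons a F)
      have "a \<in> q" using pCons.prems[of 0] by simp
      moreover have "F \<in> Q" using pCons.prems[of "Suc i" for i] by (intro pCons.IH) simp
      ultimately have "[:a:] + [:0, 1:] * F \<in> Q" by (intro Qadd Ql) (simp add: q_def)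
      thus ?case by simp
    qed
    \<comment> \<open>Discarding leading terms with coefficients in \<open>q\<close> yields a
      representative that has the same degree as its class in \<open>(R/q)[X]\<close>.\<close>
    have strip: "\<exists>G. (\<forall>i. coeff (F - G) i \<in> q) \<and> lead_coeff G \<notin> q \<and> degree G \<le> degree F"
      if "coeff F i \<notin> q" for F i
      using that
    proof (induction "degree F" arbitrary: F rule: less_induct)
      case less
      show ?case
      proof (cases "lead_coeff F \<in> q")
        case False
        thus ?thesis by (intro exI[of _ F]) (simp add: q0)
      next
        case True
        let ?m = "monom (lead_coeff F) (degree F)"
        have i: "i \<noteq> degree F" using True less.prems by auto
        have nz: "coeff (F - ?m) i \<notin> q" using i less.prems by simp
        hence "F - ?m \<noteq> 0" using q0 by (metis coeff_0)
        moreover have "degree (F - ?m) \<le> degree F"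
          by (intro degree_diff_le) (simp_all add: degree_monom_le)
        ultimately have deg: "degree (F - ?m) < degree F"
          by (intro degree_less_if_less_eqI) auto
        then obtain G where G: "\<forall>i. coeff (F - ?m - G) i \<in> q" "lead_coeff G \<notin> q"
          "degree G \<le> degree (F - ?m)"
          using less.hyps[OF deg nz] by blast
        have "coeff (F - G) j \<in> q" for j
        proof -
          have "coeff (F - G) j = coeff (F - ?m - G) j + coeff ?m j" by simp
          thus ?thesis using G(1) True by (auto intro!: qadd simp: q0 simp del: coeff_diff)
        qed
        thus ?thesis using G deg by (intro exI[of _ G]) auto
      qed
    qed
    obtain i where i: "coeff f i \<notin> q" using coeffs f by blast
    show ?thesis
    proof (cases "\<forall>F\<in>Q. \<forall>i. coeff F i \<in> q")
      case True
      obtain \<phi> where \<phi>: "\<phi> \<in> H" "\<forall>r\<in>q. \<phi> r = 0" "\<phi> (coeff f i) \<noteq> 0"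
        using H q i unfolding nullstellensatz_def by blast
      have \<phi>0: "\<phi> 0 = 0" by (rule unital_homD(4)[OF hom[OF \<phi>(1)]])
      let ?g = "map_poly \<phi> f"
      have "coeff ?g i \<noteq> 0" using \<phi> \<phi>0 by (simp add: coeff_map_poly)
      hence g: "?g \<noteq> 0" by auto
      \<comment> \<open>A root of \<open>X g - 1\<close> is a point where \<open>g\<close> does not
        vanish.\<close>
      have "degree (pCons (- 1) ?g) > 0" using g by simp
      then obtain \<tau> where "poly (pCons (- 1) ?g) \<tau> = 0"
        using alg_closed_imp_poly_has_root by blast
      hence "poly ?g \<tau> \<noteq> 0" by auto
      moreover have "map_poly \<phi> h = 0" if "h \<in> Q" for h
        using True that \<phi> \<phi>0 by (intro poly_eqI) (simp add: coeff_map_poly)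
      ultimately show ?thesis
        using \<phi> by (intro bexI[of _ \<phi>] exI[of _ \<tau>]) (simp_all add: eval_poly_conv_poly hom)
    next
      case False
      then obtain F j where "F \<in> Q" "coeff F j \<notin> q" by blast
      moreover from strip[OF this(2)] obtain G where "\<forall>i. coeff (F - G) i \<in> q" "lead_coeff G \<notin> q"
        by blast
      ultimately have "G \<in> Q" "lead_coeff G \<notin> q"
        using Qdiff[OF _ coeffs[of "F - G"], of F] by auto
      then obtain P where P: "P \<in> Q" "lead_coeff P \<notin> q"
        and min: "\<And>P'. P' \<in> Q \<Longrightarrow> lead_coeff P' \<notin> q \<Longrightarrow> degree P \<le> degree P'"
        using ex_has_least_nat[of "\<lambda>P. P \<in> Q \<and> lead_coeff P \<notin> q" G degree] by blast
      define a where "a = lead_coeff P"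
      have P0: "P \<noteq> 0" using P(2) q0 by auto
      \<comment> \<open>By minimality of \<open>P\<close>, elements of \<open>Q\<close> of smaller
        degree vanish modulo \<open>q\<close>.\<close>
      have low: "coeff v i \<in> q" if "v \<in> Q" "degree v < degree P" for v i
      proof (rule ccontr)
        assume "coeff v i \<notin> q"
        from strip[OF this] obtain G where "\<forall>i. coeff (v - G) i \<in> q" "lead_coeff G \<notin> q"
          "degree G \<le> degree v" by blast
        moreover from this have "G \<in> Q" using Qdiff[OF \<open>v \<in> Q\<close> coeffs[of "v - G"]] by simp
        ultimately show False using min[of G] that by simp
      qed
      have degP: "degree P > 0"
      proof (rule ccontr)
        assume "\<not> ?thesis"
        hence "P = [:lead_coeff P:]" using degree_0_id[of P] by simp
        thus False using P by (simp add: q_def)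
      qed
      have pdiv: "\<exists>n u v. smult (lead_coeff G ^ n) F = G * u + v \<and> (v = 0 \<or> degree v < degree G)"
        if "G \<noteq> 0" for F G :: "'r poly"
      proof -
        obtain u v where "pseudo_divmod F G = (u, v)" by fastforce
        from pseudo_divmod[OF that this] show ?thesis by blast
      qed
      have smultQ: "smult c F \<in> Q \<longleftrightarrow> c \<in> q \<or> F \<in> Q" for c F
        using Qp[of "[:c:]" F] Ql[of F "[:c:]"] Qr[of "[:c:]" F] by (auto simp: q_def)
      \<comment> \<open>Some multiple of \<open>f\<close> is congruent modulo \<open>Q\<close> to a
        constant \<open>r\<close> outside \<open>q\<close>. It is found as a polynomial of least
        degree among those outside \<open>Q\<close> that are congruent to a multiple of
        \<open>f\<close>.\<close>
      obtain r u where r: "r \<notin> q" "[:r:] - f * u \<in> Q"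
      proof -
        let ?F = "\<lambda>F. F \<notin> Q \<and> (\<exists>u. F - f * u \<in> Q)"
        have "?F f" using f Q0 by (auto intro!: exI[of _ 1])
        then obtain F where F: "?F F" and minF: "\<And>G. ?F G \<Longrightarrow> degree F \<le> degree G"
          using ex_has_least_nat[of ?F f degree] by blast
        obtain j where "coeff F j \<notin> q" using coeffs F by blast
        from strip[OF this] obtain G where G: "\<forall>i. coeff (F - G) i \<in> q" "lead_coeff G \<notin> q"
          "degree G \<le> degree F" by blast
        have FG: "F - G \<in> Q" using G(1) coeffs by blast
        have GQ: "G \<notin> Q" using F Qadd[OF FG, of G] by auto
        obtain u where u: "G - f * u \<in> Q"
        proof -
          obtain u where "F - f * u \<in> Q" using F by blast
          from Qdiff[OF this FG] show ?thesis by (intro that[of u]) simp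
        qed
        have minG: "v \<in> Q" if "v - f * w \<in> Q" "v = 0 \<or> degree v < degree G" for v w
        proof (cases "v = 0")
          case False
          with that(2) G(3) have "degree v < degree F" by simp
          thus ?thesis using minF[of v] that(1) by fastforce
        qed (simp add: Q0)
        have G0: "G \<noteq> 0" using G(2) q0 by auto
        define c where "c = lead_coeff G"
        \<comment> \<open>Otherwise pseudo-division of \<open>G\<close> by \<open>P\<close> leaves a
          remainder of smaller degree that is still a multiple of \<open>f\<close> modulo
          \<open>Q\<close>.\<close>
        have degG: "degree G < degree P"
        proof (rule ccontr)
          assume *: "\<not> ?thesis"
          obtain n w v where v: "smult (a ^ n) G = P * w + v" "v = 0 \<or> degree v < degree P"
            using pdiv[OF P0, of G] by (auto simp: a_def)
          have "smult (a ^ n) (G - f * u) - P * w \<in> Q"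
            by (intro Qdiff) (simp_all add: smultQ u Qr P)
          moreover have "smult (a ^ n) (G - f * u) - P * w = v - f * smult (a ^ n) u"
            using v(1) by (simp add: smult_diff_right)
          ultimately have "v - f * smult (a ^ n) u \<in> Q" by simp
          moreover have "v = 0 \<or> degree v < degree G" using v(2) * by auto
          ultimately have "v \<in> Q" by (rule minG)
          hence "smult (a ^ n) G \<in> Q" unfolding v(1) by (intro Qadd Qr P)
          thus False using GQ qpow[of a n] P(2) by (simp add: smultQ a_def)
        qed
        \<comment> \<open>Otherwise \<open>P\<close> is pseudo-divided by \<open>G\<close>. The
          remainder lies in \<open>Q\<close> by minimality of \<open>G\<close>, so
          \<open>G * w\<close> and hence \<open>w\<close> lie in \<open>Q\<close>. Comparing top
          coefficients in the division identity gives a contradiction whether or not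
          \<open>w\<close> vanishes modulo \<open>q\<close>.\<close>
        have "degree G = 0"
        proof (rule ccontr)
          assume *: "degree G \<noteq> 0"
          obtain n w v where v: "smult (c ^ n) P = G * w + v" "v = 0 \<or> degree v < degree G"
            using pdiv[OF G0, of P] by (auto simp: c_def)
          have "smult (c ^ n) P - (G - f * u) * w \<in> Q"
            by (intro Qdiff) (simp_all add: smultQ u Qr P)
          moreover have "smult (c ^ n) P - (G - f * u) * w = v - f * (- u * w)"
            unfolding v(1) by (simp add: left_diff_distrib mult.assoc)
          ultimately have "v - f * (- u * w) \<in> Q" by simp
          hence vQ: "v \<in> Q" using v(2) by (rule minG)
          have "smult (c ^ n) P \<in> Q" using P(1) by (simp add: smultQ)
          from Qdiff[OF this vQ] have "G * w \<in> Q" unfolding v(1) by simp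
          hence w: "w \<in> Q" using Qp GQ by blast
          have vk: "coeff v k = 0" if "k \<ge> degree G" for k
            using v(2) that by (auto intro: coeff_eq_0)
          have multq: "coeff (G * e) k \<in> q" if "\<And>k. coeff e k \<in> q" for e k
            unfolding coeff_mult using that by (intro qsum ql)
          show False
          proof (cases "\<exists>k. coeff w k \<notin> q")
            case False
            have "coeff (smult (c ^ n) P) (degree P) \<in> q"
              unfolding v(1) using False vk degG by (simp add: multq)
            hence "c ^ n \<in> q \<or> lead_coeff P \<in> q" using qp by simp
            thus False using qpow[of c n] G(2) P(2) by (auto simp: c_def)
          next
            case True
            then obtain k where "coeff w k \<notin> q" by blast
            from strip[OF this] obtain w' where w': "\<forall>i. coeff (w - w') i \<in> q" "lead_coeff w' \<notin> q"
              by blast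
            have "w' \<in> Q" using Qdiff[OF w coeffs[of "w - w'"]] w'(1) by simp
            hence deg: "degree P \<le> degree w'" using min w'(2) by blast
            let ?k = "degree G + degree w'"
            have "G * w' = smult (c ^ n) P - v - G * (w - w')"
              unfolding v(1) by (simp add: right_diff_distrib)
            moreover have "coeff P ?k = 0" using deg * by (intro coeff_eq_0) simp
            ultimately have "coeff (G * w') ?k = - coeff (G * (w - w')) ?k"
              by (simp add: vk del: coeff_mult)
            hence "lead_coeff G * lead_coeff w' \<in> q"
              using univ_ideal_minus(1)[OF qi multq[of "w - w'" ?k]] w'(1)
              by (simp add: coeff_mult_degree_sum)
            thus False using qp G(2) w'(2) by blast
          qed
        qed
        hence "G = [:lead_coeff G:]" using degree_0_id[of G] by simp
        then obtain r where "G = [:r:]" by blast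
        with G(2) u show ?thesis by (intro that[of r u]) simp_all
      qed
      \<comment> \<open>The constant \<open>a\<close> must survive so that \<open>P\<close>
        specialises to a nonconstant polynomial, and \<open>r\<close> so that \<open>f\<close> does
        not vanish at the root.\<close>
      have "a * r \<notin> q" using qp r P(2) by (auto simp: a_def)
      then obtain \<phi> where \<phi>: "\<phi> \<in> H" "\<forall>r\<in>q. \<phi> r = 0" "\<phi> (a * r) \<noteq> 0"
        using H q unfolding nullstellensatz_def by blast
      note h = unital_homD[OF hom[OF \<phi>(1)]]
      have nz: "\<phi> a \<noteq> 0" "\<phi> r \<noteq> 0" using \<phi>(3) by (auto simp: h)
      have "degree (map_poly \<phi> P) \<ge> degree P"
        using nz h(4) by (intro le_degree) (simp add: coeff_map_poly a_def)
      with degP obtain \<tau> where \<tau>: "poly (map_poly \<phi> P) \<tau> = 0"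
        using alg_closed_imp_poly_has_root[of "map_poly \<phi> P"] by auto
      let ?e = "eval_poly \<phi> \<tau>"
      note he = unital_homD[OF homp[OF \<phi>(1), of \<tau>]]
      have eP: "?e P = 0" using \<tau> by (simp add: eval_poly_conv_poly hom \<phi>)
      \<comment> \<open>Pseudo-division by \<open>P\<close> reduces an element of \<open>Q\<close>
        to a remainder with coefficients in \<open>q\<close>, which \<open>\<phi>\<close>
        kills.\<close>
      have kill: "?e h = 0" if "h \<in> Q" for h
      proof -
        obtain n w v where v: "smult (a ^ n) h = P * w + v" "v = 0 \<or> degree v < degree P"
          using pdiv[OF P0, of h] by (auto simp: a_def)
        have "v = smult (a ^ n) h - P * w" using v(1) by simp
        hence "v \<in> Q" using that P by (simp only:) (intro Qdiff, simp_all add: smultQ Qr)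
        hence "coeff v i \<in> q" for i
          using v(2) low[of v i] q0 by (cases "v = 0") simp_all
        hence "map_poly \<phi> v = 0" using \<phi>(2) h(4) by (intro poly_eqI) (simp add: coeff_map_poly)
        hence "?e v = 0" by (simp add: eval_poly_conv_poly hom \<phi>)
        hence "?e (smult (a ^ n) h) = 0" using v(1) eP by (simp add: he)
        moreover have "?e (smult (a ^ n) h) = \<phi> a ^ n * ?e h"
          using he(3)[of "[:a ^ n:]" h] by (simp add: eval_poly_const hom \<phi> h)
        ultimately show ?thesis using nz by simp
      qed
      have "?e ([:r:] - f * u) = 0" by (rule kill[OF r(2)])
      hence "?e f * ?e u = \<phi> r" by (simp add: he eval_poly_const hom \<phi>)
      hence "?e f \<noteq> 0" using nz by auto
      thus ?thesis using \<phi>(1) kill by (intro bexI[of _ \<phi>] exI[of _ \<tau>] conjI) simp_all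
    qed
  qed
  note main = this
  show ?thesis
    unfolding nullstellensatz_def
  proof (intro conjI ballI allI impI)
    fix \<psi> assume "\<psi> \<in> {eval_poly \<phi> \<tau> | \<phi> \<tau>. \<phi> \<in> H}"
    thus "unital_hom \<psi>" using homp by auto
  next
    fix Q :: "'r poly set" and f
    assume "Q \<in> prime_spectrum univ_ring" "f \<notin> Q"
    from main[OF this] obtain \<phi> \<tau> where
      "\<phi> \<in> H" "\<forall>h\<in>Q. eval_poly \<phi> \<tau> h = 0" "eval_poly \<phi> \<tau> f \<noteq> 0"
      by (elim bexE exE conjE)
    thus "\<exists>\<psi>\<in>{eval_poly \<phi> \<tau> | \<phi> \<tau>. \<phi> \<in> H}. (\<forall>q\<in>Q. \<psi> q = 0) \<and> \<psi> f \<noteq> 0"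
      by (intro bexI[of _ "eval_poly \<phi> \<tau>"] conjI) auto
  qed
qed

section \<open>Simple modules over rings that are finite over their center\<close>

text \<open>Combinations of \<open>bs\<close> with coefficients in \<open>m\<close>, up to an
  element of \<open>L\<close>; the choice \<open>L = {0}\<close> gives the plain span. The recursion
  peels off one generator at a time, the shape in which Nakayama's lemma eliminates
  generators.\<close>

fun lin_span :: "'a::ring_1 set \<Rightarrow> 'a list \<Rightarrow> 'a set \<Rightarrow> 'a set" where
  "lin_span m [] L = L"
| "lin_span m (b # bs) L = {\<mu> * b + w | \<mu> w. \<mu> \<in> m \<and> w \<in> lin_span m bs L}"

lemma lin_span_ConsI: "\<mu> \<in> m \<Longrightarrow> w \<in> lin_span m bs L \<Longrightarrow> \<mu> * b + w \<in> lin_span m (b # bs) L"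
  by auto

lemma lin_span_add:
  assumes "\<And>a b. a \<in> m \<Longrightarrow> b \<in> m \<Longrightarrow> a + b \<in> m" "\<And>a b. a \<in> L \<Longrightarrow> b \<in> L \<Longrightarrow> a + b \<in> L"
  shows "u \<in> lin_span m bs L \<Longrightarrow> v \<in> lin_span m bs L \<Longrightarrow> u + v \<in> lin_span m bs L"
proof (induction bs arbitrary: u v)
  case (Cons b bs)
  then obtain \<mu> w \<nu> x where "u = \<mu> * b + w" "v = \<nu> * b + x" "\<mu> \<in> m" "\<nu> \<in> m"
    "w \<in> lin_span m bs L" "x \<in> lin_span m bs L" by auto
  moreover from this have "u + v = (\<mu> + \<nu>) * b + (w + x)" by (simp add: algebra_simps)
  ultimately show ?case using Cons.IH assms(1) by (simp only:) (intro lin_span_ConsI)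
qed (simp add: assms(2))

lemma lin_span_mult:
  assumes "\<And>\<mu>. \<mu> \<in> m \<Longrightarrow> c * \<mu> \<in> m'" "\<And>l. l \<in> L \<Longrightarrow> c * l \<in> L'"
  shows "u \<in> lin_span m bs L \<Longrightarrow> c * u \<in> lin_span m' bs L'"
proof (induction bs arbitrary: u)
  case (Cons b bs)
  then obtain \<mu> w where "u = \<mu> * b + w" "\<mu> \<in> m" "w \<in> lin_span m bs L" by auto
  moreover from this have "c * u = (c * \<mu>) * b + c * w" by (simp add: algebra_simps)
  ultimately show ?case using Cons.IH assms(1) by auto
qed (simp add: assms(2))

lemma lin_span_add_right:
  assumes "l \<in> L"
  shows "u \<in> lin_span m bs {0} \<Longrightarrow> u + l \<in> lin_span m bs L"
proof (induction bs arbitrary: u)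
  case (Cons b bs)
  then obtain \<mu> w where "u = \<mu> * b + w" "\<mu> \<in> m" "w \<in> lin_span m bs {0}" by auto
  moreover from this have "u + l = \<mu> * b + (w + l)" by (simp add: algebra_simps)
  ultimately show ?case using Cons.IH by (simp only:) (intro lin_span_ConsI)
qed (simp add: assms)

lemma lin_span_zero: "0 \<in> m \<Longrightarrow> 0 \<in> L \<Longrightarrow> 0 \<in> lin_span m bs L"
  by (induction bs) force+

lemma lin_span_base: "0 \<in> m \<Longrightarrow> 0 \<in> L \<Longrightarrow> \<mu> \<in> m \<Longrightarrow> b \<in> set bs \<Longrightarrow> \<mu> * b \<in> lin_span m bs L"
proof (induction bs)
  case (Cons c bs)
  show ?case
  proof (cases "b = c")
    case True
    have "\<mu> * b + 0 \<in> lin_span m (c # bs) L"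
      using Cons.prems True lin_span_zero[of m L bs] by (auto simp del: add_0_right)
    thus ?thesis by simp
  next
    case False
    hence "0 * c + \<mu> * b \<in> lin_span m (c # bs) L"
      using Cons by (auto simp del: mult_zero_left add_0_left)
    thus ?thesis by simp
  qed
qed simp

section \<open>Algebras over a commutative ring and their central characters\<close>

locale central_eval =
  fixes ev :: "'r::comm_ring_1 \<Rightarrow> 'a::ring_1"
  assumes hom: "unital_hom ev" and central: "ev F * a = a * ev F"
begin

lemmas ev = unital_homD[OF hom]

lemma ev_commute: "ev F * (a * b) = a * (ev F * b)"
  by (metis central mult.assoc)

text \<open>Nakayama's lemma in localised form, by elimination: elements with
  \<open>\<phi> F \<noteq> 0\<close> are the denominators, and the kernel of \<open>\<phi>\<close>
  is the maximal ideal. In the relation for the first generator, its total coefficient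
  \<open>F0 - G0\<close> is again a denominator, so the relation can be solved for this generator
  and substituted into the others.\<close>

lemma nakayama:
  fixes \<phi> :: "'r \<Rightarrow> 'k::field"
  assumes \<phi>: "unital_hom \<phi>"
    and L: "0 \<in> L" "\<And>a b. a \<in> L \<Longrightarrow> b \<in> L \<Longrightarrow> a + b \<in> L" "\<And>r a. a \<in> L \<Longrightarrow> r * a \<in> L"
    and "\<And>b. b \<in> set bs \<Longrightarrow> \<exists>F. \<phi> F \<noteq> 0 \<and> ev F * b \<in> lin_span {ev F | F. \<phi> F = 0} bs L"
  shows "\<exists>F. \<phi> F \<noteq> 0 \<and> (\<forall>b\<in>set bs. ev F * b \<in> L)"
  using assms(5)
proof (induction bs)
  case Nil
  show ?case by (auto intro!: exI[of _ 1] simp: unital_homD[OF \<phi>])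
next
  case (Cons b0 bs)
  let ?m = "{ev F | F. \<phi> F = 0}"
  note \<phi> = unital_homD[OF \<phi>]
  have madd: "a + b \<in> ?m" if ab: "a \<in> ?m" "b \<in> ?m" for a b
  proof -
    obtain F G where "a = ev F" "b = ev G" "\<phi> F = 0" "\<phi> G = 0" using ab by blast
    thus ?thesis by (auto intro!: exI[of _ "F + G"] simp: ev \<phi>)
  qed
  have mmult: "ev F * \<mu> \<in> ?m" if \<mu>: "\<mu> \<in> ?m" for F \<mu>
  proof -
    obtain G where "\<mu> = ev G" "\<phi> G = 0" using \<mu> by blast
    thus ?thesis by (auto intro!: exI[of _ "F * G"] simp: ev \<phi>)
  qed
  have add: "u + v \<in> lin_span ?m bs L" if "u \<in> lin_span ?m bs L" "v \<in> lin_span ?m bs L" for u v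
    by (rule lin_span_add[OF madd L(2) that])
  have mult: "ev F * u \<in> lin_span ?m bs L" if "u \<in> lin_span ?m bs L" for F u
    by (rule lin_span_mult[OF mmult L(3) that])
  obtain F0 where F0: "\<phi> F0 \<noteq> 0" "ev F0 * b0 \<in> lin_span ?m (b0 # bs) L"
    using Cons.prems[of b0] by auto
  then obtain G0 w0 where w0: "ev F0 * b0 = ev G0 * b0 + w0" "\<phi> G0 = 0" "w0 \<in> lin_span ?m bs L"
    by auto
  define D where "D = F0 - G0"
  have D: "\<phi> D \<noteq> 0" "ev D * b0 = w0"
    using F0 w0 by (auto simp: D_def \<phi> ev left_diff_distrib)
  have "\<exists>F. \<phi> F \<noteq> 0 \<and> ev F * b \<in> lin_span ?m bs L" if b: "b \<in> set bs" for b
  proof -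
    obtain F where F: "\<phi> F \<noteq> 0" "ev F * b \<in> lin_span ?m (b0 # bs) L"
      using Cons.prems[of b] b by auto
    then obtain G w where w: "ev F * b = ev G * b0 + w" "\<phi> G = 0" "w \<in> lin_span ?m bs L"
      by auto
    have "ev (D * F) * b = ev D * (ev F * b)" by (simp add: ev mult.assoc)
    also have "\<dots> = ev G * (ev D * b0) + ev D * w"
      by (simp only: w(1) distrib_left ev_commute[of D "ev G" b0])
    also have "\<dots> \<in> lin_span ?m bs L" unfolding D(2) by (intro add mult w0 w)
    finally show ?thesis using D F by (intro exI[of _ "D * F"]) (simp add: \<phi>)
  qed
  from Cons.IH[OF this] obtain E where E: "\<phi> E \<noteq> 0" "\<And>b. b \<in> set bs \<Longrightarrow> ev E * b \<in> L" by auto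
  have kill: "ev E * w \<in> L" if "set cs \<subseteq> set bs" "w \<in> lin_span ?m cs L" for w cs
    using that
  proof (induction cs arbitrary: w)
    case (Cons c cs)
    then obtain \<mu> v where v: "w = \<mu> * c + v" "v \<in> lin_span ?m cs L" by auto
    have "ev E * w = \<mu> * (ev E * c) + ev E * v" by (simp add: v(1) distrib_left ev_commute)
    also have "\<dots> \<in> L" using Cons v by (intro L E(2) Cons.IH) auto
    finally show ?case .
  qed (simp add: L)
  have "ev (E * D) * b \<in> L" if "b \<in> set (b0 # bs)" for b
  proof (cases "b = b0")
    case True
    thus ?thesis using kill[OF subset_refl w0(3)] by (simp add: ev mult.assoc D)
  next
    case False
    hence "ev D * (ev E * b) \<in> L" using that by (intro L E(2)) simp
    thus ?thesis by (simp add: ev mult.assoc ev_commute[of E "ev D"])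
  qed
  thus ?case using E D by (intro exI[of _ "E * D"]) (auto simp: \<phi>)
qed

text \<open>
  The last hypothesis holds for maximal left ideals as well as for maximal two-sided ideals.
\<close>

theorem ex_character:
  fixes H :: "('r \<Rightarrow> 'k::field) set"
  assumes H: "nullstellensatz H" and span: "\<And>a. a \<in> lin_span (range ev) bs {0}"
    and L: "0 \<in> L" "\<And>a b. a \<in> L \<Longrightarrow> b \<in> L \<Longrightarrow> a + b \<in> L" "\<And>r a. a \<in> L \<Longrightarrow> r * a \<in> L" "1 \<notin> L"
    and max: "\<And>I. ideal I univ_ring \<Longrightarrow> I \<subseteq> L \<or> (\<exists>i\<in>I. 1 - i \<in> L)"
  shows "\<exists>\<phi>\<in>H. \<forall>F a. \<phi> F = 0 \<longrightarrow> a * ev F \<in> L"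
proof -
  \<comment> \<open>\<open>Q\<close> is the contraction of \<open>L\<close>. If \<open>F\<close>
    lies outside it, the ideal generated by \<open>ev F\<close> is not contained in \<open>L\<close>
    and thus contains an element congruent to \<open>1\<close> modulo \<open>L\<close>; this makes
    \<open>Q\<close> prime.\<close>
  define Q where "Q = {F. ev F \<in> L}"
  have "G \<in> Q" if FG: "F * G \<in> Q" "F \<notin> Q" for F G
  proof -
    let ?I = "{a * ev F | a. True}"
    have 1: "1 * ev F \<in> ?I" and 0: "0 * ev F \<in> ?I" by blast+
    have I: "ideal ?I univ_ring"
      unfolding ideal_univ_ring_iff
    proof (intro conjI ballI allI)
      show "0 \<in> ?I" using 0 by simp
      fix a assume "a \<in> ?I"
      then obtain c where a: "a = c * ev F" by blast
      show "a + b \<in> ?I" if b: "b \<in> ?I" for b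
      proof -
        obtain d where "b = d * ev F" using b by blast
        hence "a + b = (c + d) * ev F" by (simp add: a distrib_right)
        thus ?thesis by blast
      qed
      fix r
      have "r * a = (r * c) * ev F" "a * r = (c * r) * ev F"
        by (simp_all add: a mult.assoc central)
      thus "r * a \<in> ?I" "a * r \<in> ?I" by blast+
    qed
    have "\<not> ?I \<subseteq> L" using 1 FG(2) by (auto simp: Q_def)
    then obtain a where "1 - a * ev F \<in> L" using max[OF I] by blast
    hence "ev G * (1 - a * ev F) + a * ev (F * G) \<in> L"
      using FG(1) by (intro L) (simp_all add: Q_def)
    moreover have "ev G * (1 - a * ev F) + a * ev (F * G) = ev G"
      by (simp add: right_diff_distrib ev) (metis central mult.assoc)
    ultimately show ?thesis by (simp add: Q_def)
  qed
  moreover have "ideal Q univ_ring"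
  proof -
    have "ev (F * G) \<in> L" if "ev G \<in> L" for F G using L(3)[OF that] by (simp add: ev(3))
    thus ?thesis using L(1,2)
      by (auto simp: Q_def ideal_univ_ring_iff ev(2,4)) (metis mult.commute)
  qed
  moreover have "1 \<notin> Q" using L by (simp add: Q_def ev)
  ultimately have "Q \<in> prime_spectrum univ_ring" "1 \<notin> Q"
    unfolding prime_spectrum_comm_iff by blast+
  then obtain \<phi> where \<phi>H: "\<phi> \<in> H" and kill: "\<And>F. F \<in> Q \<Longrightarrow> \<phi> F = 0"
    using H unfolding nullstellensatz_def by metis
  have \<phi>h: "unital_hom \<phi>" using H \<phi>H by (simp add: nullstellensatz_def)
  note \<phi> = unital_homD[OF \<phi>h]
  let ?m = "{ev F | F. \<phi> F = 0}"
  \<comment> \<open>As \<open>bs\<close> spans the whole algebra, \<open>I\<close> is the two-sided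
    ideal generated by the image of the kernel of \<open>\<phi>\<close>.\<close>
  define I where "I = lin_span ?m bs {0}"
  have m0: "0 \<in> ?m" using \<phi>(4) ev(4) by (auto intro!: exI[of _ 0])
  have madd: "a + b \<in> ?m" if ab: "a \<in> ?m" "b \<in> ?m" for a b
  proof -
    obtain F G where "a = ev F" "b = ev G" "\<phi> F = 0" "\<phi> G = 0" using ab by blast
    thus ?thesis by (auto intro!: exI[of _ "F + G"] simp: ev \<phi>)
  qed
  have Iadd: "u + v \<in> I" if "u \<in> I" "v \<in> I" for u v
    using lin_span_add[OF madd _ that[unfolded I_def]] unfolding I_def by simp
  have I0: "0 \<in> I" unfolding I_def by (intro lin_span_zero m0) simp
  have multI: "ev F * a \<in> I" if F: "\<phi> F = 0" for F a
    unfolding I_def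
  proof (rule lin_span_mult[OF _ _ span])
    fix \<mu> assume "\<mu> \<in> range ev"
    then obtain G where "\<mu> = ev G" by blast
    thus "ev F * \<mu> \<in> ?m" using F by (auto intro!: exI[of _ "F * G"] simp: ev \<phi>)
  qed simp
  have "r * w \<in> I \<and> w * r \<in> I" if "w \<in> lin_span ?m cs {0}" for r w cs
    using that
  proof (induction cs arbitrary: w)
    case (Cons c cs)
    then obtain F v where v: "w = ev F * c + v" "\<phi> F = 0" "v \<in> lin_span ?m cs {0}" by auto
    have "r * w = ev F * (r * c) + r * v" "w * r = ev F * (c * r) + v * r"
      by (simp_all add: v(1) distrib_left distrib_right ev_commute mult.assoc)
    thus ?case using Cons.IH[OF v(3)] multI[OF v(2)] Iadd by simp
  qed (simp add: I0)
  hence I: "ideal I univ_ring"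
    using I0 Iadd unfolding ideal_univ_ring_iff I_def by blast
  show ?thesis
  proof (cases "I \<subseteq> L")
    case True
    hence "a * ev F \<in> L" if "\<phi> F = 0" for a F
      using multI[OF that, of a] by (auto simp: central)
    thus ?thesis using \<phi>H by blast
  next
    case False
    then obtain i where i: "i \<in> I" "1 - i \<in> L" using max[OF I] by blast
    \<comment> \<open>Here the algebra equals \<open>I + L\<close>. Nakayama's lemma then yields
      \<open>F\<close> with \<open>\<phi> F \<noteq> 0\<close> but \<open>ev F\<close> in
      \<open>L\<close>, although \<open>\<phi>\<close> vanishes on \<open>Q\<close>.\<close>
    have "ev 1 * b \<in> lin_span ?m bs L" for b
    proof -
      have "b * i + b * (1 - i) \<in> lin_span ?m bs L"
        using I i L by (intro lin_span_add_right) (auto simp: I_def ideal_univ_ring_iff)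
      thus ?thesis by (simp add: ev right_diff_distrib)
    qed
    hence "\<exists>F. \<phi> F \<noteq> 0 \<and> ev F * b \<in> lin_span ?m bs L" for b
      by (intro exI[of _ 1]) (simp add: \<phi>)
    from nakayama[OF \<phi>h L(1,2,3) this] obtain F where
      F: "\<phi> F \<noteq> 0" "\<And>b. b \<in> set bs \<Longrightarrow> ev F * b \<in> L" by blast
    have "ev F * w \<in> L" if "set cs \<subseteq> set bs" "w \<in> lin_span (range ev) cs {0}" for w cs
      using that
    proof (induction cs arbitrary: w)
      case (Cons c cs)
      then obtain \<mu> v where v: "w = \<mu> * c + v" "v \<in> lin_span (range ev) cs {0}" by auto
      have "ev F * w = \<mu> * (ev F * c) + ev F * v" by (simp add: v(1) distrib_left ev_commute)
      also have "\<dots> \<in> L" using Cons v by (intro L F(2) Cons.IH) auto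
      finally show ?case .
    qed (simp add: L)
    from this[OF subset_refl span[of 1]] have "F \<in> Q" by (simp add: Q_def)
    thus ?thesis using kill F(1) by blast
  qed
qed

end

section \<open>Central elements of \<open>A\<close>\<close>

lemma sjp_scalar_commute: "sjp_scalar c * a = a * sjp_scalar c"
proof (induction a rule: sjp_induct)
  case (scalar d)
  show ?case by (simp add: mult.commute flip: sjp_scalar_hom)
next
  case (gen i)
  show ?case by (rule sjp_scalar_gen_commute)
next
  case (mult a b)
  thus ?case by (metis mult.assoc)
qed (simp add: distrib_left distrib_right)

lemma unital_hom_sjp_scalar: "unital_hom sjp_scalar"
  by (simp add: unital_hom_def sjp_scalar_hom)

lemma sjp_scalar_of_nat: "sjp_scalar (of_nat n) = of_nat n"
  by (induction n) (simp_all add: sjp_scalar_hom)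

lemma sjp_of_nat_CHAR: "(of_nat CHAR('k) :: 'k::field sjp) = 0"
  by (simp add: sjp_scalar_hom flip: sjp_scalar_of_nat)

lemma sjp_centralI:
  assumes "\<And>i. c * sjp_gen i = sjp_gen i * c"
  shows "c * a = a * c"
proof (induction a rule: sjp_induct)
  case (scalar d)
  show ?case by (rule sjp_scalar_commute[symmetric])
next
  case (mult a b)
  thus ?case by (metis mult.assoc)
qed (simp_all add: assms distrib_left distrib_right)

section \<open>Commutation rules among the generators and s\<close>

lemma sjp_y_s: "sjp_y * sjp_s = sjp_s * sjp_y + sjp_x * (sjp_s :: 'k::field sjp)"
  using sjp_relations(2)[where ?'k = 'k] by (simp add: algebra_simps)

lemma sjp_y_x: "sjp_y * sjp_x = sjp_s - sjp_x * (sjp_y :: 'k::field sjp)"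
  by (simp add: sjp_s_def)

lemma sjp_x_g: "sjp_x * sjp_g = - (sjp_g * (sjp_x :: 'k::field sjp))"
proof -
  have "sjp_g * sjp_x * (sjp_ginv * sjp_g) = - sjp_x * (sjp_g :: 'k sjp)"
    by (simp only: sjp_relations(5) flip: mult.assoc)
  thus ?thesis by (simp add: sjp_relations(4))
qed

lemma sjp_y_g: "sjp_y * sjp_g = - (sjp_g * (sjp_y + sjp_x :: 'k::field sjp))"
proof -
  have "sjp_g * sjp_y * (sjp_ginv * sjp_g) = (- sjp_y + sjp_x) * (sjp_g :: 'k sjp)"
    by (simp only: sjp_relations(6) flip: mult.assoc)
  hence "sjp_g * sjp_y = - (sjp_y * sjp_g) + sjp_x * (sjp_g :: 'k sjp)"
    by (simp add: sjp_relations(4) distrib_right left_diff_distrib)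
  thus ?thesis by (simp add: sjp_x_g distrib_left)
qed

lemma sjp_ginv_x: "sjp_ginv * sjp_x = - (sjp_x * (sjp_ginv :: 'k::field sjp))"
proof -
  have "sjp_ginv * (sjp_x * sjp_g) * sjp_ginv = - (sjp_ginv * sjp_g) * sjp_x * (sjp_ginv :: 'k sjp)"
    by (simp add: sjp_x_g mult.assoc)
  thus ?thesis by (simp add: mult.assoc sjp_relations(3,4))
qed

lemma sjp_ginv_y: "sjp_ginv * sjp_y = - ((sjp_y + sjp_x) * (sjp_ginv :: 'k::field sjp))"
proof -
  have "sjp_ginv * (sjp_y * sjp_g) * sjp_ginv
      = - (sjp_ginv * sjp_g) * (sjp_y + sjp_x) * (sjp_ginv :: 'k sjp)"
    by (simp only: sjp_y_g) (simp add: mult.assoc)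
  thus ?thesis by (simp add: mult.assoc sjp_relations(3,4) algebra_simps)
qed

lemma sjp_x_s_power: "sjp_s ^ n * sjp_x = sjp_x * (sjp_s ^ n :: 'k::field sjp)"
  by (rule power_commuting_commutes) (simp add: sjp_s_x)

lemma sjp_y_s_power:
  "sjp_y * sjp_s ^ n = sjp_s ^ n * sjp_y + of_nat n * (sjp_x * (sjp_s ^ n :: 'k::field sjp))"
proof -
  have "sjp_y * sjp_s ^ n = sjp_s ^ n * (sjp_y + of_nat n * (sjp_x :: 'k sjp))"
    by (simp add: sjp_s_power_normal sjp_twist_gen twist_gen_simps sjp_scalar_of_nat)
  moreover have "sjp_s ^ n * (of_nat n * (sjp_x :: 'k sjp)) = of_nat n * (sjp_s ^ n * sjp_x)"
    by (metis mult.assoc mult_of_nat_commute)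
  ultimately show ?thesis by (simp add: distrib_left sjp_x_s_power)
qed

text \<open>The commutator with \<open>y^2\<close> multiplies each of \<open>x\<close>,
  \<open>s\<close> and \<open>g\<close> by \<open>s\<close>, as here and in the next two facts. This
  produces the ladders \<open>x s^k\<close> and \<open>g s^k\<close> used for the centrality of
  \<open>y^(2p)\<close>.\<close>

lemma sjp_y2_x: "sjp_y ^ 2 * sjp_x = sjp_x * sjp_y ^ 2 + sjp_x * (sjp_s :: 'k::field sjp)"
proof -
  have "sjp_y * (sjp_y * sjp_x) = sjp_y * sjp_s - sjp_y * sjp_x * (sjp_y :: 'k sjp)"
    by (subst sjp_y_x) (simp add: right_diff_distrib mult.assoc)
  also have "\<dots> = sjp_s * sjp_y + sjp_x * sjp_s - (sjp_s - sjp_x * sjp_y) * sjp_y"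
    by (simp only: sjp_y_s sjp_y_x)
  finally show ?thesis by (simp add: power2_eq_square left_diff_distrib mult.assoc)
qed

lemma sjp_y2_s: "sjp_y ^ 2 * sjp_s = sjp_s * sjp_y ^ 2 + (sjp_s * sjp_s :: 'k::field sjp)"
proof -
  have "sjp_x * (sjp_x * sjp_s) = (0 :: 'k sjp)" by (simp add: sjp_relations(1) flip: mult.assoc)
  hence "sjp_x * (sjp_s * sjp_y) = sjp_x * sjp_y * (sjp_s :: 'k sjp)"
    using sjp_y_s[where ?'k = 'k] by (simp add: mult.assoc distrib_left)
  moreover have "sjp_y * (sjp_y * sjp_s) = sjp_s * sjp_y * sjp_y + sjp_x * (sjp_s * sjp_y)
      + sjp_y * sjp_x * (sjp_s :: 'k sjp)"
    by (simp add: sjp_y_s distrib_left mult.assoc) (simp add: sjp_y_s distrib_right flip: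
      mult.assoc)
  ultimately show ?thesis
    by (simp add: power2_eq_square mult.assoc sjp_s_def distrib_right)
qed

lemma sjp_y2_g: "sjp_y ^ 2 * sjp_g = sjp_g * sjp_y ^ 2 + sjp_g * (sjp_s :: 'k::field sjp)"
proof -
  have "sjp_y * (sjp_y * sjp_g) = - (sjp_y * sjp_g * (sjp_y + sjp_x :: 'k sjp))"
    by (subst sjp_y_g) (simp add: mult.assoc)
  also have "\<dots> = sjp_g * ((sjp_y + sjp_x) * (sjp_y + sjp_x))"
    by (subst sjp_y_g) (simp add: mult.assoc)
  also have "(sjp_y + sjp_x) * (sjp_y + sjp_x) = sjp_y * sjp_y + (sjp_s :: 'k sjp)"
    by (simp add: sjp_s_def distrib_left distrib_right sjp_relations(1))
  finally show ?thesis by (simp add: power2_eq_square mult.assoc distrib_left)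
qed

text \<open>The \<open>k\<close>-fold commutator of \<open>v\<close> with \<open>a 0\<close> is
  \<open>k! * a k\<close>, so this is the Leibniz expansion of \<open>v^n * a 0\<close> with the
  commutators moved to the left.\<close>

lemma power_mult_ladder:
  fixes v :: "'a::ring_1"
  assumes "\<And>k. v * a k = a k * v + of_nat (Suc k) * a (Suc k)"
  shows "v ^ n * a 0 = (\<Sum>k\<le>n. of_nat (fact k * (n choose k)) * (a k * v ^ (n - k)))"
proof (induction n)
  case (Suc n)
  let ?c = "\<lambda>n k. of_nat (fact k * (n choose k)) :: 'a"
  \<comment> \<open>\<open>?d k\<close> is the commutator term that arises at index
    \<open>k - 1\<close>; after the shift of the summation index it lines up with
    \<open>a k\<close>.\<close>
  let ?d = "\<lambda>k. case k of 0 \<Rightarrow> 0 | Suc j \<Rightarrow> of_nat (Suc j) * ?c n j * (a k * v ^ (n - j))"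
  have "v ^ Suc n * a 0 = v * (v ^ n * a 0)" by (simp add: mult.assoc)
  also have "\<dots> = (\<Sum>k\<le>n. v * (?c n k * (a k * v ^ (n - k))))"
    by (simp only: Suc.IH sum_distrib_left)
  also have "\<dots> = (\<Sum>k\<le>n. ?c n k * (a k * v ^ (Suc n - k)) + ?d (Suc k))"
  proof (rule sum.cong)
    fix k assume k: "k \<in> {..n}"
    have "v * (?c n k * (a k * v ^ (n - k))) = ?c n k * ((v * a k) * v ^ (n - k))"
      by (metis mult.assoc mult_of_nat_commute)
    also have "\<dots> = ?c n k * (a k * (v * v ^ (n - k)))
        + ?c n k * of_nat (Suc k) * (a (Suc k) * v ^ (n - k))"
      by (simp only: assms distrib_left distrib_right mult.assoc)
    also have "?c n k * of_nat (Suc k) = of_nat (Suc k) * ?c n k"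
      by (rule mult_of_nat_commute[symmetric])
    also have "v * v ^ (n - k) = v ^ (Suc n - k)"
      using k by (simp add: Suc_diff_le)
    also have "of_nat (Suc k) * ?c n k * (a (Suc k) * v ^ (n - k)) = ?d (Suc k)"
      by (simp only: nat.case)
    finally show "v * (?c n k * (a k * v ^ (n - k))) = ?c n k * (a k * v ^ (Suc n - k)) +
      ?d (Suc k)" .
  qed simp
  also have "\<dots> = (\<Sum>k\<le>Suc n. ?c n k * (a k * v ^ (Suc n - k))) + (\<Sum>k\<le>Suc n. ?d k)"
    unfolding sum.distrib sum.atMost_Suc_shift[of ?d] by (simp add: binomial_eq_0)
  also have "\<dots> = (\<Sum>k\<le>Suc n. ?c (Suc n) k * (a k * v ^ (Suc n - k)))"
    unfolding sum.distrib[symmetric]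
  proof (rule sum.cong)
    fix k assume "k \<in> {..Suc n}"
    show "?c n k * (a k * v ^ (Suc n - k)) + ?d k = ?c (Suc n) k * (a k * v ^ (Suc n - k))"
    proof (cases k)
      case (Suc j)
      have "?c (Suc n) k = ?c n k + of_nat (Suc j) * ?c n j"
        by (simp add: Suc algebra_simps flip: of_nat_add of_nat_mult of_nat_Suc)
      thus ?thesis by (simp add: Suc distrib_right)
    qed simp
  qed simp
  finally show ?case .
qed simp

text \<open>For \<open>0 < k < p\<close> the binomial coefficient is divisible by \<open>p\<close>,
  and for \<open>k = p\<close> the factorial is. Only the term with \<open>k = 0\<close>
  survives.\<close>

lemma power_prime_commute:
  fixes v :: "'a::ring_1"
  assumes "\<And>k. v * a k = a k * v + of_nat (Suc k) * a (Suc k)"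
    and p: "prime p" "of_nat p = (0 :: 'a)"
  shows "v ^ p * a 0 = a 0 * v ^ p"
proof -
  have "of_nat (fact k * (p choose k)) = (0 :: 'a)" if "k \<in> {..p} - {0}" for k
  proof -
    have "p dvd fact k * (p choose k)"
    proof (cases "k = p")
      case True
      thus ?thesis using prime_ge_1_nat[OF p(1)] dvd_fact[of p p] by simp
    next
      case False
      thus ?thesis using that p(1) by (intro dvd_mult dvd_choose_prime) auto
    qed
    then obtain c where "fact k * (p choose k) = p * c" by blast
    thus ?thesis using p(2) by (metis mult_zero_left of_nat_mult)
  qed
  hence "v ^ p * a 0 = (\<Sum>k\<in>{0}. of_nat (fact k * (p choose k)) * (a k * v ^ (p - k)))"
    unfolding power_mult_ladder[of v a p, OF assms(1)]
    by (intro sum.mono_neutral_right) auto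
  thus ?thesis by simp
qed

context
  fixes p :: nat
  assumes p: "CHAR('k::field) = p" and p0: "p > 0"
begin

lemma prime_p: "prime p"
  using prime_CHAR_semidom[where ?'a = 'k] p p0 by simp

lemma sjp_of_nat_p: "of_nat p = (0 :: 'k sjp)"
  using sjp_of_nat_CHAR[where ?'k = 'k] by (simp add: p)

lemma sjp_central_s: "sjp_s ^ p * a = a * (sjp_s ^ p :: 'k sjp)"
  using sjp_s_power_normal[of a p] sjp_twist_zero[of a] p by (metis of_nat_CHAR)

text \<open>The ladders \<open>x s^k\<close> and \<open>g s^k\<close> satisfy the recursion of
  \<open>power_prime_commute\<close> for \<open>v = y^2\<close>: each factor \<open>s\<close> that
  is passed adds one to the multiplicity.\<close>

lemma sjp_central_y: "sjp_y ^ (2 * p) * a = a * (sjp_y ^ (2 * p) :: 'k sjp)"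
proof (rule sjp_centralI)
  fix i
  have x: "(sjp_y ^ 2) ^ p * sjp_x = sjp_x * ((sjp_y ^ 2) ^ p :: 'k sjp)"
  proof -
    have "sjp_y ^ 2 * (sjp_x * sjp_s ^ k) = sjp_x * sjp_s ^ k * sjp_y ^ 2
        + of_nat (Suc k) * (sjp_x * (sjp_s ^ Suc k :: 'k sjp))" for k
    proof (induction k)
      case (Suc k)
      have "sjp_y ^ 2 * (sjp_x * sjp_s ^ Suc k) = (sjp_y ^ 2 * (sjp_x * sjp_s ^ k)) * (sjp_s :: 'k
        sjp)"
        by (simp only: power_Suc2 mult.assoc)
      also have "\<dots> = sjp_x * sjp_s ^ k * (sjp_y ^ 2 * sjp_s)
          + of_nat (Suc k) * (sjp_x * sjp_s ^ Suc (Suc k))"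
        by (simp only: Suc distrib_right power_Suc2 mult.assoc)
      also have "\<dots> = sjp_x * sjp_s ^ Suc k * sjp_y ^ 2
          + of_nat (Suc (Suc k)) * (sjp_x * sjp_s ^ Suc (Suc k))"
        by (simp only: sjp_y2_s) (simp only: of_nat_Suc distrib_right distrib_left power_Suc2
          mult.assoc
          mult_1_left mult_1_right add_ac)
      finally show ?case .
    qed (simp add: sjp_y2_x)
    thus ?thesis
      using power_prime_commute[of "sjp_y ^ 2" "\<lambda>k. sjp_x * sjp_s ^ k", OF _ prime_p sjp_of_nat_p]
      by simp
  qed
  have g: "(sjp_y ^ 2) ^ p * sjp_g = sjp_g * ((sjp_y ^ 2) ^ p :: 'k sjp)"
  proof -
    have "sjp_y ^ 2 * (sjp_g * sjp_s ^ k) = sjp_g * sjp_s ^ k * sjp_y ^ 2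
        + of_nat (Suc k) * (sjp_g * (sjp_s ^ Suc k :: 'k sjp))" for k
    proof (induction k)
      case (Suc k)
      have "sjp_y ^ 2 * (sjp_g * sjp_s ^ Suc k) = (sjp_y ^ 2 * (sjp_g * sjp_s ^ k)) * (sjp_s :: 'k
        sjp)"
        by (simp only: power_Suc2 mult.assoc)
      also have "\<dots> = sjp_g * sjp_s ^ k * (sjp_y ^ 2 * sjp_s)
          + of_nat (Suc k) * (sjp_g * sjp_s ^ Suc (Suc k))"
        by (simp only: Suc distrib_right power_Suc2 mult.assoc)
      also have "\<dots> = sjp_g * sjp_s ^ Suc k * sjp_y ^ 2
          + of_nat (Suc (Suc k)) * (sjp_g * sjp_s ^ Suc (Suc k))"
        by (simp only: sjp_y2_s) (simp only: of_nat_Suc distrib_right distrib_left power_Suc2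
          mult.assoc
          mult_1_left mult_1_right add_ac)
      finally show ?case .
    qed (simp add: sjp_y2_g)
    thus ?thesis
      using power_prime_commute[of "sjp_y ^ 2" "\<lambda>k. sjp_g * sjp_s ^ k", OF _ prime_p sjp_of_nat_p]
      by simp
  qed
  have h: "sjp_ginv * (sjp_y ^ 2) ^ p = (sjp_y ^ 2) ^ p * (sjp_ginv :: 'k sjp)"
    by (rule commute_inverse[OF sjp_relations(3,4) g[symmetric]])
  have y: "(sjp_y ^ 2) ^ p * sjp_y = sjp_y * ((sjp_y ^ 2) ^ p :: 'k sjp)"
    by (simp add: power_commutes flip: power_mult)
  show "sjp_y ^ (2 * p) * sjp_gen i = sjp_gen i * (sjp_y ^ (2 * p) :: 'k sjp)"
    unfolding power_mult using x g h y by (cases i) auto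
qed

end

section \<open>Powers of g and the element C\<close>

lemma sjp_x_g_power: "sjp_x * sjp_g ^ n = (- 1) ^ n * (sjp_g ^ n * (sjp_x :: 'k::field sjp))"
proof (induction n)
  case (Suc n)
  have "sjp_x * sjp_g ^ Suc n = (sjp_x * sjp_g ^ n) * (sjp_g :: 'k sjp)"
    by (simp only: power_Suc2 mult.assoc)
  also have "\<dots> = (- 1) ^ n * (sjp_g ^ n * (sjp_x * sjp_g))" by (simp only: Suc mult.assoc)
  finally show ?case by (simp add: sjp_x_g power_Suc2 mult.assoc del: power_Suc)
qed simp

lemma sjp_y_g_power:
  "sjp_y * sjp_g ^ n = (- 1) ^ n * (sjp_g ^ n * (sjp_y + of_nat n * (sjp_x :: 'k::field sjp)))"
proof (induction n)
  case (Suc n)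
  have "sjp_y * sjp_g ^ Suc n = (sjp_y * sjp_g ^ n) * (sjp_g :: 'k sjp)"
    by (simp only: power_Suc2 mult.assoc)
  also have "\<dots> = (- 1) ^ n * (sjp_g ^ n * (sjp_y * sjp_g + of_nat n * (sjp_x * sjp_g)))"
    by (simp only: Suc mult.assoc distrib_right)
  also have "sjp_y * sjp_g + of_nat n * (sjp_x * sjp_g)
      = - (sjp_g * (sjp_y + of_nat (Suc n) * (sjp_x :: 'k sjp)))"
  proof -
    have "of_nat n * (sjp_g * sjp_x) = sjp_g * (of_nat n * (sjp_x :: 'k sjp))"
      by (metis mult.assoc mult_of_nat_commute)
    thus ?thesis by (simp add: sjp_y_g sjp_x_g distrib_left distrib_right)
  qed
  finally show ?case by (simp add: power_Suc2 mult.assoc del: power_Suc of_nat_Suc)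
qed simp

lemma sjp_g_power_ginv: "sjp_g ^ n * sjp_ginv ^ n = (1 :: 'k::field sjp)"
  "sjp_ginv ^ n * sjp_g ^ n = (1 :: 'k::field sjp)"
proof -
  have "a ^ n * b ^ n = 1" if "a * b = 1" for a b :: "'k sjp"
  proof (induction n)
    case (Suc n)
    have "a ^ Suc n * b ^ Suc n = a ^ n * (a * b) * b ^ n"
      by (simp only: power_Suc2[of a] power_Suc[of b] mult.assoc)
    thus ?case using Suc that by simp
  qed simp
  thus "sjp_g ^ n * sjp_ginv ^ n = (1 :: 'k sjp)" "sjp_ginv ^ n * sjp_g ^ n = (1 :: 'k sjp)"
    by (simp_all add: sjp_relations)
qed

text \<open>Moving \<open>x\<close> and \<open>y\<close> past \<open>g^n\<close> costs the sign
  \<open>(-1)^n\<close> and, for \<open>y\<close>, the summand \<open>n x\<close>; the exponent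
  \<open>2 p\<close> removes both.\<close>

lemma sjp_central_g:
  assumes "CHAR('k::field) = p"
  shows "sjp_g ^ (2 * p) * a = a * (sjp_g ^ (2 * p) :: 'k sjp)"
    and "sjp_ginv ^ (2 * p) * a = a * (sjp_ginv ^ (2 * p) :: 'k sjp)"
proof -
  have "of_nat (2 * p) = (0 :: 'k sjp)"
    using sjp_of_nat_CHAR[where ?'k = 'k] assms by simp
  hence y: "sjp_y * sjp_g ^ (2 * p) = (sjp_g ^ (2 * p) :: 'k sjp) * sjp_y"
    unfolding sjp_y_g_power by simp
  have h: "sjp_ginv * sjp_g ^ (2 * p) = sjp_g ^ (2 * p) * (sjp_ginv :: 'k sjp)"
    by (rule commute_inverse[OF sjp_relations(3,4)]) (simp add: power_commutes)
  show *: "sjp_g ^ (2 * p) * a = a * (sjp_g ^ (2 * p) :: 'k sjp)" for a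
  proof (rule sjp_centralI)
    fix i
    show "sjp_g ^ (2 * p) * sjp_gen i = sjp_gen i * (sjp_g ^ (2 * p) :: 'k sjp)"
      by (cases i) (simp_all add: y h sjp_x_g_power power_commutes)
  qed
  show "sjp_ginv ^ (2 * p) * a = a * (sjp_ginv ^ (2 * p) :: 'k sjp)"
    by (rule commute_inverse[OF sjp_g_power_ginv *])
qed

text \<open>Here \<open>w\<close> is the commutator \<open>y x - x y\<close>, and
  \<open>C = w g\<inverse>\<close>. Its skew commutation with \<open>x\<close> and \<open>y\<close>
  is the same as that of \<open>g\<close>, so the two cancel in \<open>C\<close> and make it
  central; \<open>w\<^sup>2 = s\<^sup>2\<close> makes \<open>C\<close> invertible along with
  \<open>s\<close>.\<close>

lemma sjp_w_facts:
  fixes w :: "'k::field sjp"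
  defines "w \<equiv> 2 * sjp_y * sjp_x - sjp_s"
  shows "w * sjp_x = - (sjp_x * w)" "w * (sjp_y + sjp_x) = - (sjp_y * w)"
    "sjp_ginv * w = w * sjp_ginv" "w * w = sjp_s * sjp_s"
proof -
  let ?x = "sjp_x :: 'k sjp" and ?y = "sjp_y :: 'k sjp"
  have w: "w = ?y * ?x - ?x * ?y" by (simp add: w_def sjp_s_def mult_2 distrib_right)
  have x0: "?x * ?x = 0" "?x * (?x * a) = 0" for a
    by (simp_all add: sjp_relations(1) flip: mult.assoc)
  show "w * ?x = - (?x * w)"
    by (simp add: w left_diff_distrib right_diff_distrib mult.assoc x0)
  show yw: "w * (?y + ?x) = - (?y * w)"
  proof -
    have "?y * ?x * ?y + ?y * ?y * ?x - (?x * ?y * ?y + ?y * ?x * ?y) - ?x * (?x * ?y + ?y * ?x) =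
      0"
      using sjp_relations(2)[where ?'k = 'k]
      by (simp add: sjp_s_def distrib_left distrib_right mult.assoc)
    hence "?y * (?y * ?x) - ?x * (?y * ?y) - ?x * (?y * ?x) = 0"
      by (simp add: distrib_left mult.assoc x0)
    thus ?thesis
      by (simp add: w distrib_left left_diff_distrib right_diff_distrib mult.assoc x0 algebra_simps)
  qed
  have gw: "sjp_ginv * w = sjp_ginv * ?y * ?x - sjp_ginv * ?x * ?y"
    by (simp add: w right_diff_distrib mult.assoc)
  also have "\<dots> = - ((?y + ?x) * (sjp_ginv * ?x)) + ?x * (sjp_ginv * ?y)"
    by (simp add: sjp_ginv_y sjp_ginv_x mult.assoc)
  also have "\<dots> = ((?y + ?x) * ?x - ?x * (?y + ?x)) * sjp_ginv"
    by (simp add: sjp_ginv_y sjp_ginv_x mult.assoc distrib_left distrib_right left_diff_distrib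
        right_diff_distrib)
  finally show "sjp_ginv * w = w * sjp_ginv" by (simp add: w distrib_left distrib_right x0)
  have sx: "sjp_s = ?y * ?x + ?x * ?y" by (simp add: sjp_s_def add.commute)
  have xw: "?x * w = sjp_s * ?x"
    by (simp add: w sx right_diff_distrib distrib_right mult.assoc x0)
  have wx: "w * ?x = - (sjp_s * ?x)" using xw \<open>w * ?x = - (?x * w)\<close> by simp
  have "w * w = w * ?y * ?x - w * ?x * ?y" by (simp add: w right_diff_distrib mult.assoc)
  also have "w * ?y = - (?y * w) - w * ?x" using yw by (simp add: distrib_left algebra_simps)
  also have "(- (?y * w) - w * ?x) * ?x - w * ?x * ?y = ?y * (sjp_s * ?x) + sjp_s * ?x * ?y"
    by (simp add: wx left_diff_distrib mult.assoc x0)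
  also have "?y * (sjp_s * ?x) = (sjp_s * ?y + ?x * sjp_s) * ?x"
    by (simp only: sjp_y_s mult.assoc[symmetric])
  also have "\<dots> = sjp_s * (?y * ?x)" by (simp add: distrib_right mult.assoc sjp_s_x x0)
  also have "sjp_s * (?y * ?x) + sjp_s * ?x * ?y = sjp_s * sjp_s"
    by (simp add: sx distrib_left mult.assoc)
  finally show "w * w = sjp_s * sjp_s" .
qed

lemma sjp_central_C: "sjp_C * a = a * (sjp_C :: 'k::field sjp)"
proof (rule sjp_centralI)
  fix i
  define w where "w = (2 * sjp_y * sjp_x - sjp_s :: 'k sjp)"
  note w = sjp_w_facts[where ?'k = 'k, folded w_def]
  have C: "sjp_C = w * sjp_ginv" by (simp add: sjp_C_def w_def)
  have x: "sjp_C * sjp_x = sjp_x * (sjp_C :: 'k sjp)"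
    unfolding C mult.assoc sjp_ginv_x by (simp add: w(1) flip: mult.assoc)
  have y: "sjp_C * sjp_y = sjp_y * (sjp_C :: 'k sjp)"
    unfolding C mult.assoc sjp_ginv_y by (simp add: w(2) flip: mult.assoc)
  have h: "sjp_ginv * sjp_C = sjp_C * (sjp_ginv :: 'k sjp)"
    unfolding C by (simp add: w(3) flip: mult.assoc)
  have g: "sjp_g * sjp_C = sjp_C * (sjp_g :: 'k sjp)"
    by (rule commute_inverse[OF sjp_relations(4,3) h])
  show "sjp_C * sjp_gen i = sjp_gen i * (sjp_C :: 'k sjp)"
    using x y g h by (cases i) auto
qed

text \<open>This ties \<open>C\<close> to \<open>s\<close> and \<open>g\<close>: once powers of
  these two are scalars, so is a power of \<open>C\<close>.\<close>

lemma sjp_C_square: "sjp_C * sjp_C = sjp_s * sjp_s * (sjp_ginv * sjp_ginv :: 'k::field sjp)"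
proof -
  define w where "w = (2 * sjp_y * sjp_x - sjp_s :: 'k sjp)"
  note w = sjp_w_facts[where ?'k = 'k, folded w_def]
  have "w * sjp_ginv * (w * sjp_ginv) = w * (sjp_ginv * w) * sjp_ginv" by (simp only: mult.assoc)
  also have "\<dots> = w * w * (sjp_ginv * sjp_ginv)" by (simp only: w(3) mult.assoc)
  finally show ?thesis by (simp add: w(4) sjp_C_def flip: w_def)
qed


section \<open>\<open>A\<close> is finite over a central subalgebra\<close>

text \<open>The four variables stand for \<open>s^p\<close>, \<open>y^(2p)\<close>,
  \<open>g^(2p)\<close> and \<open>g^(-2p)\<close>, the innermost first. The inverse has a variable
  of its own, so the source is a plain polynomial ring. \<open>C\<close> is left out and recovered
  later through \<open>C_g_power\<close>.\<close>

definition sjp_eval :: "'k::field poly poly poly poly \<Rightarrow> 'k sjp" where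
  "sjp_eval = eval_poly (eval_poly (eval_poly (eval_poly sjp_scalar
     (sjp_s ^ CHAR('k))) (sjp_y ^ (2 * CHAR('k)))) (sjp_g ^ (2 * CHAR('k)))) (sjp_ginv ^ (2 *
       CHAR('k)))"

text \<open>Monomials of Poincare-Birkhoff-Witt type, with \<open>s\<close> treated as a further
  generator. Only their spanning property is established.\<close>

definition sjp_monom :: "nat \<Rightarrow> nat \<Rightarrow> nat \<Rightarrow> nat \<Rightarrow> 'k::field sjp" where
  "sjp_monom k e i j = sjp_g ^ k * (sjp_x ^ e * (sjp_s ^ i * sjp_y ^ j))"

definition sjp_monoms :: "'k::field sjp list" where
  "sjp_monoms = (let p = CHAR('k) in
     [sjp_monom k e i j. k \<leftarrow> [0..<2 * p], e \<leftarrow> [0..<2], i \<leftarrow> [0..<p], j \<leftarrow> [0..<2 * p]])"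

context
  fixes p :: nat
  assumes p: "CHAR('k::field) = p" and p0: "p > 0"
begin

lemma central_eval_sjp_eval: "central_eval (sjp_eval :: _ \<Rightarrow> 'k sjp)"
  and sjp_eval_gens:
    "sjp_eval [:[:[:[:c:]:]:]:] = (sjp_scalar c :: 'k sjp)"
    "sjp_eval [:[:[:[:0, 1:]:]:]:] = (sjp_s ^ p :: 'k sjp)"
    "sjp_eval [:[:[:0, 1:]:]:] = (sjp_y ^ (2 * p) :: 'k sjp)"
    "sjp_eval [:[:0, 1:]:] = (sjp_g ^ (2 * p) :: 'k sjp)"
    "sjp_eval [:0, 1:] = (sjp_ginv ^ (2 * p) :: 'k sjp)"
proof -
  note centr = sjp_central_s[OF p p0] sjp_central_y[OF p p0] sjp_central_g[OF p]
  let ?e1 = "eval_poly sjp_scalar (sjp_s ^ p :: 'k sjp)"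
  let ?e2 = "eval_poly ?e1 (sjp_y ^ (2 * p))"
  let ?e3 = "eval_poly ?e2 (sjp_g ^ (2 * p))"
  have h1: "unital_hom ?e1"
    by (rule unital_hom_eval_poly[OF unital_hom_sjp_scalar]) (rule centr(1)[symmetric])
  have h2: "unital_hom ?e2"
    by (rule unital_hom_eval_poly[OF h1]) (rule centr(2)[symmetric])
  have h3: "unital_hom ?e3"
    by (rule unital_hom_eval_poly[OF h2]) (rule centr(3)[symmetric])
  have h4: "unital_hom (sjp_eval :: _ \<Rightarrow> 'k sjp)"
    unfolding sjp_eval_def p by (rule unital_hom_eval_poly[OF h3]) (rule centr(4)[symmetric])
  have c1: "?e1 F * a = a * ?e1 F" for F a
    by (rule eval_poly_commute[OF unital_hom_sjp_scalar sjp_scalar_commute centr(1)])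
  have c2: "?e2 F * a = a * ?e2 F" for F a
    by (rule eval_poly_commute[OF h1 c1 centr(2)])
  have c3: "?e3 F * a = a * ?e3 F" for F a
    by (rule eval_poly_commute[OF h2 c2 centr(3)])
  have c4: "sjp_eval F * a = a * sjp_eval F" for F and a :: "'k sjp"
    unfolding sjp_eval_def p by (rule eval_poly_commute[OF h3 c3 centr(4)])
  show "central_eval (sjp_eval :: _ \<Rightarrow> 'k sjp)" by standard (rule h4 c4)+
  note simps = sjp_eval_def p eval_poly_const[OF h3] eval_poly_const[OF h2] eval_poly_const[OF h1]
    eval_poly_const[OF unital_hom_sjp_scalar] eval_poly_X[OF h3] eval_poly_X[OF h2]
      eval_poly_X[OF h1]
    eval_poly_X[OF unital_hom_sjp_scalar]
  show "sjp_eval [:[:[:[:c:]:]:]:] = (sjp_scalar c :: 'k sjp)"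
    "sjp_eval [:[:[:[:0, 1:]:]:]:] = (sjp_s ^ p :: 'k sjp)"
    "sjp_eval [:[:[:0, 1:]:]:] = (sjp_y ^ (2 * p) :: 'k sjp)"
    "sjp_eval [:[:0, 1:]:] = (sjp_g ^ (2 * p) :: 'k sjp)"
    "sjp_eval [:0, 1:] = (sjp_ginv ^ (2 * p) :: 'k sjp)"
    by (simp_all only: simps)
qed

text \<open>The span \<open>V\<close> contains monomials with arbitrary exponents, because the
  excess powers are central and \<open>x^2 = 0\<close>. It is stable under left multiplication by
  the generators and contains \<open>1\<close>, hence is everything.\<close>

lemma sjp_finite_over_center: "a \<in> lin_span (range sjp_eval) sjp_monoms {0 :: 'k sjp}"
proof -
  interpret E: central_eval "sjp_eval :: _ \<Rightarrow> 'k sjp" by (rule central_eval_sjp_eval)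
  let ?Z = "range (sjp_eval :: _ \<Rightarrow> 'k sjp)"
  define V where "V = lin_span ?Z sjp_monoms {0}"
  have Zadd: "a + b \<in> ?Z" and Zmult: "a * b \<in> ?Z" if ab: "a \<in> ?Z" "b \<in> ?Z" for a b
  proof -
    obtain F G where "a = sjp_eval F" "b = sjp_eval G" using ab by blast
    hence "a + b = sjp_eval (F + G)" "a * b = sjp_eval (F * G)" by (simp_all add: E.ev)
    thus "a + b \<in> ?Z" "a * b \<in> ?Z" by blast+
  qed
  have Z0: "0 \<in> ?Z" and Z1: "1 \<in> ?Z" and Zm1: "- 1 \<in> ?Z"
    using E.ev(4) E.ev(1) E.ev(5)[of 1] by (metis rangeI)+
  have Zpow: "a ^ n \<in> ?Z" if "a \<in> ?Z" for a n
    using that by (induction n) (auto simp: Z1 intro: Zmult)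
  have Zof_nat: "of_nat n \<in> ?Z" for n
    using sjp_eval_gens(1)[of "of_nat n"] by (metis rangeI sjp_scalar_of_nat)
  have Zgens: "sjp_scalar c \<in> ?Z" "sjp_s ^ p \<in> ?Z" "sjp_y ^ (2 * p) \<in> ?Z" "sjp_g ^ (2 * p) \<in> ?Z"
    "sjp_ginv ^ (2 * p) \<in> ?Z" for c
    using sjp_eval_gens by (metis rangeI)+
  have Zc: "\<zeta> * a = a * \<zeta>" if "\<zeta> \<in> ?Z" for \<zeta> a
    using that E.central by auto
  have Vadd: "u + v \<in> V" if "u \<in> V" "v \<in> V" for u v
    using that unfolding V_def by (intro lin_span_add Zadd) auto
  have VZ: "\<zeta> * u \<in> V" if "\<zeta> \<in> ?Z" "u \<in> V" for \<zeta> u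
    using that unfolding V_def by (intro lin_span_mult[of ?Z \<zeta> ?Z]) (auto intro: Zmult)
  have Vdiff: "u - v \<in> V" if "u \<in> V" "v \<in> V" for u v
    using Vadd[OF that(1) VZ[OF Zm1 that(2)]] by simp
  have V0: "0 \<in> V" unfolding V_def by (intro lin_span_zero Z0) simp
  have monom: "sjp_monom k e i j \<in> V" for k e i j
  proof (cases "e < 2")
    case False
    then obtain n where "e = Suc (Suc n)" by (metis less_2_cases_iff not0_implies_Suc One_nat_def)
    hence "sjp_x ^ e = (0 :: 'k sjp)"
      by (simp add: sjp_relations(1) flip: mult.assoc)
    thus ?thesis by (simp add: sjp_monom_def V0)
  next
    case True
    have split: "a ^ n = (a ^ m) ^ (n div m) * a ^ (n mod m)" for a :: "'k sjp" and n m
      by (simp flip: power_mult power_add)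
    let ?\<zeta> = "(sjp_g ^ (2 * p)) ^ (k div (2 * p)) :: 'k sjp"
    let ?\<xi> = "(sjp_s ^ p) ^ (i div p) :: 'k sjp"
    let ?\<upsilon> = "(sjp_y ^ (2 * p)) ^ (j div (2 * p)) :: 'k sjp"
    have Z: "?\<zeta> \<in> ?Z" "?\<xi> \<in> ?Z" "?\<upsilon> \<in> ?Z" by (intro Zpow Zgens)+
    have pull: "a * (\<xi> * b) = \<xi> * (a * b)" if "\<xi> \<in> ?Z" for a \<xi> b
      using Zc[OF that] by (metis mult.assoc)
    have "sjp_monom k e i j
        = ?\<zeta> * (?\<xi> * (?\<upsilon> * sjp_monom (k mod (2 * p)) e (i mod p) (j mod (2 * p))))"
      unfolding sjp_monom_def
      by (subst split[of sjp_g k "2 * p"], subst split[of sjp_s i p],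
        subst split[of sjp_y j "2 * p"])
        (simp only: mult.assoc pull[OF Z(2), of "sjp_x ^ e"] pull[OF Z(2),
          of "sjp_g ^ (k mod (2 * p))"]
          pull[OF Z(3), of "sjp_x ^ e"] pull[OF Z(3), of "sjp_g ^ (k mod (2 * p))"]
          pull[OF Z(3), of "sjp_s ^ (i mod p)"])
    moreover have "sjp_monom (k mod (2 * p)) e (i mod p) (j mod (2 * p)) \<in> set (sjp_monoms :: 'k sjp
      list)"
    proof -
      have "k mod (2 * p) \<in> {0..<2 * p}" "e \<in> {0..<2}" "i mod p \<in> {0..<p}" "j mod (2 * p) \<in> {0..<2 *
        p}"
        using True p0 by auto
      thus ?thesis
        unfolding sjp_monoms_def Let_def p set_concat set_map set_upt image_image UN_iff
        by - ((rule bexI)+, rule imageI, assumption+)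
    qed
    from lin_span_base[OF Z0 _ Z1 this, of "{0}"]
    have "sjp_monom (k mod (2 * p)) e (i mod p) (j mod (2 * p)) \<in> V" by (simp add: V_def)
    ultimately show ?thesis using Z VZ by simp
  qed
  have left: "c * u \<in> V" if c: "\<And>k e i j. e < 2 \<Longrightarrow> c * sjp_monom k e i j \<in> V" and u: "u \<in> V" for c u
  proof -
    have "c * u \<in> V" if "u \<in> lin_span ?Z bs {0}" "set bs \<subseteq> set sjp_monoms" for u bs
      using that
    proof (induction bs arbitrary: u)
      case (Cons b bs)
      then obtain \<mu> w where w: "u = \<mu> * b + w" "\<mu> \<in> ?Z" "w \<in> lin_span ?Z bs {0}" by auto
      have "c * (\<mu> * b) = \<mu> * (c * b)" using Zc[OF w(2)] by (metis mult.assoc)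
      moreover have "c * b \<in> V"
        using Cons.prems(2) c by (auto simp: sjp_monoms_def Let_def)
      ultimately show ?case
        using Cons.IH[OF w(3)] Cons.prems(2) w VZ Vadd by (simp add: distrib_left)
    qed (simp add: V0)
    thus ?thesis using u unfolding V_def by blast
  qed
  have neg: "(- 1) ^ n * u \<in> V" if "u \<in> V" for n u
    by (intro VZ Zpow Zm1 that)
  have gen_monom: "sjp_gen l * sjp_monom k e i j \<in> V" if e: "e < 2" for l k e i j
  proof (cases l)
    case GX
    have "sjp_x * sjp_monom k e i j = (- 1) ^ k * (sjp_monom k (Suc e) i j :: 'k sjp)"
      by (simp only: sjp_monom_def mult.assoc[symmetric] sjp_x_g_power power_Suc)
    thus ?thesis using GX neg monom by simp
  next
    case GG
    have "sjp_g * sjp_monom k e i j = (sjp_monom (Suc k) e i j :: 'k sjp)"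
      by (simp add: sjp_monom_def mult.assoc)
    thus ?thesis using GG monom by simp
  next
    case GGinv
    \<comment> \<open>A single \<open>g\<inverse>\<close> is traded for the central
      \<open>g^(-2p)\<close> and the nonnegative power \<open>g^(2p-1)\<close>.\<close>
    have "sjp_ginv * sjp_g ^ k = sjp_ginv ^ (2 * p) * (sjp_g ^ (2 * p - 1 + k) :: 'k sjp)"
    proof -
      obtain q where q: "2 * p = Suc q" using p0 by (cases "2 * p") auto
      have "sjp_ginv ^ Suc q * (sjp_g ^ (q + k) :: 'k sjp)
          = sjp_ginv * (sjp_ginv ^ q * sjp_g ^ q) * sjp_g ^ k"
        by (simp only: power_add power_Suc mult.assoc)
      thus ?thesis by (simp add: q sjp_g_power_ginv)
    qed
    hence "sjp_ginv * sjp_monom k e i j = sjp_ginv ^ (2 * p) * (sjp_monom (2 * p - 1 +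
      k) e i j :: 'k sjp)"
      by (simp add: sjp_monom_def flip: mult.assoc)
    thus ?thesis using GGinv VZ Zgens monom by simp
  next
    case GY
    let ?m = "sjp_s ^ i * sjp_y ^ j :: 'k sjp"
    have ym: "sjp_y * ?m = sjp_s ^ i * sjp_y ^ Suc j + of_nat i * (sjp_x * ?m)"
    proof -
      have "sjp_y * ?m = sjp_y * sjp_s ^ i * sjp_y ^ j" by (simp only: mult.assoc)
      thus ?thesis by (simp add: sjp_y_s_power distrib_right mult.assoc)
    qed
    have x2: "sjp_x * (sjp_x * a) = 0" for a :: "'k sjp"
      by (simp add: sjp_relations(1) flip: mult.assoc)
    have g_of_nat: "sjp_g ^ k * (of_nat n * a) = of_nat n * (sjp_g ^ k * a)" for n and a :: "'k sjp"
      by (metis mult.assoc mult_of_nat_commute)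
    have yg: "sjp_y * (sjp_g ^ k * a) = (- 1) ^ k * (sjp_g ^ k * (sjp_y * a +
      of_nat k * (sjp_x * a)))"
      for a :: "'k sjp"
      by (simp add: sjp_y_g_power distrib_right mult.assoc flip: mult.assoc[of sjp_y])
    consider "e = 0" | "e = 1" using e by linarith
    hence "sjp_y * sjp_monom k e i j \<in> V"
    proof cases
      case 1
      have "sjp_y * sjp_monom k e i j = (- 1) ^ k * ((sjp_monom k 0 i (Suc j) :: 'k sjp)
          + of_nat i * sjp_monom k 1 i j + of_nat k * sjp_monom k 1 i j)"
        by (simp add: 1 sjp_monom_def yg ym distrib_left g_of_nat del: power_Suc)
      thus ?thesis by (simp only:) (intro neg Vadd VZ monom Zof_nat)
    next
      case 2
      have "sjp_y * (sjp_x * ?m) = sjp_s * ?m - sjp_x * (sjp_y * ?m)"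
        by (simp add: sjp_y_x left_diff_distrib flip: mult.assoc)
      also have "\<dots> = sjp_s ^ Suc i * sjp_y ^ j - sjp_x * (sjp_s ^ i * sjp_y ^ Suc j)"
      proof -
        have "sjp_x * (of_nat i * (sjp_x * ?m)) = 0"
          using x2 by (metis mult.assoc mult_of_nat_commute mult_zero_right)
        thus ?thesis by (simp add: ym distrib_left mult.assoc del: power_Suc) (simp add: mult.assoc)
      qed
      finally have "sjp_y * sjp_monom k e i j
          = (- 1) ^ k * ((sjp_monom k 0 (Suc i) j :: 'k sjp) - sjp_monom k 1 i (Suc j))"
        by (simp add: 2 sjp_monom_def yg x2 right_diff_distrib del: power_Suc)
      thus ?thesis by (simp only:) (intro neg Vdiff monom)
    qed
    thus ?thesis by (simp add: GY)
  qed
  have "\<forall>u\<in>V. a * u \<in> V" for a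
  proof (induction a rule: sjp_induct)
    case (scalar c)
    show ?case using VZ Zgens(1) by blast
  next
    case (gen i)
    show ?case
    proof
      fix u assume u: "u \<in> V"
      show "sjp_gen i * u \<in> V" using gen_monom u by (rule left)
    qed
  next
    case (add a b)
    thus ?case by (simp add: distrib_right Vadd)
  next
    case (mult a b)
    thus ?case by (simp add: mult.assoc)
  qed
  moreover have "sjp_monom 0 0 0 0 \<in> V" by (rule monom)
  ultimately have "a * sjp_monom 0 0 0 0 \<in> V" by blast
  thus ?thesis by (simp add: V_def sjp_monom_def)
qed

end

section \<open>Representations by periodic sequences\<close>

text \<open>Linear operators on all functions on the integers. The defining relations can be checked
  pointwise, with no index wrapping around; finite matrices arise afterwards by restriction to
  periodic functions.\<close>

typedef (overloaded) 'k seq_end =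
  "{f :: (int \<Rightarrow> 'k::field) \<Rightarrow> int \<Rightarrow> 'k. \<forall>c u v. f (\<lambda>j. c * u j + v j) = (\<lambda>j. c * f u j + f v j)}"
  morphisms seq_app Seq_end
  by (rule exI[of _ "\<lambda>v. v"]) simp

setup_lifting type_definition_seq_end

lemma seq_app_linear: "seq_app f (\<lambda>j. c * u j + v j) = (\<lambda>j. c * seq_app f u j + seq_app f v j)"
  using seq_app[of f] by blast

lemma seq_app_zero: "seq_app f (\<lambda>_. 0) = (\<lambda>_. 0)"
  using seq_app_linear[of f "- 1" "\<lambda>_. 0" "\<lambda>_. 0"] by simp

lemma seq_app_sum:
  "seq_app f (\<lambda>i. \<Sum>j\<in>K. c j * w j i) = (\<lambda>i. \<Sum>j\<in>K. c j * seq_app f (w j) i)"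
  by (induction K rule: infinite_finite_induct) (simp_all add: seq_app_zero seq_app_linear)

instantiation seq_end :: (field) ring_1
begin

lift_definition zero_seq_end :: "'a seq_end" is "\<lambda>_ _. 0" by simp
lift_definition one_seq_end :: "'a seq_end" is "\<lambda>v. v" by simp
lift_definition plus_seq_end :: "'a seq_end \<Rightarrow> 'a seq_end \<Rightarrow> 'a seq_end" is "\<lambda>f g v j. f v j + g v j"
  by (simp add: algebra_simps)
lift_definition minus_seq_end :: "'a seq_end \<Rightarrow> 'a seq_end \<Rightarrow> 'a seq_end" is "\<lambda>f g v j. f v j - g v j"
  by (simp add: algebra_simps)
lift_definition uminus_seq_end :: "'a seq_end \<Rightarrow> 'a seq_end" is "\<lambda>f v j. - f v j"
  by (simp add: algebra_simps)
lift_definition times_seq_end :: "'a seq_end \<Rightarrow> 'a seq_end \<Rightarrow> 'a seq_end" is "\<lambda>f g v. f (g v)"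
  by simp

instance
proof
  fix a b c :: "'a seq_end"
  show "a * (b + c) = a * b + a * c"
  proof transfer
    fix f g h :: "(int \<Rightarrow> 'a) \<Rightarrow> int \<Rightarrow> 'a"
    assume "\<forall>c u v. f (\<lambda>j. c * u j + v j) = (\<lambda>j. c * f u j + f v j)"
    from this[THEN spec, of 1]
    show "(\<lambda>v. f (\<lambda>j. g v j + h v j)) = (\<lambda>v j. f (g v) j + f (h v) j)" by simp
  qed
  show "(0 :: 'a seq_end) \<noteq> 1"
    by transfer (metis zero_neq_one)
qed (transfer; simp add: algebra_simps)+

end

lift_definition seq_scalar :: "'k::field \<Rightarrow> 'k seq_end" is "\<lambda>c v j. c * v j"
  by (simp add: algebra_simps)

lemma seq_end_eqI: "(\<And>v j. seq_app f v j = seq_app g v j) \<Longrightarrow> f = g"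
  by transfer blast

lemma seq_app_ops:
  "seq_app 0 v j = 0" "seq_app 1 v = v" "seq_app (f + g) v j = seq_app f v j + seq_app g v j"
  "seq_app (f - g) v j = seq_app f v j - seq_app g v j" "seq_app (- f) v j = - seq_app f v j"
  "seq_app (f * g) v = seq_app f (seq_app g v)" "seq_app (seq_scalar c) v j = c * v j"
  by (transfer; simp)+

section \<open>Representations prescribed on the generators\<close>

lemma sjp_universal:
  fixes sc :: "'k::field \<Rightarrow> 'b::ring_1"
  assumes sc: "unital_hom sc" and comm: "\<And>c i. sc c * f i = f i * sc c"
    and rel: "f GX * f GX = 0"
      "f GY * (f GX * f GY + f GY * f GX) = (f GX * f GY + f GY * f GX) * f GY
         + f GX * (f GX * f GY + f GY * f GX)"
      "f GG * f GGinv = 1" "f GGinv * f GG = 1"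
      "f GG * f GX * f GGinv = - f GX" "f GG * f GY * f GGinv = - f GY + f GX"
  obtains \<Phi> :: "'k sjp \<Rightarrow> 'b" where "unital_hom \<Phi>" "\<And>c. \<Phi> (sjp_scalar c) = sc c" "\<And>i. \<Phi> (sjp_gen i) =
    f i"
proof -
  interpret eval_data sc f
    by standard (simp_all add: unital_homD[OF sc] comm)
  have relators: "free_eval sc f r = 0" if "r \<in> sjp_relators" for r
    using that rel by (auto simp: sjp_relators_def Let_def eval_add eval_diff eval_mult
      eval_free_gen eval_one)
  have relideal: "free_eval sc f q = 0" if "q \<in> sjp_relideal" for q
    by (rule eval_relideal[OF _ that]) (rule relators)
  define \<Phi> where "\<Phi> a = free_eval sc f (rep_sjp a)" for a
  have \<Phi>: "\<Phi> (abs_sjp q) = free_eval sc f q" for q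
  proof -
    have "rep_sjp (abs_sjp q) - q \<in> sjp_relideal"
      by (rule rep_abs_rsp_left[OF Quotient3_sjp]) (simp add: sjp_relidealD)
    from relideal[OF this] show ?thesis by (simp add: \<Phi>_def eval_diff)
  qed
  have surj: "\<exists>q. a = abs_sjp q" for a :: "'k sjp" by (metis Quotient3_abs_rep Quotient3_sjp)
  show ?thesis
  proof (rule that[of \<Phi>])
    show "unital_hom \<Phi>"
      unfolding unital_hom_def
    proof (intro conjI allI)
      show "\<Phi> 1 = 1" by (simp add: one_sjp_def \<Phi> eval_one)
      fix a b :: "'k sjp"
      obtain q r where "a = abs_sjp q" "b = abs_sjp r" using surj by metis
      thus "\<Phi> (a + b) = \<Phi> a + \<Phi> b" "\<Phi> (a * b) = \<Phi> a * \<Phi> b"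
        by (simp_all add: plus_sjp.abs_eq times_sjp.abs_eq \<Phi> eval_add eval_mult)
    qed
    show "\<Phi> (sjp_scalar c) = sc c" for c
      by (simp add: sjp_scalar.abs_eq \<Phi> eval_single zero_sjp_word_def)
    show "\<Phi> (sjp_gen i) = f i" for i
      by (simp add: sjp_gen.abs_eq \<Phi> eval_free_gen)
  qed
qed

lemma unital_hom_seq_scalar: "unital_hom seq_scalar"
  unfolding unital_hom_def by (auto intro!: seq_end_eqI simp: seq_app_ops algebra_simps)

lemma seq_scalar_commute: "seq_scalar c * f = f * seq_scalar c"
proof (rule seq_end_eqI)
  fix v j
  show "seq_app (seq_scalar c * f) v j = seq_app (f * seq_scalar c) v j"
    using seq_app_linear[of f c v "\<lambda>_. 0"] 
    by (simp add: seq_app_ops seq_app_zero) (simp add: seq_app_ops(7)[abs_def])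
qed

lemma int_sub_2_div_2: "(j - 2) div 2 = j div 2 - (1::int)" "(j - 3) div 2 =
  (j - 1) div 2 - (1::int)"
  by presburger+

text \<open>
  On \<open>2p\<close>-periodic sequences this is the simple module with \<open>C = \<kappa>\<inverse>\<close> and \<open>s\<^sup>p = \<sigma>\<^sup>p\<close>;
  the value of \<open>y\<^sup>2\<^sup>p\<close> depends on \<open>b\<close>.
\<close>

context
  fixes \<sigma> \<kappa> b :: "'k::field"
begin

lift_definition rep_x :: "'k seq_end" is "\<lambda>v j. if odd j then v (j - 1) else 0" by auto
lift_definition rep_y :: "'k seq_end" is
  "\<lambda>v j. (if odd j then b + of_int (j div 2) else \<sigma>) * v (j - 1)"
  by (auto simp: algebra_simps)
lift_definition rep_g :: "'k seq_end" is
  "\<lambda>v j. (if odd j then - 1 else 1) * (\<kappa> * \<sigma>) * v (j - 2)"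
  by (auto simp: algebra_simps)
lift_definition rep_ginv :: "'k seq_end" is
  "\<lambda>v j. (if odd j then - 1 else 1) * v (j + 2) / (\<kappa> * \<sigma>)"
  by (auto simp: diff_divide_distrib add_divide_distrib)

lemma rep_app:
  "seq_app rep_x v j = (if odd j then v (j - 1) else 0)"
  "seq_app rep_y v j = (if odd j then b + of_int (j div 2) else \<sigma>) * v (j - 1)"
  "seq_app rep_g v j = (if odd j then - 1 else 1) * (\<kappa> * \<sigma>) * v (j - 2)"
  "seq_app rep_ginv v j = (if odd j then - 1 else 1) * v (j + 2) / (\<kappa> * \<sigma>)"
  by (transfer; simp)+

text \<open>At even positions only \<open>y x\<close> contributes, at odd ones only
  \<open>x y\<close>; together they form a multiple of the shift by two.\<close>

lemma rep_s: "seq_app (rep_x * rep_y + rep_y * rep_x) v j = \<sigma> * v (j - 2)"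
  by (simp add: seq_app_ops rep_app)

lemma ex_seq_rep:
  assumes "\<sigma> \<noteq> 0" "\<kappa> \<noteq> 0"
  obtains \<Phi> :: "'k sjp \<Rightarrow> 'k seq_end" where "unital_hom \<Phi>" "\<And>c. \<Phi> (sjp_scalar c) = seq_scalar c"
    "\<Phi> sjp_x = rep_x" "\<Phi> sjp_y = rep_y" "\<Phi> sjp_g = rep_g" "\<Phi> sjp_ginv = rep_ginv"
proof -
  define f where "f i = (case i of GX \<Rightarrow> rep_x | GY \<Rightarrow> rep_y | GG \<Rightarrow> rep_g | GGinv \<Rightarrow> rep_ginv)" for i
  have f: "f GX = rep_x" "f GY = rep_y" "f GG = rep_g" "f GGinv = rep_ginv"
    by (simp_all add: f_def)
  show ?thesis
  proof (rule sjp_universal[of seq_scalar f])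
    show "unital_hom (seq_scalar :: 'k \<Rightarrow> 'k seq_end)" by (rule unital_hom_seq_scalar)
    show "seq_scalar c * f i = f i * seq_scalar c" for c i by (rule seq_scalar_commute)
    show "f GX * f GX = 0" unfolding f
      by (rule seq_end_eqI) (simp add: seq_app_ops rep_app)
    show "f GG * f GGinv = 1" "f GGinv * f GG = 1" unfolding f
      using assms by (auto intro!: seq_end_eqI simp: seq_app_ops rep_app)
    show "f GG * f GX * f GGinv = - f GX" unfolding f
      using assms by (auto intro!: seq_end_eqI simp: seq_app_ops rep_app)
    show "f GG * f GY * f GGinv = - f GY + f GX" unfolding f
      using assms by (auto intro!: seq_end_eqI simp: seq_app_ops rep_app int_sub_2_div_2
        field_simps)
    \<comment> \<open>A shift by two lowers \<open>j div 2\<close> by one, and the resulting change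
      in the odd weights of \<open>y\<close> is exactly the term \<open>x s\<close>.\<close>
    show "f GY * (f GX * f GY + f GY * f GX)
        = (f GX * f GY + f GY * f GX) * f GY + f GX * (f GX * f GY + f GY * f GX)"
    proof (rule seq_end_eqI)
      fix v j
      show "seq_app (f GY * (f GX * f GY + f GY * f GX)) v j
          = seq_app ((f GX * f GY + f GY * f GX) * f GY + f GX * (f GX * f GY + f GY * f GX)) v j"
        unfolding f
        by (simp only: seq_app_ops(3)[of "_ * rep_y"] seq_app_ops(6) rep_s)
          (simp add: seq_app_ops(6) rep_s rep_app int_sub_2_div_2 algebra_simps)
    qed
  next
    fix \<Phi> :: "'k sjp \<Rightarrow> 'k seq_end"
    assume "unital_hom \<Phi>" "\<And>c. \<Phi> (sjp_scalar c) = seq_scalar c" "\<And>i. \<Phi> (sjp_gen i) = f i"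
    thus thesis using f that by metis
  qed
qed

end

text \<open>For \<open>\<sigma> = \<kappa> = 1\<close> the constant function \<open>1\<close> is
  fixed by \<open>s\<close>. This rules out \<open>0 = 1\<close> in \<open>A\<^sub>s\<close> and
  gives the instance of \<open>ring_1\<close> below.\<close>

lemma sjp_s_power_nonzero: "sjp_s ^ n \<noteq> (0 :: 'k::field sjp)"
proof -
  obtain \<Phi> :: "'k sjp \<Rightarrow> 'k seq_end" where \<Phi>: "unital_hom \<Phi>" "\<Phi> sjp_x = rep_x" "\<Phi> sjp_y = rep_y 1 0"
    using ex_seq_rep[of 1 1 0] by auto
  have "seq_app (\<Phi> (sjp_s ^ n)) (\<lambda>_. 1) = (\<lambda>_. 1)" for n
  proof (induction n)
    case (Suc n)
    have "\<Phi> (sjp_s ^ Suc n) = \<Phi> sjp_s * \<Phi> (sjp_s ^ n)"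
      by (simp add: unital_homD[OF \<Phi>(1)])
    moreover have "seq_app (\<Phi> sjp_s) v j = 1 * v (j - 2)" for v j
      unfolding sjp_s_def by (simp only: unital_homD[OF \<Phi>(1)] \<Phi> rep_s)
    ultimately show ?case using Suc by (auto simp: seq_app_ops)
  qed (simp add: unital_homD[OF \<Phi>(1)] seq_app_ops)
  from fun_cong[OF this[of n], of 0] show ?thesis
    using unital_homD(4)[OF \<Phi>(1)] by (auto simp: seq_app_ops)
qed

instance sjp_loc :: (field) ring_1
proof
  show "(0 :: 'a sjp_loc) \<noteq> 1"
    using sjp_loc_localization(7)[of "1 :: 'a sjp"] sjp_s_power_nonzero
    by (auto simp: sjp_loc_localization(3))
qed

section \<open>Matrix quotients of \<open>A\<close>\<close>

text \<open>Surjectivity is built in: it makes the kernel maximal, makes the column vectors a simple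
  module, and identifies the quotient with the full matrix ring.\<close>

definition sjp_mat_rep :: "nat \<Rightarrow> ('k::field sjp \<Rightarrow> 'k mat) \<Rightarrow> bool" where
  "sjp_mat_rep n \<rho> \<longleftrightarrow> \<rho> 1 = 1\<^sub>m n \<and> (\<forall>a. \<rho> a \<in> carrier_mat n n) \<and> (\<forall>a b. \<rho> (a + b) = \<rho> a + \<rho> b) \<and>
     (\<forall>a b. \<rho> (a * b) = \<rho> a * \<rho> b) \<and> (\<forall>c. \<rho> (sjp_scalar c) = c \<cdot>\<^sub>m 1\<^sub>m n) \<and>
     (\<forall>M\<in>carrier_mat n n. \<exists>a. \<rho> a = M)"

lemma sjp_mat_rep_ring_hom:
  assumes "sjp_mat_rep n \<rho>"
  shows "ring_hom_ring univ_ring (ring_mat TYPE('k::field) n ()) \<rho>"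
proof (rule ring_hom_ringI2[OF ring_univ_ring ring_mat])
  show "\<rho> \<in> Ring.ring_hom univ_ring (ring_mat TYPE('k) n ())"
    using assms by (auto simp: sjp_mat_rep_def Ring.ring_hom_def ring_mat_def)
qed

lemma a_kernel_ring_mat: "a_kernel univ_ring (ring_mat TYPE('k::field) n ()) \<rho> = {a. \<rho> a = 0\<^sub>m n n}"
  unfolding a_kernel_def' by (simp add: ring_mat_def)

lemma sjp_mat_rep_kernel_ideal:
  fixes \<rho> :: "'k::field sjp \<Rightarrow> 'k mat"
  assumes "sjp_mat_rep n \<rho>"
  shows "ideal {a. \<rho> a = 0\<^sub>m n n} univ_ring"
proof -
  interpret ring_hom_ring univ_ring "ring_mat TYPE('k) n ()" \<rho>
    by (rule sjp_mat_rep_ring_hom[OF assms])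
  show ?thesis using kernel_is_ideal unfolding a_kernel_ring_mat .
qed

text \<open>The first isomorphism theorem, with the additional check that the coset of a scalar is
  sent to the prescribed image of that scalar.\<close>

lemma sjp_algebra_isoI:
  assumes hom: "ring_hom_ring univ_ring S h" and surj: "h ` UNIV = carrier S"
    and ker: "a_kernel univ_ring S h = I" and scalar: "\<And>c. h (sjp_scalar c) = \<kappa> c"
  shows "algebra_iso (sjp_ring Quot I) (\<lambda>c. I +>\<^bsub>sjp_ring\<^esub> sjp_scalar c) S \<kappa>"
proof -
  have iso: "(\<lambda>X. the_elem (h ` X)) \<in> ring_iso (univ_ring Quot I) S"
    using ring_hom_ring.FactRing_iso_set[OF hom] surj unfolding ker by simp
  have h: "h \<in> Ring.ring_hom univ_ring S" and S: "ring S"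
    using hom by (simp_all add: ring_hom_ring_def ring_hom_ring_axioms_def)
  have hS: "h a \<in> carrier S" for a using ring_hom_closed[OF h, of a] by simp
  have I: "ideal I univ_ring" using ring_hom_ring.kernel_is_ideal[OF hom] unfolding ker .
  have image: "the_elem (h ` (I +>\<^bsub>sjp_ring\<^esub> sjp_scalar c)) = \<kappa> c" for c
  proof -
    have const: "h (i + sjp_scalar c) = h (sjp_scalar c)" if "i \<in> I" for i
    proof -
      have "h i = \<zero>\<^bsub>S\<^esub>" using that unfolding ker[symmetric] a_kernel_def' by simp
      moreover have "h (i + sjp_scalar c) = h i \<oplus>\<^bsub>S\<^esub> h (sjp_scalar c)"
        using ring_hom_add[OF h, of i "sjp_scalar c"] by simp
      ultimately show ?thesis
        using abelian_monoid.l_zero[OF ring.is_abelian_group[OF S, THEN abelian_group.axioms(1)] hS]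
        by simp
    qed
    have "I +>\<^bsub>sjp_ring\<^esub> sjp_scalar c = (\<lambda>i. i + sjp_scalar c) ` I"
      by (auto simp: a_r_coset_def')
    hence "h ` (I +>\<^bsub>sjp_ring\<^esub> sjp_scalar c) = (\<lambda>_. h (sjp_scalar c)) ` I"
      by (simp only: image_image) (rule image_cong[OF refl const])
    also have "\<dots> = {h (sjp_scalar c)}" using I by (auto simp: ideal_univ_ring_iff)
    finally show ?thesis by (simp add: scalar)
  qed
  show ?thesis
    unfolding algebra_iso_def using iso image by (intro bexI[of _ "\<lambda>X. the_elem (h ` X)"]) simp_all
qed

lemma sjp_mat_rep_iso:
  fixes \<rho> :: "'k::field sjp \<Rightarrow> 'k mat"
  assumes \<rho>: "sjp_mat_rep n \<rho>" and I: "I = {a. \<rho> a = 0\<^sub>m n n}"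
  shows "algebra_iso (sjp_ring Quot I) (\<lambda>c. I +>\<^bsub>sjp_ring\<^esub> sjp_scalar c)
    (ring_mat TYPE('k) n ()) (\<lambda>c. c \<cdot>\<^sub>m 1\<^sub>m n)"
proof (rule sjp_algebra_isoI[OF sjp_mat_rep_ring_hom[OF \<rho>]])
  show "\<rho> ` UNIV = carrier (ring_mat TYPE('k) n ())"
    using \<rho> by (auto simp: sjp_mat_rep_def ring_mat_def image_iff) metis
  show "a_kernel univ_ring (ring_mat TYPE('k) n ()) \<rho> = I" unfolding a_kernel_ring_mat I ..
  show "\<rho> (sjp_scalar c) = c \<cdot>\<^sub>m 1\<^sub>m n" for c using \<rho> by (simp add: sjp_mat_rep_def)
qed

lemma sjp_mat_rep_sum_entry:
  assumes "sjp_mat_rep n \<rho>" "i < n" "j < n"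
  shows "\<rho> (\<Sum>l\<in>K. u l) $$ (i, j) = (\<Sum>l\<in>K. \<rho> (u l) $$ (i, j))"
proof -
  have car: "\<rho> a \<in> carrier_mat n n" and add: "\<rho> (a + b) = \<rho> a + \<rho> b" for a b
    using assms by (auto simp: sjp_mat_rep_def)
  have "\<rho> (sjp_scalar 0) = 0 \<cdot>\<^sub>m 1\<^sub>m n" using assms by (auto simp: sjp_mat_rep_def)
  hence "\<rho> 0 $$ (i, j) = 0" using assms by (simp add: sjp_scalar_hom)
  moreover have "\<rho> (a + b) $$ (i, j) = \<rho> a $$ (i, j) + \<rho> b $$ (i, j)" for a b
    using car[of a] car[of b] assms by (simp add: add)
  ultimately show ?thesis by (induction K rule: infinite_finite_induct) simp_all
qed

definition unit_mat :: "nat \<Rightarrow> nat \<Rightarrow> nat \<Rightarrow> 'a::{zero,one} mat" where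
  "unit_mat n i j = mat n n (\<lambda>(r, s). if r = i \<and> s = j then 1 else 0)"

lemma unit_mat_sandwich:
  fixes M :: "'a::semiring_1 mat"
  assumes "M \<in> carrier_mat n n" "k < n" "l < n" "r < n" "s < n"
  shows "(unit_mat n i k * M * unit_mat n l j) $$ (r, s) = (if r = i \<and> s = j then M $$ (k,
    l) else 0)"
proof -
  have 1: "(unit_mat n i k * M) $$ (r, t) = (if r = i then M $$ (k, t) else 0)" if "t < n" for t
  proof -
    have "(unit_mat n i k * M) $$ (r, t) = (\<Sum>u\<in>{0..<n}. (if r = i \<and> u = k then 1 else 0) * M $$ (u,
      t))"
      using assms that by (simp add: unit_mat_def times_mat_def scalar_prod_def)
    also have "\<dots> = (\<Sum>u\<in>{0..<n}. if u = k then (if r = i then M $$ (k, t) else 0) else 0)"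
      by (intro sum.cong) auto
    finally show ?thesis using assms by simp
  qed
  have "(unit_mat n i k * M * unit_mat n l j) $$ (r, s)
      = (\<Sum>t\<in>{0..<n}. (unit_mat n i k * M) $$ (r, t) * (if t = l \<and> s = j then 1 else 0))"
    using assms by (simp add: unit_mat_def times_mat_def scalar_prod_def)
  also have "\<dots> = (\<Sum>t\<in>{0..<n}. if t = l then (if r = i \<and> s = j then M $$ (k, l) else 0) else 0)"
    using assms by (intro sum.cong) (auto simp: 1)
  finally show ?thesis using assms by simp
qed

text \<open>Simplicity of a matrix ring, pulled back along \<open>\<rho>\<close>. If an element
  \<open>a\<close> of \<open>J\<close> has a nonzero entry at \<open>(k, l)\<close>, the sum over
  \<open>i\<close> of \<open>E_ik a E_li\<close> is that entry times the identity; lifting the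
  matrix units to \<open>A\<close> puts a nonzero scalar into \<open>J\<close>.\<close>

lemma sjp_mat_rep_max:
  fixes \<rho> :: "'k::field sjp \<Rightarrow> 'k mat"
  assumes \<rho>: "sjp_mat_rep n \<rho>" and n: "n > 0"
  shows "{a. \<rho> a = 0\<^sub>m n n} \<in> max_spectrum univ_ring"
  unfolding max_spectrum_univ_iff
proof (intro conjI allI impI)
  let ?I = "{a. \<rho> a = 0\<^sub>m n n}"
  have car: "\<rho> a \<in> carrier_mat n n" and add: "\<rho> (a + b) = \<rho> a + \<rho> b"
    and mult: "\<rho> (a * b) = \<rho> a * \<rho> b"
    and scalar: "\<rho> (sjp_scalar c) = c \<cdot>\<^sub>m 1\<^sub>m n" and surj: "\<And>M. M \<in> carrier_mat n n \<Longrightarrow> \<exists>a. \<rho> a = M"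
      for a b c
    using \<rho> by (auto simp: sjp_mat_rep_def)
  show I: "ideal ?I univ_ring" by (rule sjp_mat_rep_kernel_ideal[OF \<rho>])
  have "(1\<^sub>m n :: 'k mat) $$ (0, 0) \<noteq> 0\<^sub>m n n $$ (0, 0)" using n by simp
  thus "1 \<notin> ?I" using \<rho> by (auto simp: sjp_mat_rep_def)
  fix J assume J: "ideal J (univ_ring :: 'k sjp ring)" "?I \<subseteq> J"
  note Ji = J(1)[unfolded ideal_univ_ring_iff]
  show "J = ?I \<or> 1 \<in> J"
  proof (cases "J \<subseteq> ?I")
    case False
    then obtain a where a: "a \<in> J" "\<rho> a \<noteq> 0\<^sub>m n n" by blast
    then obtain k l where kl: "k < n" "l < n" "\<rho> a $$ (k, l) \<noteq> 0"
      using car[of a] by (metis carrier_matD eq_matI index_zero_mat)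
    have "\<exists>e. \<rho> e = unit_mat n i j" for i j by (rule surj) (simp add: unit_mat_def)
    then obtain e where e: "\<And>i j. \<rho> (e i j) = unit_mat n i j" by metis
    define u where "u = (\<Sum>i<n. e i k * a * e l i)"
    let ?c = "\<rho> a $$ (k, l)"
    have "sum f K \<in> J" if "\<And>i. i \<in> K \<Longrightarrow> f i \<in> J" for f and K :: "nat set"
      using that Ji by (induction K rule: infinite_finite_induct) auto
    hence "u \<in> J" using Ji a by (simp add: u_def)
    have "\<rho> u = ?c \<cdot>\<^sub>m 1\<^sub>m n"
    proof (rule eq_matI)
      fix r s assume rs: "r < dim_row (?c \<cdot>\<^sub>m 1\<^sub>m n)" "s < dim_col (?c \<cdot>\<^sub>m (1\<^sub>m n :: 'k mat))"
      hence "\<rho> u $$ (r, s) = (\<Sum>i<n. if r = i \<and> s = i then ?c else 0)"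
        using kl car by (simp add: u_def sjp_mat_rep_sum_entry[OF \<rho>] mult e unit_mat_sandwich)
      also have "\<dots> = (\<Sum>i<n. if i = r then (if r = s then ?c else 0) else 0)"
        by (intro sum.cong) auto
      finally show "\<rho> u $$ (r, s) = (?c \<cdot>\<^sub>m 1\<^sub>m n) $$ (r, s)" using rs by simp
    qed (use car[of u] in auto)
    hence "\<rho> (u + sjp_scalar (- ?c)) = 0\<^sub>m n n"
      by (auto simp: add scalar intro!: eq_matI)
    hence "u + sjp_scalar (- ?c) \<in> J" using J(2) by blast
    from univ_ideal_minus(2)[OF J(1) this \<open>u \<in> J\<close>] have "sjp_scalar (- ?c) \<in> J" by simp
    hence "sjp_scalar (inverse (- ?c)) * sjp_scalar (- ?c) \<in> J" using Ji by blast
    thus ?thesis using kl(3) by (simp add: sjp_scalar_hom flip: sjp_scalar_hom(2))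
  qed (use J in blast)
qed

text \<open>Column vectors form a simple module on which a nonzero matrix acts nontrivially. The
  passage from vectors to the carriers in \<open>prim_spectrum\<close> is
  \<open>annihilator_in_prim_spectrum\<close>.\<close>

lemma sjp_mat_rep_prim:
  fixes \<rho> :: "'k::field sjp \<Rightarrow> 'k mat"
  assumes \<rho>: "sjp_mat_rep n \<rho>" and n: "n > 0"
  shows "{a. \<rho> a = 0\<^sub>m n n} \<in> prim_spectrum univ_ring"
proof -
  have car: "\<rho> a \<in> carrier_mat n n" and add: "\<rho> (a + b) = \<rho> a + \<rho> b"
    and mult: "\<rho> (a * b) = \<rho> a * \<rho> b"
    and one: "\<rho> 1 = 1\<^sub>m n" and surj: "\<And>M. M \<in> carrier_mat n n \<Longrightarrow> \<exists>a. \<rho> a = M" for a b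
    using \<rho> by (auto simp: sjp_mat_rep_def)
  define M :: "('k sjp, 'k vec) module" where
    "M = \<lparr>carrier = carrier_vec n, monoid.mult = undefined, one = undefined,
       ring.zero = 0\<^sub>v n, add = (+), module.smult = (\<lambda>a v. \<rho> a *\<^sub>v v)\<rparr>"
  have M [simp]: "carrier M = carrier_vec n" "\<zero>\<^bsub>M\<^esub> = 0\<^sub>v n" "u \<oplus>\<^bsub>M\<^esub> v = u + v" "a \<odot>\<^bsub>M\<^esub> v =
    \<rho> a *\<^sub>v v" for u v a
    by (simp_all add: M_def)
  have "abelian_group M"
  proof (rule abelian_groupI)
    fix u assume "u \<in> carrier M"
    thus "\<exists>v\<in>carrier M. v \<oplus>\<^bsub>M\<^esub> u = \<zero>\<^bsub>M\<^esub>" by (intro bexI[of _ "- u"]) auto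
  qed (auto simp: assoc_add_vec[of _ n] comm_add_vec[of _ n])
  hence "left_module univ_ring M"
  proof (intro left_module.intro ring_univ_ring left_module_axioms.intro)
    fix a b u v
    assume "u \<in> carrier M"
    hence u: "u \<in> carrier_vec n" by simp
    show "a \<odot>\<^bsub>M\<^esub> u \<in> carrier M" using mult_mat_vec_carrier[OF car u] by simp
    show "(a \<oplus>\<^bsub>univ_ring\<^esub> b) \<odot>\<^bsub>M\<^esub> u = a \<odot>\<^bsub>M\<^esub> u \<oplus>\<^bsub>M\<^esub> b \<odot>\<^bsub>M\<^esub> u"
      using add_mult_distrib_mat_vec[OF car car u] by (simp add: add)
    show "(a \<otimes>\<^bsub>univ_ring\<^esub> b) \<odot>\<^bsub>M\<^esub> u = a \<odot>\<^bsub>M\<^esub> (b \<odot>\<^bsub>M\<^esub> u)"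
      using assoc_mult_mat_vec[OF car car u] by (simp add: mult)
    show "\<one>\<^bsub>univ_ring\<^esub> \<odot>\<^bsub>M\<^esub> u = u" using u by (simp add: one)
    assume "v \<in> carrier M"
    thus "a \<odot>\<^bsub>M\<^esub> (u \<oplus>\<^bsub>M\<^esub> v) = a \<odot>\<^bsub>M\<^esub> u \<oplus>\<^bsub>M\<^esub> a \<odot>\<^bsub>M\<^esub> v"
      using mult_add_distrib_mat_vec[OF car u] by simp
  qed
  moreover have "carrier M \<noteq> {\<zero>\<^bsub>M\<^esub>}"
  proof
    assume "carrier M = {\<zero>\<^bsub>M\<^esub>}"
    moreover have "unit_vec n 0 \<in> carrier M" by simp
    ultimately have "unit_vec n 0 = (0\<^sub>v n :: 'k vec)" by (simp only: M(2) singleton_iff)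
    from arg_cong[OF this, of "\<lambda>v. vec_index v 0"] show False using n by simp
  qed
  moreover have "N = {\<zero>\<^bsub>M\<^esub>} \<or> N = carrier M" if "submodule N univ_ring M" for N
  proof (rule disjCI)
    interpret N: submodule N univ_ring M by (rule that)
    assume "N \<noteq> carrier M"
    have "v = 0\<^sub>v n" if v: "v \<in> N" for v
    proof (rule ccontr)
      assume "v \<noteq> 0\<^sub>v n"
      moreover have vc: "v \<in> carrier_vec n" using N.subset v by auto
      ultimately obtain i where i: "i < n" "v $ i \<noteq> 0"
        by (metis carrier_vecD eq_vecI index_zero_vec)
      have "u \<in> N" if u: "u \<in> carrier_vec n" for u
      proof -
        \<comment> \<open>The matrix sends \<open>v\<close> to \<open>u\<close>: it is zero outside
          column \<open>i\<close>, where \<open>v\<close> does not vanish, and that column is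
          \<open>u\<close> divided by \<open>v $ i\<close>.\<close>
        let ?B = "mat n n (\<lambda>(r, s). if s = i then u $ r / v $ i else 0)"
        obtain a where a: "\<rho> a = ?B" using surj[of ?B] by auto
        have "?B *\<^sub>v v = u"
        proof (rule eq_vecI)
          fix r assume r: "r < dim_vec u"
          have "(?B *\<^sub>v v) $ r = (\<Sum>s\<in>{0..<n}. (if s = i then u $ r / v $ i else 0) * v $ s)"
            using r u vc by (simp add: scalar_prod_def)
          also have "\<dots> = (\<Sum>s\<in>{0..<n}. if s = i then u $ r else 0)"
            using i by (intro sum.cong) auto
          finally show "(?B *\<^sub>v v) $ r = u $ r" using i by simp
        qed (use u in auto)
        thus ?thesis using N.smult_closed[OF _ v, of a] by (simp add: a)
      qed
      hence "carrier M \<subseteq> N" by auto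
      with N.subset \<open>N \<noteq> carrier M\<close> show False by simp
    qed
    moreover have "0\<^sub>v n \<in> N" using N.one_closed by simp
    ultimately have "N = {0\<^sub>v n}" by blast
    thus "N = {\<zero>\<^bsub>M\<^esub>}" by simp
  qed
  ultimately have "simple_module univ_ring M" by (simp add: simple_module_def)
  moreover have "annihilator univ_ring M = {a. \<rho> a = 0\<^sub>m n n}"
  proof -
    have "\<rho> a = 0\<^sub>m n n" if "\<And>v. v \<in> carrier_vec n \<Longrightarrow> \<rho> a *\<^sub>v v = 0\<^sub>v n" for a
    proof (rule eq_matI)
      fix i j assume ij: "i < dim_row (0\<^sub>m n n)" "j < dim_col (0\<^sub>m n n)"
      hence "(\<rho> a *\<^sub>v unit_vec n j) $ i = 0" using that by simp
      thus "\<rho> a $$ (i, j) = 0\<^sub>m n n $$ (i, j)" using ij car[of a] by simp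
    qed (use car[of a] in auto)
    thus ?thesis by (auto simp: annihilator_def)
  qed
  ultimately show ?thesis using annihilator_in_prim_spectrum by metis
qed

section \<open>Matrices of operators on periodic sequences\<close>

definition periodic :: "nat \<Rightarrow> (int \<Rightarrow> 'a) \<Rightarrow> bool" where
  "periodic n v \<longleftrightarrow> (\<forall>j. v (j + int n) = v j)"

lemma periodic_mult:
  assumes "periodic n v"
  shows "v (j + int n * k) = v j"
proof (induction k rule: int_induct[of _ 0])
  case (step1 i)
  have "v (j + int n * (i + 1)) = v (j + int n * i + int n)" by (simp add: algebra_simps)
  thus ?case using assms step1 by (simp add: periodic_def)
next
  case (step2 i)
  have "v (j + int n * (i - 1) + int n) = v (j + int n * i)" by (simp add: algebra_simps)
  thus ?case using assms step2 by (simp add: periodic_def)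
qed simp

lemma periodic_mod: "periodic n v \<Longrightarrow> v (j mod int n) = v j"
  using periodic_mult[of n v "j mod int n" "j div int n"] by simp

text \<open>Indicator functions of residue classes modulo \<open>n\<close>; those of
  \<open>0, ..., n - 1\<close> are the basis in which operators on periodic functions become
  matrices.\<close>

definition periodic_unit :: "nat \<Rightarrow> int \<Rightarrow> int \<Rightarrow> 'k::field" where
  "periodic_unit n j = (\<lambda>i. if i mod int n = j mod int n then 1 else 0)"

lemma periodic_periodic_unit: "periodic n (periodic_unit n j)"
  by (simp add: periodic_def periodic_unit_def)

lemma periodic_expand:
  fixes v :: "int \<Rightarrow> 'k::field"
  assumes n: "n > 0" and v: "periodic n v"
  shows "v = (\<lambda>i. \<Sum>j<n. v (int j) * periodic_unit n (int j) i)"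
proof
  fix i
  have mod: "int (nat (i mod int n)) = i mod int n" using n by simp
  hence "nat (i mod int n) < n" using n by (metis of_nat_0_less_iff of_nat_less_iff pos_mod_bound)
  have "(\<Sum>j<n. v (int j) * periodic_unit n (int j) i)
      = (\<Sum>j<n. if j = nat (i mod int n) then v (int j) else 0)"
    using n by (intro sum.cong) (auto simp: periodic_unit_def)
  also have "\<dots> = v (i mod int n)" using \<open>nat (i mod int n) < n\<close> mod by simp
  finally show "v i = (\<Sum>j<n. v (int j) * periodic_unit n (int j) i)"
    by (simp add: periodic_mod[OF v])
qed

locale periodic_rep =
  fixes n :: nat and \<Phi> :: "'k::field sjp \<Rightarrow> 'k seq_end"
  assumes n: "n > 0" and hom: "unital_hom \<Phi>" and scalar: "\<Phi> (sjp_scalar c) = seq_scalar c"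
    and periodic_gen: "periodic n (v :: int \<Rightarrow> 'k) \<Longrightarrow> periodic n (seq_app (\<Phi> (sjp_gen i)) v)"
begin

lemmas \<Phi> = unital_homD[OF hom]

lemma periodic_app: "periodic n v \<Longrightarrow> periodic n (seq_app (\<Phi> a) v)"
proof (induction a arbitrary: v rule: sjp_induct)
  case (scalar c)
  thus ?case by (simp add: periodic_rep.scalar[OF periodic_rep_axioms] periodic_def seq_app_ops)
next
  case (add a b)
  thus ?case by (simp add: \<Phi> periodic_def seq_app_ops)
next
  case (mult a b)
  thus ?case by (simp add: \<Phi> seq_app_ops)
qed (rule periodic_gen)

definition matrix :: "'k sjp \<Rightarrow> 'k mat" where
  "matrix a = mat n n (\<lambda>(i, j). seq_app (\<Phi> a) (periodic_unit n (int j)) (int i))"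

lemma app_matrix:
  assumes "periodic n v" "i < n"
  shows "seq_app (\<Phi> a) v (int i) = (\<Sum>j<n. matrix a $$ (i, j) * v (int j))"
  using assms(2)
  by (subst periodic_expand[OF n assms(1)]) (simp add: seq_app_sum matrix_def mult.commute)

text \<open>Kernels can thus be found by applying operators to functions, without touching matrix
  entries.\<close>

lemma matrix_zero_iff: "matrix a = 0\<^sub>m n n \<longleftrightarrow> (\<forall>v. periodic n v \<longrightarrow> seq_app (\<Phi> a) v = (\<lambda>_. 0))"
proof
  assume a: "matrix a = 0\<^sub>m n n"
  show "\<forall>v. periodic n v \<longrightarrow> seq_app (\<Phi> a) v = (\<lambda>_. 0)"
  proof (intro allI impI ext)
    fix v :: "int \<Rightarrow> 'k" and j :: int assume v: "periodic n v"
    have j: "int (nat (j mod int n)) = j mod int n" "nat (j mod int n) < n"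
      using n by (simp_all add: nat_less_iff)
    have "seq_app (\<Phi> a) v (j mod int n) = 0"
      using app_matrix[OF v j(2), of a] j by (simp add: a)
    thus "seq_app (\<Phi> a) v j = 0" by (simp add: periodic_mod[OF periodic_app[OF v]])
  qed
next
  assume "\<forall>v. periodic n v \<longrightarrow> seq_app (\<Phi> a) v = (\<lambda>_. 0)"
  thus "matrix a = 0\<^sub>m n n"
    by (auto simp: matrix_def periodic_periodic_unit intro!: eq_matI)
qed

text \<open>
  The three hypotheses produce the matrix unit at the origin, the columns and the rows.
\<close>

lemma matrix_rep:
  assumes origin: "\<And>v. periodic n v \<Longrightarrow> seq_app (\<Phi> a0) v = (\<lambda>i. v 0 * periodic_unit n 0 i)"
    and column: "\<And>i. i < n \<Longrightarrow> \<exists>a. seq_app (\<Phi> a) (periodic_unit n 0) = periodic_unit n (int i)"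
    and row: "\<And>j. j < n \<Longrightarrow> \<exists>b. \<forall>v. periodic n v \<longrightarrow> seq_app (\<Phi> b) v 0 = v (int j)"
  shows "sjp_mat_rep n matrix"
proof -
  have car: "matrix a \<in> carrier_mat n n" for a by (simp add: matrix_def)
  have unit: "periodic_unit n (int j) (int i) = (if i = j then 1 else 0 :: 'k)" if "i < n" "j < n"
    for i j
    using that by (auto simp: periodic_unit_def)
  have sc: "matrix (sjp_scalar c) = c \<cdot>\<^sub>m 1\<^sub>m n" for c
    by (rule eq_matI) (simp_all add: matrix_def scalar seq_app_ops unit)
  moreover have "matrix 1 = 1\<^sub>m n" using sc[of 1] by (auto simp: sjp_scalar_hom intro!: eq_matI)
  moreover have add: "matrix (a + b) = matrix a + matrix b" for a b
    by (rule eq_matI) (simp_all add: matrix_def \<Phi> seq_app_ops)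
  moreover have "matrix (a * b) = matrix a * matrix b" for a b
  proof (rule eq_matI)
    fix i j assume "i < dim_row (matrix a * matrix b)" "j < dim_col (matrix a * matrix b)"
    hence ij: "i < n" "j < n" by (simp_all add: matrix_def)
    have "matrix (a * b) $$ (i, j)
        = seq_app (\<Phi> a) (seq_app (\<Phi> b) (periodic_unit n (int j))) (int i)"
      using ij by (simp add: matrix_def \<Phi> seq_app_ops)
    also have "\<dots> = (\<Sum>k<n. matrix a $$ (i, k) * matrix b $$ (k, j))"
      using ij by (simp add: app_matrix[OF periodic_app[OF periodic_periodic_unit]])
        (simp add: matrix_def)
    also have "\<dots> = (matrix a * matrix b) $$ (i, j)"
      using ij car[of a] car[of b] by (simp add: times_mat_def scalar_prod_def atLeast0LessThan)
    finally show "matrix (a * b) $$ (i, j) = (matrix a * matrix b) $$ (i, j)" .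
  qed (simp_all add: matrix_def)
  moreover have "\<exists>a. matrix a = B" if B: "B \<in> carrier_mat n n" for B
  proof -
    obtain e where e: "\<And>i. i < n \<Longrightarrow> seq_app (\<Phi> (e i)) (periodic_unit n 0) = periodic_unit n (int i)"
      using column by metis
    obtain f where f: "\<And>j v. j < n \<Longrightarrow> periodic n v \<Longrightarrow> seq_app (\<Phi> (f j)) v 0 = v (int j)"
      using row by metis
    \<comment> \<open>\<open>e i * (a0 * f j)\<close> acts as the matrix unit at
      \<open>(i, j)\<close>: it brings entry \<open>j\<close> to the origin, projects there and
      moves the result to \<open>i\<close>.\<close>
    define u where "u = (\<Sum>i<n. \<Sum>j<n. sjp_scalar (B $$ (i, j)) * (e i * (a0 * f j)))"
    have unit_ij: "seq_app (\<Phi> (e i * (a0 * f j))) v = (\<lambda>l. v (int j) * periodic_unit n (int i) l)"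
      if "i < n" "j < n" "periodic n v" for i j v
    proof -
      have "seq_app (\<Phi> (e i * (a0 * f j))) v
          = seq_app (\<Phi> (e i)) (\<lambda>l. seq_app (\<Phi> (f j)) v 0 * periodic_unit n 0 l + 0)"
        using that by (simp add: \<Phi> seq_app_ops origin periodic_app)
      also have "\<dots> = (\<lambda>l. v (int j) * periodic_unit n (int i) l)"
        using that by (subst seq_app_linear) (simp add: e f seq_app_zero)
      finally show ?thesis .
    qed
    have sum: "seq_app (\<Phi> (sum h K)) v l = (\<Sum>k\<in>K. seq_app (\<Phi> (h k)) v l)" for h v l
      and K :: "nat set"
      by (induction K rule: infinite_finite_induct) (simp_all add: \<Phi> seq_app_ops)
    have "matrix u = B"
    proof (rule eq_matI)
      fix r s assume "r < dim_row B" "s < dim_col B"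
      hence rs: "r < n" "s < n" using B by auto
      have "matrix u $$ (r, s)
          = (\<Sum>i<n. \<Sum>j<n. B $$ (i, j) * (periodic_unit n (int s) (int j) * periodic_unit n (int i)
            (int r)))"
        using rs by (simp add: matrix_def u_def sum \<Phi>(3)[of "sjp_scalar _"] scalar seq_app_ops
            unit_ij periodic_periodic_unit)
      also have "\<dots> = (\<Sum>i<n. if i = r then B $$ (i, s) else 0)"
      proof (rule sum.cong[OF refl])
        fix i assume "i \<in> {..<n}"
        hence i: "i < n" by simp
        have "(\<Sum>j<n. B $$ (i, j) * (periodic_unit n (int s) (int j) * periodic_unit n (int i) (int
          r)))
            = (\<Sum>j<n. if j = s then B $$ (i, j) * periodic_unit n (int i) (int r) else 0)"
          using rs by (intro sum.cong refl) (simp add: unit)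
        thus "(\<Sum>j<n. B $$ (i, j) * (periodic_unit n (int s) (int j) * periodic_unit n (int i) (int
          r)))
            = (if i = r then B $$ (i, s) else 0)"
          using rs i by (simp add: unit)
      qed
      finally show "matrix u $$ (r, s) = B $$ (r, s)" using rs by simp
    qed (use B in \<open>auto simp: matrix_def\<close>)
    thus ?thesis by blast
  qed
  ultimately show ?thesis using car by (auto simp: sjp_mat_rep_def)
qed

end

section \<open>The one-dimensional quotients\<close>

lemma univ_Idl:
  fixes X :: "'a::{ring,monoid_mult} set"
  shows "ideal (Idl\<^bsub>univ_ring\<^esub> X) univ_ring" "X \<subseteq> Idl\<^bsub>univ_ring\<^esub> X"
    "ideal J univ_ring \<Longrightarrow> X \<subseteq> J \<Longrightarrow> Idl\<^bsub>univ_ring\<^esub> X \<subseteq> J"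
  using ring.genideal_ideal[OF ring_univ_ring, of X] ring.genideal_self[OF ring_univ_ring, of X]
    ring.genideal_minimal[OF ring_univ_ring, of J X] by simp_all

text \<open>Every element is congruent to its value under \<open>\<chi>\<close> modulo the listed
  ideal, so the kernel cannot be larger than that ideal.\<close>

lemma ex_character_quotient:
  fixes \<gamma> :: "'k::field"
  assumes "\<gamma> \<noteq> 0"
  obtains \<chi> :: "'k sjp \<Rightarrow> 'k" where "unital_hom \<chi>" "\<And>c. \<chi> (sjp_scalar c) = c"
    "{a. \<chi> a = 0} = Idl\<^bsub>sjp_ring\<^esub> {sjp_s, sjp_x, sjp_y, sjp_g - sjp_scalar \<gamma>}"
proof -
  let ?I = "Idl\<^bsub>sjp_ring\<^esub> {sjp_s, sjp_x, sjp_y, sjp_g - sjp_scalar \<gamma>}"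
  define f where "f i = (case i of GX \<Rightarrow> 0 | GY \<Rightarrow> 0 | GG \<Rightarrow> \<gamma> | GGinv \<Rightarrow> inverse \<gamma>)" for i
  have f: "f GX = 0" "f GY = 0" "f GG = \<gamma>" "f GGinv = inverse \<gamma>" by (simp_all add: f_def)
  obtain \<chi> :: "'k sjp \<Rightarrow> 'k" where \<chi>: "unital_hom \<chi>" "\<And>c. \<chi> (sjp_scalar c) = c"
    "\<And>i. \<chi> (sjp_gen i) = f i"
    by (rule sjp_universal[of "\<lambda>c::'k. c" f])
      (use assms in \<open>auto simp: f mult.commute unital_hom_def\<close>)
  note h = unital_homD[OF \<chi>(1)]
  note Ii = univ_Idl(1)[of "{sjp_s, sjp_x, sjp_y, sjp_g - sjp_scalar \<gamma>}"]
  note I = Ii[unfolded ideal_univ_ring_iff]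
  note Idiff = univ_ideal_minus(2)[OF Ii] and Iminus = univ_ideal_minus(1)[OF Ii]
  have gens: "sjp_s \<in> ?I" "sjp_x \<in> ?I" "sjp_y \<in> ?I" "sjp_g - sjp_scalar \<gamma> \<in> ?I"
    using univ_Idl(2)[of "{sjp_s, sjp_x, sjp_y, sjp_g - sjp_scalar \<gamma>}"] by auto
  have reduce: "a - sjp_scalar (\<chi> a) \<in> ?I" for a
  proof (induction a rule: sjp_induct)
    case (scalar c)
    show ?case using I by (simp add: \<chi>)
  next
    case (gen i)
    \<comment> \<open>The identity \<open>g\<inverse> - \<gamma>\<inverse> = - \<gamma>\<inverse>
      g\<inverse> (g - \<gamma>)\<close> covers the inverse generator.\<close>
    have "- sjp_scalar (inverse \<gamma>) * (sjp_ginv * (sjp_g - sjp_scalar \<gamma>)) \<in> ?I"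
      using I gens by blast
    moreover have "- sjp_scalar (inverse \<gamma>) * (sjp_ginv * (sjp_g - sjp_scalar \<gamma>))
        = sjp_ginv - sjp_scalar (inverse \<gamma>)"
    proof -
      have "sjp_scalar (inverse \<gamma>) * (sjp_ginv * sjp_scalar \<gamma>)
          = sjp_scalar (inverse \<gamma>) * sjp_scalar \<gamma> * sjp_ginv"
        by (simp only: sjp_scalar_commute[of \<gamma> sjp_ginv, symmetric] mult.assoc)
      also have "\<dots> = sjp_ginv" using assms by (simp add: sjp_scalar_hom(4) flip: sjp_scalar_hom(2))
      finally show ?thesis by (simp add: right_diff_distrib sjp_relations(4))
    qed
    ultimately show ?case using gens by (cases i) (simp_all add: \<chi> f sjp_scalar_hom)
  next
    case (add a b)
    hence "(a - sjp_scalar (\<chi> a)) + (b - sjp_scalar (\<chi> b)) \<in> ?I" using I by blast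
    thus ?case by (simp add: h sjp_scalar_hom algebra_simps)
  next
    case (mult a b)
    hence "(a - sjp_scalar (\<chi> a)) * b + sjp_scalar (\<chi> a) * (b - sjp_scalar (\<chi> b)) \<in> ?I"
      using I by blast
    thus ?case by (simp add: h sjp_scalar_hom algebra_simps)
  qed
  have "{a. \<chi> a = 0} \<subseteq> ?I"
  proof
    fix a assume "a \<in> {a. \<chi> a = 0}"
    thus "a \<in> ?I" using reduce[of a] by (simp add: sjp_scalar_hom)
  qed
  moreover have "?I \<subseteq> {a. \<chi> a = 0}"
    by (rule univ_Idl(3)) (auto simp: ideal_univ_ring_iff h \<chi> f sjp_s_def)
  ultimately show ?thesis using that \<chi> by blast
qed

text \<open>Scalars are read as \<open>1 \<times> 1\<close> matrices, so that the first family
  shares the maximality and primitivity arguments of the other two.\<close>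

lemma sjp_character_mat_rep:
  fixes \<chi> :: "'k::field sjp \<Rightarrow> 'k"
  assumes "unital_hom \<chi>" "\<And>c. \<chi> (sjp_scalar c) = c"
  shows "sjp_mat_rep 1 (\<lambda>a. mat 1 1 (\<lambda>_. \<chi> a))"
    and "mat 1 1 (\<lambda>_. \<chi> a) = 0\<^sub>m 1 1 \<longleftrightarrow> \<chi> a = 0"
proof -
  note h = unital_homD[OF assms(1)]
  have "\<exists>a. mat 1 1 (\<lambda>_. \<chi> a) = M" if "M \<in> carrier_mat 1 1" for M
    using that assms(2) by (intro exI[of _ "sjp_scalar (M $$ (0, 0))"]) (auto intro!: eq_matI)
  moreover have "mat 1 1 (\<lambda>_. \<chi> (a * b)) = mat 1 1 (\<lambda>_. \<chi> a) * mat 1 1 (\<lambda>_. \<chi> b)" for a b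
    by (rule eq_matI) (simp_all add: h times_mat_def scalar_prod_def)
  ultimately show "sjp_mat_rep 1 (\<lambda>a. mat 1 1 (\<lambda>_. \<chi> a))"
    unfolding sjp_mat_rep_def by (auto simp: h assms(2) intro!: eq_matI)
  show "mat 1 1 (\<lambda>_. \<chi> a) = 0\<^sub>m 1 1 \<longleftrightarrow> \<chi> a = 0"
    by (auto simp: mat_eq_iff)
qed

section \<open>The two-dimensional representations\<close>

context
  fixes \<alpha> d :: "'k::field"
begin

text \<open>On functions of period two, \<open>y\<close> becomes the matrix with rows
  \<open>(0, \<alpha>)\<close> and \<open>(1, 0)\<close>, and \<open>g\<close> becomes
  \<open>diag(d, -d)\<close>. Together with \<open>x = 0\<close> this gives
  \<open>y\<^sup>2 = \<alpha>\<close> and \<open>g\<^sup>2 = d\<^sup>2\<close>.\<close>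

lift_definition alt_y :: "'k seq_end" is "\<lambda>v j. (if odd j then 1 else \<alpha>) * v (j - 1)"
  by (auto simp: algebra_simps)
lift_definition alt_g :: "'k seq_end" is "\<lambda>v j. (if odd j then - d else d) * v j"
  by (auto simp: algebra_simps)
lift_definition alt_ginv :: "'k seq_end" is "\<lambda>v j. (if odd j then - 1 else 1) * v j / d"
  by (auto simp: diff_divide_distrib add_divide_distrib)

lemma alt_app:
  "seq_app alt_y v j = (if odd j then 1 else \<alpha>) * v (j - 1)"
  "seq_app alt_g v j = (if odd j then - d else d) * v j"
  "seq_app alt_ginv v j = (if odd j then - 1 else 1) * v j / d"
  by (transfer; simp)+

end

text \<open>Modulo the listed ideal every element is a combination of \<open>1\<close>,
  \<open>y\<close>, \<open>g\<close> and \<open>y g\<close>. Because \<open>2 \<noteq> 0\<close>,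
  these four have linearly independent images, so the kernel is no larger than the ideal.\<close>

lemma ex_mat_rep_2:
  fixes \<alpha> \<beta> :: "'k::alg_closed_field"
  assumes nz: "\<alpha> \<noteq> 0" "\<beta> \<noteq> 0" and two: "(2 :: 'k) \<noteq> 0"
  obtains \<rho> :: "'k sjp \<Rightarrow> 'k mat" where "sjp_mat_rep 2 \<rho>"
    "{a. \<rho> a = 0\<^sub>m 2 2}
      = Idl\<^bsub>sjp_ring\<^esub> {sjp_s, sjp_x, sjp_y ^ 2 - sjp_scalar \<alpha>, sjp_g ^ 2 - sjp_scalar \<beta>}"
proof -
  let ?X = "{sjp_s, sjp_x, sjp_y ^ 2 - sjp_scalar \<alpha>, sjp_g ^ 2 - sjp_scalar \<beta>}"
  let ?I = "Idl\<^bsub>sjp_ring\<^esub> ?X"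
  obtain d where d2: "d ^ 2 = \<beta>" using nth_root_exists[of 2 \<beta>] by auto
  have d: "d \<noteq> 0" using d2 nz by auto
  define f where "f i = (case i of GX \<Rightarrow> 0 | GY \<Rightarrow> alt_y \<alpha> | GG \<Rightarrow> alt_g d | GGinv \<Rightarrow> alt_ginv d)" for i
  have f: "f GX = 0" "f GY = alt_y \<alpha>" "f GG = alt_g d" "f GGinv = alt_ginv d"
    by (simp_all add: f_def)
  obtain \<Phi> :: "'k sjp \<Rightarrow> 'k seq_end" where hom0: "unital_hom \<Phi>"
    and scalar0: "\<And>c. \<Phi> (sjp_scalar c) = seq_scalar c" and gen0: "\<And>i. \<Phi> (sjp_gen i) = f i"
  proof (rule sjp_universal[of seq_scalar f])
    show "f GG * f GGinv = 1" "f GGinv * f GG = 1" "f GG * f GY * f GGinv = - f GY + f GX"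
      unfolding f using d by (auto intro!: seq_end_eqI simp: seq_app_ops alt_app)
  qed (simp_all add: f unital_hom_seq_scalar seq_scalar_commute)
  note ev = unital_homD[OF hom0]
  have per2: "v (- 1) = v 1" "v (1 + j) = v (j - 1)" if "periodic 2 v" for v :: "int \<Rightarrow> 'k" and j
  proof -
    have v: "v (j - 1 + int 2) = v (j - 1)" for j using that unfolding periodic_def by blast
    have "j - 1 + int 2 = 1 + j" by simp
    with v[of j] show "v (1 + j) = v (j - 1)" by simp
    from v[of 0] show "v (- 1) = v 1" by simp
  qed
  interpret periodic_rep 2 \<Phi>
  proof
    fix v :: "int \<Rightarrow> 'k" and i assume v: "periodic 2 v"
    have "periodic 2 (seq_app (f i) v)"
      using v by (cases i) (auto simp: f periodic_def seq_app_ops alt_app per2[OF v])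
    thus "periodic 2 (seq_app (\<Phi> (sjp_gen i)) v)" by (simp only: gen0)
  qed (simp_all add: hom0 scalar0)
  have app: "seq_app (\<Phi> sjp_y) v j = (if odd j then 1 else \<alpha>) * v (j - 1)"
    "seq_app (\<Phi> sjp_g) v j = (if odd j then - d else d) * v j" for v j
    by (simp_all only: gen0 f alt_app)
  have rep: "sjp_mat_rep 2 matrix"
  proof (rule matrix_rep)
    \<comment> \<open>\<open>(1 + g/d) / 2\<close> is the projection onto the even
      positions.\<close>
    let ?a = "sjp_scalar (1 / 2) * (1 + sjp_scalar (1 / d) * sjp_g)"
    show "seq_app (\<Phi> ?a) v = (\<lambda>i. v 0 * periodic_unit 2 0 i)" if v: "periodic 2 v" for v
    proof
      fix i
      have "seq_app (\<Phi> ?a) v i = (if odd i then 0 else v i)"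
        using d two by (simp add: scalar0 seq_app_ops app ev)
      moreover have "v i = v 0" if "even i"
        using periodic_mod[OF v, of i] that by simp
      ultimately show "seq_app (\<Phi> ?a) v i = v 0 * periodic_unit 2 0 i"
        by (auto simp: periodic_unit_def even_iff_mod_2_eq_zero)
    qed
    fix i :: nat assume "i < 2"
    hence i: "i = 0 \<or> i = 1" by auto
    have "seq_app (\<Phi> 1) (periodic_unit 2 0) = periodic_unit 2 0"
      by (simp add: ev seq_app_ops)
    moreover have "seq_app (\<Phi> sjp_y) (periodic_unit 2 0) = periodic_unit 2 1"
    proof
      fix j :: int
      have "j mod 2 = 0 \<and> (j - 1) mod 2 = 1 \<or> j mod 2 = 1 \<and> (j - 1) mod 2 = 0" by presburger
      thus "seq_app (\<Phi> sjp_y) (periodic_unit 2 0) j = periodic_unit 2 1 j"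
        by (auto simp: app periodic_unit_def odd_iff_mod_2_eq_one)
    qed
    ultimately show "\<exists>a. seq_app (\<Phi> a) (periodic_unit 2 0) = periodic_unit 2 (int i)"
      using i by auto
    have "seq_app (\<Phi> 1) v 0 = v 0" for v by (simp add: ev seq_app_ops)
    moreover have "seq_app (\<Phi> (sjp_scalar (1 / \<alpha>) * sjp_y)) v 0 = v 1" if "periodic 2 v" for v
      using nz by (simp add: ev scalar0 seq_app_ops app per2[OF that])
    ultimately show "\<exists>b. \<forall>v. periodic 2 v \<longrightarrow> seq_app (\<Phi> b) v 0 = v (int i)"
      using i by (metis of_nat_0 of_nat_1)
  qed
  note Ii = univ_Idl(1)[of ?X]
  note I = Ii[unfolded ideal_univ_ring_iff]
  note Idiff = univ_ideal_minus(2)[OF Ii]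
  have gens: "sjp_x \<in> ?I" "sjp_y ^ 2 - sjp_scalar \<alpha> \<in> ?I" "sjp_g ^ 2 - sjp_scalar \<beta> \<in> ?I"
    using univ_Idl(2)[of ?X] by auto
  define el where "el c0 c1 c2 c3 = sjp_scalar c0 + sjp_scalar c1 * sjp_y + sjp_scalar c2 * sjp_g
    + sjp_scalar c3 * (sjp_y * sjp_g)" for c0 c1 c2 c3 :: 'k
  have pull: "a * (sjp_scalar c * b) = sjp_scalar c * (a * b)" for a b c
    by (metis mult.assoc sjp_scalar_commute)
  have com: "sjp_gen i * sjp_scalar c = sjp_scalar c * sjp_gen i" for i and c :: 'k
    by (rule sjp_scalar_commute[symmetric])
  have y: "sjp_y * el c0 c1 c2 c3 - el (c1 * \<alpha>) c0 (c3 * \<alpha>) c2 \<in> ?I" for c0 c1 c2 c3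
  proof -
    have "sjp_y * el c0 c1 c2 c3 - el (c1 * \<alpha>) c0 (c3 * \<alpha>) c2
        = sjp_scalar c1 * (sjp_y ^ 2 - sjp_scalar \<alpha>) + sjp_scalar c3 * ((sjp_y ^ 2 - sjp_scalar \<alpha>) *
          sjp_g)"
      by (simp add: el_def distrib_left left_diff_distrib right_diff_distrib pull[of sjp_y]
          com power2_eq_square sjp_scalar_hom mult.assoc)
    thus ?thesis using I gens by simp
  qed
  have gy: "sjp_g * sjp_y = sjp_x * sjp_g - sjp_y * (sjp_g :: 'k sjp)"
    by (simp add: sjp_y_g sjp_x_g distrib_left)
  have g: "sjp_g * el c0 c1 c2 c3 - el (c2 * \<beta>) (- (c3 * \<beta>)) c0 (- c1) \<in> ?I" for c0 c1 c2 c3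
  proof -
    have "sjp_g * (sjp_y * sjp_g) = sjp_x * (sjp_g * sjp_g) - sjp_y * (sjp_g * (sjp_g :: 'k sjp))"
      by (simp add: gy left_diff_distrib flip: mult.assoc)
    hence "sjp_g * el c0 c1 c2 c3 - el (c2 * \<beta>) (- (c3 * \<beta>)) c0 (- c1)
        = sjp_scalar c1 * (sjp_x * sjp_g) + sjp_scalar c2 * (sjp_g ^ 2 - sjp_scalar \<beta>)
          + sjp_scalar c3 * (sjp_x * (sjp_g * sjp_g))
          - sjp_scalar c3 * (sjp_y * (sjp_g ^ 2 - sjp_scalar \<beta>))"
      by (simp add: el_def distrib_left left_diff_distrib right_diff_distrib pull[of sjp_g]
          com power2_eq_square gy sjp_scalar_hom unital_homD(5)[OF unital_hom_sjp_scalar]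
            mult.assoc)
    thus ?thesis using I gens Idiff by simp
  qed
  \<comment> \<open>The elements congruent to such a combination are stable under left
    multiplication by all of \<open>A\<close>; since \<open>1\<close> is among them,
    \<open>W\<close> is everything.\<close>
  define W where "W = {a. \<exists>c0 c1 c2 c3. a - el c0 c1 c2 c3 \<in> ?I}"
  have WI: "a \<in> W" if b: "b \<in> W" "a - b \<in> ?I" for a b
  proof -
    obtain c0 c1 c2 c3 where "b - el c0 c1 c2 c3 \<in> ?I" using b(1) by (auto simp: W_def)
    with b(2) have "(a - b) + (b - el c0 c1 c2 c3) \<in> ?I" using I by blast
    thus ?thesis by (auto simp: W_def)
  qed
  have Wel: "el c0 c1 c2 c3 \<in> W" for c0 c1 c2 c3
    unfolding W_def using I
    by (intro CollectI exI[of _ c0] exI[of _ c1] exI[of _ c2] exI[of _ c3]) simp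
  have Wadd: "a + b \<in> W" if ab: "a \<in> W" "b \<in> W" for a b
  proof -
    obtain c0 c1 c2 c3 where c: "a - el c0 c1 c2 c3 \<in> ?I" using ab(1) by (auto simp: W_def)
    obtain e0 e1 e2 e3 where e: "b - el e0 e1 e2 e3 \<in> ?I" using ab(2) by (auto simp: W_def)
    have "(a - el c0 c1 c2 c3) + (b - el e0 e1 e2 e3) \<in> ?I" using I c e by blast
    moreover have "el (c0 + e0) (c1 + e1) (c2 + e2) (c3 + e3) = el c0 c1 c2 c3 + el e0 e1 e2 e3"
      by (simp add: el_def sjp_scalar_hom distrib_right)
    ultimately have "a + b - el (c0 + e0) (c1 + e1) (c2 + e2) (c3 + e3) \<in> ?I"
      by (simp add: algebra_simps)
    thus ?thesis by (rule WI[OF Wel])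
  qed
  have Wmult: "c * a \<in> W" if c: "\<And>c0 c1 c2 c3. c * el c0 c1 c2 c3 \<in> W" and a: "a \<in> W" for a c
  proof -
    obtain c0 c1 c2 c3 where "a - el c0 c1 c2 c3 \<in> ?I" using a by (auto simp: W_def)
    hence "c * (a - el c0 c1 c2 c3) \<in> ?I" using I by blast
    hence "c * a - c * el c0 c1 c2 c3 \<in> ?I" by (simp add: right_diff_distrib)
    thus ?thesis by (rule WI[OF c])
  qed
  have Wscalar: "sjp_scalar c * a \<in> W" if "a \<in> W" for c a
  proof (rule Wmult[OF _ that])
    fix c0 c1 c2 c3
    have "sjp_scalar c * el c0 c1 c2 c3 = el (c * c0) (c * c1) (c * c2) (c * c3)"
      by (simp add: el_def sjp_scalar_hom distrib_left mult.assoc)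
    thus "sjp_scalar c * el c0 c1 c2 c3 \<in> W" using Wel by simp
  qed
  have Wg: "sjp_g * a \<in> W" if "a \<in> W" for a
    using Wmult[OF WI[OF Wel g] that] .
  have "\<forall>u\<in>W. a * u \<in> W" for a
  proof (induction a rule: sjp_induct)
    case (gen i)
    show ?case
    proof (cases i)
      case GX
      have "sjp_x * u - el 0 0 0 0 \<in> ?I" for u using I gens by (simp add: el_def sjp_scalar_hom)
      thus ?thesis using WI[OF Wel] GX by blast
    next
      case GY
      thus ?thesis using Wmult[OF WI[OF Wel y]] by blast
    next
      case GG
      thus ?thesis using Wg by blast
    next
      case GGinv
      \<comment> \<open>Modulo the ideal, \<open>g\<inverse>\<close> equals
        \<open>\<beta>\<inverse> g\<close>.\<close>
      have "sjp_ginv * u \<in> W" if "u \<in> W" for u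
      proof (rule WI)
        show "sjp_scalar (inverse \<beta>) * (sjp_g * u) \<in> W" by (intro Wscalar Wg that)
        have "- sjp_scalar (inverse \<beta>) * (sjp_ginv * (sjp_g ^ 2 - sjp_scalar \<beta>) * u) \<in> ?I"
          using I gens by blast
        moreover have "sjp_scalar (inverse \<beta>) * (sjp_ginv * (sjp_g ^ 2 - sjp_scalar \<beta>) * u)
            = sjp_scalar (inverse \<beta>) * (sjp_g * u) - sjp_ginv * u"
        proof -
          have "sjp_ginv * (sjp_g ^ 2) = (sjp_g :: 'k sjp)"
            by (simp add: power2_eq_square sjp_relations(4) flip: mult.assoc)
          moreover have "sjp_ginv * sjp_scalar \<beta> = sjp_scalar \<beta> * sjp_ginv"
            by (rule sjp_scalar_commute[symmetric])
          moreover have "sjp_scalar (inverse \<beta>) * (sjp_scalar \<beta> * a) = a" for a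
            using nz by (simp add: sjp_scalar_hom(4) flip: mult.assoc sjp_scalar_hom(2))
          ultimately show ?thesis
            by (simp add: right_diff_distrib left_diff_distrib mult.assoc)
        qed
        ultimately show "sjp_ginv * u - sjp_scalar (inverse \<beta>) * (sjp_g * u) \<in> ?I" by simp
      qed
      thus ?thesis using GGinv by blast
    qed
  qed (auto simp: Wscalar Wadd distrib_right mult.assoc)
  moreover have "el 1 0 0 0 \<in> W" by (rule Wel)
  ultimately have "a * el 1 0 0 0 \<in> W" for a by blast
  hence reduce: "a \<in> W" for a by (simp add: el_def sjp_scalar_hom)
  have "?I \<subseteq> {a. matrix a = 0\<^sub>m 2 2}"
  proof (rule univ_Idl(3)[OF sjp_mat_rep_kernel_ideal[OF rep]])
    have x: "\<Phi> sjp_x = 0" by (simp add: gen0 f)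
    have "seq_app (\<Phi> (sjp_y ^ 2 - sjp_scalar \<alpha>)) v = (\<lambda>_. 0)" if v: "periodic 2 v" for v
    proof
      fix j
      have "v (j - 2) = v j" using v[unfolded periodic_def, rule_format, of "j - 2"] by simp
      thus "seq_app (\<Phi> (sjp_y ^ 2 - sjp_scalar \<alpha>)) v j = 0"
        by (simp add: power2_eq_square ev scalar0 seq_app_ops app)
    qed
    moreover have "seq_app (\<Phi> (sjp_g ^ 2 - sjp_scalar \<beta>)) v = (\<lambda>_. 0)" for v
      by (rule ext) (simp add: power2_eq_square ev scalar0 seq_app_ops app flip: d2)
    ultimately show "?X \<subseteq> {a. matrix a = 0\<^sub>m 2 2}"
      unfolding matrix_zero_iff by (auto simp: sjp_s_def ev x seq_app_ops)
  qed
  moreover have "{a. matrix a = 0\<^sub>m 2 2} \<subseteq> ?I"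
  proof
    fix a assume a: "a \<in> {a. matrix a = 0\<^sub>m 2 2}"
    obtain c0 c1 c2 c3 where c: "a - el c0 c1 c2 c3 \<in> ?I" using reduce[of a] by (auto simp: W_def)
    hence "matrix (a - el c0 c1 c2 c3) = 0\<^sub>m 2 2" using calculation by blast
    hence el0: "seq_app (\<Phi> (el c0 c1 c2 c3)) v = (\<lambda>_. 0)" if "periodic 2 v" for v
      using that a unfolding mem_Collect_eq matrix_zero_iff
      by (auto simp: ev seq_app_ops fun_eq_iff)
    have expand: "seq_app (\<Phi> (el c0 c1 c2 c3)) v j = c0 * v j + c1 * seq_app (\<Phi> sjp_y) v j
        + c2 * seq_app (\<Phi> sjp_g) v j + c3 * seq_app (\<Phi> sjp_y) (seq_app (\<Phi> sjp_g) v) j" for v j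
      by (simp add: el_def ev scalar0 seq_app_ops)
    \<comment> \<open>The two indicator functions at the two parities yield
      \<open>c0 \<plusminus> c2 d = 0\<close> and, up to a factor \<open>\<alpha>\<close>,
      \<open>c1 \<plusminus> c3 d = 0\<close>.\<close>
    note eq = el0[OF periodic_periodic_unit, THEN fun_cong, unfolded expand app]
    have "c0 + c2 * d = 0" "c0 - c2 * d = 0" "c1 + c3 * d = 0" "c1 - c3 * d = 0"
      using eq[of 0 0] eq[of 1 1] eq[of 0 1] eq[of 1 0] nz
      by (simp_all add: periodic_unit_def algebra_simps)
    moreover have "u = 0 \<and> v = 0" if "u + v = 0" "u - v = 0" for u v :: 'k
    proof -
      have "u = v" using that(2) by simp
      hence "2 * v = 0" using that(1) by (simp only: mult_2)
      thus ?thesis using two \<open>u = v\<close> by simp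
    qed
    ultimately have "c0 = 0 \<and> c2 * d = 0" "c1 = 0 \<and> c3 * d = 0" by blast+
    hence "el c0 c1 c2 c3 = 0" using d by (simp add: el_def sjp_scalar_hom)
    thus "a \<in> ?I" using c by simp
  qed
  ultimately show ?thesis using that[OF rep] by blast
qed

section \<open>The representations of dimension 2p\<close>

context
  fixes p :: nat
  assumes p: "CHAR('k::field) = p" and p0: "p > 0"
begin

lemma of_nat_p: "of_nat p = (0 :: 'k)"
  using of_nat_CHAR[where ?'a = 'k] p by simp

text \<open>In characteristic \<open>p\<close> the product runs over all residues; it is the
  Artin-Schreier polynomial \<open>z^p - z\<close>, invariant under integer translations. A
  translation by one only exchanges the factor \<open>z - (p - 1)\<close> for the equal factor
  \<open>z + 1\<close>.\<close>

lemma falling_prod_shift: "(\<Prod>i<p. z + of_int N - of_nat i :: 'k) = (\<Prod>i<p. z - of_nat i)"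
proof -
  obtain q where q: "p = Suc q" using p0 by (cases p) auto
  have step: "(\<Prod>i<p. z + 1 - of_nat i :: 'k) = (\<Prod>i<p. z - of_nat i)" for z
  proof -
    have "(\<Prod>i<p. z + 1 - of_nat i :: 'k) = (z + 1) * (\<Prod>i<q. z - of_nat i)"
      unfolding q prod.lessThan_Suc_shift by simp
    moreover have "z + 1 = z - of_nat q"
      using of_nat_p by (simp add: q eq_neg_iff_add_eq_0 algebra_simps)
    ultimately show ?thesis by (simp only:) (simp add: q mult.commute)
  qed
  show ?thesis
  proof (induction N rule: int_induct[of _ 0])
    case (step1 i)
    have "(\<Prod>j<p. z + of_int (i + 1) - of_nat j :: 'k) = (\<Prod>j<p. (z + of_int i) + 1 - of_nat j)"
      by (simp add: algebra_simps)
    thus ?case using step1 step[of "z + of_int i"] by simp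
  next
    case (step2 i)
    have "(\<Prod>j<p. z + of_int i - of_nat j :: 'k) = (\<Prod>j<p. (z + of_int (i - 1)) + 1 - of_nat j)"
      by (simp add: algebra_simps)
    thus ?case using step2 step[of "z + of_int (i - 1)"] by simp
  qed simp
qed

lemma of_int_mod_p: "(of_int (m mod int p) :: 'k) = of_int m"
proof -
  have "(of_int m :: 'k) = of_int (m mod int p + int p * (m div int p))" by simp
  thus ?thesis unfolding of_int_add of_int_mult by (simp add: of_nat_p)
qed

end

lemma ex_falling_prod_root:
  fixes c :: "'k::alg_closed_field"
  assumes "n > 0"
  obtains b where "(\<Prod>i<n. b - of_nat i) = c"
proof -
  let ?P = "\<Prod>i<n. [:- of_nat i, 1 :: 'k:]"
  have "degree ?P = n" by (subst degree_prod_sum_eq) auto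
  hence "degree (?P + [:- c:]) > 0" using assms by (subst degree_add_eq_left) auto
  then obtain b where "poly (?P + [:- c:]) b = 0" using alg_closed_imp_poly_has_root by blast
  thus ?thesis using that[of b] by (simp add: poly_prod)
qed

text \<open>The parameters match the three scalars: \<open>s^p\<close> acts as
  \<open>\<sigma>^p\<close>, \<open>C\<close> as the inverse of \<open>\<kappa>\<close>, and
  \<open>y^2\<close> as the double shift with weight \<open>\<sigma> (b + N j)\<close>. Hence
  \<open>y^(2p)\<close> is \<open>\<sigma>^p\<close> times a product over all residues, which
  depends on \<open>b\<close> alone.\<close>

lemma ex_mat_rep_2p:
  fixes \<alpha> \<beta> \<gamma> :: "'k::alg_closed_field"
  assumes p: "CHAR('k) = p" and p0: "p > 0" and nz: "\<alpha> \<noteq> 0" "\<beta> \<noteq> 0"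
  obtains \<rho> :: "'k sjp \<Rightarrow> 'k mat" where "sjp_mat_rep (2 * p) \<rho>"
    "{sjp_C - sjp_scalar \<alpha>, sjp_s ^ p - sjp_scalar \<beta>, sjp_y ^ (2 * p) - sjp_scalar \<gamma>}
      \<subseteq> {a. \<rho> a = 0\<^sub>m (2 * p) (2 * p)}"
proof -
  let ?n = "2 * p"
  obtain q where q: "p = Suc q" using p0 by (cases p) auto
  obtain \<sigma> where \<sigma>: "\<sigma> ^ p = \<beta>" using nth_root_exists[of p \<beta>] p0 by auto
  have \<sigma>0: "\<sigma> \<noteq> 0" using \<sigma> nz p0 by auto
  obtain b where b: "(\<Prod>i<p. b - of_nat i) = \<gamma> / \<beta>"
    using ex_falling_prod_root[OF p0, of "\<gamma> / \<beta>"] by blast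
  obtain \<Phi> :: "'k sjp \<Rightarrow> 'k seq_end" where hom0: "unital_hom \<Phi>"
    and scalar0: "\<And>c. \<Phi> (sjp_scalar c) = seq_scalar c" and gen0: "\<Phi> sjp_x = rep_x"
    "\<Phi> sjp_y = rep_y \<sigma> b" "\<Phi> sjp_g = rep_g \<sigma> (inverse \<alpha>)" "\<Phi> sjp_ginv = rep_ginv \<sigma> (inverse \<alpha>)"
    using ex_seq_rep[of \<sigma> "inverse \<alpha>" b] \<sigma>0 nz by auto
  note ev = unital_homD[OF hom0]
  \<comment> \<open>\<open>N j\<close> is the integer entering the weight of \<open>y^2\<close> at
    \<open>j\<close>; for even \<open>j\<close> it comes from the odd position
    \<open>j - 1\<close>.\<close>
  define N :: "int \<Rightarrow> int" where "N j = (if odd j then j div 2 else (j - 1) div 2)" for j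
  have N2: "N (j - 2) = N j - 1" for j unfolding N_def by (auto simp: int_sub_2_div_2)
  have app_x: "seq_app (\<Phi> sjp_x) v j = (if odd j then v (j - 1) else 0)"
    and app_y: "seq_app (\<Phi> sjp_y) v j = (if odd j then b + of_int (j div 2) else \<sigma>) * v (j - 1)"
    and app_h: "seq_app (\<Phi> sjp_ginv) v j = (if odd j then - 1 else 1) * v (j + 2) / (inverse \<alpha> * \<sigma>)"
    and app_s: "seq_app (\<Phi> sjp_s) v j = \<sigma> * v (j - 2)" for v j
    by (simp_all only: gen0 rep_app sjp_s_def ev rep_s)
  have app_y2: "seq_app (\<Phi> (sjp_y ^ 2)) v j = \<sigma> * (b + of_int (N j)) * v (j - 2)" for v j
    by (auto simp: power2_eq_square ev seq_app_ops app_y N_def)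
  have app_s_power: "seq_app (\<Phi> (sjp_s ^ m)) v j = \<sigma> ^ m * v (j - 2 * int m)" for m v j
  proof (induction m arbitrary: v j)
    case (Suc m)
    have "seq_app (\<Phi> (sjp_s ^ Suc m)) v j = seq_app (\<Phi> sjp_s) (seq_app (\<Phi> (sjp_s ^ m)) v) j"
      by (simp add: ev seq_app_ops)
    thus ?case by (simp add: app_s Suc algebra_simps)
  qed (simp add: ev seq_app_ops)
  have app_y2_power: "seq_app (\<Phi> ((sjp_y ^ 2) ^ m)) v j
      = \<sigma> ^ m * (\<Prod>i<m. b + of_int (N j) - of_nat i) * v (j - 2 * int m)" for m v j
  proof (induction m arbitrary: v j)
    case (Suc m)
    have "seq_app (\<Phi> ((sjp_y ^ 2) ^ Suc m)) v j
        = seq_app (\<Phi> (sjp_y ^ 2)) (seq_app (\<Phi> ((sjp_y ^ 2) ^ m)) v) j"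
      by (simp only: power_Suc ev seq_app_ops)
    also have "\<dots> = \<sigma> ^ Suc m * ((b + of_int (N j)) * (\<Prod>i<m. b + of_int (N j) - of_nat (Suc i)))
        * v (j - 2 - 2 * int m)"
      by (simp only: app_y2 Suc N2) (simp add: algebra_simps)
    finally show ?case by (simp only: prod.lessThan_Suc_shift) (simp add: algebra_simps)
  qed (simp add: ev seq_app_ops)
  interpret periodic_rep "2 * p" \<Phi>
  proof
    fix v :: "int \<Rightarrow> 'k" and i assume v: "periodic ?n v"
    have v: "v (j + 2 * int p) = v j" for j using v by (simp add: periodic_def)
    have "v (j + 2 * int p + k) = v (j + k)" for j k using v[of "j + k"] by (simp add: add_ac)
    note v = this[of _ "- 1"] this[of _ "- 2"] this[of _ 2]
    have "(of_int ((j + 2 * int p) div 2) :: 'k) = of_int (j div 2)" for j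
      using of_nat_p[OF p p0] by simp
    thus "periodic ?n (seq_app (\<Phi> (sjp_gen i)) v)"
      using v by (cases i) (auto simp: gen0 periodic_def rep_app)
  qed (use p0 in \<open>simp_all add: hom0 scalar0\<close>)
  have shift: "v (j - 2 * int p) = v j" if "periodic ?n v" for v :: "int \<Rightarrow> 'k" and j
    using periodic_mult[OF that, of j "- 1"] by simp
  have per_y: "periodic ?n (seq_app (\<Phi> a) v)" if "periodic ?n v" for a v
    by (rule periodic_app[OF that])
  have app_sq: "seq_app (\<Phi> (sjp_s ^ q * a)) v j = \<sigma> ^ q * seq_app (\<Phi> a) v (j + 2)"
    if "periodic ?n v" for a v j
  proof -
    have "j - 2 * int q = (j + 2) - 2 * int p" by (simp add: q)
    thus ?thesis by (simp only: ev(3) seq_app_ops(6) app_s_power shift[OF per_y[OF that]])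
  qed
  have \<sigma>p: "\<sigma> ^ q * \<sigma> = \<beta>" using \<sigma> by (simp add: q mult.commute)
  \<comment> \<open>On periodic functions \<open>s^(p-1) y x\<close> is \<open>\<beta>\<close> times
    the projection onto even positions, where \<open>s^(p-1) y^2\<close> is diagonal with entry
    \<open>\<beta> (b + l)\<close> at \<open>2 l\<close>. The further factors of \<open>T q\<close>
    kill the positions with \<open>l\<close> congruent to \<open>1, ..., p - 1\<close>, leaving only
    the origin.\<close>
  define T where "T = rec_nat (sjp_s ^ q * (sjp_y * sjp_x)) (\<lambda>m t.
    (sjp_s ^ q * sjp_y ^ 2 - sjp_scalar (\<beta> * (b + of_nat (Suc m)))) * t)"
  have T: "seq_app (\<Phi> (T m)) v j = (if odd j then 0 else
      \<beta> ^ Suc m * (\<Prod>i<m. of_int (j div 2) - of_nat (Suc i)) * v j)" if "periodic ?n v" for m v j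
  proof (induction m arbitrary: j)
    case 0
    have "seq_app (\<Phi> (T 0)) v j = \<sigma> ^ q * seq_app (\<Phi> (sjp_y * sjp_x)) v (j + 2)"
      by (simp add: T_def app_sq[OF that])
    also have "\<dots> = (if odd j then 0 else (\<sigma> ^ q * \<sigma>) * v j)"
      by (simp add: ev seq_app_ops app_x app_y)
    finally show ?case by (simp add: \<sigma>p)
  next
    case (Suc m)
    have "seq_app (\<Phi> (T (Suc m))) v j = \<sigma> ^ q * seq_app (\<Phi> (sjp_y ^ 2)) (seq_app (\<Phi> (T m)) v) (j +
      2)
        - \<beta> * (b + of_nat (Suc m)) * seq_app (\<Phi> (T m)) v j"
      using app_sq[OF per_y[OF that], of "sjp_y ^ 2" "T m" j]
      by (simp add: T_def ev scalar0 seq_app_ops)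
    also have "\<dots> = (\<sigma> ^ q * \<sigma>) * (b + of_int (N (j + 2))) * seq_app (\<Phi> (T m)) v j
        - \<beta> * (b + of_nat (Suc m)) * seq_app (\<Phi> (T m)) v j"
      by (simp add: app_y2)
    also have "\<dots> = \<beta> * (of_int (N (j + 2)) - of_nat (Suc m)) * seq_app (\<Phi> (T m)) v j"
      by (simp only: \<sigma>p) (simp add: algebra_simps)
    finally have "seq_app (\<Phi> (T (Suc m))) v j
      = \<beta> * (of_int (N (j + 2)) - of_nat (Suc m)) * seq_app (\<Phi> (T m)) v j" .
    note step = this
    show ?case
    proof (cases "odd j")
      case True
      thus ?thesis unfolding step Suc by simp
    next
      case False
      hence "N (j + 2) = j div 2" unfolding N_def by presburger
      thus ?thesis using False unfolding step Suc
        by (simp only: if_False prod.lessThan_Suc power_Suc mult_ac)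
    qed
  qed
  \<comment> \<open>The entry of \<open>T q\<close> at the origin, nonzero because
    \<open>1, ..., p - 1\<close> are nonzero in the field.\<close>
  define K where "K = \<beta> ^ p * (\<Prod>i<q. - of_nat (Suc i) :: 'k)"
  have of_nat_nz: "(of_nat (Suc i) :: 'k) \<noteq> 0" if "i < q" for i
    using that p by (subst of_nat_eq_0_iff_char_dvd) (auto dest: dvd_imp_le simp: q)
  have K: "K \<noteq> 0" using nz of_nat_nz by (auto simp: K_def simp del: of_nat_Suc)
  have rep: "sjp_mat_rep ?n matrix"
  proof (rule matrix_rep)
    fix v :: "int \<Rightarrow> 'k" assume v: "periodic ?n v"
    show "seq_app (\<Phi> (sjp_scalar (1 / K) * T q)) v = (\<lambda>i. v 0 * periodic_unit ?n 0 i)"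
    proof
      fix j
      have *: "seq_app (\<Phi> (sjp_scalar (1 / K) * T q)) v j = 1 / K * (if odd j then 0 else
        \<beta> ^ p * (\<Prod>i<q. of_int (j div 2) - of_nat (Suc i)) * v j)"
        by (simp only: ev(3) scalar0 seq_app_ops T[OF v] q)
      show "seq_app (\<Phi> (sjp_scalar (1 / K) * T q)) v j = v 0 * periodic_unit ?n 0 j"
      proof (cases "j mod int ?n = 0")
        case True
        then obtain k where "j = int ?n * k" by blast
        hence k: "j = 2 * (int p * k)" by simp
        have "even j" "(of_int (j div 2) :: 'k) = of_nat p * of_int k" by (simp_all add: k)
        hence j: "even j" "(of_int (j div 2) :: 'k) = 0" by (simp_all add: of_nat_p[OF p p0])
        have vj: "v j = v 0" using periodic_mod[OF v, of j] True by simp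
        have "seq_app (\<Phi> (sjp_scalar (1 / K) * T q)) v j = 1 / K * (K * v 0)"
          by (simp only: * j vj simp_thms if_False diff_0 flip: K_def)
        thus ?thesis using True K by (simp add: periodic_unit_def)
      next
        case False
        have "odd j \<or> (\<Prod>i<q. of_int (j div 2) - of_nat (Suc i) :: 'k) = 0"
        proof (rule disjCI)
          assume "\<not> (\<Prod>i<q. of_int (j div 2) - of_nat (Suc i) :: 'k) = 0"
          hence prod: "(of_int (j div 2) :: 'k) \<noteq> of_nat (Suc i)" if "i < q" for i
            using that by auto
          show "odd j"
          proof
            assume "even j"
            then obtain l where l: "j = 2 * l" by blast
            define r where "r = nat (l mod int p)"
            have "l mod int p \<noteq> 0" using False l by auto
            moreover have "0 \<le> l mod int p" "l mod int p < int p" using p0 by simp_all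
            ultimately have r: "0 < r" "r < p" "int r = l mod int p" unfolding r_def by auto
            have "(of_nat r :: 'k) = of_int (j div 2)"
              using of_int_mod_p[OF p p0, of l] unfolding r(3)[symmetric] by (simp add: l)
            moreover have "r - 1 < q" using r(1,2) unfolding q by linarith
            ultimately show False using prod[of "r - 1"] r(1) by simp
          qed
        qed
        thus ?thesis using False unfolding * by (auto simp: periodic_unit_def)
      qed
    qed
  next
    fix i assume i: "i < ?n"
    define m where "m = i div 2"
    have unit: "periodic_unit ?n 0 (j - 2 * int m) = (periodic_unit ?n (2 * int m) j :: 'k)" for j
      by (simp only: periodic_unit_def mod_eq_dvd_iff diff_0_right)
    \<comment> \<open>From the origin, powers of \<open>s\<close> reach the even positions and one
      further \<open>x\<close> the odd ones.\<close>
    have even: "seq_app (\<Phi> (sjp_scalar (1 / \<sigma> ^ m) * sjp_s ^ m)) (periodic_unit ?n 0) =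
      periodic_unit ?n (2 * int m)"
      using \<sigma>0 by (intro ext) (simp only: ev(3) scalar0 seq_app_ops app_s_power unit, simp)
    have odd: "seq_app (\<Phi> (sjp_x * (sjp_scalar (1 / \<sigma> ^ m) * sjp_s ^ m))) (periodic_unit ?n 0)
        = periodic_unit ?n (2 * int m + 1)"
    proof
      fix j
      have "seq_app (\<Phi> (sjp_x * (sjp_scalar (1 / \<sigma> ^ m) * sjp_s ^ m))) (periodic_unit ?n 0) j
          = (if odd j then periodic_unit ?n (2 * int m) (j - 1) else 0)"
        using even by (simp only: ev(3)[of sjp_x] seq_app_ops app_x)
      also have "\<dots> = periodic_unit ?n (2 * int m + 1) j"
      proof -
        have "odd j" if "int ?n dvd j - (2 * int m + 1)"
        proof -
          have "2 dvd j - (2 * int m + 1)" using that by (rule dvd_trans[rotated]) simp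
          thus ?thesis by presburger
        qed
        moreover have "j - 1 - 2 * int m = j - (2 * int m + 1)" by simp
        ultimately show ?thesis unfolding periodic_unit_def mod_eq_dvd_iff by (simp only:) auto
      qed
      finally show "seq_app (\<Phi> (sjp_x * (sjp_scalar (1 / \<sigma> ^ m) * sjp_s ^ m))) (periodic_unit ?n 0)
        j
          = periodic_unit ?n (2 * int m + 1) j" .
    qed
    have "i = 2 * m \<or> i = 2 * m + 1" unfolding m_def by presburger
    thus "\<exists>a. seq_app (\<Phi> a) (periodic_unit ?n 0) = periodic_unit ?n (int i)"
      using even odd by (auto simp: algebra_simps)
    have m: "m < p" using i by (simp add: m_def)
    \<comment> \<open>Rows use the period: \<open>s^(p-m)\<close> shifts back by
      \<open>2 p - 2 m\<close>, which amounts to reading entry \<open>2 m\<close> at the origin. An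
      odd entry is read by \<open>s^(p-1-m)\<close> followed by one \<open>y\<close>.\<close>
    have row_even: "seq_app (\<Phi> (sjp_scalar (1 / \<sigma> ^ (p - m)) * sjp_s ^ (p - m))) v 0 =
      v (2 * int m)"
      if v: "periodic ?n v" for v
    proof -
      have "0 - 2 * int (p - m) = 2 * int m - 2 * int p" using m by (simp add: of_nat_diff)
      thus ?thesis using \<sigma>0 by (simp only: ev(3) scalar0 seq_app_ops app_s_power shift[OF v]) simp
    qed
    have row_odd: "seq_app (\<Phi> (sjp_scalar (1 / \<sigma> ^ (p - m)) * (sjp_s ^ (q - m) * sjp_y))) v 0 =
      v (2 * int m + 1)"
      if v: "periodic ?n v" for v
    proof -
      have "0 - 2 * int (q - m) - 1 = (2 * int m + 1) - 2 * int p" using m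
        by (simp add: of_nat_diff q)
      moreover have "\<sigma> ^ (p - m) = \<sigma> ^ (q - m) * \<sigma>"
        using m by (simp add: q Suc_diff_le)
      moreover have "even (0 - 2 * int (q - m))" by simp
      ultimately show ?thesis
        using \<sigma>0 by (simp only: ev(3) scalar0 seq_app_ops app_s_power app_y shift[OF v]
          if_False simp_thms) simp
    qed
    show "\<exists>b. \<forall>v. periodic ?n v \<longrightarrow> seq_app (\<Phi> b) v 0 = v (int i)"
      using \<open>i = 2 * m \<or> i = 2 * m + 1\<close> row_even row_odd
        by (metis of_nat_1 of_nat_add of_nat_mult of_nat_numeral)
  qed
  have "seq_app (\<Phi> (sjp_C - sjp_scalar \<alpha>)) v j = 0" for v j
  proof -
    have "2 * sjp_y * sjp_x = sjp_y * sjp_x + sjp_y * (sjp_x :: 'k sjp)"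
      by (simp add: mult_2 distrib_right)
    hence C: "sjp_C = (sjp_y * sjp_x + sjp_y * sjp_x - sjp_s) * (sjp_ginv :: 'k sjp)"
      by (simp only: sjp_C_def)
    show ?thesis using \<sigma>0 nz
      by (simp add: C ev scalar0 seq_app_ops app_s app_x app_y app_h field_simps)
  qed
  moreover have "seq_app (\<Phi> (sjp_s ^ p - sjp_scalar \<beta>)) v j = 0" if "periodic ?n v" for v j
    by (simp only: ev(6) scalar0 seq_app_ops app_s_power shift[OF that] \<sigma>) simp
  moreover have "seq_app (\<Phi> (sjp_y ^ (2 * p) - sjp_scalar \<gamma>)) v j = 0" if "periodic ?n v" for v j
  proof -
    have "seq_app (\<Phi> ((sjp_y ^ 2) ^ p)) v j = \<gamma> * v j"
      using nz by (simp add: app_y2_power falling_prod_shift[OF p p0] b \<sigma> shift[OF that])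
    thus ?thesis by (simp add: ev(6) scalar0 seq_app_ops power_mult)
  qed
  ultimately show ?thesis
    using that[OF rep] by (simp add: matrix_zero_iff fun_eq_iff)
qed

section \<open>Matrix units and a Weyl pair in \<open>A\<^sub>s\<close>\<close>

text \<open>
  Once \<open>s\<close> is invertible with inverse \<open>t\<close>, the elements \<open>x\<close> and \<open>mu\<close> generate a copy of the
  \<open>2 \<times> 2\<close> matrices, whose centralizer contains the Weyl pair \<open>t\<close>, \<open>z\<close>.
\<close>

locale super_jordan =
  fixes x y s t :: "'a::ring_1"
  assumes xx: "x * x = 0" and xy: "x * y + y * x = s" and sx: "s * x = x * s"
    and ys: "y * s = s * y + x * s" and st: "s * t = 1" and ts: "t * s = 1"
begin

definition "yt = t * y"
definition "q = yt * yt"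
text \<open>The element \<open>yt\<close> satisfies \<open>x yt + yt x = 1\<close>, but its square
  \<open>q\<close> need not vanish. As \<open>q\<close> commutes with \<open>x\<close> and
  \<open>yt\<close>, subtracting \<open>q x\<close> turns the square into
  \<open>q - q (yt x + x yt) = 0\<close> and keeps the first relation.\<close>

definition "mu = yt - q * x"
text \<open>The factor \<open>s\<^sup>2\<close> normalises \<open>t q - q t = t\<^sup>2\<close> to
  \<open>t z - z t = 1\<close>.\<close>

definition "z = s * s * q"

lemma cancel: "x * (x * a) = 0" "s * (t * a) = a" "t * (s * a) = a"
  by (simp_all add: xx st ts flip: mult.assoc)

lemma tx: "t * x = x * t"
  by (rule commute_inverse[OF st ts sx])

lemma tx': "t * (x * a) = x * (t * a)" and sx': "s * (x * a) = x * (s * a)"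
  by (simp_all add: tx sx flip: mult.assoc)

lemma yt_t: "yt * t = t * yt - t * t * x"
proof -
  have "t * (y * s) * t = t * (s * y + x * s) * t" by (simp only: ys)
  hence "t * y = y * t + t * x" by (simp add: mult.assoc distrib_left distrib_right st cancel)
  hence "y * t = t * y - t * x" by simp
  thus ?thesis by (simp add: yt_def mult.assoc right_diff_distrib)
qed

lemma x_yt: "x * yt = 1 - yt * x"
proof -
  have "t * (x * y + y * x) = 1" by (simp add: xy ts)
  thus ?thesis by (simp add: yt_def distrib_left tx' mult.assoc eq_diff_eq)
qed

lemma q_x: "q * x = x * q"
proof -
  have "yt * (yt * x) = yt * (1 - x * yt)" by (simp add: x_yt)
  also have "\<dots> = (1 - yt * x) * yt" by (simp add: right_diff_distrib left_diff_distrib mult.assoc)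
  finally show ?thesis by (simp add: q_def mult.assoc x_yt[symmetric])
qed

lemma q_x': "q * (x * a) = x * (q * a)" by (simp add: q_x flip: mult.assoc)

lemma x_mu: "x * mu = x * yt" and mu_x: "mu * x = yt * x"
  by (simp_all add: mu_def right_diff_distrib left_diff_distrib mult.assoc xx cancel q_x)

lemma unit_sum: "mu * x + x * mu = 1"
  by (simp add: x_mu mu_x x_yt)

lemma mu_mu: "mu * mu = 0"
proof -
  have "mu * mu = q - (yt * q * x + q * x * yt) + q * x * q * x"
    by (simp add: mu_def right_diff_distrib left_diff_distrib q_def mult.assoc)
  also have "yt * q * x = q * (yt * x)" by (simp add: q_def mult.assoc)
  also have "q * (yt * x) + q * x * yt = q"
    by (simp add: x_yt right_diff_distrib mult.assoc)
  also have "q * x * q * x = 0" by (simp add: q_x q_x' mult.assoc cancel)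
  finally show ?thesis by simp
qed

lemma q_t: "q * t = t * q - t * t"
proof -
  have "q * t = yt * (t * yt - t * t * x)" by (simp add: q_def mult.assoc yt_t)
  also have "\<dots> = (yt * t) * yt - (yt * t) * (t * x)" by (simp add: right_diff_distrib mult.assoc)
  also have "\<dots> = (t * yt - t * t * x) * yt - (t * yt - t * t * x) * (t * x)" by (simp only: yt_t)
  also have "\<dots> = t * q - t * t * (x * yt) - t * (yt * t * x)"
  proof -
    have "x * (t * x) = 0" by (simp add: tx'[symmetric] xx)
    thus ?thesis by (simp add: left_diff_distrib q_def mult.assoc)
  qed
  also have "yt * t * x = t * (yt * x)"
    by (simp add: yt_t left_diff_distrib mult.assoc xx)
  finally show ?thesis by (simp add: x_yt right_diff_distrib mult.assoc)
qed

text \<open>The correction term in \<open>mu\<close> also absorbs the summand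
  \<open>t\<^sup>2 x\<close> by which \<open>yt\<close> fails to commute with
  \<open>t\<close>.\<close>

lemma t_mu: "t * mu = mu * t"
proof -
  have "mu * t = yt * t - q * t * x" by (simp add: mu_def left_diff_distrib mult.assoc tx)
  thus ?thesis
    by (simp add: yt_t q_t mu_def left_diff_distrib right_diff_distrib mult.assoc)
qed

lemma s_mu: "s * mu = mu * s"
  by (rule commute_inverse[OF ts st t_mu])

lemma t_z: "t * z = z * t + 1"
  by (simp add: z_def q_t mult.assoc right_diff_distrib cancel st)

lemma q_mu: "q * mu = mu * q"
  by (simp add: mu_def left_diff_distrib right_diff_distrib mult.assoc q_x q_x') (simp add: q_def
    mult.assoc)

lemma z_x: "z * x = x * z" and z_mu: "z * mu = mu * z"
proof -
  show "z * x = x * z" by (simp add: z_def mult.assoc q_x sx')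
  have "s * (mu * a) = mu * (s * a)" for a by (simp add: s_mu flip: mult.assoc)
  thus "z * mu = mu * z" by (simp add: z_def mult.assoc q_mu)
qed

text \<open>This recovers \<open>y\<close> from \<open>s\<close>, the matrix units and the Weyl
  pair; \<open>w_eq\<close> does the same for \<open>y x - x y\<close>, from which \<open>C\<close>
  recovers \<open>g\<close>.\<close>

lemma y_eq: "y = s * mu + t * (z * x)"
  by (simp add: mu_def z_def yt_def right_diff_distrib mult.assoc cancel)

lemma w_eq: "y * x - x * y = s * (mu * x - x * mu)"
  by (simp add: mu_x x_mu yt_def right_diff_distrib mult.assoc cancel sx' tx')

lemma units: "mu * (x * mu) = mu" "x * (mu * x) = x"
proof -
  have *: "x * mu = 1 - mu * x" using unit_sum by (simp add: eq_diff_eq add.commute)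
  have "mu * (x * mu) = mu - mu * mu * x" unfolding * by (simp add: right_diff_distrib mult.assoc)
  thus "mu * (x * mu) = mu" by (simp add: mu_mu)
  have "x * mu * x = x - mu * (x * x)" unfolding * by (simp add: left_diff_distrib mult.assoc)
  thus "x * (mu * x) = x" by (simp add: xx mult.assoc)
qed

text \<open>\<open>y\<^sup>2\<close> is block diagonal for the idempotents \<open>mu x\<close> and
  \<open>x mu\<close>: it is \<open>z\<close> on the first block and the conjugate
  \<open>t z s\<close> of \<open>z\<close> on the second.\<close>

lemma y_y: "y * y = z * (mu * x) + t * z * s * (x * mu)"
proof -
  have mu': "s * (mu * a) = mu * (s * a)" for a by (simp add: s_mu flip: mult.assoc)
  have y: "y = s * mu + s * (q * x)" using y_eq by (simp add: z_def mult.assoc cancel)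
  have "s * mu * (s * mu) = s * s * (mu * mu)" by (simp add: mult.assoc mu')
  hence "s * mu * (s * mu) = 0" by (simp add: mu_mu)
  moreover have "s * (q * x) * (s * (q * x)) = 0"
    by (simp add: mult.assoc q_x q_x' sx' cancel)
  moreover have "s * mu * (s * (q * x)) = z * (mu * x)"
  proof -
    have "s * mu * (s * (q * x)) = s * s * (mu * q) * x" by (simp add: mult.assoc mu')
    thus ?thesis by (simp add: q_mu[symmetric] z_def mult.assoc)
  qed
  moreover have "s * (q * x) * (s * mu) = t * z * s * (x * mu)"
    by (simp add: z_def mult.assoc cancel sx')
  ultimately show ?thesis by (subst (1 2) y) (simp add: distrib_left distrib_right)
qed

lemma t_z_power: "t * z ^ n = z ^ n * t + of_nat n * z ^ (n - 1)"
proof (induction n)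
  case (Suc n)
  have "t * z ^ Suc n = (t * z ^ n) * z" by (simp only: power_Suc2 mult.assoc)
  also have "\<dots> = z ^ n * (t * z) + of_nat n * (z ^ (n - 1) * z)"
    by (simp only: Suc distrib_right mult.assoc)
  also have "of_nat n * (z ^ (n - 1) * z) = of_nat n * z ^ n"
    by (cases n) (simp_all add: power_commutes)
  finally show ?case by (simp add: t_z distrib_left distrib_right power_Suc2 mult.assoc del:
    power_Suc)
qed simp

text \<open>Powers of \<open>y\<^sup>2\<close> keep the block form of \<open>y_y\<close>. When
  \<open>p = 0\<close> in the ring, \<open>z^p\<close> commutes with \<open>t\<close>, and the two
  blocks agree.\<close>

lemma y_power:
  assumes "of_nat p = (0 :: 'a)"
  shows "y ^ (2 * p) = z ^ p"
proof -
  have zc: "z ^ n * x = x * z ^ n" "z ^ n * mu = mu * z ^ n" for n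
    by (rule power_commuting_commutes, rule z_x z_mu)+
  let ?e = "mu * x" and ?f = "x * mu"
  have ef: "?e * ?e = ?e" "?f * ?f = ?f" "?e * ?f = 0" "?f * ?e = 0"
  proof -
    show "?e * ?e = ?e" "?f * ?f = ?f" by (simp_all add: mult.assoc units)
    have "mu * (x * (x * mu)) = 0" by (simp add: cancel)
    thus "?e * ?f = 0" by (simp add: mult.assoc)
    have "x * (mu * mu) * x = 0" by (simp add: mu_mu)
    thus "?f * ?e = 0" by (simp add: mult.assoc)
  qed
  have comm: "?e * z = z * ?e" "?f * z = z * ?f" "?e * t = t * ?e" "?f * t = t * ?f"
    "?e * s = s * ?e" "?f * s = s * ?f"
  proof -
    have prod: "a * b * c = c * (a * b)" if "c * a = a * c" "c * b = b * c" for a b c :: 'a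
      by (metis mult.assoc that)
    show "?e * z = z * ?e" "?f * z = z * ?f" "?e * t = t * ?e" "?f * t = t * ?f"
      "?e * s = s * ?e" "?f * s = s * ?f"
      by (intro prod z_x z_mu tx t_mu sx s_mu)+
  qed
  have "(y * y) ^ n = z ^ n * ?e + t * z ^ n * s * ?f" for n
  proof (induction n)
    case 0
    show ?case using unit_sum by (simp add: ts)
  next
    case (Suc n)
    let ?b = "t * z * s"
    have eb: "?e * ?b = ?b * ?e" "?f * ?b = ?b * ?f"
      by (metis comm mult.assoc)+
    have "(y * y) ^ Suc n = (y * y) ^ n * (y * y)" by (simp only: power_Suc2)
    also have "\<dots> = (z ^ n * ?e + t * z ^ n * s * ?f) * (y * y)" by (simp only: Suc)
    also have "\<dots> = (z ^ n * ?e + t * z ^ n * s * ?f) * (z * ?e + ?b * ?f)" by (simp only: y_y)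
    also have "\<dots> = z ^ n * (?e * z) * ?e + z ^ n * (?e * ?b) * ?f
        + (t * z ^ n * s * (?f * z) * ?e + t * z ^ n * s * (?f * ?b) * ?f)"
      by (simp only: distrib_left distrib_right mult.assoc add_ac)
    also have "\<dots> = z ^ n * z * (?e * ?e) + z ^ n * ?b * (?e * ?f)
        + (t * z ^ n * s * z * (?f * ?e) + t * z ^ n * s * ?b * (?f * ?f))"
      by (simp only: comm eb) (simp only: mult.assoc)
    also have "\<dots> = z ^ Suc n * ?e + t * z ^ n * (s * ?b) * ?f"
      by (simp only: ef power_Suc2) (simp add: mult.assoc)
    also have "s * ?b = z * s" by (simp add: mult.assoc cancel)
    also have "t * z ^ n * (z * s) = t * z ^ Suc n * s" by (simp only: power_Suc2 mult.assoc)
    finally show ?case .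
  qed
  note this[of p]
  moreover have "t * z ^ p = z ^ p * t" by (simp add: t_z_power assms)
  ultimately have "(y * y) ^ p = z ^ p * (?e + ?f)"
    by (simp add: distrib_left mult.assoc cancel)
  thus ?thesis by (simp add: unit_sum power_mult power2_eq_square)
qed

end

section \<open>Expansions in a Weyl pair\<close>

lemma weyl_coeffs:
  fixes u v :: "'a::ring_1"
  assumes J: "ideal J univ_ring" and uv: "u * v = v * u + 1"
  shows "(\<And>i. u * r i = r i * u) \<Longrightarrow> (\<And>i. 0 < i \<Longrightarrow> i < n \<Longrightarrow> \<exists>c. c * of_nat i = (1 :: 'a))
    \<Longrightarrow> (\<Sum>i<n. r i * v ^ i) \<in> J \<Longrightarrow> i < n \<Longrightarrow> r i \<in> J"
proof (induction n arbitrary: r i)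
  case (Suc n)
  note Jdiff = univ_ideal_minus(2)[OF J]
  have J0: "0 \<in> J" and Jadd: "\<And>a b. a \<in> J \<Longrightarrow> b \<in> J \<Longrightarrow> a + b \<in> J"
    and Jl: "\<And>a r. a \<in> J \<Longrightarrow> r * a \<in> J" and Jr: "\<And>a r. a \<in> J \<Longrightarrow> a * r \<in> J"
    using J by (auto simp: ideal_univ_ring_iff)
  have uv_power: "u * v ^ i = v ^ i * u + of_nat i * v ^ (i - 1)" for i
  proof (induction i)
    case (Suc i)
    have "u * v ^ Suc i = (u * v ^ i) * v" by (simp only: power_Suc2 mult.assoc)
    also have "\<dots> = v ^ i * (u * v) + of_nat i * (v ^ (i - 1) * v)"
      by (simp only: Suc distrib_right mult.assoc)
    also have "of_nat i * (v ^ (i - 1) * v) = of_nat i * v ^ i"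
      by (cases i) (simp_all add: power_commutes)
    finally show ?case by (simp add: uv distrib_left distrib_right power_Suc2 mult.assoc del:
      power_Suc)
  qed simp
  let ?f = "\<Sum>i<Suc n. r i * v ^ i"
  \<comment> \<open>Commutation with \<open>u\<close> is formal differentiation with respect to
    \<open>v\<close>. The derivative stays in \<open>J\<close> and has one term less, so by
    induction the multiples \<open>i r_i\<close> lie in \<open>J\<close>. The integers
    \<open>i\<close> are invertible, and what remains of the sum is \<open>r 0\<close>.\<close>
  have "u * (r i * v ^ i) - r i * v ^ i * u = of_nat i * r i * v ^ (i - 1)" for i
  proof -
    have "u * (r i * v ^ i) = r i * (u * v ^ i)" by (simp add: Suc.prems(1) flip: mult.assoc)
    also have "\<dots> = r i * v ^ i * u + r i * of_nat i * v ^ (i - 1)"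
      by (simp add: uv_power distrib_left mult.assoc)
    finally show ?thesis by (simp add: mult_of_nat_commute)
  qed
  hence "u * ?f - ?f * u = (\<Sum>i<Suc n. of_nat i * r i * v ^ (i - 1))"
    by (simp only: sum_distrib_left sum_distrib_right flip: sum_subtractf)
  also have "\<dots> = (\<Sum>i<n. of_nat (Suc i) * r (Suc i) * v ^ i)"
    by (simp only: sum.lessThan_Suc_shift) simp
  finally have "u * ?f - ?f * u = (\<Sum>i<n. of_nat (Suc i) * r (Suc i) * v ^ i)" .
  moreover have "u * ?f - ?f * u \<in> J" by (intro Jdiff Jl Jr Suc.prems(3))
  ultimately have "(\<Sum>i<n. of_nat (Suc i) * r (Suc i) * v ^ i) \<in> J" by simp
  moreover have "u * (of_nat (Suc i) * r (Suc i)) = of_nat (Suc i) * r (Suc i) * u" for i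
    by (metis Suc.prems(1) mult.assoc mult_of_nat_commute)
  ultimately have IH: "of_nat (Suc i) * r (Suc i) \<in> J" if "i < n" for i
    using Suc.IH[of "\<lambda>i. of_nat (Suc i) * r (Suc i)" i] Suc.prems(2) that by simp
  have high: "r (Suc i) \<in> J" if "i < n" for i
  proof -
    obtain c where "c * of_nat (Suc i) = (1 :: 'a)" using Suc.prems(2)[of "Suc i"] \<open>i < n\<close> by auto
    moreover have "c * (of_nat (Suc i) * r (Suc i)) \<in> J" by (rule Jl[OF IH[OF that]])
    ultimately show ?thesis by (simp only: mult_1_left flip: mult.assoc)
  qed
  have Jsum: "sum f K \<in> J" if "\<And>i. i \<in> K \<Longrightarrow> f i \<in> J" for f and K :: "nat set"
    using that by (induction K rule: infinite_finite_induct) (simp_all add: J0 Jadd)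
  have "(\<Sum>i<n. r (Suc i) * v ^ Suc i) \<in> J" by (intro Jsum Jr high) simp
  hence "r 0 \<in> J"
    using Jdiff[OF Suc.prems(3), of "\<Sum>i<n. r (Suc i) * v ^ Suc i"]
    by (simp only: sum.lessThan_Suc_shift) simp
  thus ?case using high Suc.prems(4) by (cases i) auto
qed simp

text \<open>Truncated polynomials in \<open>v\<close> with left coefficients from \<open>R\<close>;
  two nested layers give the expansions in \<open>t^i z^j\<close>. The coefficient family is indexed
  by all natural numbers and has to be padded when only the first \<open>n\<close> values are known
  to lie in \<open>R\<close>.\<close>

definition layer :: "'a::ring_1 set \<Rightarrow> 'a \<Rightarrow> nat \<Rightarrow> 'a set" where
  "layer R v n = {\<Sum>i<n. r i * v ^ i | r. \<forall>i. r i \<in> R}"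

lemma layerI: "(\<And>i. r i \<in> R) \<Longrightarrow> (\<Sum>i<n. r i * v ^ i) \<in> layer R v n"
  by (auto simp: layer_def)

lemma layerE:
  assumes "a \<in> layer R v n"
  obtains r where "\<And>i. r i \<in> R" "a = (\<Sum>i<n. r i * v ^ i)"
  using assms by (auto simp: layer_def)

lemma layer_add:
  assumes "\<And>a b. a \<in> R \<Longrightarrow> b \<in> R \<Longrightarrow> a + b \<in> R" "a \<in> layer R v n" "b \<in> layer R v n"
  shows "a + b \<in> layer R v n"
proof -
  obtain r where "\<And>i. r i \<in> R" "a = (\<Sum>i<n. r i * v ^ i)" using assms(2) by (rule layerE) blast
  moreover obtain r' where "\<And>i. r' i \<in> R" "b = (\<Sum>i<n. r' i * v ^ i)"
    using assms(3) by (rule layerE) blast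
  moreover from calculation have "a + b = (\<Sum>i<n. (r i + r' i) * v ^ i)"
    by (simp add: distrib_right sum.distrib)
  ultimately show ?thesis using assms(1) layerI[of "\<lambda>i. r i + r' i"] by simp
qed

lemma layer_left:
  assumes "\<And>a. a \<in> R \<Longrightarrow> c * a \<in> R'" "a \<in> layer R v n"
  shows "c * a \<in> layer R' v n"
proof -
  from assms(2) obtain r where "\<And>i. r i \<in> R" "a = (\<Sum>i<n. r i * v ^ i)" by (rule layerE) blast
  moreover from this have "c * a = (\<Sum>i<n. (c * r i) * v ^ i)"
    by (simp add: sum_distrib_left mult.assoc)
  ultimately show ?thesis using assms(1) layerI[of "\<lambda>i. c * r i"] by simp
qed

lemma layer_right:
  assumes "\<And>a. a \<in> R \<Longrightarrow> a * c \<in> R'" "v * c = c * v" "a \<in> layer R v n"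
  shows "a * c \<in> layer R' v n"
proof -
  from assms(3) obtain r where r: "\<And>i. r i \<in> R" "a = (\<Sum>i<n. r i * v ^ i)" by (rule layerE) blast
  have "v ^ i * c = c * v ^ i" for i by (rule power_commuting_commutes[OF assms(2)])
  with r(2) have "a * c = (\<Sum>i<n. (r i * c) * v ^ i)"
    by (simp add: sum_distrib_right mult.assoc)
  thus ?thesis using r assms(1) layerI[of "\<lambda>i. r i * c"] by simp
qed

lemma layer_base:
  assumes "0 \<in> R" "a \<in> R" "n > 0"
  shows "a \<in> layer R v n"
proof -
  have "(\<Sum>i<n. (if i = 0 then a else 0) * v ^ i) \<in> layer R v n"
    using assms by (intro layerI) auto
  also have "(\<Sum>i<n. (if i = 0 then a else 0) * v ^ i) = (\<Sum>i<n. if i = 0 then a else 0)"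
    by (intro sum.cong) auto
  finally show ?thesis using assms by simp
qed

text \<open>The term that leaves the range at degree \<open>n\<close> returns as a coefficient of
  degree zero, because \<open>R v^n\<close> lies in \<open>R\<close>.\<close>

lemma layer_shift:
  assumes R: "0 \<in> R" "\<And>a b. a \<in> R \<Longrightarrow> b \<in> R \<Longrightarrow> a + b \<in> R"
    and top: "\<And>a. a \<in> R \<Longrightarrow> a * v ^ n \<in> R" and n: "n > 0" and a: "a \<in> layer R v n"
  shows "a * v \<in> layer R v n"
proof -
  obtain m where m: "n = Suc m" using n by (cases n) auto
  from a obtain r where r: "\<And>i. r i \<in> R" "a = (\<Sum>i<n. r i * v ^ i)" by (rule layerE) blast
  let ?r = "\<lambda>i. case i of 0 \<Rightarrow> r m * v ^ n | Suc j \<Rightarrow> r j"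
  have "a * v = (\<Sum>i<m. r i * v ^ Suc i) + r m * v ^ n"
    by (simp add: r(2) m sum_distrib_right distrib_right mult.assoc power_commutes)
  also have "\<dots> = (\<Sum>i<n. ?r i * v ^ i)"
    by (simp only: m sum.lessThan_Suc_shift) (simp add: add.commute)
  also have "\<dots> \<in> layer R v n" using r(1) top by (intro layerI) (simp split: nat.split)
  finally show ?thesis .
qed

text \<open>Moving \<open>u\<close> to the left past \<open>v^i\<close> adds only a term of lower
  degree, so the truncation is respected.\<close>

lemma layer_weyl:
  assumes R: "0 \<in> R" "\<And>a b. a \<in> R \<Longrightarrow> b \<in> R \<Longrightarrow> a + b \<in> R" "\<And>a. a \<in> R \<Longrightarrow> - a \<in> R"
    and uv: "u * v = v * u + 1" and Ru: "\<And>a. a \<in> R \<Longrightarrow> a * u \<in> R" and a: "a \<in> layer R v n"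
  shows "a * u \<in> layer R v n"
proof -
  have uv_power: "v ^ i * u = u * v ^ i - of_nat i * v ^ (i - 1)" for i
  proof (induction i)
    case (Suc i)
    have "u * v ^ Suc i = (u * v ^ i) * v" by (simp only: power_Suc2 mult.assoc)
    also have "u * v ^ i = v ^ i * u + of_nat i * v ^ (i - 1)" using Suc by simp
    also have "\<dots> * v = v ^ i * (u * v) + of_nat i * (v ^ (i - 1) * v)"
      by (simp only: distrib_right mult.assoc)
    also have "of_nat i * (v ^ (i - 1) * v) = of_nat i * v ^ i"
      by (cases i) (simp_all add: power_commutes)
    finally show ?case by (simp add: uv distrib_left distrib_right power_Suc2 mult.assoc del:
      power_Suc)
  qed simp
  have Rof_nat: "of_nat k * b \<in> R" if "b \<in> R" for k b
    using that R by (induction k) (simp_all add: distrib_right)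
  from a obtain r where r: "\<And>i. r i \<in> R" "a = (\<Sum>i<n. r i * v ^ i)" by (rule layerE) blast
  \<comment> \<open>\<open>?d i\<close> is the coefficient of \<open>v^i\<close> in the negated
    derivative; nothing arrives at the top degree.\<close>
  let ?d = "\<lambda>i. if Suc i < n then - (of_nat (Suc i) * r (Suc i)) else 0"
  have "a * u = (\<Sum>i<n. (r i * u) * v ^ i + - (of_nat i * r i * v ^ (i - 1)))"
  proof -
    have "r i * v ^ i * u = (r i * u) * v ^ i + - (of_nat i * r i * v ^ (i - 1))" for i
      by (simp add: mult.assoc uv_power right_diff_distrib) (metis mult.assoc mult_of_nat_commute)
    thus ?thesis by (simp add: r(2) sum_distrib_right)
  qed
  also have "\<dots> = (\<Sum>i<n. (r i * u) * v ^ i) + (\<Sum>i<n. - (of_nat i * r i * v ^ (i - 1)))"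
    by (rule sum.distrib)
  also have "(\<Sum>i<n. - (of_nat i * r i * v ^ (i - 1))) = (\<Sum>i<n. ?d i * v ^ i)"
  proof (cases n)
    case (Suc m)
    have "(\<Sum>i<n. - (of_nat i * r i * v ^ (i - 1))) = (\<Sum>i<m. - (of_nat (Suc i) * r (Suc i)) * v ^ i)"
      by (simp only: Suc sum.lessThan_Suc_shift) simp
    thus ?thesis by (simp add: Suc)
  qed simp
  also have "(\<Sum>i<n. (r i * u) * v ^ i) + (\<Sum>i<n. ?d i * v ^ i) = (\<Sum>i<n. (r i * u + ?d i) * v ^ i)"
    by (simp only: distrib_right sum.distrib)
  also have "\<dots> \<in> layer R v n" using r(1) R Ru Rof_nat
    by (intro layerI R(2)) (simp_all del: of_nat_Suc)
  finally show ?thesis .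
qed

section \<open>Ideals of \<open>A\<^sub>s\<close>\<close>

lemma unital_hom_sjp_loc_of: "unital_hom sjp_loc_of"
  using sjp_loc_localization(1-3) by (auto simp: unital_hom_def)

lemmas loc_hom = unital_homD[OF unital_hom_sjp_loc_of]

lemma loc_of_nat: "sjp_loc_of (of_nat n) = of_nat n"
  by (induction n) (simp_all add: loc_hom)

lemma sjp_loc_of_central:
  fixes c :: "'k::field sjp"
  assumes "\<And>a. c * a = a * c"
  shows "sjp_loc_of c * u = u * sjp_loc_of c"
proof -
  have ca: "sjp_loc_of c * sjp_loc_of a = sjp_loc_of a * sjp_loc_of c" for a
    using assms[of a] by (metis loc_hom(3))
  have "sjp_s_inverse * sjp_loc_of c = sjp_loc_of c * sjp_s_inverse"
    by (rule commute_inverse[OF sjp_loc_localization(4,5) ca[symmetric]])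
  hence t: "sjp_s_inverse ^ n * sjp_loc_of c = sjp_loc_of c * sjp_s_inverse ^ n" for n
    by (rule power_commuting_commutes)
  obtain a n where "u = sjp_loc_of a * sjp_s_inverse ^ n" using sjp_loc_localization(6) by blast
  thus ?thesis by (simp add: t mult.assoc) (simp add: ca flip: mult.assoc)
qed

lemma sjp_loc_power_inverse:
  "sjp_loc_of sjp_s ^ n * sjp_s_inverse ^ n = (1 :: 'k::field sjp_loc)"
  "sjp_s_inverse ^ n * sjp_loc_of sjp_s ^ n = (1 :: 'k sjp_loc)"
proof -
  have "a ^ n * b ^ n = 1" if "a * b = 1" for a b :: "'k sjp_loc"
  proof (induction n)
    case (Suc n)
    have "a ^ Suc n * b ^ Suc n = a ^ n * (a * b) * b ^ n"
      by (simp only: power_Suc2[of a] power_Suc[of b] mult.assoc)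
    thus ?case using Suc that by simp
  qed simp
  thus "sjp_loc_of sjp_s ^ n * sjp_s_inverse ^ n = (1 :: 'k sjp_loc)"
    "sjp_s_inverse ^ n * sjp_loc_of sjp_s ^ n = (1 :: 'k sjp_loc)"
    by (simp_all add: sjp_loc_localization(4,5))
qed

interpretation L: super_jordan "sjp_loc_of sjp_x" "sjp_loc_of sjp_y" "sjp_loc_of sjp_s"
  sjp_s_inverse
  by standard
    (simp_all add: sjp_loc_localization(4,5) sjp_relations(1) sjp_s_x sjp_y_s flip: loc_hom(2,3)
      add: loc_hom(4) sjp_s_def[symmetric])

abbreviation loc_x :: "'k::field sjp_loc" where "loc_x \<equiv> sjp_loc_of sjp_x"
abbreviation loc_s :: "'k::field sjp_loc" where "loc_s \<equiv> sjp_loc_of sjp_s"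
abbreviation loc_t :: "'k::field sjp_loc" where "loc_t \<equiv> sjp_s_inverse"
abbreviation loc_u :: "'k::field sjp_loc" where "loc_u \<equiv> L.mu"
abbreviation loc_z :: "'k::field sjp_loc" where "loc_z \<equiv> L.z"

text \<open>With \<open>mu x\<close>, \<open>mu\<close>, \<open>x\<close> and \<open>x mu\<close> as
  matrix units, this is the set of \<open>2 \<times> 2\<close> matrices with entries in
  \<open>q\<close>.\<close>

definition unit_span :: "'k::field sjp_loc set \<Rightarrow> 'k sjp_loc set" where
  "unit_span q = {a * (loc_u * loc_x) + b * loc_u + c * loc_x + d * (loc_x * loc_u) | a b c d.
     a \<in> q \<and> b \<in> q \<and> c \<in> q \<and> d \<in> q}"

text \<open>An explicit form of the extension \<open>q A\<^sub>s\<close>, confirmed by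
  \<open>ideal_prod_loc_span\<close>.\<close>

definition loc_span :: "'k::field sjp_loc set \<Rightarrow> 'k sjp_loc set" where
  "loc_span q = layer (layer (unit_span q) loc_t CHAR('k)) loc_z CHAR('k)"

abbreviation loc_center :: "'k::field sjp_loc set" where
  "loc_center \<equiv> carrier sjp_central_subalgebra"

definition loc_Cinv :: "'k::field sjp_loc" where
  "loc_Cinv = inv\<^bsub>univ_ring\<^esub> (sjp_loc_of sjp_C)"

lemma loc_Cinv: "sjp_loc_of sjp_C * loc_Cinv = (1 :: 'k::field sjp_loc)" "loc_Cinv * sjp_loc_of
  sjp_C = (1 :: 'k sjp_loc)"
  using monoid.Units_r_inv[OF ring.is_monoid[OF ring_univ_ring] sjp_C_Units]
    monoid.Units_l_inv[OF ring.is_monoid[OF ring_univ_ring] sjp_C_Units]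
  by (simp_all add: loc_Cinv_def)

lemma unit_products:
  fixes a :: "'k::field sjp_loc"
  shows "loc_x * (loc_x * a) = 0" "loc_u * (loc_u * a) = 0"
    "loc_u * (loc_x * (loc_u * a)) = loc_u * a" "loc_x * (loc_u * (loc_x * a)) = loc_x * a"
proof -
  have u: "loc_u * loc_x * loc_u = (loc_u :: 'k sjp_loc)"
    and x: "loc_x * loc_u * loc_x = (loc_x :: 'k sjp_loc)"
    by (simp_all add: mult.assoc L.units)
  show "loc_x * (loc_x * a) = 0" by (rule L.cancel)
  show "loc_u * (loc_u * a) = 0" by (simp add: L.mu_mu flip: mult.assoc)
  show "loc_u * (loc_x * (loc_u * a)) = loc_u * a" "loc_x * (loc_u * (loc_x * a)) = loc_x * a"
    by (simp_all only: u x mult.assoc[symmetric])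
qed

lemma univ_ring_minus: "\<ominus>\<^bsub>univ_ring\<^esub> a = - (a :: 'a::ring_1)"
  by (rule abelian_group.minus_equality[OF ring.is_abelian_group[OF ring_univ_ring]]) auto

section \<open>Extension of central ideals to the localization\<close>

context
  fixes p :: nat
  assumes p: "CHAR('k::field) = p" and p0: "p > 0"
begin

abbreviation Z :: "'k sjp_loc set" where "Z \<equiv> loc_center"

lemma loc_center_def: "Z = generate_ring univ_ring
   (range (\<lambda>c. sjp_loc_of (sjp_scalar c)) \<union>
     {sjp_loc_of sjp_C, loc_Cinv, loc_s ^ p, loc_t ^ p, sjp_loc_of sjp_y ^ (2 * p)})"
  by (simp add: sjp_central_subalgebra_def p loc_Cinv_def)

lemma loc_center_closed:
  shows "1 \<in> Z" "0 \<in> Z" "a \<in> Z \<Longrightarrow> - a \<in> Z" "a \<in> Z \<Longrightarrow> b \<in> Z \<Longrightarrow> a + b \<in> Z"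
    "a \<in> Z \<Longrightarrow> b \<in> Z \<Longrightarrow> a * b \<in> Z"
    "sjp_loc_of (sjp_scalar c) \<in> Z" "sjp_loc_of sjp_C \<in> Z" "loc_Cinv \<in> Z"
    "loc_s ^ p \<in> Z" "loc_t ^ p \<in> Z" "sjp_loc_of sjp_y ^ (2 * p) \<in> Z"
proof -
  note rules = generate_ring.intros[where R = "univ_ring :: 'k sjp_loc ring"]
  show "1 \<in> Z" using rules(1) by (simp add: loc_center_def)
  show "a \<in> Z \<Longrightarrow> - a \<in> Z" for a
    using rules(3) unfolding loc_center_def univ_ring_minus .
  show add: "a \<in> Z \<Longrightarrow> b \<in> Z \<Longrightarrow> a + b \<in> Z" for a b
    using rules(4) unfolding loc_center_def by simp
  show "a \<in> Z \<Longrightarrow> b \<in> Z \<Longrightarrow> a * b \<in> Z"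
    using rules(5) unfolding loc_center_def by simp
  show sc: "sjp_loc_of (sjp_scalar c) \<in> Z" for c
    unfolding loc_center_def by (rule rules(2)) simp
  show "0 \<in> Z" using sc[of 0] by (simp add: sjp_scalar_hom loc_hom)
  show "sjp_loc_of sjp_C \<in> Z" "loc_Cinv \<in> Z"
    "loc_s ^ p \<in> Z" "loc_t ^ p \<in> Z" "sjp_loc_of sjp_y ^ (2 * p) \<in> Z"
    unfolding loc_center_def by (rule rules(2), simp)+
qed

lemma loc_center_central:
  assumes "\<zeta> \<in> Z"
  shows "\<zeta> * u = u * (\<zeta> :: 'k sjp_loc)"
proof -
  have c: "\<zeta> * u = u * \<zeta>" if \<zeta>: "\<zeta> \<in> range (\<lambda>c. sjp_loc_of (sjp_scalar c)) \<union>
     {sjp_loc_of sjp_C, loc_Cinv, loc_s ^ p, loc_t ^ p, sjp_loc_of sjp_y ^ (2 * p)}" for \<zeta> u :: "'k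
       sjp_loc"
  proof -
    have C: "sjp_loc_of sjp_C * u = u * sjp_loc_of sjp_C" for u :: "'k sjp_loc"
      by (rule sjp_loc_of_central[OF sjp_central_C])
    have s: "loc_s ^ p * u = u * loc_s ^ p" for u :: "'k sjp_loc"
      using sjp_loc_of_central[OF sjp_central_s[OF p p0]] by (simp add: loc_hom)
    have "loc_Cinv * u = u * loc_Cinv" by (rule commute_inverse[OF loc_Cinv C])
    moreover have "loc_t ^ p * u = u * loc_t ^ p"
      by (rule commute_inverse[OF sjp_loc_power_inverse s])
    moreover have "sjp_loc_of sjp_y ^ (2 * p) * u = u * sjp_loc_of sjp_y ^ (2 * p)"
      using sjp_loc_of_central[OF sjp_central_y[OF p p0], of u] by (simp add: loc_hom)
    moreover have "sjp_loc_of (sjp_scalar c) * u = u * sjp_loc_of (sjp_scalar c)" for c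
      by (rule sjp_loc_of_central[OF sjp_scalar_commute])
    ultimately show ?thesis using \<zeta> C s by auto
  qed
  from assms show ?thesis
    unfolding loc_center_def
  proof (induction \<zeta> arbitrary: u rule: generate_ring.induct)
    case (incl h)
    thus ?case by (rule c)
  next
    case (a_inv h)
    thus ?case by (simp add: univ_ring_minus)
  next
    case (eng_mult h1 h2)
    have "h1 * h2 * u = h1 * (u * h2)" by (simp only: mult.assoc eng_mult.IH(2))
    also have "\<dots> = (h1 * u) * h2" by (simp only: mult.assoc)
    also have "h1 * u = u * h1" by (rule eng_mult.IH(1))
    finally show ?case by (simp add: mult.assoc)
  qed (simp_all add: distrib_left distrib_right)
qed

context
  fixes q :: "'k sjp_loc set"
  assumes q0: "0 \<in> q" and qadd: "\<And>a b. a \<in> q \<Longrightarrow> b \<in> q \<Longrightarrow> a + b \<in> q"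
    and qmult: "\<And>\<zeta> a. \<zeta> \<in> Z \<Longrightarrow> a \<in> q \<Longrightarrow> \<zeta> * a \<in> q"
    and qZ: "q \<subseteq> Z"
begin

lemma unit_spanI:
  "\<lbrakk>a \<in> q; b \<in> q; c \<in> q; d \<in> q\<rbrakk> \<Longrightarrow>
    a * (loc_u * loc_x) + b * loc_u + c * loc_x + d * (loc_x * loc_u) \<in> unit_span q"
  unfolding unit_span_def by blast

lemma unit_span_zero: "0 \<in> unit_span q"
  using unit_spanI[OF q0 q0 q0 q0] by simp

lemma unit_span_add:
  assumes "r \<in> unit_span q" "r' \<in> unit_span q"
  shows "r + r' \<in> unit_span q"
proof -
  obtain a b c d where r: "r = a * (loc_u * loc_x) + b * loc_u + c * loc_x + d * (loc_x * loc_u)"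
    "a \<in> q" "b \<in> q" "c \<in> q" "d \<in> q" using assms(1) unfolding unit_span_def by blast
  obtain a' b' c' d' where r': "r' = a' * (loc_u * loc_x) + b' * loc_u + c' * loc_x +
    d' * (loc_x * loc_u)"
    "a' \<in> q" "b' \<in> q" "c' \<in> q" "d' \<in> q" using assms(2) unfolding unit_span_def by blast
  have "r + r' = (a + a') * (loc_u * loc_x) + (b + b') * loc_u + (c + c') * loc_x + (d +
    d') * (loc_x * loc_u)"
    by (simp only: r(1) r'(1) distrib_right add_ac)
  thus ?thesis using r r' by (simp only:) (intro unit_spanI qadd)
qed

lemma unit_span_center:
  assumes "\<zeta> \<in> Z" "r \<in> unit_span q"
  shows "\<zeta> * r \<in> unit_span q" "r * \<zeta> \<in> unit_span q"
proof -
  obtain a b c d where r: "r = a * (loc_u * loc_x) + b * loc_u + c * loc_x + d * (loc_x * loc_u)"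
    "a \<in> q" "b \<in> q" "c \<in> q" "d \<in> q" using assms(2) unfolding unit_span_def by blast
  have "\<zeta> * r = (\<zeta> * a) * (loc_u * loc_x) + (\<zeta> * b) * loc_u + (\<zeta> * c) * loc_x +
    (\<zeta> * d) * (loc_x * loc_u)"
    by (simp only: r(1) distrib_left mult.assoc)
  thus "\<zeta> * r \<in> unit_span q" using r assms by (simp only:) (intro unit_spanI qmult)
  thus "r * \<zeta> \<in> unit_span q" using loc_center_central[OF assms(1), of r] by simp
qed

lemma unit_span_x: "r * loc_x \<in> unit_span q" and unit_span_u: "r * loc_u \<in> unit_span q"
  if r: "r \<in> unit_span q"
proof -
  obtain a b c d where r: "r = a * (loc_u * loc_x) + b * loc_u + c * loc_x + d * (loc_x * loc_u)"
    "a \<in> q" "b \<in> q" "c \<in> q" "d \<in> q" using r unfolding unit_span_def by blast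
  have "r * loc_x = b * (loc_u * loc_x) + 0 * loc_u + d * loc_x + 0 * (loc_x * loc_u)"
    by (simp add: r(1) distrib_right mult.assoc L.xx unit_products L.units)
  thus "r * loc_x \<in> unit_span q" using r q0 by (simp only:) (intro unit_spanI)
  have "r * loc_u = 0 * (loc_u * loc_x) + a * loc_u + 0 * loc_x + c * (loc_x * loc_u)"
    by (simp add: r(1) distrib_right mult.assoc L.mu_mu unit_products L.units)
  thus "r * loc_u \<in> unit_span q" using r q0 by (simp only:) (intro unit_spanI)
qed

lemma unit_span_commute:
  assumes r: "r \<in> unit_span q"
  shows "loc_t * r = r * loc_t" "loc_z * r = r * loc_z"
proof -
  obtain a b c d where r: "r = a * (loc_u * loc_x) + b * loc_u + c * loc_x + d * (loc_x * loc_u)"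
    "a \<in> q" "b \<in> q" "c \<in> q" "d \<in> q" using r unfolding unit_span_def by blast
  have "v * r = r * v" if v: "v * loc_u = loc_u * v" "v * loc_x = loc_x * v" for v
  proof -
    have pull: "v * (\<zeta> * w) = \<zeta> * (v * w)" if "\<zeta> \<in> q" for \<zeta> w
      using loc_center_central[of \<zeta> v] qZ that by (metis mult.assoc subsetD)
    have "v * (loc_u * w) = loc_u * (v * w)" "v * (loc_x * w) = loc_x * (v * w)" for w
      by (simp_all add: v flip: mult.assoc)
    thus ?thesis
      by (simp add: r(1) distrib_left distrib_right pull[OF r(2)] pull[OF r(3)] pull[OF r(4)]
        pull[OF r(5)]
          mult.assoc v)
  qed
  thus "loc_t * r = r * loc_t" "loc_z * r = r * loc_z"
    by (simp_all add: L.t_mu L.tx L.z_mu L.z_x)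
qed

abbreviation "t_span \<equiv> layer (unit_span q) loc_t p"

lemma t_span_zero: "0 \<in> t_span"
  by (rule layer_base[OF unit_span_zero unit_span_zero p0])

lemma t_span_add: "a \<in> t_span \<Longrightarrow> b \<in> t_span \<Longrightarrow> a + b \<in> t_span"
  by (rule layer_add[OF unit_span_add])

lemma t_span_center: "\<zeta> \<in> Z \<Longrightarrow> a \<in> t_span \<Longrightarrow> \<zeta> * a \<in> t_span"
  by (rule layer_left[OF unit_span_center(1)])

lemma t_span_commute: "loc_t * r = r * loc_t" if r: "r \<in> t_span"
proof -
  obtain c where c: "\<And>i. c i \<in> unit_span q" "r = (\<Sum>i<p. c i * loc_t ^ i)"
    using r by (rule layerE) blast
  have "loc_t * (c i * loc_t ^ i) = c i * loc_t ^ i * loc_t" for i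
    using unit_span_commute(1)[OF c(1), of i] by (metis mult.assoc power_commutes)
  thus ?thesis by (simp add: c(2) sum_distrib_left sum_distrib_right)
qed

lemma loc_span_add: "a \<in> loc_span q \<Longrightarrow> b \<in> loc_span q \<Longrightarrow> a + b \<in> loc_span q"
  unfolding loc_span_def p by (rule layer_add[OF t_span_add])

lemma loc_span_zero: "0 \<in> loc_span q"
  unfolding loc_span_def p by (rule layer_base[OF t_span_zero t_span_zero p0])

text \<open>The right stabiliser \<open>T\<close> of the span is a subring. It contains
  \<open>Z\<close>, the matrix units and the Weyl pair, and from these all generators of
  \<open>A\<close> and the inverse of \<open>s\<close> are recovered.\<close>

lemma loc_span_right: "a * u \<in> loc_span q" if a: "a \<in> loc_span q"
proof -
  define T where "T = {u. \<forall>a\<in>loc_span q. a * u \<in> loc_span q}"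
  have Tadd: "u + v \<in> T" if "u \<in> T" "v \<in> T" for u v
    using that by (simp add: T_def distrib_left loc_span_add)
  have Tmult: "u * v \<in> T" if "u \<in> T" "v \<in> T" for u v
    using that by (simp add: T_def flip: mult.assoc)
  have TZ: "\<zeta> \<in> T" if "\<zeta> \<in> Z" for \<zeta>
  proof -
    have "a * \<zeta> \<in> loc_span q" if "a \<in> loc_span q" for a
    proof -
      have "\<zeta> * a \<in> loc_span q" using that unfolding loc_span_def p
        by (rule layer_left[rotated]) (rule t_span_center[OF \<open>\<zeta> \<in> Z\<close>])
      thus ?thesis using loc_center_central[OF \<open>\<zeta> \<in> Z\<close>, of a] by simp
    qed
    thus ?thesis by (simp add: T_def)
  qed
  have Tneg: "- u \<in> T" if "u \<in> T" for u
    using Tmult[OF TZ[OF loc_center_closed(3)[OF loc_center_closed(1)]] that] by simp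
  have Tpow: "u ^ n \<in> T" if "u \<in> T" for u n
    using that TZ[OF loc_center_closed(1)] by (induction n) (auto intro: Tmult)
  have Tx: "loc_x \<in> T"
  proof -
    have "a * loc_x \<in> t_span" if "a \<in> t_span" for a
      by (rule layer_right[OF unit_span_x L.tx that])
    hence "a * loc_x \<in> loc_span q" if "a \<in> loc_span q" for a
      using that unfolding loc_span_def p by (rule layer_right[OF _ L.z_x])
    thus ?thesis by (simp add: T_def)
  qed
  have Tu: "loc_u \<in> T"
  proof -
    have "a * loc_u \<in> t_span" if "a \<in> t_span" for a
      by (rule layer_right[OF unit_span_u L.t_mu that])
    hence "a * loc_u \<in> loc_span q" if "a \<in> loc_span q" for a
      using that unfolding loc_span_def p by (rule layer_right[OF _ L.z_mu])
    thus ?thesis by (simp add: T_def)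
  qed
  have Tz: "loc_z \<in> T"
  proof -
    \<comment> \<open>Degree \<open>p\<close> in \<open>z\<close> folds back because
      \<open>z^p = y^(2p)\<close> lies in \<open>Z\<close>.\<close>
    have "L.z ^ p = sjp_loc_of (sjp_y :: 'k sjp) ^ (2 * p)"
      by (rule L.y_power[symmetric])
        (metis loc_hom(4) loc_of_nat sjp_of_nat_p[OF p p0])
    hence zp: "loc_z ^ p \<in> Z" by (simp add: loc_center_closed)
    have "a * loc_z \<in> loc_span q" if "a \<in> loc_span q" for a
      using that unfolding loc_span_def p
      by (intro layer_shift t_span_zero t_span_add p0)
        (simp_all add: t_span_center[OF zp] flip: loc_center_central[OF zp])
    thus ?thesis by (simp add: T_def)
  qed
  have Tt: "loc_t \<in> T"
  proof -
    have minus: "- a \<in> t_span" if "a \<in> t_span" for a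
      using t_span_center[OF loc_center_closed(3)[OF loc_center_closed(1)] that] by simp
    have "a * loc_t \<in> t_span" if "a \<in> t_span" for a
      using that loc_center_closed(10)
      by (intro layer_shift unit_span_zero unit_span_add p0) (simp_all add: unit_span_center)
    hence "a * loc_t \<in> loc_span q" if "a \<in> loc_span q" for a
      using that unfolding loc_span_def p
      by (intro layer_weyl[OF t_span_zero t_span_add minus L.t_z])
    thus ?thesis by (simp add: T_def)
  qed
  have Ts: "loc_s \<in> T"
  proof -
    \<comment> \<open>\<open>s = t^(p-1) s^p\<close>, and \<open>s^p\<close> lies in
      \<open>Z\<close>.\<close>
    obtain m where m: "p = Suc m" using p0 by (cases p) auto
    have "loc_t ^ m * loc_s ^ p = (loc_s :: 'k sjp_loc)"
      by (simp add: m power_Suc2 sjp_loc_power_inverse flip: mult.assoc del: power_Suc)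
    thus ?thesis using Tmult[OF Tpow[OF Tt] TZ[OF loc_center_closed(9)], of m] by simp
  qed
  have Ty: "sjp_loc_of sjp_y \<in> T"
  proof -
    have "loc_s * loc_u + loc_t * (loc_z * loc_x) \<in> T" by (intro Tadd Tmult Ts Tu Tt Tz Tx)
    thus ?thesis by (simp only: L.y_eq[symmetric])
  qed
  define w where "w = (2 * sjp_y * sjp_x - sjp_s :: 'k sjp)"
  have "w = sjp_y * sjp_x - sjp_x * sjp_y" by (simp add: w_def sjp_s_def mult_2 distrib_right)
  hence w: "sjp_loc_of w = loc_s * (loc_u * loc_x + - (loc_x * loc_u))"
    using L.w_eq[where ?'a = 'k] by (simp add: loc_hom)
  have Tw: "sjp_loc_of w \<in> T" unfolding w by (intro Tadd Tmult Tneg Ts Tu Tx)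
  have C: "sjp_C = w * sjp_ginv" by (simp add: sjp_C_def w_def)
  \<comment> \<open>From \<open>C = w g\<inverse>\<close> and \<open>w\<^sup>2 = s\<^sup>2\<close>
    come \<open>g = C\<inverse> w\<close> and, in the next step,
    \<open>g\<inverse> = t\<^sup>2 w C\<close>.\<close>
  have Tg: "sjp_loc_of sjp_g \<in> T"
  proof -
    have "sjp_loc_of sjp_C * sjp_loc_of sjp_g = sjp_loc_of w"
      by (simp add: C mult.assoc sjp_relations(4) flip: loc_hom(3))
    hence "loc_Cinv * sjp_loc_of w = loc_Cinv * sjp_loc_of sjp_C * sjp_loc_of sjp_g"
      by (simp add: mult.assoc)
    hence "sjp_loc_of sjp_g = loc_Cinv * sjp_loc_of w" by (simp add: loc_Cinv)
    thus ?thesis using Tmult[OF TZ[OF loc_center_closed(8)] Tw] by simp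
  qed
  have Th: "sjp_loc_of sjp_ginv \<in> T"
  proof -
    have "w * sjp_C = sjp_s * sjp_s * sjp_ginv"
      using sjp_w_facts(4)[where ?'k = 'k] by (simp add: C w_def flip: mult.assoc)
    hence "loc_t * loc_t * (sjp_loc_of w * sjp_loc_of sjp_C)
        = loc_t * (loc_t * (loc_s * (loc_s * sjp_loc_of sjp_ginv)))"
      by (simp add: mult.assoc flip: loc_hom(3))
    hence "loc_t * loc_t * (sjp_loc_of w * sjp_loc_of sjp_C) = sjp_loc_of sjp_ginv"
      by (simp add: L.cancel)
    moreover have "loc_t * loc_t * (sjp_loc_of w * sjp_loc_of sjp_C) \<in> T"
      by (intro Tmult Tt Tw TZ loc_center_closed)
    ultimately show ?thesis by simp
  qed
  have "sjp_loc_of b \<in> T" for b :: "'k sjp"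
  proof (induction b rule: sjp_induct)
    case (scalar c)
    show ?case by (intro TZ loc_center_closed)
  next
    case (gen i)
    show ?case using Tx Ty Tg Th by (cases i) auto
  qed (simp_all add: loc_hom Tadd Tmult)
  moreover obtain b n where "u = sjp_loc_of b * sjp_s_inverse ^ n" using sjp_loc_localization(6)
    by blast
  ultimately have "u \<in> T" using Tmult Tpow[OF Tt] by simp
  thus ?thesis using a by (simp add: T_def)
qed

lemma loc_span_unit:
  assumes "c \<in> q"
  shows "c \<in> loc_span q"
proof -
  have "c * (loc_u * loc_x) + 0 * loc_u + 0 * loc_x + c * (loc_x * loc_u) \<in> unit_span q"
    by (intro unit_spanI assms q0)
  moreover have "c * (loc_u * loc_x) + c * (loc_x * loc_u) = c"
    using L.unit_sum[where ?'a = 'k] by (metis distrib_left mult.right_neutral)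
  ultimately have "c \<in> unit_span q" by simp
  hence "c \<in> t_span" by (rule layer_base[OF unit_span_zero _ p0])
  thus ?thesis unfolding loc_span_def p by (rule layer_base[OF t_span_zero _ p0])
qed

text \<open>The span contains \<open>q\<close> and absorbs multiplication from the right;
  conversely, each of its terms has a left factor in \<open>q\<close>.\<close>

lemma ideal_prod_loc_span: "q \<cdot>\<^bsub>univ_ring\<^esub> UNIV = loc_span q"
proof
  show "q \<cdot>\<^bsub>univ_ring\<^esub> UNIV \<subseteq> loc_span q"
  proof
    fix a assume "a \<in> q \<cdot>\<^bsub>univ_ring\<^esub> UNIV"
    thus "a \<in> loc_span q"
      by induction (simp_all add: loc_span_right loc_span_unit loc_span_add)
  qed
  have prod: "c * u \<in> q \<cdot>\<^bsub>univ_ring\<^esub> UNIV" if "c \<in> q" for c u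
    using ideal_prod.prod[OF that, of u UNIV univ_ring] by simp
  have add: "a + b \<in> q \<cdot>\<^bsub>univ_ring\<^esub> UNIV"
    if "a \<in> q \<cdot>\<^bsub>univ_ring\<^esub> UNIV" "b \<in> q \<cdot>\<^bsub>univ_ring\<^esub> UNIV" for a b
    using ideal_prod.sum[OF that] by simp
  have zero: "0 \<in> q \<cdot>\<^bsub>univ_ring\<^esub> UNIV" using prod[OF q0, of 0] by simp
  have right: "a * u \<in> q \<cdot>\<^bsub>univ_ring\<^esub> UNIV" if "a \<in> q \<cdot>\<^bsub>univ_ring\<^esub> UNIV" for a u
    using that by induction (simp_all add: mult.assoc prod distrib_right add)
  have sum: "sum f K \<in> q \<cdot>\<^bsub>univ_ring\<^esub> UNIV" if "\<And>i. f i \<in> q \<cdot>\<^bsub>univ_ring\<^esub> UNIV" for f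
    and K :: "nat set"
    using that by (induction K rule: infinite_finite_induct) (simp_all add: zero add)
  have layer: "layer R v n \<subseteq> q \<cdot>\<^bsub>univ_ring\<^esub> UNIV" if R: "R \<subseteq> q \<cdot>\<^bsub>univ_ring\<^esub> UNIV" for R v n
  proof
    fix a assume "a \<in> layer R v n"
    then obtain r where "\<And>i. r i \<in> R" "a = (\<Sum>i<n. r i * v ^ i)" by (rule layerE) blast
    thus "a \<in> q \<cdot>\<^bsub>univ_ring\<^esub> UNIV" using R by (simp only:) (intro sum right, blast)
  qed
  have "unit_span q \<subseteq> q \<cdot>\<^bsub>univ_ring\<^esub> UNIV"
  proof
    fix r assume "r \<in> unit_span q"
    then obtain a b c d where "r = a * (loc_u * loc_x) + b * loc_u + c * loc_x +
      d * (loc_x * loc_u)"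
      "a \<in> q" "b \<in> q" "c \<in> q" "d \<in> q" unfolding unit_span_def by blast
    thus "r \<in> q \<cdot>\<^bsub>univ_ring\<^esub> UNIV" by (simp only:) (intro add prod)
  qed
  thus "loc_span q \<subseteq> q \<cdot>\<^bsub>univ_ring\<^esub> UNIV"
    unfolding loc_span_def by (intro layer)
qed

end

end

section \<open>Ideals of the localization and of its central subalgebra\<close>

context
  fixes p :: nat
  assumes p: "CHAR('k::field) = p" and p0: "p > 0"
begin

abbreviation (input) Zk :: "'k sjp_loc set" where "Zk \<equiv> loc_center"

definition center_ideal :: "'k sjp_loc set \<Rightarrow> bool" where
  "center_ideal q \<longleftrightarrow> 0 \<in> q \<and> (\<forall>a\<in>q. \<forall>b\<in>q. a + b \<in> q) \<and> (\<forall>\<zeta>\<in>Zk. \<forall>a\<in>q. \<zeta> * a \<in> q) \<and> q \<subseteq> Zk"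

lemma ring_loc_center: "ring (sjp_central_subalgebra :: 'k sjp_loc ring)"
  unfolding sjp_central_subalgebra_def
  by (rule ring.generate_ring_is_ring[OF ring_univ_ring]) simp

lemma loc_center_ops:
  "mult (sjp_central_subalgebra :: 'k sjp_loc ring) = (*)" "one (sjp_central_subalgebra :: 'k
    sjp_loc ring) = 1"
  "add (sjp_central_subalgebra :: 'k sjp_loc ring) = (+)" "zero (sjp_central_subalgebra :: 'k
    sjp_loc ring) = 0"
  by (simp_all add: sjp_central_subalgebra_def)

lemma center_ideal_iff: "ideal q sjp_central_subalgebra \<longleftrightarrow> center_ideal q"
proof
  assume "ideal q (sjp_central_subalgebra :: 'k sjp_loc ring)"
  then interpret ideal q "sjp_central_subalgebra :: 'k sjp_loc ring" .
  show "center_ideal q"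
    using additive_subgroup.zero_closed[OF is_additive_subgroup]
      additive_subgroup.a_closed[OF is_additive_subgroup]
      additive_subgroup.a_subset[OF is_additive_subgroup] I_l_closed
    by (auto simp: center_ideal_def loc_center_ops)
next
  assume q: "center_ideal q"
  let ?R = "sjp_central_subalgebra :: 'k sjp_loc ring"
  have minus: "- a \<in> q" if "a \<in> q" for a
  proof -
    have "- 1 * a \<in> q"
      using q that loc_center_closed(3)[OF p p0 loc_center_closed(1)[OF p p0]]
      unfolding center_ideal_def by blast
    thus ?thesis by simp
  qed
  show "ideal q ?R"
  proof (rule idealI[OF ring_loc_center])
    interpret R: ring ?R by (rule ring_loc_center)
    have inv: "\<ominus>\<^bsub>?R\<^esub> a = - a" if "a \<in> Zk" for a
      using that loc_center_closed(3)[OF p p0 that]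
      by (intro R.minus_equality) (simp_all add: loc_center_ops)
    show "subgroup q (add_monoid ?R)"
    proof (rule R.add.subgroupI)
      show "q \<subseteq> carrier ?R" "q \<noteq> {}" using q by (auto simp: center_ideal_def)
      show "\<ominus>\<^bsub>?R\<^esub> a \<in> q" if "a \<in> q" for a
        using q that inv[of a] minus[OF that] by (auto simp: center_ideal_def)
      show "a \<oplus>\<^bsub>?R\<^esub> b \<in> q" if "a \<in> q" "b \<in> q" for a b
        using q that by (simp add: center_ideal_def loc_center_ops)
    qed
  next
    fix a \<zeta> assume a: "a \<in> q" and \<zeta>: "\<zeta> \<in> carrier ?R"
    show za: "\<zeta> \<otimes>\<^bsub>?R\<^esub> a \<in> q" using q a \<zeta> by (simp add: center_ideal_def loc_center_ops)
    thus "a \<otimes>\<^bsub>?R\<^esub> \<zeta> \<in> q"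
      using loc_center_central[OF p p0 \<zeta>, of a] by (simp add: loc_center_ops)
  qed
qed

lemma center_idealD:
  assumes "center_ideal q"
  shows "0 \<in> q" "\<And>a b. a \<in> q \<Longrightarrow> b \<in> q \<Longrightarrow> a + b \<in> q"
    "\<And>\<zeta> a. \<zeta> \<in> loc_center \<Longrightarrow> a \<in> q \<Longrightarrow> \<zeta> * a \<in> q" "q \<subseteq> loc_center"
  using assms by (auto simp: center_ideal_def)

lemma center_ideal_Z: "center_ideal Zk"
  using loc_center_closed[OF p p0] by (auto simp: center_ideal_def)

lemma center_ideal_Int:
  assumes "ideal J univ_ring"
  shows "center_ideal (J \<inter> Zk)"
  using assms loc_center_closed[OF p p0] by (auto simp: center_ideal_def ideal_univ_ring_iff)

lemma loc_span_Z: "a \<in> loc_span Zk"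
proof -
  have "1 \<in> loc_span Zk"
    using loc_span_unit[OF p p0 center_idealD[OF center_ideal_Z]] loc_center_closed(1)[OF p p0]
      by blast
  from loc_span_right[OF p p0 center_idealD[OF center_ideal_Z] this, of a] show ?thesis by simp
qed

lemma ideal_loc_span:
  assumes q: "center_ideal q"
  shows "ideal (loc_span q) univ_ring"
proof -
  note qD = center_idealD[OF q]
  note prod = ideal_prod_loc_span[OF p p0 qD]
  have "r * a \<in> loc_span q" if "a \<in> loc_span q" for r a
  proof -
    have "a \<in> q \<cdot>\<^bsub>univ_ring\<^esub> UNIV" using that by (simp only: prod)
    thus ?thesis
    proof induction
      case (prod c u)
      hence "r * (c * u) = c * (r * u)"
        using loc_center_central[OF p p0, of c r] qD(4) by (metis mult.assoc subsetD)
      thus ?case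
        using loc_span_right[OF p p0 qD loc_span_unit[OF p p0 qD prod(1)]] by simp
    next
      case (sum a b)
      thus ?case using loc_span_add[OF p p0 qD] by (simp add: distrib_left)
    qed
  qed
  thus ?thesis
    using loc_span_zero[OF p p0 qD] loc_span_add[OF p p0 qD] loc_span_right[OF p p0 qD]
    by (auto simp: ideal_univ_ring_iff)
qed

lemma loc_of_nat_invertible:
  assumes "0 < i" "i < p"
  shows "\<exists>c. c * of_nat i = (1 :: 'k sjp_loc)"
proof -
  have "(of_nat i :: 'k) \<noteq> 0"
    using assms p by (subst of_nat_eq_0_iff_char_dvd) (auto dest: dvd_imp_le)
  hence "sjp_scalar (1 / of_nat i) * of_nat i = (1 :: 'k sjp)"
    by (simp add: sjp_scalar_hom(4) flip: sjp_scalar_of_nat sjp_scalar_hom(2))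
  hence "sjp_loc_of (sjp_scalar (1 / of_nat i)) * of_nat i = (1 :: 'k sjp_loc)"
    by (metis loc_hom(1) loc_hom(3) loc_of_nat)
  thus ?thesis by blast
qed

text \<open>Multiplication by matrix units from both sides moves a chosen entry to either diagonal
  position. The sum of the two results is that entry times \<open>mu x + x mu = 1\<close>.\<close>

lemma unit_coeffs:
  assumes J: "ideal J univ_ring" and Zk: "a \<in> Zk" "b \<in> Zk" "c \<in> Zk" "d \<in> Zk"
    and r: "a * (loc_u * loc_x) + b * loc_u + c * loc_x + d * (loc_x * loc_u) \<in> J" (is "?r \<in> J")
  shows "a \<in> J" "b \<in> J" "c \<in> J" "d \<in> J"
proof -
  have pull: "v * (\<zeta> * w) = \<zeta> * (v * w)" if "\<zeta> \<in> Zk" for v \<zeta> w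
    using loc_center_central[OF p p0 that, of v] by (metis mult.assoc)
  note simps = distrib_left distrib_right mult.assoc pull[OF Zk(1)] pull[OF Zk(2)] pull[OF Zk(3)]
    pull[OF Zk(4)] unit_products L.units L.xx L.mu_mu
  let ?e = "loc_u * loc_x" and ?f = "loc_x * loc_u"
  have 1: "\<zeta> * ?e + \<zeta> * ?f = \<zeta>" for \<zeta> :: "'k sjp_loc"
    using L.unit_sum[where ?'a = 'k] by (metis distrib_left mult.right_neutral)
  have J': "u * ?r * v + u' * ?r * v' \<in> J" for u v u' v'
    using J r unfolding ideal_univ_ring_iff by blast
  have "?e * ?r * ?e + loc_x * ?r * loc_u = a * ?e + a * ?f" by (simp add: simps)
  thus "a \<in> J" using J'[of ?e ?e loc_x loc_u] by (simp only: 1)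
  have "?e * ?r * loc_x + loc_x * ?r * ?f = b * ?e + b * ?f" by (simp add: simps)
  thus "b \<in> J" using J'[of ?e loc_x loc_x ?f] by (simp only: 1)
  have "loc_u * ?r * ?e + ?f * ?r * loc_u = c * ?e + c * ?f" by (simp add: simps)
  thus "c \<in> J" using J'[of loc_u ?e ?f loc_u] by (simp only: 1)
  have "loc_u * ?r * loc_x + ?f * ?r * ?f = d * ?e + d * ?f" by (simp add: simps)
  thus "d \<in> J" using J'[of loc_u loc_x ?f ?f] by (simp only: 1)
qed

text \<open>
  Commutators with \<open>t\<close> and \<open>z\<close> act as the partial derivatives of the Weyl pair; they extract the
  central coefficients of an element without leaving a two-sided ideal.
\<close>

lemma ideal_coeffs:
  assumes J: "ideal J univ_ring" and r: "\<And>i. r i \<in> layer (unit_span Zk) loc_t p"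
    and a: "(\<Sum>i<p. r i * loc_z ^ i) \<in> J" and "i < p"
  shows "r i \<in> J"
proof (rule weyl_coeffs[OF J L.t_z _ _ a \<open>i < p\<close>])
  show "loc_t * r i = r i * loc_t" for i
    by (rule t_span_commute[OF p p0 center_idealD[OF center_ideal_Z] r])
qed (rule loc_of_nat_invertible)

lemma t_span_coeffs:
  assumes J: "ideal J univ_ring" and r: "\<And>i. r i \<in> unit_span Zk"
    and a: "(\<Sum>i<p. r i * loc_t ^ i) \<in> J" and "i < p"
  shows "r i \<in> J"
proof (rule weyl_coeffs[OF J _ _ _ a \<open>i < p\<close>])
  \<comment> \<open>The pair \<open>(-z, t)\<close> is again a Weyl pair, so the two variables can
    exchange roles.\<close>
  show "- loc_z * loc_t = loc_t * - loc_z + (1 :: 'k sjp_loc)" by (simp add: L.t_z)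
  show "- loc_z * r i = r i * - loc_z" for i
    using unit_span_commute(2)[OF p p0 center_idealD[OF center_ideal_Z] r] by simp
qed (rule loc_of_nat_invertible)

lemma ideal_loc_span_Int:
  assumes J: "ideal J univ_ring"
  shows "loc_span (J \<inter> Zk) = J"
proof
  note qD = center_idealD[OF center_ideal_Int[OF J]]
  have zero: "0 \<in> J" using J by (simp add: ideal_univ_ring_iff)
  have "a \<in> J" if "a \<in> (J \<inter> Zk) \<cdot>\<^bsub>univ_ring\<^esub> UNIV" for a
    using that J by (induction rule: ideal_prod.induct) (auto simp: ideal_univ_ring_iff)
  hence "(J \<inter> Zk) \<cdot>\<^bsub>univ_ring\<^esub> UNIV \<subseteq> J" by (intro subsetI)
  thus "loc_span (J \<inter> Zk) \<subseteq> J" by (simp only: ideal_prod_loc_span[OF p p0 qD])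
  show "J \<subseteq> loc_span (J \<inter> Zk)"
  proof
    fix a assume a: "a \<in> J"
    obtain r where r: "\<And>i. r i \<in> layer (unit_span Zk) loc_t p" "a = (\<Sum>i<p. r i * loc_z ^ i)"
      using loc_span_Z[of a] unfolding loc_span_def p by (rule layerE) blast
    have "r i \<in> layer (unit_span (J \<inter> Zk)) loc_t p" if "i < p" for i
    proof -
      have ri: "r i \<in> J" by (rule ideal_coeffs[OF J r(1) a[unfolded r(2)] that])
      obtain c where c: "\<And>j. c j \<in> unit_span Zk" "r i = (\<Sum>j<p. c j * loc_t ^ j)"
        using r(1)[of i] by (rule layerE) blast
      have "c j \<in> unit_span (J \<inter> Zk)" if "j < p" for j
      proof -
        have cj: "c j \<in> J" by (rule t_span_coeffs[OF J c(1) ri[unfolded c(2)] that])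
        obtain k l m n where k: "c j = k * (loc_u * loc_x) + l * loc_u + m * loc_x +
          n * (loc_x * loc_u)"
          "k \<in> Zk" "l \<in> Zk" "m \<in> Zk" "n \<in> Zk" using c(1)[of j] unfolding unit_span_def by blast
        show ?thesis
          using unit_coeffs[OF J k(2-5) cj[unfolded k(1)]] k unfolding unit_span_def by blast
      qed
      \<comment> \<open>Padding by zero, since membership in the smaller span is known only below
        \<open>p\<close>.\<close>
      hence "(\<Sum>j<p. (if j < p then c j else 0) * loc_t ^ j) \<in> layer (unit_span (J \<inter> Zk)) loc_t p"
        using unit_span_zero[OF p p0 qD] by (intro layerI) auto
      thus ?thesis by (simp add: c(2))
    qed
    hence "(\<Sum>i<p. (if i < p then r i else 0) * loc_z ^ i) \<in> loc_span (J \<inter> Zk)"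
      unfolding loc_span_def p using t_span_zero[OF p p0 qD] by (intro layerI) auto
    thus "a \<in> loc_span (J \<inter> Zk)" by (simp add: r(2))
  qed
qed

text \<open>Coefficient extraction for the zero ideal amounts to uniqueness of expansions. It is
  applied to the difference between the expansion of \<open>\<zeta>\<close> over \<open>q\<close>
  and the trivial one with \<open>\<zeta>\<close> in degree zero, successively for \<open>z\<close>,
  for \<open>t\<close> and for the matrix units.\<close>

lemma loc_span_Int_Z:
  assumes q: "center_ideal q"
  shows "loc_span q \<inter> Zk = q"
proof
  note qD = center_idealD[OF q]
  show "q \<subseteq> loc_span q \<inter> Zk" using loc_span_unit[OF p p0 qD] qD(4) by blast
  show "loc_span q \<inter> Zk \<subseteq> q"
  proof
    fix \<zeta> assume \<zeta>: "\<zeta> \<in> loc_span q \<inter> Zk"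
    have zero: "ideal {0 :: 'k sjp_loc} univ_ring" by (simp add: ideal_univ_ring_iff)
    obtain m where m: "p = Suc m" using p0 by (cases p) auto
    have mono: "unit_span q \<subseteq> unit_span Zk" unfolding unit_span_def using qD(4) by blast
    have monot: "layer (unit_span q) loc_t p \<subseteq> layer (unit_span Zk) loc_t p"
      using mono unfolding layer_def by blast
    have ZD: "- \<xi> \<in> Zk" if "\<xi> \<in> Zk" for \<xi> by (rule loc_center_closed(3)[OF p p0 that])
    note Zs = center_idealD[OF center_ideal_Z]
    have minus: "- r \<in> unit_span Zk" if "r \<in> unit_span Zk" for r
      using unit_span_center(1)[OF p p0 Zs ZD[OF loc_center_closed(1)[OF p p0]] that] by simp
    have minust: "- r \<in> layer (unit_span Zk) loc_t p" if "r \<in> layer (unit_span Zk) loc_t p" for r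
      using t_span_center[OF p p0 Zs ZD[OF loc_center_closed(1)[OF p p0]] that] by simp
    have unit: "\<zeta> \<in> unit_span Zk"
    proof -
      have "\<zeta> * (loc_u * loc_x) + 0 * loc_u + 0 * loc_x + \<zeta> * (loc_x * loc_u) \<in> unit_span Zk"
        using \<zeta> by (intro unit_spanI[OF p p0 Zs]) (simp_all add: loc_center_closed(2)[OF p p0])
      moreover have "\<zeta> * (loc_u * loc_x) + \<zeta> * (loc_x * loc_u) = \<zeta>"
        using L.unit_sum[where ?'a = 'k] by (metis distrib_left mult.right_neutral)
      ultimately show ?thesis by simp
    qed
    have unit0: "0 \<in> unit_span Zk" by (rule unit_span_zero[OF p p0 Zs])
    have unitt: "\<zeta> \<in> layer (unit_span Zk) loc_t p" "0 \<in> layer (unit_span Zk) loc_t p"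
      using layer_base[OF unit0 unit p0] t_span_zero[OF p p0 Zs] by simp_all
    obtain r where r: "\<And>i. r i \<in> layer (unit_span q) loc_t p" "\<zeta> = (\<Sum>i<p. r i * loc_z ^ i)"
      using \<zeta> unfolding loc_span_def p by (blast elim: layerE)
    have delta: "(\<Sum>i<p. ((if i = 0 then \<zeta> else 0) + - f i) * v ^ i) = \<zeta> - (\<Sum>i<p. f i * v ^ i)"
      for f and v :: "'k sjp_loc"
      unfolding m sum.lessThan_Suc_shift by (simp add: sum_negf)
    have "(if (0::nat) = 0 then \<zeta> else 0) + - r 0 \<in> {0}"
    proof (rule ideal_coeffs[where r = "\<lambda>i. (if i = 0 then \<zeta> else 0) + - r i", OF zero _ _ p0])
      show "(\<Sum>i<p. ((if i = 0 then \<zeta> else 0) + - r i) * loc_z ^ i) \<in> {0}"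
        by (simp only: delta) (simp flip: r(2))
      show "(if i = 0 then \<zeta> else 0) + - r i \<in> layer (unit_span Zk) loc_t p" for i
        using unitt minust monot r(1)[of i] by (intro t_span_add[OF p p0 Zs]) auto
    qed
    hence r0: "r 0 = \<zeta>" by simp
    obtain c where c: "\<And>j. c j \<in> unit_span q" "r 0 = (\<Sum>j<p. c j * loc_t ^ j)"
      using r(1)[of 0] by (rule layerE) blast
    have "(if (0::nat) = 0 then \<zeta> else 0) + - c 0 \<in> {0}"
    proof (rule t_span_coeffs[where r = "\<lambda>i. (if i = 0 then \<zeta> else 0) + - c i", OF zero _ _ p0])
      show "(\<Sum>i<p. ((if i = 0 then \<zeta> else 0) + - c i) * loc_t ^ i) \<in> {0}"
        by (simp only: delta) (simp add: r0 flip: c(2))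
      show "(if i = 0 then \<zeta> else 0) + - c i \<in> unit_span Zk" for i
        using unit unit0 minus mono c(1)[of i] by (intro unit_span_add[OF p p0 Zs]) auto
    qed
    hence c0: "c 0 = \<zeta>" by simp
    obtain k l m n where k: "c 0 = k * (loc_u * loc_x) + l * loc_u + m * loc_x +
      n * (loc_x * loc_u)"
      "k \<in> q" "l \<in> q" "m \<in> q" "n \<in> q" using c(1)[of 0] unfolding unit_span_def by blast
    have "\<zeta> * (loc_u * loc_x) + \<zeta> * (loc_x * loc_u) = \<zeta>"
      using L.unit_sum[where ?'a = 'k] by (metis distrib_left mult.right_neutral)
    moreover have "(k - \<zeta>) * (loc_u * loc_x) + l * loc_u + m * loc_x + (n - \<zeta>) * (loc_x * loc_u)
        = c 0 - (\<zeta> * (loc_u * loc_x) + \<zeta> * (loc_x * loc_u))"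
      unfolding k(1) by (simp add: left_diff_distrib)
    ultimately have "(k - \<zeta>) * (loc_u * loc_x) + l * loc_u + m * loc_x +
      (n - \<zeta>) * (loc_x * loc_u) \<in> {0}"
      using c0 by simp
    moreover have "k - \<zeta> \<in> Zk" "n - \<zeta> \<in> Zk"
      using k qD(4) \<zeta> ZD loc_center_closed(4)[OF p p0, of _ "- \<zeta>"] by auto
    ultimately have "k - \<zeta> \<in> {0}"
      using unit_coeffs(1)[OF zero, of "k - \<zeta>" l m "n - \<zeta>"] k qD(4) by blast
    thus "\<zeta> \<in> q" using k(2) by simp
  qed
qed

end

section \<open>The prime spectrum\<close>

context
  fixes p :: nat
  assumes p: "CHAR('k::field) = p" and p0: "p > 0"
begin

abbreviation (input) Zc :: "'k sjp_loc set" where "Zc \<equiv> loc_center"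

text \<open>The extension of \<open>J\<close> to \<open>A\<^sub>s\<close>. Only exponents divisible
  by \<open>p\<close> occur: such denominators are central and can be cleared from sums and products
  without a twist.\<close>

definition loc_ext :: "'k sjp set \<Rightarrow> 'k sjp_loc set" where
  "loc_ext J = {u. \<exists>n. \<exists>b\<in>J. u * loc_s ^ (p * n) = sjp_loc_of b}"

lemma loc_s_central: "loc_s ^ (p * n) * u = u * (loc_s ^ (p * n) :: 'k sjp_loc)"
proof -
  have "loc_s ^ p * u = u * (loc_s ^ p :: 'k sjp_loc)" for u
    by (rule loc_center_central[OF p p0 loc_center_closed(9)[OF p p0]])
  thus ?thesis unfolding power_mult by (rule power_commuting_commutes)
qed

lemma loc_denominator:
  fixes u :: "'k sjp_loc"
  obtains n a where "u * loc_s ^ (p * n) = sjp_loc_of a"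
proof -
  obtain b m where u: "u = sjp_loc_of b * sjp_s_inverse ^ m" using sjp_loc_localization(6) by blast
  \<comment> \<open>The exponent \<open>m\<close> is raised to the multiple \<open>p * m\<close>,
    which makes the denominator central.\<close>
  obtain l where l: "p * m = m + l" using p0
    by (metis le_add_diff_inverse mult_le_mono1 mult_1 Suc_leI One_nat_def)
  have "u * loc_s ^ (p * m) = sjp_loc_of b * (sjp_s_inverse ^ m * loc_s ^ m) * loc_s ^ l"
    by (simp only: u l power_add mult.assoc)
  also have "\<dots> = sjp_loc_of (b * sjp_s ^ l)" by (simp add: sjp_loc_power_inverse loc_hom)
  finally show ?thesis by (rule that)
qed

lemma ideal_loc_ext:
  assumes J: "ideal J univ_ring"
  shows "ideal (loc_ext J) univ_ring"
  unfolding ideal_univ_ring_iff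
proof (intro conjI ballI allI)
  note Ji = J[unfolded ideal_univ_ring_iff]
  show "0 \<in> loc_ext J"
    unfolding loc_ext_def using Ji by (auto intro!: exI[of _ 0] bexI[of _ 0] simp: loc_hom)
  fix u assume "u \<in> loc_ext J"
  then obtain n b where b: "b \<in> J" "u * loc_s ^ (p * n) = sjp_loc_of b" unfolding loc_ext_def
    by blast
  show "u + v \<in> loc_ext J" if v: "v \<in> loc_ext J" for v
  proof -
    obtain m c where c: "c \<in> J" "v * loc_s ^ (p * m) = sjp_loc_of c" using v unfolding loc_ext_def
      by blast
    have "(u + v) * loc_s ^ (p * (n + m)) = u * loc_s ^ (p * n) * loc_s ^ (p * m)
        + v * loc_s ^ (p * m) * loc_s ^ (p * n)"
      by (simp add: distrib_right distrib_left mult.assoc add.commute flip: power_add)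
    also have "\<dots> = sjp_loc_of (b * sjp_s ^ (p * m) + c * sjp_s ^ (p * n))"
      by (simp add: b c loc_hom)
    finally show ?thesis unfolding loc_ext_def using b(1) c(1) Ji by blast
  qed
  fix r :: "'k sjp_loc"
  obtain m c where c: "r * loc_s ^ (p * m) = sjp_loc_of c" by (rule loc_denominator)
  have split: "loc_s ^ (p * (m + n)) = loc_s ^ (p * m) * (loc_s ^ (p * n) :: 'k sjp_loc)"
    by (simp add: distrib_left power_add)
  have "r * u * loc_s ^ (p * (m + n)) = r * (u * loc_s ^ (p * m)) * loc_s ^ (p * n)"
    by (simp only: split mult.assoc)
  also have "u * loc_s ^ (p * m) = loc_s ^ (p * m) * u" by (rule loc_s_central[symmetric])
  also have "r * (loc_s ^ (p * m) * u) * loc_s ^ (p * n) = r * loc_s ^ (p * m) * (u * loc_s ^ (p *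
    n))"
    by (simp only: mult.assoc)
  also have "\<dots> = sjp_loc_of (c * b)" by (simp only: b c loc_hom)
  finally show "r * u \<in> loc_ext J" unfolding loc_ext_def using b(1) Ji by blast
  have "u * r * loc_s ^ (p * (m + n)) = u * (r * loc_s ^ (p * m) * loc_s ^ (p * n))"
    by (simp only: split mult.assoc)
  also have "r * loc_s ^ (p * m) * loc_s ^ (p * n) = loc_s ^ (p * n) * (r * loc_s ^ (p * m))"
    by (rule loc_s_central[symmetric])
  also have "u * (loc_s ^ (p * n) * (r * loc_s ^ (p * m))) = u * loc_s ^ (p * n) * (r * loc_s ^ (p *
    m))"
    by (simp only: mult.assoc)
  also have "\<dots> = sjp_loc_of (b * c)" by (simp only: b c loc_hom)
  finally show "u * r \<in> loc_ext J" unfolding loc_ext_def using b(1) Ji by blast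
qed

text \<open>Contracting the extension of \<open>J\<close> gives its saturation with respect to
  \<open>s\<close>.\<close>

lemma loc_ext_of_iff:
  assumes J: "ideal J univ_ring"
  shows "sjp_loc_of a \<in> loc_ext J \<longleftrightarrow> (\<exists>N. a * sjp_s ^ N \<in> J)"
proof
  note Ji = J[unfolded ideal_univ_ring_iff]
  assume "sjp_loc_of a \<in> loc_ext J"
  then obtain n b where b: "b \<in> J" "sjp_loc_of a * loc_s ^ (p * n) = sjp_loc_of b"
    unfolding loc_ext_def by blast
  hence "sjp_loc_of (a * sjp_s ^ (p * n) - b) = 0" by (simp add: loc_hom)
  then obtain m where "(a * sjp_s ^ (p * n) - b) * sjp_s ^ m = 0"
    using sjp_loc_localization(7) by blast
  hence "a * sjp_s ^ (p * n + m) = b * sjp_s ^ m"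
    by (simp add: left_diff_distrib power_add mult.assoc)
  moreover have "b * sjp_s ^ m \<in> J" using Ji b(1) by blast
  ultimately show "\<exists>N. a * sjp_s ^ N \<in> J" by metis
next
  note Ji = J[unfolded ideal_univ_ring_iff]
  assume "\<exists>N. a * sjp_s ^ N \<in> J"
  then obtain N where N: "a * sjp_s ^ N \<in> J" by blast
  obtain l where l: "p * N = N + l" using p0
    by (metis le_add_diff_inverse mult_le_mono1 mult_1 Suc_leI One_nat_def)
  have "a * sjp_s ^ N * sjp_s ^ l \<in> J" using Ji N by blast
  moreover have "sjp_loc_of a * loc_s ^ (p * N) = sjp_loc_of (a * sjp_s ^ N * sjp_s ^ l)"
    by (simp add: l power_add loc_hom mult.assoc)
  ultimately show "sjp_loc_of a \<in> loc_ext J" unfolding loc_ext_def by blast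
qed

text \<open>By \<open>ideal_loc_span_Int\<close> an ideal of \<open>A\<^sub>s\<close> is generated
  by its central part, so inclusions can be tested there.\<close>

lemma ideal_subset_center:
  assumes I: "ideal I univ_ring" and J: "ideal J univ_ring" and sub: "I \<inter> Zc \<subseteq> J"
  shows "I \<subseteq> J"
proof -
  have "u \<in> J" if "u \<in> (I \<inter> Zc) \<cdot>\<^bsub>univ_ring\<^esub> UNIV" for u
    using that
  proof (induction rule: ideal_prod.induct)
    case (prod i j)
    thus ?case using sub J by (auto simp: ideal_univ_ring_iff)
  next
    case (sum s1 s2)
    thus ?case using J by (simp add: ideal_univ_ring_iff)
  qed
  hence "(I \<inter> Zc) \<cdot>\<^bsub>univ_ring\<^esub> UNIV \<subseteq> J" by (intro subsetI)
  thus ?thesis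
    by (simp only: ideal_prod_loc_span[OF p p0 center_idealD[OF p p0 center_ideal_Int[OF p p0 I]]]
        ideal_loc_span_Int[OF p p0 I])
qed

text \<open>By normality, \<open>b s\<close> in \<open>P\<close> implies
  \<open>b r s = b s \<tau>(r)\<close> in \<open>P\<close> for every \<open>r\<close>, where
  \<open>\<tau>\<close> is \<open>sjp_twist 1\<close>. Primeness then removes one factor
  \<open>s\<close> at a time.\<close>

lemma prime_s_power:
  fixes P :: "'k sjp set"
  assumes P: "P \<in> prime_spectrum univ_ring" and s: "sjp_s \<notin> P" and N: "a * sjp_s ^ N \<in> P"
  shows "a \<in> P"
proof -
  note P' = P[unfolded prime_spectrum_univ_iff]
  have Pr: "\<And>b r. b \<in> P \<Longrightarrow> b * r \<in> P" using P' by (simp add: ideal_univ_ring_iff)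
  have step: "b \<in> P" if "b * sjp_s \<in> P" for b
  proof -
    have "b * r * sjp_s \<in> P" for r
      using Pr[OF that, of "sjp_twist 1 r"] by (simp add: mult.assoc sjp_s_normal sjp_twist_hom)
    thus ?thesis using P' s by blast
  qed
  from N show ?thesis by (induction N) (auto simp: power_Suc2 dest!: step simp del: power_Suc simp
    flip: mult.assoc)
qed

lemma contraction_eq:
  fixes q :: "'k sjp_loc set"
  assumes "center_ideal q"
  shows "sjp_contraction q = {a. sjp_loc_of a \<in> loc_span q}"
  unfolding sjp_contraction_def using ideal_prod_loc_span[OF p p0 center_idealD[OF p p0 assms]]
    by simp

lemma prime_loc_center_iff:
  "q \<in> prime_spectrum sjp_central_subalgebra \<longleftrightarrow> center_ideal q \<and> 1 \<notin> q \<and>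
     (\<forall>a\<in>Zc. \<forall>b\<in>Zc. a * b \<in> q \<longrightarrow> a \<in> q \<or> b \<in> q)"
proof -
  let ?R = "sjp_central_subalgebra :: 'k sjp_loc ring"
  note Z = loc_center_closed[OF p p0]
  have one: "q \<noteq> Zc \<longleftrightarrow> 1 \<notin> q" if "center_ideal q"
  proof -
    have "q = Zc" if "1 \<in> q"
    proof -
      have "\<zeta> \<in> q" if "\<zeta> \<in> Zc" for \<zeta>
        using center_idealD(3)[OF p p0 \<open>center_ideal q\<close> that \<open>1 \<in> q\<close>] by simp
      thus ?thesis using center_idealD(4)[OF p p0 \<open>center_ideal q\<close>] by blast
    qed
    thus ?thesis using Z(1) by blast
  qed
  have sandwich: "(\<forall>r\<in>Zc. a * r * b \<in> q) \<longleftrightarrow> a * b \<in> q" if "center_ideal q" "a \<in> Zc" "b \<in> Zc" for a b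
  proof
    assume "\<forall>r\<in>Zc. a * r * b \<in> q"
    from this[rule_format, OF Z(1)] show "a * b \<in> q" by simp
  next
    assume ab: "a * b \<in> q"
    show "\<forall>r\<in>Zc. a * r * b \<in> q"
    proof
      fix r assume r: "r \<in> Zc"
      have "a * r = r * a" by (rule loc_center_central[OF p p0 r, symmetric])
      hence "a * r * b = r * (a * b)" by (simp only: mult.assoc[symmetric])
      thus "a * r * b \<in> q" using center_idealD(3)[OF p p0 that(1) r ab] by simp
    qed
  qed
  show ?thesis
    unfolding ring.prime_spectrum_elementwise[OF ring_loc_center[OF p p0]] center_ideal_iff[OF p p0]
      loc_center_ops[OF p p0]
  proof (intro conj_cong refl ball_cong)
    assume q: "center_ideal q"
    show "q \<noteq> Zc \<longleftrightarrow> 1 \<notin> q" by (rule one[OF q])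
    fix a b assume "a \<in> Zc" "b \<in> Zc"
    thus "((\<forall>r\<in>Zc. a * r * b \<in> q) \<longrightarrow> a \<in> q \<or> b \<in> q) = (a * b \<in> q \<longrightarrow> a \<in> q \<or> b \<in> q)"
      by (simp only: sandwich[OF q])
  qed
qed

text \<open>The prime is saturated, hence the contraction of its extension, and the extension is
  generated by its central part. That part is prime because central elements can be multiplied into
  \<open>A\<close> by central denominators.\<close>

lemma prime_is_contraction:
  assumes P: "P \<in> prime_spectrum (univ_ring :: 'k sjp ring)" and s: "sjp_s \<notin> P"
  shows "\<exists>q\<in>prime_spectrum sjp_central_subalgebra. P = sjp_contraction q"
proof
  note P' = P[unfolded prime_spectrum_univ_iff]
  have Pi: "ideal P univ_ring" using P' by blast
  let ?J = "loc_ext P"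
  have J: "ideal ?J univ_ring" by (rule ideal_loc_ext[OF Pi])
  have mem: "sjp_loc_of a \<in> ?J \<longleftrightarrow> a \<in> P" for a
  proof -
    have "a \<in> P \<Longrightarrow> a * sjp_s ^ 0 \<in> P" by simp
    thus ?thesis unfolding loc_ext_of_iff[OF Pi] using prime_s_power[OF P s] by blast
  qed
  note q = center_ideal_Int[OF p p0 J]
  show "P = sjp_contraction (?J \<inter> Zc)"
    unfolding contraction_eq[OF q] ideal_loc_span_Int[OF p p0 J] by (auto simp: mem)
  have "1 \<notin> ?J" using mem[of 1] P' by (simp add: loc_hom)
  moreover have "a \<in> ?J \<or> b \<in> ?J" if ab: "a \<in> Zc" "b \<in> Zc" "a * b \<in> ?J" for a b
  proof -
    obtain n a' where a': "a * loc_s ^ (p * n) = sjp_loc_of a'" by (rule loc_denominator)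
    obtain m b' where b': "b * loc_s ^ (p * m) = sjp_loc_of b'" by (rule loc_denominator)
    have "a' * r * b' \<in> P" for r
    proof -
      have "sjp_loc_of (a' * r * b') = a * (loc_s ^ (p * n) * sjp_loc_of r * b) * loc_s ^ (p * m)"
        by (simp add: loc_hom mult.assoc flip: a' b')
      also have "loc_s ^ (p * n) * sjp_loc_of r * b = b * (loc_s ^ (p * n) * sjp_loc_of r)"
        by (rule loc_center_central[OF p p0 ab(2), symmetric])
      also have "a * (b * (loc_s ^ (p * n) * sjp_loc_of r)) * loc_s ^ (p * m)
          = a * b * (loc_s ^ (p * n) * sjp_loc_of r * loc_s ^ (p * m))"
        by (simp only: mult.assoc)
      also have "\<dots> \<in> ?J" using J ab(3) unfolding ideal_univ_ring_iff by blast
      finally show ?thesis by (simp only: mem)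
    qed
    hence "a' \<in> P \<or> b' \<in> P" using P' by blast
    thus ?thesis unfolding loc_ext_def using a' b' by blast
  qed
  moreover have "a * b \<in> Zc" if "a \<in> Zc" "b \<in> Zc" for a b using loc_center_closed(5)[OF p p0 that] .
  ultimately show "?J \<inter> Zc \<in> prime_spectrum sjp_central_subalgebra"
    unfolding prime_loc_center_iff using q by blast
qed

lemma contraction_is_prime:
  assumes q: "q \<in> prime_spectrum sjp_central_subalgebra"
  shows "sjp_contraction q \<in> prime_spectrum (univ_ring :: 'k sjp ring)"
proof -
  have qi: "center_ideal q" and q1: "1 \<notin> q"
    and qp: "\<And>a b. a \<in> Zc \<Longrightarrow> b \<in> Zc \<Longrightarrow> a * b \<in> q \<Longrightarrow> a \<in> q \<or> b \<in> q"
    using q unfolding prime_loc_center_iff by blast+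
  let ?J = "loc_span q"
  note Z = loc_center_closed[OF p p0]
  have J: "ideal ?J univ_ring" by (rule ideal_loc_span[OF p p0 qi])
  note Ji = J[unfolded ideal_univ_ring_iff]
  have JZ: "?J \<inter> Zc = q" by (rule loc_span_Int_Z[OF p p0 qi])
  have J1: "1 \<notin> ?J" using JZ q1 Z(1) by blast
  have Jr: "\<And>u r. u \<in> ?J \<Longrightarrow> u * r \<in> ?J" and Jl: "\<And>u r. u \<in> ?J \<Longrightarrow> r * u \<in> ?J"
    and Jadd: "\<And>u v. u \<in> ?J \<Longrightarrow> v \<in> ?J \<Longrightarrow> u + v \<in> ?J" and J0: "0 \<in> ?J"
    using Ji by blast+
  have "a \<in> sjp_contraction q \<or> b \<in> sjp_contraction q"
    if ab: "\<And>r. a * r * b \<in> sjp_contraction q" for a b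
  proof -
    \<comment> \<open>\<open>I1\<close> and \<open>I2\<close> are ideals of \<open>A\<^sub>s\<close>
      that contain \<open>a\<close> and \<open>b\<close> and have their product in
      \<open>?J\<close>. Their central parts multiply into the prime \<open>q\<close>, so one of
      these parts lies in \<open>q\<close>, and with it the whole ideal lies in
      \<open>?J\<close>.\<close>
    define I1 where "I1 = {u. \<forall>r. u * r * sjp_loc_of b \<in> ?J}"
    define I2 where "I2 = {v. \<forall>u\<in>I1. \<forall>r. u * r * v \<in> ?J}"
    have I1: "ideal I1 univ_ring"
      unfolding I1_def ideal_univ_ring_iff mem_Collect_eq
      using J0 Jadd Jl by (auto simp: distrib_right mult.assoc) (metis mult.assoc)
    have I1': "\<And>u r. u \<in> I1 \<Longrightarrow> u * r \<in> I1" using I1 by (simp add: ideal_univ_ring_iff)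
    have I2: "ideal I2 univ_ring"
      unfolding ideal_univ_ring_iff
    proof (intro conjI ballI allI)
      show "0 \<in> I2" by (simp add: I2_def J0)
      fix v assume v: "v \<in> I2"
      show "v + w \<in> I2" if "w \<in> I2" for w using v that Jadd by (simp add: I2_def distrib_left)
      show "s * v \<in> I2" for s
      proof -
        have "u * r * (s * v) \<in> ?J" if "u \<in> I1" for u r
          using v that unfolding I2_def by (metis (mono_tags, lifting) mem_Collect_eq mult.assoc)
        thus ?thesis by (simp add: I2_def)
      qed
      show "v * s \<in> I2" for s
        using v Jr by (simp add: I2_def flip: mult.assoc)
    qed
    have a: "sjp_loc_of a \<in> I1"
    proof -
      \<comment> \<open>The assumption covers multipliers from \<open>A\<close> only. The
        denominator of \<open>r\<close> is central, so it can be moved to the right and cancelled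
        there.\<close>
      have "sjp_loc_of a * r * sjp_loc_of b \<in> ?J" for r
      proof -
        obtain n c where c: "r * loc_s ^ (p * n) = sjp_loc_of c" by (rule loc_denominator)
        have "sjp_loc_of (a * c * b) \<in> ?J" using ab[of c] unfolding contraction_eq[OF qi] by blast
        moreover have "sjp_loc_of (a * c * b) = sjp_loc_of a * r * (loc_s ^ (p * n) * sjp_loc_of b)"
          by (simp add: loc_hom mult.assoc flip: c)
        moreover have "loc_s ^ (p * n) * sjp_loc_of b = sjp_loc_of b * loc_s ^ (p * n)"
          by (rule loc_s_central)
        ultimately have "sjp_loc_of a * r * (sjp_loc_of b * loc_s ^ (p * n)) * loc_t ^ (p * n) \<in> ?J"
          using Jr by metis
        thus ?thesis by (simp add: mult.assoc sjp_loc_power_inverse)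
      qed
      thus ?thesis by (simp add: I1_def)
    qed
    have b: "sjp_loc_of b \<in> I2" by (simp add: I2_def I1_def)
    have cap: "c * d \<in> q" if "c \<in> I1 \<inter> Zc" "d \<in> I2 \<inter> Zc" for c d
    proof -
      have "c * 1 * d \<in> ?J" using that unfolding I2_def by blast
      moreover have "c * d \<in> Zc" using that Z(5) by blast
      ultimately show ?thesis using JZ by auto
    qed
    have mono: "I \<subseteq> ?J" if I: "ideal I univ_ring" "I \<inter> Zc \<subseteq> q" for I
      using I(2) JZ by (intro ideal_subset_center[OF I(1) J]) blast
    have "I1 \<inter> Zc \<subseteq> q \<or> I2 \<inter> Zc \<subseteq> q"
    proof (rule disjCI)
      assume "\<not> I2 \<inter> Zc \<subseteq> q"
      then obtain d where "d \<in> I2 \<inter> Zc" "d \<notin> q" by blast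
      thus "I1 \<inter> Zc \<subseteq> q" using cap qp by blast
    qed
    hence "sjp_loc_of a \<in> ?J \<or> sjp_loc_of b \<in> ?J"
      using mono[OF I1] mono[OF I2] a b by blast
    thus ?thesis unfolding contraction_eq[OF qi] by blast
  qed
  moreover have "ideal (sjp_contraction q) univ_ring"
    unfolding contraction_eq[OF qi] ideal_univ_ring_iff mem_Collect_eq
    using J0 Jadd Jl Jr by (simp add: loc_hom)
  moreover have "1 \<notin> sjp_contraction q"
    unfolding contraction_eq[OF qi] using J1 by (simp add: loc_hom)
  ultimately show ?thesis unfolding prime_spectrum_univ_iff by blast
qed

text \<open>Modulo \<open>J\<close> the element \<open>s\<close> is invertible, with inverse
  \<open>\<beta>\<inverse> s^(p-1)\<close>.\<close>

lemma cancel_s_power: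
  fixes J :: "'k sjp set"
  assumes J: "ideal J univ_ring" and s: "sjp_s ^ p - sjp_scalar \<beta> \<in> J" and \<beta>: "\<beta> \<noteq> 0"
    and a: "a * sjp_s ^ N \<in> J"
  shows "a \<in> J"
proof -
  note Ji = J[unfolded ideal_univ_ring_iff]
  obtain m where m: "p = Suc m" using p0 by (cases p) auto
  have step: "b \<in> J" if "b * sjp_s \<in> J" for b
  proof -
    have "b * sjp_s * sjp_s ^ m - b * (sjp_s ^ p - sjp_scalar \<beta>) \<in> J"
      using Ji that s by (intro univ_ideal_minus(2)[OF J]) blast+
    hence "b * sjp_scalar \<beta> \<in> J" by (simp add: m right_diff_distrib mult.assoc)
    hence "b * sjp_scalar \<beta> * sjp_scalar (inverse \<beta>) \<in> J" using Ji by blast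
    thus ?thesis using \<beta> by (simp add: mult.assoc sjp_scalar_hom(4) flip: sjp_scalar_hom(2))
  qed
  from a show ?thesis
    by (induction N) (auto simp: power_Suc2 dest!: step simp del: power_Suc simp flip: mult.assoc)
qed

text \<open>Modulo the extension of the ideal to \<open>A\<^sub>s\<close>, every element of
  \<open>Z\<close> is a scalar. A larger extension therefore either has no new central elements, and
  is equal, or contains a nonzero scalar. As \<open>s\<close> is invertible modulo both ideals,
  nothing is lost on returning to \<open>A\<close>. Properness of the ideal is supplied later by a
  matrix representation.\<close>

lemma central_ideal_maximal:
  fixes \<alpha> \<beta> \<gamma> :: 'k
  assumes nz: "\<alpha> \<noteq> 0" "\<beta> \<noteq> 0"
    and J: "ideal J univ_ring" "1 \<notin> J"
    and sub: "Idl\<^bsub>sjp_ring\<^esub> {sjp_C - sjp_scalar \<alpha>, sjp_s ^ p - sjp_scalar \<beta>,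
      sjp_y ^ (2 * p) - sjp_scalar \<gamma>} \<subseteq> J"
      (is "?I \<subseteq> J")
  shows "J = ?I"
proof
  show "?I \<subseteq> J" by (rule sub)
  have I: "ideal ?I univ_ring" by (rule univ_Idl(1))
  have gens: "sjp_C - sjp_scalar \<alpha> \<in> ?I" "sjp_s ^ p - sjp_scalar \<beta> \<in> ?I" "sjp_y ^ (2 * p) -
    sjp_scalar \<gamma> \<in> ?I"
    using univ_Idl(2)[of "{sjp_C - sjp_scalar \<alpha>, sjp_s ^ p - sjp_scalar \<beta>,
      sjp_y ^ (2 * p) - sjp_scalar \<gamma>}"]
    by auto
  have Is: "ideal (loc_ext ?I) univ_ring" by (rule ideal_loc_ext[OF I])
  note Isi = Is[unfolded ideal_univ_ring_iff] and Idiff = univ_ideal_minus(2)[OF Is]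
  have ext: "sjp_loc_of a \<in> loc_ext ?I" if "a \<in> ?I" for a
    using that unfolding loc_ext_of_iff[OF I] by (intro exI[of _ 0]) simp
  define c where "c e = (sjp_loc_of (sjp_scalar e) :: 'k sjp_loc)" for e
  have c_hom: "c (d + e) = c d + c e" "c (d * e) = c d * c e" "c 1 = 1" "c 0 = 0" "c (- e) = - c e"
    for d e
    by (simp_all add: c_def sjp_scalar_hom loc_hom unital_homD(5)[OF unital_hom_sjp_scalar])
  have c_inv: "c e * c (inverse e) = 1" if "e \<noteq> 0" for e
    using that by (simp add: c_hom(3) flip: c_hom(2))
  have base: "sjp_loc_of sjp_C - c \<alpha> \<in> loc_ext ?I" "loc_s ^ p - c \<beta> \<in> loc_ext ?I"
    "sjp_loc_of sjp_y ^ (2 * p) - c \<gamma> \<in> loc_ext ?I"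
    using ext[OF gens(1)] ext[OF gens(2)] ext[OF gens(3)] by (simp_all add: loc_hom c_def)
  \<comment> \<open>The identity \<open>z' - e\<inverse> = - z' (z - e) e\<inverse>\<close> covers
    the generators of \<open>Z\<close> that are inverses.\<close>
  have inv: "z' - c (inverse e) \<in> loc_ext ?I"
    if "z' * z = 1" "e \<noteq> 0" "z - c e \<in> loc_ext ?I" for z z' e
  proof -
    have "- (z' * (z - c e) * c (inverse e)) \<in> loc_ext ?I"
      using that(3) Isi by (intro univ_ideal_minus(1)[OF Is]) blast
    moreover have "- (z' * (z - c e) * c (inverse e)) = z' - c (inverse e)"
      using that(1) c_inv[OF that(2)] by (simp add: right_diff_distrib left_diff_distrib mult.assoc)
    ultimately show ?thesis by simp
  qed
  have reduce: "\<exists>e. \<zeta> - c e \<in> loc_ext ?I" if "\<zeta> \<in> Zc" for \<zeta>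
    using that unfolding loc_center_def[OF p p0]
  proof (induction rule: generate_ring.induct)
    case one
    show ?case using Isi by (intro exI[of _ 1]) (simp add: c_hom)
  next
    case (incl h)
    then consider (sc) d where "h = sjp_loc_of (sjp_scalar d)" | (C) "h = sjp_loc_of sjp_C"
      | (Ci) "h = loc_Cinv" | (s) "h = loc_s ^ p" | (t) "h = loc_t ^ p" | (y) "h =
        sjp_loc_of sjp_y ^ (2 * p)"
      by blast
    thus ?case
    proof cases
      case (sc d)
      hence "h - c d \<in> loc_ext ?I" using Isi by (simp add: c_def)
      thus ?thesis by blast
    next
      case C
      thus ?thesis using base(1) by blast
    next
      case Ci
      thus ?thesis using inv[OF loc_Cinv(2) nz(1) base(1)] by blast
    next
      case s
      thus ?thesis using base(2) by blast
    next
      case t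
      thus ?thesis using inv[OF sjp_loc_power_inverse(2) nz(2) base(2)] by blast
    next
      case y
      thus ?thesis using base(3) by blast
    qed
  next
    case (a_inv h)
    then obtain e where "h - c e \<in> loc_ext ?I" by blast
    hence "- (h - c e) \<in> loc_ext ?I" by (rule univ_ideal_minus(1)[OF Is])
    thus ?case by (intro exI[of _ "- e"]) (simp add: c_hom univ_ring_minus)
  next
    case (eng_add h1 h2)
    then obtain d e where "h1 - c d \<in> loc_ext ?I" "h2 - c e \<in> loc_ext ?I" by blast
    hence "(h1 - c d) + (h2 - c e) \<in> loc_ext ?I" using Isi by blast
    thus ?case by (intro exI[of _ "d + e"]) (simp add: c_hom algebra_simps)
  next
    case (eng_mult h1 h2)
    then obtain d e where de: "h1 - c d \<in> loc_ext ?I" "h2 - c e \<in> loc_ext ?I" by blast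
    have "(h1 - c d) * h2 + c d * (h2 - c e) \<in> loc_ext ?I" using Isi de by blast
    thus ?case by (intro exI[of _ "d * e"]) (simp add: c_hom algebra_simps)
  qed
  have Js: "ideal (loc_ext J) univ_ring" by (rule ideal_loc_ext[OF J(1)])
  note Jsi = Js[unfolded ideal_univ_ring_iff]
  have "loc_ext ?I \<subseteq> loc_ext J" unfolding loc_ext_def using sub by blast
  have "loc_ext J \<subseteq> loc_ext ?I"
  proof (rule ideal_subset_center[OF Js Is], rule subsetI)
    fix \<zeta> assume \<zeta>: "\<zeta> \<in> loc_ext J \<inter> Zc"
    then obtain e where e: "\<zeta> - c e \<in> loc_ext ?I" using reduce by blast
    have "e = 0"
    proof (rule ccontr)
      assume "e \<noteq> 0"
      have "\<zeta> \<in> loc_ext J" "\<zeta> - c e \<in> loc_ext J"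
        using \<zeta> e \<open>loc_ext ?I \<subseteq> loc_ext J\<close> by blast+
      hence "\<zeta> - (\<zeta> - c e) \<in> loc_ext J" by (rule univ_ideal_minus(2)[OF Js])
      hence "c e \<in> loc_ext J" by simp
      hence "c e * c (inverse e) \<in> loc_ext J" using Jsi by blast
      hence "sjp_loc_of 1 \<in> loc_ext J" using c_inv[OF \<open>e \<noteq> 0\<close>] by (simp add: loc_hom)
      then obtain N where "1 * sjp_s ^ N \<in> J" unfolding loc_ext_of_iff[OF J(1)] by blast
      moreover have "sjp_s ^ p - sjp_scalar \<beta> \<in> J" using gens(2) sub by blast
      ultimately have "1 \<in> J" using cancel_s_power[OF J(1) _ nz(2)] by blast
      thus False using J(2) by blast
    qed
    thus "\<zeta> \<in> loc_ext ?I" using e by (simp add: c_hom)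
  qed
  show "J \<subseteq> ?I"
  proof
    fix a assume "a \<in> J"
    hence "a * sjp_s ^ 0 \<in> J" by simp
    hence "sjp_loc_of a \<in> loc_ext J" unfolding loc_ext_of_iff[OF J(1)] by blast
    hence "sjp_loc_of a \<in> loc_ext ?I" using \<open>loc_ext J \<subseteq> loc_ext ?I\<close> by blast
    then obtain N where "a * sjp_s ^ N \<in> ?I" unfolding loc_ext_of_iff[OF I] by blast
    thus "a \<in> ?I" by (rule cancel_s_power[OF I gens(2) nz(2)])
  qed
qed

end

section \<open>Primes containing s\<close>

lemma prime_normal_square:
  fixes P :: "'k::field sjp set"
  assumes P: "P \<in> prime_spectrum univ_ring" and u: "u * u \<in> P"
    and gen: "\<And>i. \<exists>b. u * sjp_gen i - b * u \<in> P"
  shows "u \<in> P"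
proof -
  note P' = P[unfolded prime_spectrum_univ_iff]
  have Pi: "ideal P univ_ring" using P' by blast
  note Pii = Pi[unfolded ideal_univ_ring_iff]
  have normal: "\<exists>b. u * a - b * u \<in> P" for a :: "'k sjp"
  proof (induction a rule: sjp_induct)
    case (scalar c)
    show ?case using Pii by (intro exI[of _ "sjp_scalar c"]) (simp add: sjp_scalar_commute)
  next
    case (gen i)
    show ?case by (rule assms(3))
  next
    case (add a b)
    then obtain a' b' where ab: "u * a - a' * u \<in> P" "u * b - b' * u \<in> P" by blast
    have "(u * a - a' * u) + (u * b - b' * u) \<in> P" using Pii ab by blast
    thus ?case by (intro exI[of _ "a' + b'"]) (simp add: algebra_simps)
  next
    case (mult a b)
    then obtain a' b' where ab: "u * a - a' * u \<in> P" "u * b - b' * u \<in> P" by blast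
    have "(u * a - a' * u) * b + a' * (u * b - b' * u) \<in> P" using Pii ab by blast
    thus ?case by (intro exI[of _ "a' * b'"]) (simp add: algebra_simps)
  qed
  \<comment> \<open>Modulo \<open>P\<close>, \<open>u a u\<close> equals \<open>b u\<^sup>2\<close>
    for a suitable \<open>b\<close>, so all of \<open>u A u\<close> lies in
    \<open>P\<close>.\<close>
  have "u * a * u \<in> P" for a
  proof -
    obtain b where "u * a - b * u \<in> P" using normal by blast
    hence "(u * a - b * u) * u + b * (u * u) \<in> P" using Pii u by blast
    thus ?thesis by (simp add: algebra_simps)
  qed
  thus ?thesis using P' by blast
qed

lemma prime_s_imp_x:
  fixes P :: "'k::field sjp set"
  assumes P: "P \<in> prime_spectrum univ_ring" and s: "sjp_s \<in> P"
  shows "sjp_x \<in> P"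
proof (rule prime_normal_square[OF P])
  have zero: "0 \<in> P" using P by (simp add: prime_spectrum_univ_iff ideal_univ_ring_iff)
  thus "sjp_x * sjp_x \<in> P" by (simp add: sjp_relations(1))
  fix i
  have "sjp_x * sjp_x - 0 * sjp_x \<in> P" using zero by (simp add: sjp_relations(1))
  moreover have "sjp_x * sjp_y - (- sjp_y) * sjp_x \<in> P" using s by (simp add: sjp_s_def)
  moreover have "sjp_x * sjp_g - (- sjp_g) * sjp_x \<in> P" using zero by (simp add: sjp_x_g)
  moreover have "sjp_x * sjp_ginv - (- sjp_ginv) * sjp_x \<in> P" using zero by (simp add: sjp_ginv_x)
  ultimately show "\<exists>b. sjp_x * sjp_gen i - b * sjp_x \<in> P" by (cases i) blast+
qed

text \<open>Since a prime containing \<open>s\<close> contains \<open>x\<close>, the primes above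
  the kernel of the map to \<open>\<Lambda>\<close> are singled out by \<open>s\<close>
  alone.\<close>

lemma Lambda_primes:
  "{sjp_Lambda_preimage \<pp> | \<pp>. \<pp> \<in> prime_spectrum sjp_Lambda}
    = {P. P \<in> prime_spectrum (univ_ring :: 'k::field sjp ring) \<and> sjp_s \<in> P}"
proof -
  let ?K = "Idl\<^bsub>sjp_ring\<^esub> {sjp_s, sjp_x :: 'k sjp}"
  define \<pi> where "\<pi> = (\<lambda>a. ?K +>\<^bsub>sjp_ring\<^esub> a)"
  have Ki: "ideal ?K univ_ring" by (rule univ_Idl(1))
  have K: "sjp_s \<in> ?K" "sjp_x \<in> ?K" using univ_Idl(2)[of "{sjp_s, sjp_x :: 'k sjp}"] by auto
  have \<Lambda>: "ring (sjp_Lambda :: 'k sjp set ring)"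
    unfolding sjp_Lambda_def by (rule ideal.quotient_is_ring[OF Ki])
  have hom: "ring_hom_ring univ_ring (sjp_Lambda :: 'k sjp set ring) \<pi>"
    unfolding sjp_Lambda_def \<pi>_def by (rule ideal.rcos_ring_hom_ring[OF Ki])
  have car: "carrier (sjp_Lambda :: 'k sjp set ring) = range \<pi>"
    by (auto simp: sjp_Lambda_def \<pi>_def FactRing_def A_RCOSETS_def' )
  have h: "\<pi> \<in> Ring.ring_hom univ_ring (sjp_Lambda :: 'k sjp set ring)"
    using hom by (simp add: ring_hom_ring_def ring_hom_ring_axioms_def)
  have mult: "\<pi> (a * b) = \<pi> a \<otimes>\<^bsub>sjp_Lambda\<^esub> \<pi> b" for a b
    using ring_hom_mult[OF h, of a b] by simp
  have eq: "a - b \<in> ?K" if "\<pi> a = \<pi> b" for a b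
  proof -
    have "0 + a \<in> \<pi> a" using Ki by (force simp: \<pi>_def a_r_coset_def' ideal_univ_ring_iff)
    hence "a \<in> \<pi> b" using that by simp
    thus ?thesis by (auto simp: \<pi>_def a_r_coset_def')
  qed
  have K0: "\<pi> a = \<zero>\<^bsub>sjp_Lambda\<^esub>" if "a \<in> ?K" for a
  proof -
    have "\<pi> a = (\<lambda>k. k + a) ` ?K" by (auto simp: \<pi>_def a_r_coset_def')
    also have "\<dots> = ?K"
    proof (intro equalityI subsetI)
      fix k assume "k \<in> ?K"
      hence "k - a \<in> ?K" by (rule univ_ideal_minus(2)[OF Ki _ that])
      thus "k \<in> (\<lambda>k. k + a) ` ?K" by (intro image_eqI[of _ _ "k - a"]) simp_all
    qed (use Ki that in \<open>auto simp: ideal_univ_ring_iff\<close>)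
    finally have "\<pi> a = ?K" .
    thus ?thesis by (simp add: sjp_Lambda_def FactRing_def)
  qed
  have pre: "sjp_Lambda_preimage \<pp> = {a. \<pi> a \<in> \<pp>}" for \<pp>
    by (simp add: sjp_Lambda_preimage_def \<pi>_def)
  have 1: "sjp_Lambda_preimage \<pp> \<in> prime_spectrum univ_ring \<and> sjp_s \<in> sjp_Lambda_preimage \<pp>"
    if \<pp>: "\<pp> \<in> prime_spectrum (sjp_Lambda :: 'k sjp set ring)" for \<pp>
  proof -
    note \<pp>' = \<pp>[unfolded ring.prime_spectrum_elementwise[OF \<Lambda>]]
    have pi: "ideal \<pp> sjp_Lambda" using \<pp>' by blast
    have id: "ideal {a. \<pi> a \<in> \<pp>} univ_ring" using ring_hom_ring.ideal_vimage[OF hom pi] by simp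
    have "\<one>\<^bsub>sjp_Lambda\<^esub> \<notin> \<pp>" using \<pp>' ideal.one_imp_carrier[OF pi] by blast
    hence "\<pi> 1 \<notin> \<pp>" using ring_hom_one[OF h] by simp
    moreover have "\<pi> a \<in> \<pp> \<or> \<pi> b \<in> \<pp>" if ab: "\<forall>r. \<pi> (a * r * b) \<in> \<pp>" for a b
    proof -
      have "\<forall>r\<in>carrier sjp_Lambda. \<pi> a \<otimes>\<^bsub>sjp_Lambda\<^esub> r \<otimes>\<^bsub>sjp_Lambda\<^esub> \<pi> b \<in> \<pp>"
        using ab by (auto simp: car mult)
      thus ?thesis using \<pp>' car by blast
    qed
    moreover have "\<pi> sjp_s \<in> \<pp>"
      unfolding K0[OF K(1)] by (rule additive_subgroup.zero_closed[OF ideal.axioms(1)[OF pi]])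
    ultimately show ?thesis
      unfolding pre prime_spectrum_univ_iff mem_Collect_eq using id by blast
  qed
  have 2: "\<pi> ` P \<in> prime_spectrum sjp_Lambda \<and> sjp_Lambda_preimage (\<pi> ` P) = P"
    if P: "P \<in> prime_spectrum univ_ring" "sjp_s \<in> P" for P
  proof -
    note P' = P(1)[unfolded prime_spectrum_univ_iff]
    have Pi: "ideal P univ_ring" using P' by blast
    have KP: "?K \<subseteq> P" using P(2) prime_s_imp_x[OF P] by (intro univ_Idl(3)[OF Pi]) simp
    have mem: "\<pi> a \<in> \<pi> ` P \<longleftrightarrow> a \<in> P" for a
    proof
      assume "\<pi> a \<in> \<pi> ` P"
      then obtain b where b: "b \<in> P" "\<pi> a = \<pi> b" by blast
      have "(a - b) + b \<in> P" using eq[OF b(2)] KP b(1) Pi unfolding ideal_univ_ring_iff by blast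
      thus "a \<in> P" by simp
    qed simp
    have id: "ideal (\<pi> ` P) sjp_Lambda"
      unfolding sjp_Lambda_def \<pi>_def
        by (rule ring.ring_ideal_imp_quot_ideal[OF ring_univ_ring Ki Pi])
    have "\<pi> ` P \<noteq> carrier sjp_Lambda" using mem[of 1] P' unfolding car by blast
    moreover have "\<pi> a \<in> \<pi> ` P \<or> \<pi> b \<in> \<pi> ` P"
      if "\<forall>r\<in>carrier sjp_Lambda. \<pi> a \<otimes>\<^bsub>sjp_Lambda\<^esub> r \<otimes>\<^bsub>sjp_Lambda\<^esub> \<pi> b \<in> \<pi> ` P" for a b
    proof -
      have "\<forall>r. a * r * b \<in> P" using that by (simp add: car mem flip: mult)
      thus ?thesis using P' mem by blast
    qed
    ultimately have "\<pi> ` P \<in> prime_spectrum sjp_Lambda"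
      unfolding ring.prime_spectrum_elementwise[OF \<Lambda>] using id by (auto simp: car)
    moreover have "sjp_Lambda_preimage (\<pi> ` P) = P" by (simp add: pre mem)
    ultimately show ?thesis by blast
  qed
  show ?thesis
  proof (intro equalityI subsetI)
    fix P assume "P \<in> {sjp_Lambda_preimage \<pp> | \<pp>. \<pp> \<in> prime_spectrum (sjp_Lambda :: 'k sjp set
      ring)}"
    thus "P \<in> {P. P \<in> prime_spectrum univ_ring \<and> sjp_s \<in> P}" using 1 by blast
  next
    fix P assume "P \<in> {P. P \<in> prime_spectrum (univ_ring :: 'k sjp ring) \<and> sjp_s \<in> P}"
    hence "\<pi> ` P \<in> prime_spectrum sjp_Lambda" "P = sjp_Lambda_preimage (\<pi> ` P)" using 2[of P]
      by auto
    thus "P \<in> {sjp_Lambda_preimage \<pp> | \<pp>. \<pp> \<in> prime_spectrum (sjp_Lambda :: 'k sjp set ring)}"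
      by blast
  qed
qed

theorem sjp_prime_spectrum:
  assumes "CHAR('k::field) = p" "p > 0"
  shows "prime_spectrum (sjp_ring :: 'k sjp ring) =
     {sjp_Lambda_preimage \<pp> | \<pp>. \<pp> \<in> prime_spectrum sjp_Lambda} \<union>
     {sjp_contraction \<qq> | \<qq>. \<qq> \<in> prime_spectrum sjp_central_subalgebra}"
  unfolding Lambda_primes
  using prime_is_contraction[OF assms] contraction_is_prime[OF assms] by blast

section \<open>Primitive and maximal ideals\<close>

text \<open>\<open>L\<close> is the annihilator of a nonzero vector \<open>m\<close>. For a
  two-sided ideal \<open>I\<close>, the submodule \<open>I m\<close> is zero or everything; in the
  second case \<open>i m = m\<close> for some \<open>i\<close> in \<open>I\<close>, and
  \<open>1 - i\<close> lies in \<open>L\<close>. The annihilator of the module is the largest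
  two-sided ideal inside \<open>L\<close>.\<close>

lemma simple_module_left_ideal:
  fixes M :: "('a::ring_1, 'b, 'c) module_scheme"
  assumes "simple_module univ_ring M"
  obtains L where "0 \<in> L" "\<And>a b. a \<in> L \<Longrightarrow> b \<in> L \<Longrightarrow> a + b \<in> L" "\<And>r a. a \<in> L \<Longrightarrow> r * a \<in> L"
    "1 \<notin> L" "\<And>I. ideal I univ_ring \<Longrightarrow> I \<subseteq> L \<or> (\<exists>i\<in>I. 1 - i \<in> L)"
    "annihilator univ_ring M = {a. \<forall>b. a * b \<in> L}"
    "annihilator univ_ring M \<in> prime_spectrum univ_ring"
proof -
  from assms interpret left_module univ_ring M by (simp add: simple_module_def)
  have simple: "N = {\<zero>\<^bsub>M\<^esub>} \<or> N = carrier M" if "submodule N univ_ring M" for N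
    using assms that by (simp add: simple_module_def)
  obtain m where m: "m \<in> carrier M" "m \<noteq> \<zero>\<^bsub>M\<^esub>"
    using assms M.zero_closed unfolding simple_module_def by blast
  have closed: "a \<odot>\<^bsub>M\<^esub> v \<in> carrier M" if "v \<in> carrier M" for a v
    using smult_closed[of a v] that by simp
  have add: "(a + b) \<odot>\<^bsub>M\<^esub> v = a \<odot>\<^bsub>M\<^esub> v \<oplus>\<^bsub>M\<^esub> b \<odot>\<^bsub>M\<^esub> v" if "v \<in> carrier M" for a b v
    using smult_l_distr[of a b v] that by simp
  have mult: "(a * b) \<odot>\<^bsub>M\<^esub> v = a \<odot>\<^bsub>M\<^esub> (b \<odot>\<^bsub>M\<^esub> v)" if "v \<in> carrier M" for a b v
    using smult_assoc1[of a b v] that by simp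
  have one: "1 \<odot>\<^bsub>M\<^esub> v = v" if "v \<in> carrier M" for v
    using smult_one[of v] that by simp
  have zeroI: "u = \<zero>\<^bsub>M\<^esub>" if "u \<oplus>\<^bsub>M\<^esub> v = v" "u \<in> carrier M" "v \<in> carrier M" for u v
    using M.add.r_cancel_one[of v u] that by simp
  have zero: "0 \<odot>\<^bsub>M\<^esub> v = \<zero>\<^bsub>M\<^esub>" if "v \<in> carrier M" for v
    using add[OF that, of 0 0] closed[OF that, of 0] by (intro zeroI[of _ "0 \<odot>\<^bsub>M\<^esub> v"]) simp_all
  have smult_zero: "a \<odot>\<^bsub>M\<^esub> \<zero>\<^bsub>M\<^esub> = \<zero>\<^bsub>M\<^esub>" for a
    using mult[of "\<zero>\<^bsub>M\<^esub>" a 0] zero[of "\<zero>\<^bsub>M\<^esub>"] by simp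
  \<comment> \<open>Applied to the whole ring, this makes every nonzero vector a generator; applied
    to a two-sided ideal, it gives the dichotomy for \<open>L\<close>.\<close>
  have orbit: "{i \<odot>\<^bsub>M\<^esub> v | i. i \<in> I} = {\<zero>\<^bsub>M\<^esub>} \<or> {i \<odot>\<^bsub>M\<^esub> v | i. i \<in> I} = carrier M"
    if v: "v \<in> carrier M" and I: "0 \<in> I" "\<And>a b. a \<in> I \<Longrightarrow> b \<in> I \<Longrightarrow> a + b \<in> I"
      "\<And>r a. a \<in> I \<Longrightarrow> r * a \<in> I" for v and I :: "'a set"
  proof (rule simple, rule submodule.intro)
    let ?N = "{i \<odot>\<^bsub>M\<^esub> v | i. i \<in> I}"
    show "subgroup ?N (add_monoid M)"
    proof (rule M.add.subgroupI)
      show "?N \<subseteq> carrier M" using closed[OF v] by blast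
      show "?N \<noteq> {}" using I(1) by blast
      show "u \<oplus>\<^bsub>M\<^esub> w \<in> ?N" if uw: "u \<in> ?N" "w \<in> ?N" for u w
      proof -
        obtain a b where "a \<in> I" "b \<in> I" "u = a \<odot>\<^bsub>M\<^esub> v" "w = b \<odot>\<^bsub>M\<^esub> v" using uw by blast
        thus ?thesis using add[OF v, of a b] I(2) by (intro CollectI exI[of _ "a + b"]) simp
      qed
      fix u assume "u \<in> ?N"
      then obtain a where a: "a \<in> I" "u = a \<odot>\<^bsub>M\<^esub> v" by blast
      have "((- 1) * a) \<odot>\<^bsub>M\<^esub> v \<oplus>\<^bsub>M\<^esub> a \<odot>\<^bsub>M\<^esub> v = \<zero>\<^bsub>M\<^esub>"
        using add[OF v, of "- a" a] zero[OF v] by simp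
      hence "\<ominus>\<^bsub>M\<^esub> u = ((- 1) * a) \<odot>\<^bsub>M\<^esub> v"
        unfolding a(2) using closed[OF v] by (intro M.minus_equality) simp_all
      thus "\<ominus>\<^bsub>M\<^esub> u \<in> ?N" using I(3)[OF a(1)] by blast
    qed
    show "submodule_axioms ?N univ_ring M"
    proof
      fix a u assume "u \<in> ?N"
      then obtain b where b: "b \<in> I" "u = b \<odot>\<^bsub>M\<^esub> v" by blast
      thus "a \<odot>\<^bsub>M\<^esub> u \<in> ?N" using mult[OF v, of a b] I(3)[OF b(1), of a]
        by (metis (mono_tags, lifting) mem_Collect_eq)
    qed
  qed
  have cyclic: "\<exists>r. r \<odot>\<^bsub>M\<^esub> v = w" if v: "v \<in> carrier M" "v \<noteq> \<zero>\<^bsub>M\<^esub>" and w: "w \<in> carrier M" for v w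
  proof -
    have "1 \<odot>\<^bsub>M\<^esub> v \<in> {i \<odot>\<^bsub>M\<^esub> v | i. i \<in> UNIV}" by blast
    hence "{i \<odot>\<^bsub>M\<^esub> v | i. i \<in> UNIV} = carrier M"
      using orbit[OF v(1), of UNIV] one[OF v(1)] v(2) by auto
    with w have "w \<in> {i \<odot>\<^bsub>M\<^esub> v | i. i \<in> UNIV}" by simp
    thus ?thesis by auto
  qed
  define L where "L = {a. a \<odot>\<^bsub>M\<^esub> m = \<zero>\<^bsub>M\<^esub>}"
  have L1: "I \<subseteq> L \<or> (\<exists>i\<in>I. 1 - i \<in> L)" if I: "ideal I univ_ring" for I
  proof -
    note I' = I[unfolded ideal_univ_ring_iff]
    have "{i \<odot>\<^bsub>M\<^esub> m | i. i \<in> I} = {\<zero>\<^bsub>M\<^esub>} \<or> {i \<odot>\<^bsub>M\<^esub> m | i. i \<in> I} = carrier M"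
      using I' by (intro orbit[OF m(1)]) blast+
    thus ?thesis
    proof
      assume "{i \<odot>\<^bsub>M\<^esub> m | i. i \<in> I} = {\<zero>\<^bsub>M\<^esub>}"
      thus ?thesis by (auto simp: L_def)
    next
      assume "{i \<odot>\<^bsub>M\<^esub> m | i. i \<in> I} = carrier M"
      then obtain i where i: "i \<in> I" "i \<odot>\<^bsub>M\<^esub> m = m" using m(1) by force
      have "(1 - i) \<odot>\<^bsub>M\<^esub> m \<oplus>\<^bsub>M\<^esub> m = m" using add[OF m(1), of "1 - i" i] i(2) one[OF m(1)] by simp
      hence "(1 - i) \<odot>\<^bsub>M\<^esub> m = \<zero>\<^bsub>M\<^esub>" by (rule zeroI[OF _ closed[OF m(1)] m(1)])
      thus ?thesis using i(1) by (auto simp: L_def)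
    qed
  qed
  have ann: "annihilator univ_ring M = {a. \<forall>v\<in>carrier M. a \<odot>\<^bsub>M\<^esub> v = \<zero>\<^bsub>M\<^esub>}"
    by (simp add: annihilator_def)
  have annL: "annihilator univ_ring M = {a. \<forall>b. a * b \<in> L}"
    unfolding ann L_def using cyclic[OF m] closed[OF m(1)] mult[OF m(1)] by force
  have L: "0 \<in> L" "\<And>a b. a \<in> L \<Longrightarrow> b \<in> L \<Longrightarrow> a + b \<in> L" "\<And>r a. a \<in> L \<Longrightarrow> r * a \<in> L" "1 \<notin> L"
    using zero[OF m(1)] one[OF m(1)] m(2)
    by (auto simp: L_def add[OF m(1)] mult[OF m(1)] smult_zero)
  have prime: "annihilator univ_ring M \<in> prime_spectrum univ_ring"
    unfolding prime_spectrum_univ_iff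
  proof (intro conjI allI impI)
    show "ideal (annihilator univ_ring M) univ_ring"
      unfolding annL ideal_univ_ring_iff using L by (auto simp: distrib_right mult.assoc)
    show "1 \<notin> annihilator univ_ring M" unfolding annL using L(4) by (auto intro!: exI[of _ 1])
    fix a b assume ab: "\<forall>r. a * r * b \<in> annihilator univ_ring M"
    have "a \<in> annihilator univ_ring M" if "b \<notin> annihilator univ_ring M"
    proof -
      obtain v where v: "v \<in> carrier M" "b \<odot>\<^bsub>M\<^esub> v \<noteq> \<zero>\<^bsub>M\<^esub>" using \<open>b \<notin> _\<close> unfolding ann by blast
      have "a \<odot>\<^bsub>M\<^esub> w = \<zero>\<^bsub>M\<^esub>" if w: "w \<in> carrier M" for w
      proof -
        obtain r where "r \<odot>\<^bsub>M\<^esub> (b \<odot>\<^bsub>M\<^esub> v) = w" using cyclic[OF closed[OF v(1)] v(2) w] by blast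
        hence "a \<odot>\<^bsub>M\<^esub> w = (a * r * b) \<odot>\<^bsub>M\<^esub> v" using v(1) by (simp add: mult closed)
        moreover have "(a * r * b) \<odot>\<^bsub>M\<^esub> v = \<zero>\<^bsub>M\<^esub>" using ab v(1) by (simp add: ann)
        ultimately show ?thesis by simp
      qed
      thus ?thesis unfolding ann by blast
    qed
    thus "a \<in> annihilator univ_ring M \<or> b \<in> annihilator univ_ring M" by blast
  qed
  show ?thesis by (rule that[OF L L1 annL prime])
qed

section \<open>Elements that become scalars modulo a prime ideal\<close>

lemma commutes_modI:
  fixes P :: "'k::field sjp set"
  assumes P: "ideal P univ_ring" and x: "u * sjp_x - sjp_x * u \<in> P"
    and y: "u * sjp_y - sjp_y * u \<in> P"
    and g: "u * sjp_g - sjp_g * u \<in> P"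
  shows "u * a - a * u \<in> P"
proof (induction a rule: sjp_induct)
  note Pi = P[unfolded ideal_univ_ring_iff]
  case (scalar c)
  show ?case using Pi by (simp add: sjp_scalar_commute)
next
  note Pi = P[unfolded ideal_univ_ring_iff]
  case (gen i)
  \<comment> \<open>The commutator with \<open>g\<inverse>\<close> is
    \<open>- g\<inverse> (u g - g u) g\<inverse>\<close>.\<close>
  have "sjp_ginv * (- (u * sjp_g - sjp_g * u)) * sjp_ginv \<in> P"
    using Pi univ_ideal_minus(1)[OF P g] by blast
  moreover have "sjp_ginv * (- (u * sjp_g - sjp_g * u)) * sjp_ginv
      = sjp_ginv * sjp_g * u * sjp_ginv - sjp_ginv * u * (sjp_g * sjp_ginv)"
    by (simp add: right_diff_distrib left_diff_distrib mult.assoc)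
  ultimately have "u * sjp_ginv - sjp_ginv * u \<in> P" by (simp add: sjp_relations(3,4))
  thus ?case using x y g by (cases i) auto
next
  note Pi = P[unfolded ideal_univ_ring_iff]
  case (add a b)
  hence "(u * a - a * u) + (u * b - b * u) \<in> P" using Pi by blast
  thus ?case by (simp add: algebra_simps)
next
  note Pi = P[unfolded ideal_univ_ring_iff]
  case (mult a b)
  hence "(u * a - a * u) * b + a * (u * b - b * u) \<in> P" using Pi by blast
  thus ?case by (simp add: algebra_simps)
qed

text \<open>Over an algebraically closed field \<open>F\<close> splits into linear factors. Modulo
  \<open>P\<close> the element \<open>u\<close> is central, so primeness puts one factor
  \<open>u - r\<close> into \<open>P\<close>; the factors are split off one at a time.\<close>

lemma prime_root:
  fixes P :: "'k::alg_closed_field sjp set"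
  assumes P: "P \<in> prime_spectrum univ_ring" and comm: "\<And>a. u * a - a * u \<in> P"
    and F: "F \<noteq> 0" "eval_poly sjp_scalar u F \<in> P"
  shows "\<exists>r. poly F r = 0 \<and> u - sjp_scalar r \<in> P"
  using F
proof (induction "degree F" arbitrary: F)
  note P' = P[unfolded prime_spectrum_univ_iff]
  have Pi: "ideal P univ_ring" using P' by blast
  note Pii = Pi[unfolded ideal_univ_ring_iff]
  case 0
  then obtain e where e: "F = [:e:]" by (metis degree_eq_zeroE)
  hence "e \<noteq> 0" "sjp_scalar e \<in> P" using 0
    by (simp_all add: eval_poly_const[OF unital_hom_sjp_scalar])
  hence "sjp_scalar (inverse e) * sjp_scalar e \<in> P" using Pii by blast
  hence "1 \<in> P" using \<open>e \<noteq> 0\<close> by (simp add: sjp_scalar_hom(4) flip: sjp_scalar_hom(2))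
  thus ?case using P' by blast
next
  note P' = P[unfolded prime_spectrum_univ_iff]
  have Pi: "ideal P univ_ring" using P' by blast
  note Pii = Pi[unfolded ideal_univ_ring_iff]
  case (Suc n)
  have hom: "unital_hom (eval_poly sjp_scalar u)"
    by (rule unital_hom_eval_poly[OF unital_hom_sjp_scalar]) (rule sjp_scalar_commute)
  obtain r where r: "poly F r = 0" using alg_closed_imp_poly_has_root[of F] Suc.hyps(2) by auto
  then obtain G where G: "F = [:- r, 1:] * G" using poly_eq_0_iff_dvd by blast
  have "G \<noteq> 0" using Suc.prems(1) by (auto simp: G)
  moreover from this have "degree F = Suc (degree G)" unfolding G by (subst degree_mult_eq) simp_all
  ultimately have G0: "G \<noteq> 0" "degree G = n" using Suc.hyps(2) by simp_all
  have lin: "eval_poly sjp_scalar u [:- r, 1:] = u - sjp_scalar r"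
    by (simp add: eval_poly_pCons[OF unital_hom_sjp_scalar] unital_homD[OF unital_hom_sjp_scalar])
  have FG: "(u - sjp_scalar r) * eval_poly sjp_scalar u G \<in> P"
    using Suc.prems(2) unfolding G unital_homD(3)[OF hom] lin .
  have "(u - sjp_scalar r) * a * eval_poly sjp_scalar u G \<in> P" for a
  proof -
    have "a * ((u - sjp_scalar r) * eval_poly sjp_scalar u G) +
      (u * a - a * u) * eval_poly sjp_scalar u G \<in> P"
      using Pii FG comm by blast
    thus ?thesis by (simp add: algebra_simps sjp_scalar_commute[of r a] flip: mult.assoc)
  qed
  hence "u - sjp_scalar r \<in> P \<or> eval_poly sjp_scalar u G \<in> P" using P' by blast
  thus ?case
  proof
    assume "eval_poly sjp_scalar u G \<in> P"
    then obtain r' where "poly G r' = 0" "u - sjp_scalar r' \<in> P" using Suc.hyps(1)[of G] G0 by auto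
    thus ?thesis by (intro exI[of _ r']) (simp add: G)
  qed (use r in blast)
qed

lemma prime_power_root:
  fixes P :: "'k::alg_closed_field sjp set"
  assumes P: "P \<in> prime_spectrum univ_ring" and comm: "\<And>a. u * a - a * u \<in> P"
    and u: "u ^ n - sjp_scalar c \<in> P" and n: "n > 0"
  obtains r where "r ^ n = c" "u - sjp_scalar r \<in> P"
proof -
  let ?F = "[:0, 1:] ^ n - [:c:]"
  have hom: "unital_hom (eval_poly sjp_scalar u)"
    by (rule unital_hom_eval_poly[OF unital_hom_sjp_scalar]) (rule sjp_scalar_commute)
  have pF: "poly ?F r = r ^ n - c" for r by simp
  \<comment> \<open>The values \<open>- c\<close> at \<open>0\<close> and \<open>1 - c\<close> at
    \<open>1\<close> cannot both vanish.\<close>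
  have "?F \<noteq> 0"
  proof
    assume "?F = 0"
    hence "(0 :: 'k) ^ n - c = 0" "(1 :: 'k) ^ n - c = 0" unfolding pF[symmetric] by simp_all
    thus False using n by (simp add: power_0_left)
  qed
  moreover have "eval_poly sjp_scalar u ?F \<in> P"
    using u by (simp add: unital_homD[OF hom] eval_poly_const[OF unital_hom_sjp_scalar]
      eval_poly_X[OF unital_hom_sjp_scalar])
  ultimately obtain r where "poly ?F r = 0" "u - sjp_scalar r \<in> P"
    using prime_root[OF P comm] by blast
  thus ?thesis using that[of r] unfolding pF by simp
qed

definition sjp_max_ideals :: "nat \<Rightarrow> 'k::field sjp set set" where
  "sjp_max_ideals p =
       {Idl\<^bsub>sjp_ring\<^esub> {sjp_s, sjp_x, sjp_y, sjp_g - sjp_scalar \<gamma>} | \<gamma>. \<gamma> \<noteq> 0} \<union>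
       {Idl\<^bsub>sjp_ring\<^esub> {sjp_s, sjp_x, sjp_y ^ 2 - sjp_scalar \<alpha>, sjp_g ^ 2 - sjp_scalar \<beta>} | \<alpha> \<beta>.
          \<alpha> \<noteq> 0 \<and> \<beta> \<noteq> 0} \<union>
       {Idl\<^bsub>sjp_ring\<^esub> {sjp_C - sjp_scalar \<alpha>, sjp_s ^ p - sjp_scalar \<beta>,
         sjp_y ^ (2 * p) - sjp_scalar \<gamma>}
          | \<alpha> \<beta> \<gamma>. \<alpha> \<noteq> 0 \<and> \<beta> \<noteq> 0}"

section \<open>The listed ideals and the primes containing their generators\<close>

context
  fixes p :: nat
  assumes p: "CHAR('k::alg_closed_field) = p" and p0: "p > 0" and two: "(2 :: 'k) \<noteq> 0"
begin

abbreviation max_ideals :: "'k sjp set set" where "max_ideals \<equiv> sjp_max_ideals p"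

lemma sjp_max_idealsI:
  "\<gamma> \<noteq> 0 \<Longrightarrow> Idl\<^bsub>sjp_ring\<^esub> {sjp_s, sjp_x, sjp_y, sjp_g - sjp_scalar \<gamma>} \<in> max_ideals"
  "\<alpha> \<noteq> 0 \<Longrightarrow> \<beta> \<noteq> 0 \<Longrightarrow>
     Idl\<^bsub>sjp_ring\<^esub> {sjp_s, sjp_x, sjp_y ^ 2 - sjp_scalar \<alpha>, sjp_g ^ 2 - sjp_scalar \<beta>} \<in> max_ideals"
  "\<alpha> \<noteq> 0 \<Longrightarrow> \<beta> \<noteq> 0 \<Longrightarrow>
     Idl\<^bsub>sjp_ring\<^esub> {sjp_C - sjp_scalar \<alpha>, sjp_s ^ p - sjp_scalar \<beta>,
       sjp_y ^ (2 * p) - sjp_scalar \<gamma>} \<in> max_ideals"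
  unfolding sjp_max_ideals_def by blast+

text \<open>The kernel is a proper ideal containing the three generators, so
  \<open>central_ideal_maximal\<close> identifies it with the ideal they generate.\<close>

lemma central_kernel:
  fixes \<alpha> \<beta> \<gamma> :: 'k
  assumes nz: "\<alpha> \<noteq> 0" "\<beta> \<noteq> 0"
  obtains \<rho> :: "'k sjp \<Rightarrow> 'k mat" where "sjp_mat_rep (2 * p) \<rho>"
    "{a. \<rho> a = 0\<^sub>m (2 * p) (2 * p)}
      = Idl\<^bsub>sjp_ring\<^esub> {sjp_C - sjp_scalar \<alpha>, sjp_s ^ p - sjp_scalar \<beta>,
        sjp_y ^ (2 * p) - sjp_scalar \<gamma>}"
proof -
  obtain \<rho> :: "'k sjp \<Rightarrow> 'k mat" where \<rho>: "sjp_mat_rep (2 * p) \<rho>"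
    "{sjp_C - sjp_scalar \<alpha>, sjp_s ^ p - sjp_scalar \<beta>, sjp_y ^ (2 * p) - sjp_scalar \<gamma>}
      \<subseteq> {a. \<rho> a = 0\<^sub>m (2 * p) (2 * p)}" (is "?X \<subseteq> ?K")
    using ex_mat_rep_2p[OF p p0 nz] by blast
  have "?K \<in> max_spectrum univ_ring" using sjp_mat_rep_max[OF \<rho>(1)] p0 by simp
  hence K: "ideal ?K univ_ring" "1 \<notin> ?K" unfolding max_spectrum_univ_iff by blast+
  have "?K = Idl\<^bsub>sjp_ring\<^esub> ?X"
    by (rule central_ideal_maximal[OF p p0 nz K univ_Idl(3)[OF K(1) \<rho>(2)]])
  thus ?thesis by (rule that[OF \<rho>(1)])
qed

lemma sjp_max_ideals_subset: "max_ideals \<subseteq> max_spectrum univ_ring" "max_ideals \<subseteq> prim_spectrum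
  univ_ring"
proof -
  have "I \<in> max_spectrum univ_ring \<and> I \<in> prim_spectrum univ_ring" if I: "I \<in> max_ideals" for I
  proof -
    have ker: ?thesis if "sjp_mat_rep n \<rho>" "n > 0" "{a. \<rho> a = 0\<^sub>m n n} = I" for n
      and \<rho> :: "'k sjp \<Rightarrow> 'k mat"
      using sjp_mat_rep_max[OF that(1,2)] sjp_mat_rep_prim[OF that(1,2)] that(3) by simp
    from I consider (a) \<gamma> where "\<gamma> \<noteq> 0" "I = Idl\<^bsub>sjp_ring\<^esub> {sjp_s, sjp_x, sjp_y,
      sjp_g - sjp_scalar \<gamma>}"
      | (b) \<alpha> \<beta> where "\<alpha> \<noteq> 0" "\<beta> \<noteq> 0"
        "I = Idl\<^bsub>sjp_ring\<^esub> {sjp_s, sjp_x, sjp_y ^ 2 - sjp_scalar \<alpha>, sjp_g ^ 2 - sjp_scalar \<beta>}"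
      | (c) \<alpha> \<beta> \<gamma> where "\<alpha> \<noteq> 0" "\<beta> \<noteq> 0"
        "I = Idl\<^bsub>sjp_ring\<^esub> {sjp_C - sjp_scalar \<alpha>, sjp_s ^ p - sjp_scalar \<beta>,
          sjp_y ^ (2 * p) - sjp_scalar \<gamma>}"
      unfolding sjp_max_ideals_def by blast
    thus ?thesis
    proof cases
      case (a \<gamma>)
      obtain \<chi> :: "'k sjp \<Rightarrow> 'k" where \<chi>: "unital_hom \<chi>" "\<And>c. \<chi> (sjp_scalar c) = c"
        "{a. \<chi> a = 0} = Idl\<^bsub>sjp_ring\<^esub> {sjp_s, sjp_x, sjp_y, sjp_g - sjp_scalar \<gamma>}"
        using ex_character_quotient[OF a(1)] by blast
      show ?thesis
        using ker[OF sjp_character_mat_rep(1)[OF \<chi>(1,2)]]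
        unfolding sjp_character_mat_rep(2)[OF \<chi>(1,2)] \<chi>(3) a(2) by simp
    next
      case (b \<alpha> \<beta>)
      show ?thesis
        by (rule ex_mat_rep_2[OF b(1,2) two]) (rule ker, assumption, simp_all add: b(3))
    next
      case (c \<alpha> \<beta> \<gamma>)
      show ?thesis
        by (rule central_kernel[OF c(1,2), of \<gamma>]) (rule ker, assumption, use p0 in
          \<open>simp_all add: c(3)\<close>)
    qed
  qed
  thus "max_ideals \<subseteq> max_spectrum univ_ring" "max_ideals \<subseteq> prim_spectrum univ_ring" by blast+
qed

text \<open>Powers of \<open>g\<close> are invertible, hence lie in no proper ideal.\<close>

lemma prime_g_power:
  fixes P :: "'k sjp set"
  assumes P: "P \<in> prime_spectrum univ_ring" and g: "sjp_g ^ n - sjp_scalar c \<in> P"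
  shows "c \<noteq> 0"
proof
  assume "c = 0"
  hence "sjp_g ^ n \<in> P" using g by (simp add: sjp_scalar_hom)
  hence "sjp_g ^ n * sjp_ginv ^ n \<in> P" using P unfolding prime_spectrum_univ_iff ideal_univ_ring_iff
    by blast
  thus False using P unfolding sjp_g_power_ginv prime_spectrum_univ_iff by blast
qed

lemma prime_eq_max_ideal:
  assumes P: "P \<in> prime_spectrum univ_ring" and I: "Idl\<^bsub>sjp_ring\<^esub> X \<in> max_ideals" and X: "X \<subseteq> P"
  shows "P \<in> max_ideals"
proof -
  have Pi: "ideal P univ_ring" "1 \<notin> P" using P unfolding prime_spectrum_univ_iff by blast+
  have "Idl\<^bsub>sjp_ring\<^esub> X \<in> max_spectrum univ_ring" using sjp_max_ideals_subset(1) I by blast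
  hence "P = Idl\<^bsub>sjp_ring\<^esub> X"
    using Pi univ_Idl(3)[OF Pi(1) X] unfolding max_spectrum_univ_iff by metis
  thus ?thesis using I by simp
qed

text \<open>Modulo \<open>s\<close> and \<open>x\<close>, the squares of \<open>y\<close> and
  \<open>g\<close> are central and become scalars \<open>\<alpha>\<close> and
  \<open>\<beta>\<close>. A nonzero \<open>\<alpha>\<close> leads to the second family. For
  \<open>\<alpha> = 0\<close>, \<open>y\<close> is normal modulo \<open>P\<close> with its square in
  \<open>P\<close>, so it lies in \<open>P\<close> itself; then \<open>g\<close> is central as well,
  and the first family results.\<close>

lemma prime_in_max_ideals_s:
  assumes P: "P \<in> prime_spectrum univ_ring" and s: "sjp_s \<in> P"
    and y: "sjp_y ^ (2 * p) - sjp_scalar \<gamma> \<in> P" and g: "sjp_g ^ (2 * p) - sjp_scalar \<delta> \<in> P"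
  shows "P \<in> max_ideals"
proof -
  have Pi: "ideal P univ_ring" using P unfolding prime_spectrum_univ_iff by blast
  note Pii = Pi[unfolded ideal_univ_ring_iff]
  have x: "sjp_x \<in> P" by (rule prime_s_imp_x[OF P s])
  have "sjp_y ^ 2 * sjp_x - sjp_x * sjp_y ^ 2 \<in> P" "sjp_y ^ 2 * sjp_y - sjp_y * sjp_y ^ 2 \<in> P"
    "sjp_y ^ 2 * sjp_g - sjp_g * sjp_y ^ 2 \<in> P"
    using Pii s by (simp_all add: sjp_y2_x sjp_y2_g power_commutes)
  hence y2: "sjp_y ^ 2 * a - a * sjp_y ^ 2 \<in> P" for a by (rule commutes_modI[OF Pi])
  obtain \<alpha> where \<alpha>: "sjp_y ^ 2 - sjp_scalar \<alpha> \<in> P"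
    using prime_power_root[OF P y2 _ p0, of \<gamma>] y by (auto simp: power_mult)
  have "sjp_g ^ 2 * sjp_x - sjp_x * sjp_g ^ 2 \<in> P"
    using Pii x by (simp add: sjp_x_g_power)
  moreover have "sjp_g ^ 2 * sjp_y - sjp_y * sjp_g ^ 2 \<in> P"
  proof -
    have "sjp_g ^ 2 * sjp_y - sjp_y * sjp_g ^ 2 = - (sjp_g ^ 2 * (of_nat 2 * (sjp_x :: 'k sjp)))"
      by (simp add: sjp_y_g_power distrib_left)
    moreover have "sjp_g ^ 2 * (of_nat 2 * sjp_x) \<in> P" using Pii x by blast
    ultimately show ?thesis using univ_ideal_minus(1)[OF Pi] by simp
  qed
  moreover have "sjp_g ^ 2 * sjp_g - sjp_g * sjp_g ^ 2 \<in> P" using Pii by (simp add: power_commutes)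
  ultimately have g2: "sjp_g ^ 2 * a - a * sjp_g ^ 2 \<in> P" for a by (rule commutes_modI[OF Pi])
  obtain \<beta> where \<beta>: "sjp_g ^ 2 - sjp_scalar \<beta> \<in> P"
    using prime_power_root[OF P g2 _ p0, of \<delta>] g by (auto simp: power_mult)
  have \<beta>0: "\<beta> \<noteq> 0" by (rule prime_g_power[OF P \<beta>])
  show ?thesis
  proof (cases "\<alpha> = 0")
    case False
    show ?thesis
      by (rule prime_eq_max_ideal[OF P sjp_max_idealsI(2)[OF False \<beta>0]]) (use s x \<alpha> \<beta> in simp)
  next
    case True
    hence "sjp_y * sjp_y \<in> P" using \<alpha> by (simp add: sjp_scalar_hom power2_eq_square)
    moreover have "\<exists>b. sjp_y * sjp_gen i - b * sjp_y \<in> P" for i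
    proof -
      have "sjp_y * sjp_x - (- sjp_x) * sjp_y = (sjp_s :: 'k sjp)" by (simp add: sjp_y_x)
      hence 1: "sjp_y * sjp_x - (- sjp_x) * sjp_y \<in> P" using s by simp
      have 2: "sjp_y * sjp_y - sjp_y * sjp_y \<in> P" using Pii by simp
      have "sjp_y * sjp_g - (- sjp_g) * sjp_y = - (sjp_g * (sjp_x :: 'k sjp))"
        by (simp add: sjp_y_g distrib_left)
      hence 3: "sjp_y * sjp_g - (- sjp_g) * sjp_y \<in> P"
        using Pii x univ_ideal_minus(1)[OF Pi, of "sjp_g * sjp_x"] by simp
      have "sjp_y * sjp_ginv - (- sjp_ginv) * sjp_y = - (sjp_x * (sjp_ginv :: 'k sjp))"
        by (simp add: sjp_ginv_y distrib_right)
      hence 4: "sjp_y * sjp_ginv - (- sjp_ginv) * sjp_y \<in> P"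
        using Pii x univ_ideal_minus(1)[OF Pi, of "sjp_x * sjp_ginv"] by simp
      show ?thesis using 1 2 3 4 by (cases i) blast+
    qed
    ultimately have y: "sjp_y \<in> P" by (rule prime_normal_square[OF P])
    have "sjp_g * sjp_x - sjp_x * sjp_g \<in> P" "sjp_g * sjp_y - sjp_y * sjp_g \<in> P"
      "sjp_g * sjp_g - sjp_g * sjp_g \<in> P"
      using Pii x y univ_ideal_minus(2)[OF Pi] by simp_all
    hence g1: "sjp_g * a - a * sjp_g \<in> P" for a by (rule commutes_modI[OF Pi])
    obtain \<delta>' where \<delta>': "sjp_g - sjp_scalar \<delta>' \<in> P"
      using prime_power_root[OF P g1 \<beta>] by auto
    have "\<delta>' \<noteq> 0" using prime_g_power[OF P, of 1] \<delta>' by simp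
    show ?thesis
      by (rule prime_eq_max_ideal[OF P sjp_max_idealsI(1)[OF \<open>\<delta>' \<noteq> 0\<close>]]) (use s x y \<delta>' in simp)
  qed
qed

text \<open>The relation \<open>C\<^sup>2 g\<^sup>2 = s\<^sup>2\<close> raised to the power
  \<open>n\<close>, using that \<open>C\<^sup>2\<close> is central.\<close>

lemma C_g_power: "(sjp_C * sjp_C) ^ n * sjp_g ^ (2 * n) = (sjp_s ^ (2 * n) :: 'k sjp)"
proof -
  define D where "D = (sjp_C * sjp_C :: 'k sjp)"
  have Dg2: "D * (sjp_g * sjp_g) = sjp_s * sjp_s"
  proof -
    have "D * (sjp_g * sjp_g) = sjp_s * sjp_s * (sjp_ginv * (sjp_ginv * sjp_g) * sjp_g)"
      unfolding D_def sjp_C_square by (simp only: mult.assoc)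
    thus ?thesis by (simp add: sjp_relations(4))
  qed
  have sq: "a ^ (2 * Suc n) = a ^ (2 * n) * (a * a)" for a :: "'k sjp" and n
    using power_add[of a "2 * n" 2] by (simp add: power2_eq_square)
  have comm: "D * a = a * D" for a unfolding D_def by (metis sjp_central_C mult.assoc)
  have "D ^ n * sjp_g ^ (2 * n) = sjp_s ^ (2 * n)" for n
  proof (induction n)
    case (Suc n)
    have "D ^ Suc n * sjp_g ^ (2 * Suc n) = D ^ n * (D * sjp_g ^ (2 * n)) * (sjp_g * sjp_g)"
      by (simp only: power_Suc2 sq mult.assoc)
    also have "\<dots> = D ^ n * sjp_g ^ (2 * n) * (D * (sjp_g * sjp_g))"
      by (simp only: comm[of "sjp_g ^ (2 * n)"] mult.assoc)
    also have "\<dots> = sjp_s ^ (2 * n) * (sjp_s * sjp_s)" by (simp only: Suc.IH Dg2)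
    finally show ?case by (simp only: sq)
  qed simp
  thus ?thesis by (simp add: D_def)
qed

text \<open>If \<open>s\<close> is outside \<open>P\<close>, then \<open>\<beta>\<close> is nonzero,
  and \<open>C_g_power\<close> turns the scalars for \<open>s^p\<close> and \<open>g^(2p)\<close>
  into \<open>C^(2p) = \<beta>\<^sup>2 / \<delta>\<close> modulo \<open>P\<close>. As
  \<open>C\<close> is central, it is itself a scalar modulo \<open>P\<close>, and a nonzero
  one.\<close>

lemma prime_in_max_ideals:
  assumes P: "P \<in> prime_spectrum univ_ring" and s: "sjp_s ^ p - sjp_scalar \<beta> \<in> P"
    and y: "sjp_y ^ (2 * p) - sjp_scalar \<gamma> \<in> P" and g: "sjp_g ^ (2 * p) - sjp_scalar \<delta> \<in> P"
  shows "P \<in> max_ideals"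
proof (cases "sjp_s \<in> P")
  case True
  thus ?thesis by (rule prime_in_max_ideals_s[OF P _ y g])
next
  case False
  have Pi: "ideal P univ_ring" and P1: "1 \<notin> P" using P unfolding prime_spectrum_univ_iff by blast+
  note Pii = Pi[unfolded ideal_univ_ring_iff]
  have \<delta>: "\<delta> \<noteq> 0" by (rule prime_g_power[OF P g])
  have \<beta>: "\<beta> \<noteq> 0"
  proof
    assume "\<beta> = 0"
    hence "1 * sjp_s ^ p \<in> P" using s by (simp add: sjp_scalar_hom)
    thus False using prime_s_power[OF p p0 P False] P1 by blast
  qed
  let ?D = "sjp_C ^ (2 * p) :: 'k sjp"
  have "?D = (sjp_C * sjp_C) ^ p" by (simp add: power_mult power2_eq_square)
  moreover have "sjp_s ^ (2 * p) = (sjp_s ^ p * sjp_s ^ p :: 'k sjp)"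
    by (simp add: mult_2 power_add)
  ultimately have D: "?D * sjp_g ^ (2 * p) = sjp_s ^ p * sjp_s ^ p" by (simp only: C_g_power)
  have "(sjp_s ^ p - sjp_scalar \<beta>) * sjp_s ^ p + sjp_scalar \<beta> * (sjp_s ^ p - sjp_scalar \<beta>) \<in> P"
    "?D * (sjp_g ^ (2 * p) - sjp_scalar \<delta>) \<in> P"
    using Pii s g by blast+
  hence "(sjp_s ^ p * sjp_s ^ p - ?D * sjp_scalar \<delta>)
      - ((sjp_s ^ p - sjp_scalar \<beta>) * sjp_s ^ p + sjp_scalar \<beta> * (sjp_s ^ p - sjp_scalar \<beta>)) \<in> P"
    by (intro univ_ideal_minus(2)[OF Pi, of "_ - _" "_ + _"]) (simp_all add: right_diff_distrib D)
  hence "sjp_scalar (\<beta> * \<beta>) - ?D * sjp_scalar \<delta> \<in> P"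
    by (simp add: left_diff_distrib right_diff_distrib sjp_scalar_hom)
  hence "- (sjp_scalar (\<beta> * \<beta>) - ?D * sjp_scalar \<delta>) * sjp_scalar (inverse \<delta>) \<in> P"
    using Pii univ_ideal_minus(1)[OF Pi] by blast
  hence "?D - sjp_scalar (\<beta> * \<beta> * inverse \<delta>) \<in> P"
    using \<delta> by (simp add: left_diff_distrib mult.assoc sjp_scalar_hom(4) flip: sjp_scalar_hom(2))
  moreover have "sjp_C * a - a * sjp_C \<in> P" for a using Pii sjp_central_C[of a] by simp
  ultimately obtain \<alpha> where \<alpha>: "\<alpha> ^ (2 * p) = \<beta> * \<beta> * inverse \<delta>" "sjp_C - sjp_scalar \<alpha> \<in> P"
    using prime_power_root[OF P, of sjp_C "2 * p" "\<beta> * \<beta> * inverse \<delta>"] p0 by auto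
  have "\<alpha> \<noteq> 0" using \<alpha>(1) \<beta> \<delta> p0 by (auto simp: power_0_left)
  show ?thesis
    by (rule prime_eq_max_ideal[OF P sjp_max_idealsI(3)[OF \<open>\<alpha> \<noteq> 0\<close> \<beta>]]) (use s y \<alpha>(2) in simp)
qed

text \<open>The Nullstellensatz is applied once for each of the four variables, starting from the
  field. The resulting characters all fix the scalars, so they kill \<open>X - \<phi> X\<close> for
  every variable \<open>X\<close>.\<close>

lemma central_character:
  fixes L :: "'k sjp set"
  assumes L: "0 \<in> L" "\<And>a b. a \<in> L \<Longrightarrow> b \<in> L \<Longrightarrow> a + b \<in> L" "\<And>r a. a \<in> L \<Longrightarrow> r * a \<in> L" "1 \<notin> L"
    and max: "\<And>I. ideal I univ_ring \<Longrightarrow> I \<subseteq> L \<or> (\<exists>i\<in>I. 1 - i \<in> L)"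
  obtains \<beta> \<gamma> \<delta> where "\<And>a. a * (sjp_s ^ p - sjp_scalar \<beta>) \<in> L"
    "\<And>a. a * (sjp_y ^ (2 * p) - sjp_scalar \<gamma>) \<in> L" "\<And>a. a * (sjp_g ^ (2 * p) - sjp_scalar \<delta>) \<in> L"
proof -
  define H1 where "H1 = {eval_poly \<phi> \<tau> | (\<phi> :: 'k \<Rightarrow> 'k) \<tau>. \<phi> \<in> {\<lambda>c. c}}"
  define H2 where "H2 = {eval_poly \<phi> \<tau> | \<phi> \<tau>. \<phi> \<in> H1}"
  define H3 where "H3 = {eval_poly \<phi> \<tau> | \<phi> \<tau>. \<phi> \<in> H2}"
  define H4 where "H4 = {eval_poly \<phi> \<tau> | \<phi> \<tau>. \<phi> \<in> H3}"
  have H1: "nullstellensatz H1" unfolding H1_def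
    by (rule nullstellensatz_poly[OF nullstellensatz_field])
  have H2: "nullstellensatz H2" unfolding H2_def by (rule nullstellensatz_poly[OF H1])
  have H3: "nullstellensatz H3" unfolding H3_def by (rule nullstellensatz_poly[OF H2])
  have H4: "nullstellensatz H4" unfolding H4_def by (rule nullstellensatz_poly[OF H3])
  have hom: "unital_hom \<phi>" if "\<phi> \<in> H" "nullstellensatz H" for \<phi> :: "'r::comm_ring_1 \<Rightarrow> 'k" and H
    using that by (simp add: nullstellensatz_def)
  have id: "unital_hom (\<lambda>c :: 'k. c)" by (simp add: unital_hom_def)
  have c1: "\<phi> [:c:] = c" if "\<phi> \<in> H1" for \<phi> c
    using that by (auto simp: H1_def eval_poly_const[OF id])
  have c2: "\<phi> [:[:c:]:] = c" if "\<phi> \<in> H2" for \<phi> c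
    using that by (auto simp: H2_def eval_poly_const[OF hom[OF _ H1]] c1)
  have c3: "\<phi> [:[:[:c:]:]:] = c" if "\<phi> \<in> H3" for \<phi> c
    using that by (auto simp: H3_def eval_poly_const[OF hom[OF _ H2]] c2)
  have c4: "\<phi> [:[:[:[:c:]:]:]:] = c" if "\<phi> \<in> H4" for \<phi> c
    using that by (auto simp: H4_def eval_poly_const[OF hom[OF _ H3]] c3)
  interpret E: central_eval "sjp_eval :: _ \<Rightarrow> 'k sjp" by (rule central_eval_sjp_eval[OF p p0])
  obtain \<phi> where \<phi>: "\<phi> \<in> H4" "\<And>F a. \<phi> F = 0 \<Longrightarrow> a * sjp_eval F \<in> L"
    using E.ex_character[OF H4 sjp_finite_over_center[OF p p0] L max] by blast
  have "a * (sjp_eval X - sjp_scalar (\<phi> X)) \<in> L" for a X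
    using \<phi>(2)[of "X - [:[:[:[:\<phi> X:]:]:]:]" a]
    by (simp add: unital_homD[OF hom[OF \<phi>(1) H4]] c4[OF \<phi>(1)] E.ev sjp_eval_gens(1)[OF p p0]
        del: diff_pCons)
  from this[of _ "[:[:[:[:0, 1:]:]:]:]"] this[of _ "[:[:[:0, 1:]:]:]"] this[of _ "[:[:0, 1:]:]"]
  show ?thesis unfolding sjp_eval_gens[OF p p0] by (rule that)
qed

lemma sjp_max_prim_spectrum:
  "max_spectrum univ_ring = max_ideals" "prim_spectrum univ_ring = max_ideals"
proof -
  have "P \<in> max_ideals" if P: "P \<in> max_spectrum univ_ring" for P :: "'k sjp set"
  proof -
    have Pi: "ideal P univ_ring" and P1: "1 \<notin> P"
      and mx: "\<And>J. ideal J univ_ring \<Longrightarrow> P \<subseteq> J \<Longrightarrow> J = P \<or> 1 \<in> J"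
      using P unfolding max_spectrum_univ_iff by blast+
    note Pii = Pi[unfolded ideal_univ_ring_iff]
    \<comment> \<open>For a maximal ideal the dichotomy holds because \<open>I + P\<close> is either
      \<open>P\<close> or everything.\<close>
    have dich: "I \<subseteq> P \<or> (\<exists>i\<in>I. 1 - i \<in> P)" if I: "ideal I univ_ring" for I
    proof -
      note Ii = I[unfolded ideal_univ_ring_iff]
      let ?J = "{i + a | i a. i \<in> I \<and> a \<in> P}"
      have "ideal ?J univ_ring"
        unfolding ideal_univ_ring_iff
      proof (intro conjI ballI allI)
        show "0 \<in> ?J" using Ii Pii by (intro CollectI exI[of _ 0]) simp
        fix u assume "u \<in> ?J"
        then obtain i a where ia: "i \<in> I" "a \<in> P" "u = i + a" by blast
        show "u + v \<in> ?J" if v: "v \<in> ?J" for v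
        proof -
          obtain i' a' where ia': "i' \<in> I" "a' \<in> P" "v = i' + a'" using v by blast
          have "u + v = (i + i') + (a + a')" by (simp add: ia ia' algebra_simps)
          thus ?thesis using ia ia' Ii Pii by blast
        qed
        show "r * u \<in> ?J" "u * r \<in> ?J" for r
          unfolding ia(3) distrib_left distrib_right using ia(1,2) Ii Pii by blast+
      qed
      moreover have "P \<subseteq> ?J" using Ii by force
      ultimately have "?J = P \<or> 1 \<in> ?J" by (rule mx)
      thus ?thesis
      proof
        assume "?J = P"
        moreover have "i + 0 \<in> ?J" if "i \<in> I" for i using that Pii by blast
        ultimately show ?thesis by auto
      next
        assume "1 \<in> ?J"
        then obtain i a where ia: "i \<in> I" "a \<in> P" "1 = i + a" by blast
        have "1 - i = a" by (simp add: ia(3))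
        thus ?thesis using ia by blast
      qed
    qed
    obtain \<beta> \<gamma> \<delta> where ch: "\<And>a. a * (sjp_s ^ p - sjp_scalar \<beta>) \<in> P"
      "\<And>a. a * (sjp_y ^ (2 * p) - sjp_scalar \<gamma>) \<in> P" "\<And>a. a * (sjp_g ^ (2 * p) - sjp_scalar \<delta>) \<in> P"
      using central_character[OF _ _ _ P1 dich] Pii by metis
    show ?thesis
      using ch(1)[of 1] ch(2)[of 1] ch(3)[of 1]
      by (intro prime_in_max_ideals[OF max_spectrum_univ_prime[OF P]]) simp_all
  qed
  thus "max_spectrum univ_ring = max_ideals" using sjp_max_ideals_subset(1) by blast
  have "annihilator univ_ring M \<in> max_ideals" if M: "simple_module univ_ring M"
    for M :: "('k sjp, 'k sjp set) module"
  proof -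
    obtain L where L: "0 \<in> L" "\<And>a b. a \<in> L \<Longrightarrow> b \<in> L \<Longrightarrow> a + b \<in> L" "\<And>r a. a \<in> L \<Longrightarrow> r * a \<in> L"
      "1 \<notin> L" "\<And>I. ideal I univ_ring \<Longrightarrow> I \<subseteq> L \<or> (\<exists>i\<in>I. 1 - i \<in> L)"
      and ann: "annihilator univ_ring M = {a. \<forall>b. a * b \<in> L}"
      and prime: "annihilator univ_ring M \<in> prime_spectrum univ_ring"
      by (rule simple_module_left_ideal[OF M]) (rule that)
    obtain \<beta> \<gamma> \<delta> where ch: "\<And>a. a * (sjp_s ^ p - sjp_scalar \<beta>) \<in> L"
      "\<And>a. a * (sjp_y ^ (2 * p) - sjp_scalar \<gamma>) \<in> L" "\<And>a. a * (sjp_g ^ (2 * p) - sjp_scalar \<delta>) \<in> L"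
      using central_character[OF L(1) _ _ L(4,5)] L(2,3) by metis
    \<comment> \<open>For central \<open>u\<close>, the factor \<open>u - c\<close> can be moved to
      the right of every \<open>b\<close>. The memberships in \<open>L\<close> provided by
      \<open>ch\<close> then say that \<open>u - c\<close> lies in the annihilator.\<close>
    have comm: "(u - sjp_scalar c) * b = b * (u - sjp_scalar c)" if "u * b = b * u"
      for u b :: "'k sjp" and c
      using that sjp_scalar_commute[of c b] by (simp add: algebra_simps)
    show ?thesis
      by (rule prime_in_max_ideals[OF prime, of \<beta> \<gamma> \<delta>])
        (simp_all add: ann comm sjp_central_s[OF p p0] sjp_central_y[OF p p0] sjp_central_g[OF p]
          ch)
  qed
  thus "prim_spectrum univ_ring = max_ideals"
    using sjp_max_ideals_subset(2) unfolding prim_spectrum_def by blast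
qed

end

theorem theorem4p2:
  fixes p :: nat
  assumes "CHAR('k::alg_closed_field) = p" and "p > 2"
  shows
    "prime_spectrum (sjp_ring :: 'k sjp ring) =
       {sjp_Lambda_preimage \<pp> | \<pp>. \<pp> \<in> prime_spectrum sjp_Lambda} \<union>
       {sjp_contraction \<qq> | \<qq>. \<qq> \<in> prime_spectrum sjp_central_subalgebra}
     \<and> prim_spectrum (sjp_ring :: 'k sjp ring) = max_spectrum sjp_ring
     \<and> max_spectrum (sjp_ring :: 'k sjp ring) =
       {Idl\<^bsub>sjp_ring\<^esub> {sjp_s, sjp_x, sjp_y, sjp_g - sjp_scalar \<gamma>} | \<gamma>. \<gamma> \<noteq> 0} \<union>
       {Idl\<^bsub>sjp_ring\<^esub> {sjp_s, sjp_x, sjp_y ^ 2 - sjp_scalar \<alpha>, sjp_g ^ 2 - sjp_scalar \<beta>} | \<alpha> \<beta>.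
          \<alpha> \<noteq> 0 \<and> \<beta> \<noteq> 0} \<union>
       {Idl\<^bsub>sjp_ring\<^esub> {sjp_C - sjp_scalar \<alpha>, sjp_s ^ p - sjp_scalar \<beta>, sjp_y ^ (2 * p) - sjp_scalar \<gamma>}
          | \<alpha> \<beta> \<gamma>. \<alpha> \<noteq> 0 \<and> \<beta> \<noteq> 0}
     \<and> (\<forall>\<gamma>::'k. \<gamma> \<noteq> 0 \<longrightarrow>
         (let I = Idl\<^bsub>sjp_ring\<^esub> {sjp_s, sjp_x, sjp_y, sjp_g - sjp_scalar \<gamma>} in
          algebra_iso (sjp_ring Quot I) (\<lambda>c. I +>\<^bsub>sjp_ring\<^esub> sjp_scalar c)
            (univ_ring :: 'k ring) (\<lambda>c. c)))
     \<and> (\<forall>\<alpha> \<beta>::'k. \<alpha> \<noteq> 0 \<longrightarrow> \<beta> \<noteq> 0 \<longrightarrow>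
         (let I = Idl\<^bsub>sjp_ring\<^esub> {sjp_s, sjp_x, sjp_y ^ 2 - sjp_scalar \<alpha>, sjp_g ^ 2 - sjp_scalar \<beta>} in
          algebra_iso (sjp_ring Quot I) (\<lambda>c. I +>\<^bsub>sjp_ring\<^esub> sjp_scalar c)
            (ring_mat TYPE('k) 2 ()) (\<lambda>c. c \<cdot>\<^sub>m 1\<^sub>m 2)))
     \<and> (\<forall>\<alpha> \<beta> \<gamma>::'k. \<alpha> \<noteq> 0 \<longrightarrow> \<beta> \<noteq> 0 \<longrightarrow>
         (let I = Idl\<^bsub>sjp_ring\<^esub> {sjp_C - sjp_scalar \<alpha>, sjp_s ^ p - sjp_scalar \<beta>, sjp_y ^ (2 * p) - sjp_scalar \<gamma>} in
          algebra_iso (sjp_ring Quot I) (\<lambda>c. I +>\<^bsub>sjp_ring\<^esub> sjp_scalar c)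
            (ring_mat TYPE('k) (2 * p) ()) (\<lambda>c. c \<cdot>\<^sub>m 1\<^sub>m (2 * p))))"
proof -
  have p0: "p > 0" using assms(2) by simp
  have two: "(2 :: 'k) \<noteq> 0"
  proof
    assume "(2 :: 'k) = 0"
    hence "of_nat 2 = (0 :: 'k)" by simp
    hence "p dvd 2" unfolding of_nat_eq_0_iff_char_dvd assms(1) .
    thus False using assms(2) dvd_imp_le[of p 2] by simp
  qed
  show ?thesis
  proof (intro conjI allI impI)
    show "prime_spectrum (sjp_ring :: 'k sjp ring) =
         {sjp_Lambda_preimage \<pp> | \<pp>. \<pp> \<in> prime_spectrum sjp_Lambda} \<union>
         {sjp_contraction \<qq> | \<qq>. \<qq> \<in> prime_spectrum sjp_central_subalgebra}"
      by (rule sjp_prime_spectrum[OF assms(1) p0])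
    note spec = sjp_max_prim_spectrum[OF assms(1) p0 two]
    show "prim_spectrum (sjp_ring :: 'k sjp ring) = max_spectrum sjp_ring"
      unfolding spec ..
    show "max_spectrum (sjp_ring :: 'k sjp ring) =
         {Idl\<^bsub>sjp_ring\<^esub> {sjp_s, sjp_x, sjp_y, sjp_g - sjp_scalar \<gamma>} | \<gamma>. \<gamma> \<noteq> 0} \<union>
         {Idl\<^bsub>sjp_ring\<^esub> {sjp_s, sjp_x, sjp_y ^ 2 - sjp_scalar \<alpha>, sjp_g ^ 2 - sjp_scalar \<beta>} | \<alpha> \<beta>.
            \<alpha> \<noteq> 0 \<and> \<beta> \<noteq> 0} \<union>
         {Idl\<^bsub>sjp_ring\<^esub> {sjp_C - sjp_scalar \<alpha>, sjp_s ^ p - sjp_scalar \<beta>, sjp_y ^ (2 * p) - sjp_scalar \<gamma>}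
            | \<alpha> \<beta> \<gamma>. \<alpha> \<noteq> 0 \<and> \<beta> \<noteq> 0}"
      unfolding spec sjp_max_ideals_def ..
  next
    fix \<gamma> :: 'k assume "\<gamma> \<noteq> 0"
    then obtain \<chi> :: "'k sjp \<Rightarrow> 'k" where \<chi>: "unital_hom \<chi>" "\<And>c. \<chi> (sjp_scalar c) = c"
      "{a. \<chi> a = 0} = Idl\<^bsub>sjp_ring\<^esub> {sjp_s, sjp_x, sjp_y, sjp_g - sjp_scalar \<gamma>}"
      using ex_character_quotient by blast
    have "ring_hom_ring univ_ring (univ_ring :: 'k ring) \<chi>"
      by (intro ring_hom_ringI2[OF ring_univ_ring ring_univ_ring] ring_hom_memI)
        (simp_all add: unital_homD[OF \<chi>(1)])
    moreover have "\<chi> ` UNIV = carrier (univ_ring :: 'k ring)"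
      using \<chi>(2) by (simp) (metis surjI)
    moreover have "a_kernel univ_ring (univ_ring :: 'k ring) \<chi>
        = Idl\<^bsub>sjp_ring\<^esub> {sjp_s, sjp_x, sjp_y, sjp_g - sjp_scalar \<gamma>}"
      using \<chi>(3) by (simp add: a_kernel_def')
    ultimately show "let I = Idl\<^bsub>sjp_ring\<^esub> {sjp_s, sjp_x, sjp_y, sjp_g - sjp_scalar \<gamma>} in
        algebra_iso (sjp_ring Quot I) (\<lambda>c. I +>\<^bsub>sjp_ring\<^esub> sjp_scalar c) (univ_ring :: 'k ring) (\<lambda>c. c)"
      unfolding Let_def using \<chi>(2) by (rule sjp_algebra_isoI)
  next
    fix \<alpha> \<beta> :: 'k assume nz: "\<alpha> \<noteq> 0" "\<beta> \<noteq> 0"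
    obtain \<rho> :: "'k sjp \<Rightarrow> 'k mat" where \<rho>: "sjp_mat_rep 2 \<rho>" "{a. \<rho> a = 0\<^sub>m 2 2}
        = Idl\<^bsub>sjp_ring\<^esub> {sjp_s, sjp_x, sjp_y ^ 2 - sjp_scalar \<alpha>, sjp_g ^ 2 - sjp_scalar \<beta>}"
      using ex_mat_rep_2[OF nz two] by blast
    show "let I = Idl\<^bsub>sjp_ring\<^esub> {sjp_s, sjp_x, sjp_y ^ 2 - sjp_scalar \<alpha>, sjp_g ^ 2 - sjp_scalar \<beta>} in
        algebra_iso (sjp_ring Quot I) (\<lambda>c. I +>\<^bsub>sjp_ring\<^esub> sjp_scalar c)
          (ring_mat TYPE('k) 2 ()) (\<lambda>c. c \<cdot>\<^sub>m 1\<^sub>m 2)"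
      unfolding Let_def by (rule sjp_mat_rep_iso[OF \<rho>(1) \<rho>(2)[symmetric]])
  next
    fix \<alpha> \<beta> \<gamma> :: 'k assume nz: "\<alpha> \<noteq> 0" "\<beta> \<noteq> 0"
    obtain \<rho> :: "'k sjp \<Rightarrow> 'k mat" where \<rho>: "sjp_mat_rep (2 * p) \<rho>" "{a. \<rho> a = 0\<^sub>m (2 * p) (2 * p)}
        = Idl\<^bsub>sjp_ring\<^esub> {sjp_C - sjp_scalar \<alpha>, sjp_s ^ p - sjp_scalar \<beta>, sjp_y ^ (2 * p) - sjp_scalar \<gamma>}"
      using central_kernel[OF assms(1) p0 two nz] by blast
    show "let I = Idl\<^bsub>sjp_ring\<^esub> {sjp_C - sjp_scalar \<alpha>, sjp_s ^ p - sjp_scalar \<beta>, sjp_y ^ (2 * p) - sjp_scalar \<gamma>} in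
        algebra_iso (sjp_ring Quot I) (\<lambda>c. I +>\<^bsub>sjp_ring\<^esub> sjp_scalar c)
          (ring_mat TYPE('k) (2 * p) ()) (\<lambda>c. c \<cdot>\<^sub>m 1\<^sub>m (2 * p))"
      unfolding Let_def by (rule sjp_mat_rep_iso[OF \<rho>(1) \<rho>(2)[symmetric]])
  qed
qed

end
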